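(* Let $a\ge 4$ be even and let $b>a$ be odd. Then $$\rho^*(\alpha)=\begin{cases}\delta_0,& \text{if } b=a+1,\ b=a+3,\ \text{or } b\ge 2a-3,\\ \delta_{-2},&\text{if } a+5\le b\le 2a-5.\end{cases}$$ Moreover the sequence $(\delta_k)_{k\ge 0}$ is strictly decreasing with limit $$\delta_\infty:=\Big(1-\beta-\frac{\beta(1-D)(1+2D^2)}{1+D^2}\Big)\Big(1-\eta-\frac{D(1-D)}{1+D^2}\Big),$$ and $$\mathcal L^*\cap(\delta_\infty,\infty)=\{\delta_{-1}\}\cup\{\delta_k:k\ge0\}\cup E,$$ where $E=\{\delta_{-2}\}$ if $a+3\le b\le 2a-3$ and $E=\emptyset$ otherwise.
   Context: Negative continued fractions: $[0;c_1,c_2,\dots]^-:=\cfrac{1}{c_1-\cfrac{1}{c_2-\cdots}}$. Fix integers $2\le a<b$ and set $\alpha=\eta:=[0;\overline{a,b}]^-=\tfrac12\big(b-\sqrt{b^2-4b/a}\big)$, $\beta:=[0;\overline{b,a}]^-=\tfrac12\big(a-\sqrt{a^2-4a/b}\big)$, $D:=\eta\beta$. For real $\gamma$, $M(\alpha,\gamma):=\liminf_{|n|\to\infty,\ n\in\mathbb Z}|n|\,\|n\alpha-\gamma\|$ ($\|x\|$ = distance from $x$ to the nearest integer) and $M^*(\alpha,\gamma):=4(1-D)M(\alpha,\gamma)$. Let $\mathcal L^*:=\{M^*(\alpha,\gamma):\gamma\in\mathbb R\setminus(\mathbb Z+\alpha\mathbb Z)\}$ and $\rho^*(\alpha):=\max\mathcal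 L^*$. Expansions: to a bounded integer sequence $(b_i)_{i\ge1}$ associate $\gamma((b_i)):=\sum_{i\ge1}(b_{2i-1}\eta+b_{2i}D)D^{i-1}$; a block is a pair $(b_{2i-1},b_{2i})$. For a finite word $P$ of blocks, $\gamma_P$ is $\gamma((b_i))$ for the purely periodic sequence repeating $P$; $X^k$ denotes $k$ repetitions of $X$ ($X^0$ empty). Blocks (with $a$ even, $b$ odd, $t$ odd): $A_t=\big(\tfrac{a-2}{2},\tfrac{b-2+t}{2}\big)$, $A'_t=\big(\tfrac{a-2}{2},\tfrac{b-2-t}{2}\big)$, $C_t=\big(\tfrac{a-4}{2},\tfrac{b-2+t}{2}\big)$. Define $\delta_{-1}:=M^*(\alpha,\gamma_{A_1A_1A_1'A_1'})$, $\delta_{-2}:=M^*(\alpha,\gamma_{C_3})$, and for $k\ge0$, $\delta_k:=M^*(\alpha,\gamma_{A_1'A_1(A_1'A_1'A_1A_1)^k})$. *)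

theory Defs
  imports "HOL-Analysis.Analysis"
begin

text \<open>Parameters a b are integers with 2 \<le> a < b.
  eta = [0; a, b, a, b, ...]^-  (closed form), beta = [0; b, a, b, a, ...]^-, D = eta * beta.\<close>

definition eta :: "int \<Rightarrow> int \<Rightarrow> real" where
  "eta a b = (real_of_int b - sqrt ((real_of_int b)\<^sup>2 - 4 * real_of_int b / real_of_int a)) / 2"

definition beta :: "int \<Rightarrow> int \<Rightarrow> real" where
  "beta a b = (real_of_int a - sqrt ((real_of_int a)\<^sup>2 - 4 * real_of_int a / real_of_int b)) / 2"

definition DD :: "int \<Rightarrow> int \<Rightarrow> real" where
  "DD a b = eta a b * beta a b"

definition ndist :: "real \<Rightarrow> real" where
  "ndist x = \<bar>x - of_int (round x)\<bar>"

text \<open>M(alpha, gamma) = liminf over |n| \<rightarrow> \<infinity> (n integer) of |n| * ||n alpha - gamma||.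
  The filter "|n| \<rightarrow> \<infinity>" on the integers is the cofinite filter.\<close>
definition M_const :: "real \<Rightarrow> real \<Rightarrow> ereal" where
  "M_const \<alpha> \<gamma> = Liminf cofinite (\<lambda>n::int. ereal (\<bar>real_of_int n\<bar> * ndist (real_of_int n * \<alpha> - \<gamma>)))"

definition M_star :: "int \<Rightarrow> int \<Rightarrow> real \<Rightarrow> ereal" where
  "M_star a b \<gamma> = ereal (4 * (1 - DD a b)) * M_const (eta a b) \<gamma>"

definition L_star :: "int \<Rightarrow> int \<Rightarrow> ereal set" where
  "L_star a b = {M_star a b \<gamma> | \<gamma>. \<not> (\<exists>m n :: int. \<gamma> = real_of_int m + real_of_int n * eta a b)}"

definition rho_star :: "int \<Rightarrow> int \<Rightarrow> ereal" where
  "rho_star a b = (GREATEST x. x \<in> L_star a b)"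

text \<open>gamma_P for a nonempty finite word P of blocks (pairs of integers), the associated
  sequence being the purely periodic repetition of P:
  gamma = sum_{i \<ge> 0} (b_{2i+1} eta + b_{2i+2} D) D^i, block i = P ! (i mod length P).\<close>
definition gamma_word :: "int \<Rightarrow> int \<Rightarrow> (int \<times> int) list \<Rightarrow> real" where
  "gamma_word a b P = (\<Sum>i. (real_of_int (fst (P ! (i mod length P))) * eta a b
        + real_of_int (snd (P ! (i mod length P))) * DD a b) * DD a b ^ i)"

definition blockA :: "int \<Rightarrow> int \<Rightarrow> int \<Rightarrow> int \<times> int" where
  "blockA a b t = ((a - 2) div 2, (b - 2 + t) div 2)"

definition blockA' :: "int \<Rightarrow> int \<Rightarrow> int \<Rightarrow> int \<times> int" where
  "blockA' a b t = ((a - 2) div 2, (b - 2 - t) div 2)"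

definition blockC :: "int \<Rightarrow> int \<Rightarrow> int \<Rightarrow> int \<times> int" where
  "blockC a b t = ((a - 4) div 2, (b - 2 + t) div 2)"

definition delta_m1 :: "int \<Rightarrow> int \<Rightarrow> ereal" where
  "delta_m1 a b = M_star a b (gamma_word a b
      [blockA a b 1, blockA a b 1, blockA' a b 1, blockA' a b 1])"

definition delta_m2 :: "int \<Rightarrow> int \<Rightarrow> ereal" where
  "delta_m2 a b = M_star a b (gamma_word a b [blockC a b 3])"

definition delta :: "int \<Rightarrow> int \<Rightarrow> nat \<Rightarrow> ereal" where
  "delta a b k = M_star a b (gamma_word a b
      ([blockA' a b 1, blockA a b 1] @
       concat (replicate k [blockA' a b 1, blockA' a b 1, blockA a b 1, blockA a b 1])))"

definition delta_inf :: "int \<Rightarrow> int \<Rightarrow> real" where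
  "delta_inf a b = (let \<eta> = eta a b; \<beta> = beta a b; D = DD a b in
     (1 - \<beta> - \<beta> * (1 - D) * (1 + 2 * D\<^sup>2) / (1 + D\<^sup>2)) *
     (1 - \<eta> - D * (1 - D) / (1 + D\<^sup>2)))"

end

theory Submission
  imports Defs
begin

text \<open>Expand \<open>\<gamma>\<close> along the denominators of the continued fraction and write the digits as
  deviations \<open>s\<close>, \<open>E\<close> from the centres \<open>(a - 2)/2\<close>, \<open>(b - 2)/2\<close>. The liminf
  is governed by the vertices of divided cells of an inhomogeneous lattice, and the four vertex products
  at a digit depend only on two geometric series, one over the earlier and one over the later digits.
  A value above \<open>\<delta>\<^sub>\<infinity>\<close> forces the digits to be eventually, up to a global sign,
  the constant block \<open>C\<^sub>3\<close>, or else \<open>s = 0\<close> and \<open>E = \<plusminus>1\<close>. In a sequence of signs the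
  extremal left tail occurs next to a defect in the pattern of double blocks \<open>++--\<close>; the cuts on the two
  sides of consecutive defects compare the gaps in opposite directions, so all gaps are equal and the
  sequence is eventually periodic. It remains to evaluate the periodic patterns and to compare their
  values, for which \<open>(\<eta> - \<beta>)(1 + D) = (b - a) D\<close> and \<open>(2 \<beta> - \<eta>)(1 + D) = (2 a - b) D\<close>
  turn the conditions on \<open>b\<close> into polynomial inequalities.\<close>

text \<open>The parity of \<open>a\<close> and \<open>b\<close> makes every \<open>s\<close> even
  and every \<open>E\<close> odd, so \<open>E = 0\<close> cannot occur and \<open>s = 0\<close>,
  \<open>E = 1\<close> or \<open>- 1\<close> is as central as possible. Digits are excluded at the
  level \<open>\<theta>\<close>, the cut product with both tails replaced by \<open>- 1\<close>, a
  polynomial below the limit point. Among signs, a double block multiplies the deviation of a tail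
  from its limit \<open>w\<close> by \<open>- D * D\<close>; so the deviation seen from a defect is
  about \<open>2 * D\<close> times a power of \<open>- D * D\<close> whose exponent is one less than
  the number of blocks up to the next defect. The cuts on both sides force odd exponents, so unequal
  ones differ by at least two, and the factor \<open>D^4\<close> is more than the cuts allow. The
  obstacle is numerical: \<open>D\<close> comes close to 0.056, leading terms often cancel and
  second order terms decide, so constants derived from \<open>\<eta> < 265/1000\<close>,
  \<open>\<beta> < 212/1000\<close>, \<open>D < 6/100\<close> replace asymptotics. For
  \<open>C\<^sub>3\<close> the product \<open>p4\<close> is governed by \<open>b - a\<close> and
  \<open>p1\<close> by \<open>2 * a - b\<close>; against the value of \<open>pk 0\<close> both have
  their first order threshold at 4, which parity excludes.\<close>

section \<open>Lattice points and divided cells\<close>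

text \<open>The points \<open>(N, N * \<alpha> - \<gamma> + p)\<close> form a shifted lattice,
  spanned for each \<open>k\<close> by \<open>(q k, d k)\<close> and
  \<open>(q (k + 1), d (k + 1))\<close>. Starting from \<open>(x k, - y k)\<close>, adding the first
  vector, subtracting the second, or both, gives one point in each quadrant. \<open>v1\<close> to
  \<open>v4\<close> bound the absolute products of coordinates at the lower right, upper right,
  lower left and upper left vertex of this cell.\<close>

locale divided_chain =
  fixes x y q d :: "nat \<Rightarrow> real" and cf n :: "nat \<Rightarrow> int" and K :: nat and c :: real
  assumes q_rec: "\<And>k. q (k + 2) = cf k * q (k + 1) - q k"
    and d_rec: "\<And>k. d (k + 2) = cf k * d (k + 1) - d k"
    and x_rec: "\<And>k. x (k + 1) = x k + n k * q (k + 1)"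
    and y_rec: "\<And>k. y (k + 1) = y k - n k * d (k + 1)"
    and q_pos: "\<And>k. k \<ge> K \<Longrightarrow> 0 < q k" and q_less: "\<And>k. k \<ge> K \<Longrightarrow> q k < q (k + 1)"
    and d_pos: "\<And>k. 0 < d k" and d_less: "\<And>k. d (k + 1) < d k"
    and d_lim: "d \<longlonglongrightarrow> 0"
    and x_pos: "\<And>k. k \<ge> K \<Longrightarrow> 0 < x k" and x_less: "\<And>k. k \<ge> K \<Longrightarrow> x k < q (k + 1) - q k"
    and y_pos: "\<And>k. k \<ge> K \<Longrightarrow> 0 < y k" and y_less: "\<And>k. k \<ge> K \<Longrightarrow> y k < d k - d (k + 1)"
    and c_pos: "0 < c"
    and v1: "\<And>k. k \<ge> K \<Longrightarrow> c \<le> x k * y k"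
    and v2: "\<And>k. k \<ge> K \<Longrightarrow> c \<le> (x k + q k) * (d k - y k)"
    and v3: "\<And>k. k \<ge> K \<Longrightarrow> c \<le> (q (k + 1) - x k) * (y k + d (k + 1))"
    and v4: "\<And>k. k \<ge> K \<Longrightarrow> c \<le> (q (k + 1) - q k - x k) * (d k - d (k + 1) - y k)"
begin

definition coord :: "nat \<Rightarrow> real \<Rightarrow> real \<Rightarrow> int \<Rightarrow> int \<Rightarrow> bool" where
  "coord k X Y i j \<longleftrightarrow> X = x k + i * q k + j * q (k + 1) \<and> Y = - y k + i * d k + j * d (k + 1)"

text \<open>Substituting the recurrence for index \<open>k + 2\<close> turns the old coefficient at
  index \<open>k\<close> into minus the new coefficient at index \<open>k + 2\<close>. This relation
  between \<open>j\<close> at one stage and \<open>i\<close> at the previous one drives the descents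
  below.\<close>

lemma coord_step:
  assumes "coord k X Y i j" shows "coord (k + 1) X Y (j - n k + i * cf k) (- i)"
proof -
  have q2: "q (Suc (Suc k)) = cf k * q (Suc k) - q k" using q_rec[of k] by (simp add: numeral_2_eq_2)
  have d2: "d (Suc (Suc k)) = cf k * d (Suc k) - d k" using d_rec[of k] by (simp add: numeral_2_eq_2)
  show ?thesis
    using assms x_rec[of k] y_rec[of k] unfolding coord_def by (simp add: q2 d2 algebra_simps)
qed

lemma coord_all:
  assumes "\<exists>i j. coord K X Y i j" and "k \<ge> K" shows "\<exists>i j. coord k X Y i j"
  using assms(2)
proof (induction k rule: dec_induct)
  case base then show ?case using assms(1) .
next
  case (step k) then show ?case using coord_step[of k X Y] by (metis Suc_eq_plus1)
qed

lemma coords: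
  assumes "\<exists>i j. coord K X Y i j"
  obtains i j :: "nat \<Rightarrow> int" where "\<And>k. k \<ge> K \<Longrightarrow> coord k X Y (i k) (j k)"
    and "\<And>k. k \<ge> K \<Longrightarrow> j (k + 1) = - i k"
proof -
  from assms obtain i0 j0 where 0: "coord K X Y i0 j0" by blast
  define f where "f = rec_nat (i0, j0) (\<lambda>m (i, j). (j - n (K + m) + i * cf (K + m), - i))"
  have f0: "f 0 = (i0, j0)" by (simp add: f_def)
  have fS: "f (Suc m) = (snd (f m) - n (K + m) + fst (f m) * cf (K + m), - fst (f m))" for m
    by (simp add: f_def case_prod_beta)
  have A: "coord (K + m) X Y (fst (f m)) (snd (f m))" for m
  proof (induction m)
    case 0 then show ?case using \<open>coord K X Y i0 j0\<close> f0 by simp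
  next
    case (Suc m) then show ?case using coord_step[OF Suc] fS[of m] by simp
  qed
  show ?thesis
  proof (rule that[of "\<lambda>k. fst (f (k - K))" "\<lambda>k. snd (f (k - K))"])
    fix k assume k: "k \<ge> K"
    show "coord k X Y (fst (f (k - K))) (snd (f (k - K)))" using A[of "k - K"] k by simp
    show "snd (f (k + 1 - K)) = - fst (f (k - K))" using fS[of "k - K"] k by (simp add: Suc_diff_le)
  qed
qed

text \<open>At the first stage with \<open>i k \<ge> 1\<close> the previous stage gives
  \<open>j k = - i (k - 1) \<ge> 0\<close>, so the point dominates the upper right vertex in both
  coordinates. The lower bound on \<open>X\<close> serves the case where that stage is
  \<open>K\<close> and there is no previous one.\<close>

lemma upper_quadrant:
  assumes rep: "\<exists>i j. coord K X Y i j" and Y0: "0 \<le> Y" and Y1: "Y \<le> 1/2"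
    and X: "X \<ge> x K + q K * (1 + 1 / d K)"
  shows "c \<le> X * Y"
proof -
  obtain i j where at: "\<And>k. k \<ge> K \<Longrightarrow> coord k X Y (i k) (j k)"
    and j: "\<And>k. k \<ge> K \<Longrightarrow> j (k + 1) = - i k" using coords[OF rep] by metis
  have ex: "\<exists>k\<ge>K. i k \<ge> 1"
  proof (rule ccontr)
    \<comment> \<open>If \<open>i\<close> never became positive, \<open>Y \<ge> 0\<close> would make
      the nonnegative integers \<open>- i k\<close> decrease strictly for ever.\<close>
    assume "\<not> ?thesis"
    then have neg: "i k \<le> 0" if "k \<ge> K" for k using that by force
    have dec: "- i (k + 1) < - i k" if k: "k \<ge> K" for k
    proof -
      have "Y = - y (k+1) + i (k+1) * d (k+1) + j (k+1) * d (k+1+1)"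
        using at[of "k+1"] k unfolding coord_def by simp
      then have "- real_of_int (i (k+1)) * d (k+1) < - real_of_int (i k) * d (k+2)"
        using j[OF k] Y0 y_pos[of "k+1"] k by (simp add: algebra_simps)
      moreover have "- real_of_int (i k) * d (k+2) \<le> - real_of_int (i k) * d (k+1)"
        using neg[OF k] d_less[of "k+1"] by (intro mult_left_mono) auto
      ultimately have "- real_of_int (i (k+1)) * d (k+1) < - real_of_int (i k) * d (k+1)" by simp
      then have "- real_of_int (i (k+1)) < - real_of_int (i k)" using d_pos[of "k+1"] by (simp add: mult_less_cancel_right)
      then show ?thesis by simp
    qed
    have "- i (K + m) \<le> - i K - int m" for m
    proof (induction m)
      case (Suc m) then show ?case using dec[of "K + m"] by simp
    qed simp
    from this[of "nat (- i K) + 1"] neg[of "K + (nat (- i K) + 1)"] neg[of K] show False by simp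
  qed
  define k where "k = (LEAST k. k \<ge> K \<and> i k \<ge> 1)"
  have k: "k \<ge> K" "i k \<ge> 1" using LeastI_ex[of "\<lambda>k. k \<ge> K \<and> i k \<ge> 1"] ex unfolding k_def by auto
  have least: "i m < 1" if "m \<ge> K" "m < k" for m using not_less_Least[of m "\<lambda>k. k \<ge> K \<and> i k \<ge> 1"] that
    unfolding k_def by force
  have XY: "X = x k + i k * q k + j k * q (k+1)" "Y = - y k + i k * d k + j k * d (k+1)"
    using at[OF k(1)] unfolding coord_def by auto
  have j0: "j k \<ge> 0"
  proof (cases "k = K")
    case False
    then have "k - 1 \<ge> K" "k - 1 < k" "k - 1 + 1 = k" using k by auto
    then show ?thesis using j[of "k-1"] least[of "k-1"] by auto
  next
    case True
    show ?thesis
    proof (rule ccontr)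
      assume "\<not> ?thesis"
      then have J: "j k < 0" by simp
      have qp: "q k > 0" and dp: "d k > 0" "d (k+1) > 0" using q_pos k d_pos by auto
      have "d (k+1) * q k < d k * q (k+1)"
        using d_less[of k] q_less[OF k(1)] qp dp by (intro mult_strict_mono) auto
      then have 1: "j k * (d k * q (k+1) - d (k+1) * q k) < 0" using J by (simp add: mult_neg_pos)
      \<comment> \<open>Eliminating \<open>i\<close> from the two coordinates isolates
        \<open>j\<close>; with \<open>X\<close> this large a negative \<open>j\<close> would give
        \<open>Y > 1\<close>.\<close>
      have "q k * Y = - y k * q k + d k * (X - x k) - j k * (d k * q (k+1) - d (k+1) * q k)"
        unfolding XY by (simp add: algebra_simps)
      with 1 have "q k * Y > - y k * q k + d k * (X - x k)" by simp
      moreover have "d k * (X - x k) \<ge> d k * (q k * (1 + 1 / d k))"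
        using X dp True by (intro mult_left_mono) auto
      moreover have "d k * (q k * (1 + 1 / d k)) = q k * d k + q k" using dp by (simp add: field_simps)
      moreover have "y k * q k \<le> d k * q k"
        using y_less[OF k(1)] dp qp by (intro mult_right_mono) auto
      ultimately have "q k * Y > q k" by (simp add: algebra_simps)
      then show False using Y1 qp by (simp add: mult_less_cancel_left2)
    qed
  qed
  have "(i k - 1) * q k \<ge> 0" "j k * q (k+1) \<ge> 0" "(i k - 1) * d k \<ge> 0" "j k * d (k+1) \<ge> 0"
    using k j0 q_pos[OF k(1)] q_pos[of "k+1"] d_pos[of k] d_pos[of "k+1"] by auto
  then have "X \<ge> x k + q k" "Y \<ge> d k - y k" unfolding XY by (auto simp: algebra_simps)
  then have "(x k + q k) * (d k - y k) \<le> X * Y"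
    using x_pos[OF k(1)] q_pos[OF k(1)] y_less[OF k(1)] d_pos[of "k+1"] by (intro mult_mono) auto
  then show ?thesis using v2[OF k(1)] by simp
qed

text \<open>The product \<open>x * y\<close> stays above \<open>c\<close> while \<open>y < d\<close>
  and \<open>d\<close> tends to 0, so \<open>x\<close> cannot stay bounded.\<close>

lemma x_unbounded: "\<exists>k\<ge>K. x (k + 1) > B"
proof -
  have "eventually (\<lambda>k. d k < c / (\<bar>B\<bar> + 1)) sequentially"
    using d_lim c_pos by (intro order_tendstoD) auto
  then obtain N where N: "\<And>k. k \<ge> N \<Longrightarrow> d k < c / (\<bar>B\<bar> + 1)" unfolding eventually_sequentially by auto
  define k where "k = max N K"
  have k: "k \<ge> K" "k \<ge> N" by (auto simp: k_def)
  have "c \<le> x (k+1) * y (k+1)" using v1[of "k+1"] k by simp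
  also have "\<dots> \<le> x (k+1) * d (k+1)" using y_less[of "k+1"] d_pos[of "k+2"] x_pos[of "k+1"] k
    by (intro mult_left_mono) auto
  also have "\<dots> < x (k+1) * (c / (\<bar>B\<bar> + 1))" using N[of "k+1"] x_pos[of "k+1"] k
    by (intro mult_strict_left_mono) auto
  finally have "c * (\<bar>B\<bar> + 1) < c * x (k+1)" by (simp add: field_simps split: if_splits)
  then have "x (k+1) > \<bar>B\<bar> + 1" using c_pos by (simp only: mult_less_cancel_left_pos)
  then show ?thesis using k by (intro exI[of _ k]) auto
qed

text \<open>The vertices \<open>(x k, - y k)\<close> span the convex hull of the points in the lower right
  quadrant, and \<open>X * - Y\<close> is quasi-concave there.\<close>

lemma lower_quadrant:
  assumes rep: "\<exists>i j. coord K X Y i j" and Y0: "Y < 0" and X: "X \<ge> x K"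
  shows "c \<le> X * - Y"
proof -
  define k where "k = (LEAST k. k \<ge> K \<and> x (k + 1) > X)"
  have k: "k \<ge> K" "x (k+1) > X" using LeastI_ex[of "\<lambda>k. k \<ge> K \<and> x (k + 1) > X"] x_unbounded[of X]
    unfolding k_def by auto
  have xk: "x k \<le> X"
  proof (cases "k = K")
    case False
    then have "k - 1 \<ge> K" "k - 1 < k" "k - 1 + 1 = k" using k by auto
    then show ?thesis using not_less_Least[of "k-1" "\<lambda>k. k \<ge> K \<and> x (k + 1) > X"] unfolding k_def by force
  qed (use X in simp)
  have X0: "X > 0" using xk x_pos[OF k(1)] by simp
  obtain i j where at: "coord k X Y i j" using coord_all[OF rep k(1)] by blast
  have XY: "X = x k + i * q k + j * q (k+1)" "Y = - y k + i * d k + j * d (k+1)"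
    using at unfolding coord_def by auto
  note pos = q_pos[OF k(1)] q_less[OF k(1)] d_pos[of k] d_pos[of "k+1"] d_less[of k]
    x_pos[OF k(1)] x_less[OF k(1)] y_pos[OF k(1)] y_less[OF k(1)]
  have i0: "i \<le> 0"
  proof (rule ccontr)
    assume "\<not> ?thesis"
    then have i: "i \<ge> 1" by simp
    have j: "j < 0"
    proof (rule ccontr)
      assume "\<not> j < 0"
      then have "real_of_int j * d (k+1) \<ge> 0" using pos by simp
      moreover have "real_of_int i * d k \<ge> 1 * d k" using i pos by (intro mult_right_mono) auto
      ultimately show False using XY(2) Y0 pos(3,4,8,9) by linarith
    qed
    \<comment> \<open>With \<open>i \<ge> 1\<close> and \<open>j < 0\<close>, positivity of
      \<open>X\<close> gives \<open>J < I\<close> because \<open>q\<close> increases, and negativity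
      of \<open>Y\<close> gives \<open>I < J\<close> because \<open>d\<close> decreases.\<close>
    define I J where "I = i - 1" and "J = - j - 1"
    have IJ: "I \<ge> 0" "J \<ge> 0" "i = I + 1" "j = - J - 1" using i j by (auto simp: I_def J_def)
    have "J * q (k+1) < I * q k" using XY(1) X0 pos IJ by (simp add: algebra_simps)
    moreover have "J * q k \<le> J * q (k+1)" using IJ pos by (intro mult_left_mono) auto
    ultimately have "J < I" using pos by (smt (verit) mult_right_mono of_int_le_iff)
    have "I * d k < J * d (k+1)" using XY(2) Y0 pos IJ by (simp add: algebra_simps)
    moreover have "I * d k \<ge> I * d (k+1)" using IJ pos by (intro mult_left_mono) auto
    ultimately have "I < J" using pos by (smt (verit) mult_right_mono of_int_le_iff)
    with \<open>J < I\<close> show False by simp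
  qed
  \<comment> \<open>\<open>X\<close> lies between the abscissas of two consecutive vertices;
    \<open>\<tau>\<close> locates it on the edge joining them, and \<open>i \<le> 0\<close> will put
    the point on or below that edge.\<close>
  define \<tau> where "\<tau> = (X - x k) / q (k+1)"
  have q1: "q (k+1) > 0" using pos by simp
  have X': "X = x k + \<tau> * q (k+1)" using q1 by (simp add: \<tau>_def)
  have \<tau>0: "\<tau> \<ge> 0" using xk q1 by (simp add: \<tau>_def)
  have "\<tau> * q (k+1) < n k * q (k+1)" using k(2) X' x_rec[of k] by simp
  then have \<tau>n: "\<tau> < n k" using q1 by simp
  have dq: "d (k+1) * q k \<le> d k * q (k+1)" using pos by (intro mult_mono) auto
  have "real_of_int j * q (k+1) = \<tau> * q (k+1) - i * q k" using XY(1) X' by simp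
  then have jj: "real_of_int j = \<tau> - i * q k / q (k+1)" using q1 by (simp add: field_simps)
  have "- Y = y k - \<tau> * d (k+1) - i * (d k - d (k+1) * q k / q (k+1))"
    unfolding XY(2) jj by (simp add: algebra_simps)
  moreover have "d k - d (k+1) * q k / q (k+1) \<ge> 0" using dq q1 by (simp add: field_simps)
  ultimately have Y': "- Y \<ge> y k - \<tau> * d (k+1)"
    using i0 by (simp add: mult_nonpos_nonneg)
  define l where "l = \<tau> / n k"
  have l: "0 \<le> l" "l \<le> 1" "\<tau> = l * n k" using \<tau>0 \<tau>n by (auto simp: l_def field_simps)
  let ?a = "x k" let ?b = "y k" let ?u = "n k * q (k+1)" let ?v = "n k * d (k+1)"
  have uv: "?u \<ge> 0" "?v \<ge> 0" using \<tau>0 \<tau>n q1 pos by auto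
  have e1: "c \<le> ?a * ?b" using v1[OF k(1)] .
  have e2: "c \<le> (?a + ?u) * (?b - ?v)" using v1[of "k+1"] x_rec[of k] y_rec[of k] k(1) by simp
  have "c = (1 - l) * c + l * c" by (simp add: algebra_simps)
  also have "\<dots> \<le> (1 - l) * (?a * ?b) + l * ((?a + ?u) * (?b - ?v))"
    using e1 e2 l by (intro add_mono mult_left_mono) auto
  \<comment> \<open>Along the edge the abscissa grows while the depth shrinks, so the product is
    concave: it exceeds the linear interpolation by exactly
    \<open>l * (1 - l) * (?u * ?v)\<close>.\<close>
  also have "\<dots> \<le> (1 - l) * (?a * ?b) + l * ((?a + ?u) * (?b - ?v)) + l * (1 - l) * (?u * ?v)"
    using l uv by simp
  also have "\<dots> = (?a + l * ?u) * (?b - l * ?v)" by algebra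
  also have "\<dots> = X * (y k - \<tau> * d (k+1))" unfolding X' l(3) by (simp add: algebra_simps)
  also have "\<dots> \<le> X * - Y" using Y' X0 by (intro mult_left_mono) auto
  finally show ?thesis .
qed

lemma right_half:
  assumes "\<exists>i j. coord K X Y i j" and "\<bar>Y\<bar> \<le> 1/2" and "X \<ge> x K + q K * (1 + 1 / d K)"
  shows "c \<le> X * \<bar>Y\<bar>"
proof -
  have "q K * (1 + 1 / d K) \<ge> 0" using q_pos[of K] d_pos[of K] by simp
  then have "X \<ge> x K" using assms(3) by simp
  then show ?thesis using upper_quadrant[of X Y] lower_quadrant[of X Y] assms by (cases "Y < 0") auto
qed

text \<open>Reflection in the origin exchanges opposite vertices of every cell, hence
  \<open>v1\<close> with \<open>v4\<close> and \<open>v2\<close> with \<open>v3\<close>, and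
  replaces the digit by its complement. The left half plane is thereby reduced to the right
  one.\<close>

lemma reflected:
  "divided_chain (\<lambda>k. q (k + 1) - q k - x k) (\<lambda>k. d k - d (k + 1) - y k) q d cf (\<lambda>k. cf k - 2 - n k) K c"
proof unfold_locales
  fix k
  have q2: "q (Suc (Suc k)) = cf k * q (Suc k) - q k" using q_rec[of k] by (simp add: numeral_2_eq_2)
  have d2: "d (Suc (Suc k)) = cf k * d (Suc k) - d k" using d_rec[of k] by (simp add: numeral_2_eq_2)
  show "q (k + 1 + 1) - q (k + 1) - x (k + 1) = q (k + 1) - q k - x k + real_of_int (cf k - 2 - n k) * q (k + 1)"
    using x_rec[of k] by (simp add: q2 algebra_simps)
  show "d (k + 1) - d (k + 1 + 1) - y (k + 1) = d k - d (k + 1) - y k - real_of_int (cf k - 2 - n k) * d (k + 1)"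
    using y_rec[of k] by (simp add: d2 algebra_simps)
  show "q (k + 2) = cf k * q (k + 1) - q k" "d (k + 2) = cf k * d (k + 1) - d k" by (rule q_rec d_rec)+
  assume k: "k \<ge> K"
  show "c \<le> (q (k + 1) - q k - x k) * (d k - d (k + 1) - y k)" by (rule v4[OF k])
  show "c \<le> (q (k + 1) - q k - (q (k + 1) - q k - x k)) * (d k - d (k + 1) - (d k - d (k + 1) - y k))"
    using v1[OF k] by simp
  show "c \<le> (q (k + 1) - (q (k + 1) - q k - x k)) * (d k - d (k + 1) - y k + d (k + 1))"
    using v2[OF k] by (simp add: algebra_simps)
  show "c \<le> (q (k + 1) - q k - x k + q k) * (d k - (d k - d (k + 1) - y k))"
    using v3[OF k] by (simp add: algebra_simps)
qed (use q_pos q_less d_pos d_less d_lim x_pos x_less y_pos y_less c_pos in auto)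

lemma far_points:
  assumes rep: "\<exists>i j. coord K X Y i j" and Y: "\<bar>Y\<bar> \<le> 1/2"
    and X: "\<bar>X\<bar> \<ge> q (K + 1) + q K * (1 + 1 / d K)"
  shows "c \<le> \<bar>X\<bar> * \<bar>Y\<bar>"
proof (cases "X \<ge> 0")
  case True
  then show ?thesis using right_half[OF rep Y] X x_less[of K] q_pos[of K] by simp
next
  case False
  interpret r: divided_chain "\<lambda>k. q (k + 1) - q k - x k" "\<lambda>k. d k - d (k + 1) - y k" q d cf "\<lambda>k. cf k - 2 - n k" K c
    by (rule reflected)
  obtain i j where "coord K X Y i j" using rep by blast
  then have "r.coord K (- X) (- Y) (1 - i) (- 1 - j)"
    unfolding coord_def r.coord_def by (simp add: algebra_simps)
  then show ?thesis using r.right_half[of "- X" "- Y"] Y X False x_pos[of K] q_pos[of K] by auto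
qed

text \<open>This keeps \<open>\<gamma>\<close> out of the group generated by 1 and
  \<open>\<alpha>\<close>. On the axis, a coefficient \<open>i \<ge> 1\<close> would stay positive
  and strictly decrease; if there is none, \<open>i\<close> stays nonpositive and strictly
  increases. Both are impossible for integers.\<close>

lemma no_point_on_axis:
  assumes rep: "\<exists>i j. coord K X 0 i j" shows False
proof -
  obtain i j where at: "\<And>k. k \<ge> K \<Longrightarrow> coord k X 0 (i k) (j k)"
    and j: "\<And>k. k \<ge> K \<Longrightarrow> j (k + 1) = - i k" using coords[OF rep] by metis
  have eq: "i (k+1) * d (k+1) = y (k+1) + i k * d (k+2)" if "k \<ge> K" for k
    using at[of "k+1"] j[OF that] that unfolding coord_def by (simp add: algebra_simps)
  show False
  proof (cases "\<exists>k\<ge>K. i k \<ge> 1")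
    case True
    then obtain k where k: "k \<ge> K" "i k \<ge> 1" by auto
    have dec: "i (m + 1) \<ge> 1 \<and> i (m + 1) < i m" if "m \<ge> K" "i m \<ge> 1" for m
    proof -
      have e: "i (m+1) * d (m+1) = y (m+1) + i m * d (m+2)" using eq that by auto
      have yb: "0 < y (m+1)" "y (m+1) < d (m+1) - d (m+2)"
        using y_pos[of "m+1"] y_less[of "m+1"] that by (auto simp: numeral_2_eq_2)
      have dd: "0 < d (m+2)" "d (m+2) < d (m+1)" using d_pos d_less[of "m+1"] by auto
      have "0 < i (m+1) * d (m+1)" using e yb that dd by (simp add: add_pos_nonneg)
      then have p: "i (m+1) \<ge> 1" using dd by (simp add: zero_less_mult_iff)
      have "(i (m+1) - 1) * d (m+1) < (i m - 1) * d (m+2)" using e yb by (simp add: algebra_simps)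
      also have "\<dots> \<le> (i m - 1) * d (m+1)" using that dd by (intro mult_left_mono) auto
      finally have "i (m+1) < i m" using dd by (simp add: mult_less_cancel_right)
      then show ?thesis using p by simp
    qed
    have "i (k + m) \<ge> 1 \<and> i (k + m) \<le> i k - int m" for m
    proof (induction m)
      case (Suc m) then show ?case using dec[of "k + m"] k by auto
    qed (use k in simp)
    from this[of "nat (i k)"] k show False by auto
  next
    case False
    then have neg: "i k \<le> 0" if "k \<ge> K" for k using that by force
    have dec: "i (m + 1) > i m" if "m \<ge> K" for m
    proof -
      have e: "i (m+1) * d (m+1) = y (m+1) + i m * d (m+2)" using eq that by auto
      have yb: "0 < y (m+1)" using y_pos[of "m+1"] that by auto
      have "i m * d (m+1) \<le> i m * d (m+2)" using neg[OF that] d_less[of "m+1"] by (intro mult_left_mono_neg) auto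
      then have "i m * d (m+1) < i (m+1) * d (m+1)" using e yb by simp
      then show ?thesis using d_pos[of "m+1"] by (simp add: mult_less_cancel_right)
    qed
    have "i (K + m) \<ge> i K + int m" for m
    proof (induction m)
      case (Suc m) then show ?case using dec[of "K + m"] by auto
    qed simp
    from this[of "nat (- i K) + 1"] neg[of "K + (nat (- i K) + 1)"] neg[of K] show False by simp
  qed
qed

end

section \<open>Continued fraction expansions\<close>

lemma abs_add_le: "\<bar>x\<bar> \<le> A \<Longrightarrow> \<bar>y\<bar> \<le> B \<Longrightarrow> \<bar>x + y\<bar> \<le> A + B" for x y A B :: real
  by linarith

locale params =
  fixes a b :: int
  assumes a_ge: "4 \<le> a" and even_a: "even a" and a_less_b: "a < b" and odd_b: "odd b"
begin

abbreviation eta_ab ("\<eta>") where "\<eta> \<equiv> eta a b"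
abbreviation beta_ab ("\<beta>") where "\<beta> \<equiv> beta a b"
abbreviation DD_ab ("D") where "D \<equiv> DD a b"

lemma D_eq: "D = \<eta> * \<beta>" by (simp add: DD_def)

text \<open>Both scaled numbers are the smaller root of \<open>S * S = P * S - P\<close>, which
  makes the relations between \<open>\<eta>\<close>, \<open>\<beta>\<close> and \<open>D\<close>
  polynomial.\<close>

lemma scaled_closed_form:
  defines "P \<equiv> real_of_int a * real_of_int b"
  shows "a * \<eta> = (P - sqrt (P\<^sup>2 - 4 * P)) / 2" and "b * \<beta> = (P - sqrt (P\<^sup>2 - 4 * P)) / 2"
proof -
  have ab: "real_of_int a > 0" "real_of_int b > 0" using a_ge a_less_b by auto
  have "a * sqrt ((real_of_int b)\<^sup>2 - 4 * b / a) = sqrt ((real_of_int a)\<^sup>2 * ((real_of_int b)\<^sup>2 - 4 * b / a))"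
    using ab by (simp add: real_sqrt_mult)
  also have "(real_of_int a)\<^sup>2 * ((real_of_int b)\<^sup>2 - 4 * b / a) = P\<^sup>2 - 4 * P"
    using ab by (simp add: P_def field_simps power2_eq_square)
  finally show "a * \<eta> = (P - sqrt (P\<^sup>2 - 4 * P)) / 2" by (simp add: eta_def P_def algebra_simps)
  have "b * sqrt ((real_of_int a)\<^sup>2 - 4 * a / b) = sqrt ((real_of_int b)\<^sup>2 * ((real_of_int a)\<^sup>2 - 4 * a / b))"
    using ab by (simp add: real_sqrt_mult)
  also have "(real_of_int b)\<^sup>2 * ((real_of_int a)\<^sup>2 - 4 * a / b) = P\<^sup>2 - 4 * P"
    using ab by (simp add: P_def field_simps power2_eq_square)
  finally show "b * \<beta> = (P - sqrt (P\<^sup>2 - 4 * P)) / 2" by (simp add: beta_def P_def algebra_simps)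
qed

text \<open>The quadratic equation gives \<open>D = S * S / P = S - 1\<close>. The extreme case for
  the numerical bound is \<open>a = 4\<close>, \<open>b = 5\<close>, that is \<open>P = 20\<close>,
  where \<open>S\<close> is about 1.0557.\<close>

lemma a_eta: "a * \<eta> = 1 + D" and b_beta: "b * \<beta> = 1 + D"
  and D_less: "D < 6/100" and eta_pos: "\<eta> > 0" and beta_pos: "\<beta> > 0"
proof -
  define P where "P = real_of_int a * real_of_int b"
  define S where "S = (P - sqrt (P\<^sup>2 - 4 * P)) / 2"
  have ab: "real_of_int a \<ge> 4" "real_of_int b \<ge> 5" using a_ge a_less_b by auto
  have P: "P \<ge> 20" unfolding P_def using mult_mono[OF ab] ab by simp
  have S1: "a * \<eta> = S" "b * \<beta> = S" using scaled_closed_form by (simp_all add: S_def P_def)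
  have nn: "P\<^sup>2 - 4 * P \<ge> 0" using P by (simp add: power2_eq_square mult_right_mono)
  have "P - 2 * S = sqrt (P\<^sup>2 - 4 * P)" by (simp add: S_def field_simps)
  then have "(P - 2 * S)\<^sup>2 = P\<^sup>2 - 4 * P" using nn by simp
  then have "S\<^sup>2 = P * S - P" by (simp add: power2_eq_square algebra_simps)
  have "\<eta> = S / a" "\<beta> = S / b" using S1 ab by (auto simp: field_simps)
  then have "D = S\<^sup>2 / P" by (simp add: D_eq P_def power2_eq_square)
  also have "\<dots> = S - 1" using \<open>S\<^sup>2 = P * S - P\<close> P by (simp add: field_simps)
  finally have D: "D = S - 1" .
  show "a * \<eta> = 1 + D" "b * \<beta> = 1 + D" using S1 D by auto
  have "(P - 212/100)\<^sup>2 < P\<^sup>2 - 4 * P" using P by (simp add: power2_eq_square algebra_simps)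
  then have "P - 212/100 < sqrt (P\<^sup>2 - 4 * P)" by (rule real_less_rsqrt)
  then show "D < 6/100" by (simp add: D S_def)
  have "P\<^sup>2 - 4 * P < P\<^sup>2" using P by simp
  then have "sqrt (P\<^sup>2 - 4 * P) < P" using P by (simp add: real_less_lsqrt)
  then have "S > 0" by (simp add: S_def)
  then show "\<eta> > 0" "\<beta> > 0" using \<open>\<eta> = S / a\<close> \<open>\<beta> = S / b\<close> ab by auto
qed

lemma a_D: "a * D = \<beta> * (1 + D)" and b_D: "b * D = \<eta> * (1 + D)"
proof -
  have "a * D = \<beta> * (a * \<eta>)" "b * D = \<eta> * (b * \<beta>)" by (simp_all add: D_eq)
  then show "a * D = \<beta> * (1 + D)" "b * D = \<eta> * (1 + D)" by (simp_all only: a_eta b_beta)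
qed

lemma D_pos: "D > 0" using eta_pos beta_pos by (simp add: D_eq)

lemma eta_less: "\<eta> < 265/1000"
proof -
  have "4 * \<eta> \<le> a * \<eta>" using a_ge eta_pos by (intro mult_right_mono) auto
  then show ?thesis using a_eta D_less by simp
qed

lemma beta_less: "\<beta> < 212/1000"
proof -
  have "5 * \<beta> \<le> b * \<beta>" using a_ge a_less_b beta_pos by (intro mult_right_mono) auto
  then show ?thesis using b_beta D_less by simp
qed

lemma eta_minus_beta: "(\<eta> - \<beta>) * (1 + D) = (b - a) * D"
proof -
  have "\<eta> * (b * \<beta>) - \<beta> * (a * \<eta>) = (b - a) * D" by (simp add: D_eq algebra_simps)
  then show ?thesis by (simp add: a_eta b_beta algebra_simps)
qed

lemma beta_less_eta: "\<beta> < \<eta>"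
proof -
  have "(\<eta> - \<beta>) * (1 + D) > 0" using eta_minus_beta a_less_b D_pos by simp
  then show ?thesis using D_pos by (simp add: zero_less_mult_iff)
qed

section \<open>Convergents and their scaled limits\<close>

definition cf :: "nat \<Rightarrow> int" where "cf k = (if even k then a else b)"

text \<open>\<open>pp\<close> and \<open>qq\<close> are numerators and denominators of the
  convergents, with starting values that make \<open>qq k * \<eta> - pp k\<close> equal to 1 at
  \<open>k = 0\<close> and to \<open>\<eta>\<close> at \<open>k = 1\<close>.\<close>

fun qq :: "nat \<Rightarrow> int" where
  "qq 0 = 0" | "qq (Suc 0) = 1" | "qq (Suc (Suc k)) = cf k * qq (Suc k) - qq k"

fun pp :: "nat \<Rightarrow> int" where
  "pp 0 = - 1" | "pp (Suc 0) = 0" | "pp (Suc (Suc k)) = cf k * pp (Suc k) - pp k"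

definition dd :: "nat \<Rightarrow> real" where "dd k = (if even k then 1 else \<eta>) * D ^ (k div 2)"

lemma dd_even: "dd (2 * i) = D ^ i" and dd_odd: "dd (2 * i + 1) = \<eta> * D ^ i"
  by (simp_all add: dd_def)

lemma dd_rec: "dd (Suc (Suc k)) = cf k * dd (Suc k) - dd k"
proof (cases "even k")
  case True
  then obtain i where k: "k = 2 * i" by blast
  have "dd (Suc (Suc k)) = D * D ^ i" "dd (Suc k) = \<eta> * D ^ i" "dd k = D ^ i"
    using dd_even[of i] dd_odd[of i] dd_even[of "i+1"] by (auto simp: k)
  moreover have "a * (\<eta> * D ^ i) = (1 + D) * D ^ i" by (metis a_eta mult.assoc)
  ultimately show ?thesis using True by (simp add: cf_def algebra_simps)
next
  case False
  then obtain i where k: "k = 2 * i + 1" by (metis oddE)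
  have "dd (Suc (Suc k)) = \<eta> * D * D ^ i" "dd (Suc k) = D * D ^ i" "dd k = \<eta> * D ^ i"
    using dd_odd[of i] dd_odd[of "i+1"] dd_even[of "i+1"] by (auto simp: k algebra_simps)
  moreover have "b * (D * D ^ i) = \<eta> * (1 + D) * D ^ i" by (metis b_D mult.assoc)
  ultimately show ?thesis using False by (simp add: cf_def algebra_simps)
qed

lemma dd_lattice: "dd k = qq k * \<eta> - pp k"
proof (induction k rule: pp.induct)
  case (3 k)
  have "dd (Suc (Suc k)) = cf k * (qq (Suc k) * \<eta> - pp (Suc k)) - (qq k * \<eta> - pp k)"
    unfolding dd_rec by (simp only: 3)
  then show ?case by (simp add: algebra_simps)
qed (simp_all add: dd_def)

lemma dd_pos: "dd k > 0" using eta_pos D_pos by (simp add: dd_def)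

lemma dd_decreasing: "dd (Suc k) < dd k"
proof (cases "even k")
  case True
  then obtain i where k: "k = 2 * i" by blast
  show ?thesis using eta_less D_pos dd_even[of i] dd_odd[of i] by (simp add: k)
next
  case False
  then obtain i where k: "k = 2 * i + 1" by (metis oddE)
  have "D ^ Suc i = \<eta> * D ^ i * \<beta>" by (simp add: D_eq)
  also have "\<dots> < \<eta> * D ^ i * 1" using beta_less eta_pos D_pos by (intro mult_strict_left_mono) auto
  finally show ?thesis using dd_odd[of i] dd_even[of "i+1"] by (simp add: k)
qed

lemma D_pow_lim: "(\<lambda>i. D ^ i) \<longlonglongrightarrow> 0"
  using D_pos D_less by (intro LIMSEQ_power_zero) auto

lemma dd_lim: "dd \<longlonglongrightarrow> 0"
proof (rule tendsto_sandwich[of "\<lambda>_. 0" _ _ "\<lambda>k. D ^ (k div 2)"])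
  show "\<forall>\<^sub>F n in sequentially. dd n \<le> D ^ (n div 2)"
    using eta_less eta_pos D_pos by (auto simp: dd_def)
  have "filterlim (\<lambda>k::nat. k div 2) sequentially sequentially"
    unfolding filterlim_at_top
  proof
    fix Z :: nat
    show "\<forall>\<^sub>F k in sequentially. Z \<le> k div 2"
      using eventually_ge_at_top[of "2 * Z"] by eventually_elim auto
  qed
  from filterlim_compose[OF D_pow_lim this] show "(\<lambda>k. D ^ (k div 2)) \<longlonglongrightarrow> 0" .
qed (use dd_pos in \<open>auto intro!: always_eventually less_imp_le\<close>)

text \<open>After scaling by \<open>(1 - D) * D ^ i\<close> the denominators tend to
  \<open>\<beta>\<close> and 1, while the remainders scale with \<open>D ^ i\<close>. Doubling both
  coordinates explains the factor \<open>4 * (1 - D)\<close> in \<open>M_star\<close>.\<close>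

lemma qq_even_odd:
  "(1 - D) * D ^ i * qq (2 * i) = \<beta> * (1 - D ^ (2 * i)) \<and>
   (1 - D) * D ^ i * qq (2 * i + 1) = 1 - D ^ (2 * i + 1)"
proof (induction i)
  case 0
  then show ?case by simp
next
  case (Suc i)
  let ?q0 = "real_of_int (qq (2 * i))" let ?q1 = "real_of_int (qq (2 * i + 1))"
  define t where "t = (1 - D) * D ^ i"
  define u where "u = D ^ (2 * i)"
  have I: "t * ?q0 = \<beta> * (1 - u)" "t * ?q1 = 1 - D * u" using Suc by (auto simp: t_def u_def)
  have q2: "real_of_int (qq (2 * Suc i)) = a * ?q1 - ?q0" by (simp add: cf_def)
  have q3: "real_of_int (qq (2 * Suc i + 1)) = b * real_of_int (qq (2 * Suc i)) - ?q1" by (simp add: cf_def)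
  have e: "(1 - D) * D ^ Suc i * real_of_int (qq (2 * Suc i)) = a * D * (t * ?q1) - D * (t * ?q0)"
    unfolding q2 by (simp add: t_def algebra_simps)
  also have "\<dots> = \<beta> * (1 - D * D * u)" unfolding I a_D by (simp add: algebra_simps)
  finally have e2: "(1 - D) * D ^ Suc i * real_of_int (qq (2 * Suc i)) = \<beta> * (1 - D * D * u)" .
  have "(1 - D) * D ^ Suc i * real_of_int (qq (2 * Suc i + 1))
      = b * ((1 - D) * D ^ Suc i * real_of_int (qq (2 * Suc i))) - D * (t * ?q1)"
    unfolding q3 by (simp add: t_def algebra_simps)
  also have "\<dots> = b * \<beta> * (1 - D * D * u) - D * (1 - D * u)" unfolding e2 I by simp
  also have "\<dots> = 1 - D * D * D * u" unfolding b_beta by (simp add: algebra_simps)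
  finally have e3: "(1 - D) * D ^ Suc i * real_of_int (qq (2 * Suc i + 1)) = 1 - D * D * D * u" .
  have "D ^ (2 * Suc i) = D * D * u" "D ^ (2 * Suc i + 1) = D * D * D * u" by (auto simp: u_def)
  then show ?case by (simp only: e2 e3)
qed

lemmas qq_even = qq_even_odd[THEN conjunct1] and qq_odd = qq_even_odd[THEN conjunct2]

lemma qq_increasing: "qq k < qq (Suc k) \<and> 0 \<le> qq k"
proof (induction k)
  case (Suc k)
  have "cf k \<ge> 2" using a_ge a_less_b by (simp add: cf_def)
  then have "cf k * qq (Suc k) \<ge> 2 * qq (Suc k)" using Suc by (intro mult_right_mono) auto
  then show ?case using Suc unfolding qq.simps by linarith
qed simp

lemma qq_pos: "k \<ge> 1 \<Longrightarrow> qq k > 0"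
  using qq_increasing[of "k-1"] by (cases k) auto

lemma M_star_ge:
  assumes "\<forall>\<^sub>F n::int in cofinite. c / (4 * (1 - D)) \<le> \<bar>real_of_int n\<bar> * ndist (real_of_int n * \<eta> - \<gamma>)"
  shows "ereal c \<le> M_star a b \<gamma>"
proof -
  have p: "4 * (1 - D) > 0" using D_less by simp
  have "ereal (c / (4 * (1 - D))) \<le> M_const \<eta> \<gamma>"
    unfolding M_const_def using assms by (intro Liminf_bounded) auto
  then have "ereal (4 * (1 - D)) * ereal (c / (4 * (1 - D))) \<le> M_star a b \<gamma>"
    unfolding M_star_def using p by (intro ereal_mult_left_mono) auto
  then show ?thesis using p by simp
qed

lemma M_star_gtD:
  assumes "ereal c < M_star a b \<gamma>"
  shows "\<forall>\<^sub>F n::int in cofinite. c / (4 * (1 - D)) < \<bar>real_of_int n\<bar> * ndist (real_of_int n * \<eta> - \<gamma>)"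
proof -
  have p: "4 * (1 - D) > 0" using D_less by simp
  have "ereal (c / (4 * (1 - D))) < M_const \<eta> \<gamma>"
  proof (rule ccontr)
    assume "\<not> ?thesis"
    then have "ereal (4 * (1 - D)) * M_const \<eta> \<gamma> \<le> ereal (4 * (1 - D)) * ereal (c / (4 * (1 - D)))"
      using p by (intro ereal_mult_left_mono) auto
    then show False using assms p unfolding M_star_def by simp
  qed
  from less_LiminfD[OF this[unfolded M_const_def]] show ?thesis by simp
qed

lemma ndist_le: "ndist x \<le> \<bar>x - of_int m\<bar>"
  unfolding ndist_def using round_diff_minimal[of x m] by (simp add: abs_minus_commute)

lemma ndist_half: "ndist x \<le> 1/2"
  unfolding ndist_def using of_int_round_abs_le[of x] by (simp add: abs_minus_commute)

definition p1 :: "real \<Rightarrow> real \<Rightarrow> real" where "p1 x y = (1 - \<beta> + x) * (1 - \<eta> + y)"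
definition p2 :: "real \<Rightarrow> real \<Rightarrow> real" where "p2 x y = (1 + \<beta> + x) * (1 + \<eta> - y)"
definition p3 :: "real \<Rightarrow> real \<Rightarrow> real" where "p3 x y = (1 + \<beta> - x) * (1 + \<eta> + y)"
definition p4 :: "real \<Rightarrow> real \<Rightarrow> real" where "p4 x y = (1 - \<beta> - x) * (1 - \<eta> - y)"

text \<open>A node sits at a digit \<open>s\<close> of the first kind; the digits before it are collected in
  \<open>x\<close> and the digits after it in \<open>z\<close>. The cells just before and just after
  that digit have the (scaled) vertex products \<open>p1\<close>, ..., \<open>p4\<close>.\<close>

definition half_node :: "real \<Rightarrow> real \<Rightarrow> real \<Rightarrow> bool" where
  "half_node c x y \<longleftrightarrow> \<bar>x\<bar> < 1 - \<beta> \<and> \<bar>y\<bar> < 1 - \<eta> \<and> c \<le> p1 x y \<and> c \<le> p2 x y \<and> c \<le> p3 x y \<and> c \<le> p4 x y"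

definition node :: "real \<Rightarrow> real \<Rightarrow> real \<Rightarrow> int \<Rightarrow> bool" where
  "node c x z s \<longleftrightarrow> half_node c x (\<eta> * (s + z)) \<and> half_node c z (\<eta> * (s + x))"

end

locale expansion = params +
  fixes n :: "nat \<Rightarrow> int" and r :: "nat \<Rightarrow> real" and \<gamma> :: real and m :: int and B :: real
  assumes r_rec: "\<And>k. r (Suc k) = r k - n k * dd (Suc k)"
    and gamma_eq: "\<gamma> = m + r 0"
    and n_bound: "\<And>k. \<bar>real_of_int (n k)\<bar> \<le> B"
    and r_bound: "\<And>k. \<bar>r k\<bar> \<le> B * dd k"
begin

fun Q :: "nat \<Rightarrow> int" where "Q 0 = 0" | "Q (Suc k) = Q k + n k * qq (Suc k)"

text \<open>Doubling keeps the deviation from the centre \<open>(a - 2)/2\<close> integral. Since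
  \<open>a\<close> is even and \<open>b\<close> odd, every \<open>s i\<close> is even and every
  \<open>E i\<close> is odd.\<close>

definition s :: "nat \<Rightarrow> int" where "s i = 2 * n (2 * i) - (a - 2)"
definition E :: "nat \<Rightarrow> int" where "E i = 2 * n (2 * i + 1) - (b - 2)"

fun X :: "nat \<Rightarrow> real" where "X 0 = 0" | "X (Suc i) = \<beta> * (E i + \<eta> * (s i + X i))"
text \<open>This is the remainder solved for the unknown in \<open>r_even\<close>;
  \<open>Y_rec\<close> then identifies it as the series over the later digits.\<close>

definition Y :: "nat \<Rightarrow> real" where "Y i = (2 * r (2 * i) / D ^ i - 1 + \<eta>) / \<eta> - s i"

lemma B_nonneg: "B \<ge> 0" using n_bound[of 0] by linarith

lemma r_even: "2 * r (2 * i) = D ^ i * (1 - \<eta> + \<eta> * (s i + Y i))"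
  using eta_pos D_pos by (simp add: Y_def field_simps)

lemma r_odd: "2 * r (2 * i + 1) = \<eta> * D ^ i * (1 - \<beta> + Y i)"
proof -
  have "a * \<eta> = 1 + \<eta> * \<beta>" using a_eta by (simp add: D_eq)
  then have e: "1 - \<eta> + \<eta> * (s i + Y i) - 2 * n (2 * i) * \<eta> = \<eta> * (1 - \<beta> + Y i)"
    by (simp add: s_def algebra_simps)
  have "2 * r (2 * i + 1) = 2 * r (2 * i) - 2 * n (2 * i) * (\<eta> * D ^ i)"
    using r_rec[of "2 * i"] dd_odd[of i] by simp
  also have "\<dots> = D ^ i * (1 - \<eta> + \<eta> * (s i + Y i) - 2 * n (2 * i) * \<eta>)"
    unfolding r_even by (simp add: algebra_simps)
  finally show ?thesis unfolding e by simp
qed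

lemma Y_rec: "Y i = \<beta> * (E i + \<eta> * (s (Suc i) + Y (Suc i)))"
proof -
  have "b * \<beta> = 1 + D" by (rule b_beta)
  then have e: "\<eta> * (1 - \<beta> + Y i) - 2 * n (2 * i + 1) * D
      = \<eta> * Y i - \<eta> * \<beta> * E i + D * (1 - \<eta>)"
    unfolding E_def D_eq by (simp add: algebra_simps) algebra
  have "D ^ i * (D * (1 - \<eta> + \<eta> * (s (Suc i) + Y (Suc i)))) = 2 * r (2 * Suc i)"
    using r_even[of "Suc i"] by simp
  also have "\<dots> = 2 * r (2 * i + 1) - 2 * n (2 * i + 1) * (D ^ i * D)"
    using r_rec[of "2 * i + 1"] dd_even[of "Suc i"] by simp
  also have "\<dots> = D ^ i * (\<eta> * (1 - \<beta> + Y i) - 2 * n (2 * i + 1) * D)"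
    unfolding r_odd by (simp add: algebra_simps)
  finally have "D * (1 - \<eta> + \<eta> * (s (Suc i) + Y (Suc i))) = \<eta> * Y i - \<eta> * \<beta> * E i + D * (1 - \<eta>)"
    unfolding e using D_pos by simp
  then have "\<eta> * Y i = \<eta> * (\<beta> * (E i + \<eta> * (s (Suc i) + Y (Suc i))))"
    unfolding D_eq by (simp add: algebra_simps)
  then show ?thesis using eta_pos by simp
qed

text \<open>\<open>1 - \<beta> + X i\<close> is the limit form of the scaled abscissa.
  \<open>Z\<close> is its error, caused by the start of the expansion and by the corrections
  \<open>D ^ (2 * i)\<close> in the closed form of \<open>qq\<close>; the recursion contracts it by
  \<open>D\<close>.\<close>

definition Z :: "nat \<Rightarrow> real" where "Z i = 2 * ((1 - D) * D ^ i * Q (2 * i)) - (1 - \<beta> + X i)"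

lemma Z_rec: "Z (Suc i) = D * Z i - 2 * (n (2 * i) + n (2 * i + 1) * \<beta>) * D ^ (2 * i + 2)"
proof -
  let ?t = "(1 - D) * D ^ i"
  have Q: "real_of_int (Q (2 * Suc i)) = Q (2 * i) + n (2 * i) * qq (2 * i + 1) + n (2 * i + 1) * qq (2 * Suc i)"
    by simp
  have 1: "(1 - D) * D ^ Suc i * Q (2 * Suc i) = D * (?t * Q (2 * i)) + n (2 * i) * (D * (?t * qq (2 * i + 1)))
      + n (2 * i + 1) * ((1 - D) * D ^ Suc i * qq (2 * Suc i))"
    unfolding Q by (simp add: algebra_simps)
  have t: "2 * (?t * Q (2 * i)) = Z i + (1 - \<beta> + X i)" by (simp add: Z_def)
  define u where "u = D ^ (2 * i)"
  have u: "D ^ (2 * i + 1) = D * u" "D ^ (2 * Suc i) = D * D * u" "D ^ (2 * i + 2) = D * D * u" by (auto simp: u_def)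
  have "2 * ((1 - D) * D ^ Suc i * Q (2 * Suc i)) = D * (Z i + (1 - \<beta> + X i)) + 2 * n (2 * i) * (D * (1 - D * u))
      + 2 * n (2 * i + 1) * (\<beta> * (1 - D * D * u))"
  proof -
    have "2 * ((1 - D) * D ^ Suc i * Q (2 * Suc i)) = D * (2 * (?t * Q (2 * i)))
        + 2 * n (2 * i) * (D * (?t * qq (2 * i + 1)))
        + 2 * n (2 * i + 1) * ((1 - D) * D ^ Suc i * qq (2 * Suc i))"
      unfolding 1 by (simp only: distrib_left mult.assoc mult.left_commute[of 2])
    then show ?thesis unfolding t qq_odd qq_even u .
  qed
  moreover
  have n1: "2 * n (2 * i) = s i + a - 2"
    and n2: "2 * n (2 * i + 1) = E i + b - 2" by (auto simp: s_def E_def)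
  ultimately have W: "2 * ((1 - D) * D ^ Suc i * Q (2 * Suc i)) = D * (Z i + (1 - \<beta> + X i))
      + (s i + a - 2) * (D * (1 - D * u)) + (E i + b - 2) * (\<beta> * (1 - D * D * u))"
    by (simp only: n1 n2)
  have X: "X (Suc i) = \<beta> * E i + D * s i + D * X i" by (simp add: D_eq algebra_simps)
  have "Z (Suc i) = D * (Z i + (1 - \<beta> + X i))
      + (s i + a - 2) * (D * (1 - D * u)) + (E i + b - 2) * (\<beta> * (1 - D * D * u))
      - (1 - \<beta> + (\<beta> * E i + D * s i + D * X i))"
    unfolding Z_def[of "Suc i"] W X ..
  also have "\<dots> = D * Z i - (s i + a - 2) * (D * D * u) - (E i + b - 2) * \<beta> * (D * D * u)
      + (a * D + b * \<beta> + D - D * \<beta> - 2 * D - 2 * \<beta> - 1 + \<beta>)" by (simp add: algebra_simps)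
  also have "a * D + b * \<beta> + D - D * \<beta> - 2 * D - 2 * \<beta> - 1 + \<beta> = 0"
    unfolding a_D b_beta by (simp add: algebra_simps)
  also have "(s i + a - 2) = 2 * n (2 * i)" by (simp add: s_def)
  also have "(E i + b - 2) = 2 * n (2 * i + 1)" by (simp add: E_def)
  finally show ?thesis unfolding u by (simp add: algebra_simps)
qed

lemma Z_bound: "\<bar>Z i\<bar> \<le> (\<bar>Z 0\<bar> + 4 * B * i) * D ^ i"
proof (induction i)
  case (Suc i)
  have D1: "0 \<le> D" "D \<le> 1" using D_pos D_less by auto
  have "\<bar>n (2 * i + 1) * \<beta>\<bar> \<le> B * 1" unfolding abs_mult
    using n_bound[of "2*i+1"] beta_pos beta_less B_nonneg by (intro mult_mono) auto
  then have "\<bar>2 * (n (2 * i) + n (2 * i + 1) * \<beta>)\<bar> \<le> 4 * B" using abs_add_le[OF n_bound[of "2*i"]] by fastforce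
  moreover have "D ^ (2 * i + 2) \<le> D ^ Suc i" using D1 by (intro power_decreasing) auto
  ultimately have 1: "\<bar>2 * (n (2 * i) + n (2 * i + 1) * \<beta>) * D ^ (2 * i + 2)\<bar> \<le> 4 * B * D ^ Suc i"
    unfolding abs_mult[of _ "D ^ (2*i+2)"] using D1 B_nonneg by (intro mult_mono) auto
  have "\<bar>D * Z i\<bar> \<le> D * ((\<bar>Z 0\<bar> + 4 * B * i) * D ^ i)"
    unfolding abs_mult using Suc D1 by (intro mult_mono) auto
  then have "\<bar>Z (Suc i)\<bar> \<le> D * ((\<bar>Z 0\<bar> + 4 * B * i) * D ^ i) + 4 * B * D ^ Suc i"
    unfolding Z_rec using 1 by linarith
  then show ?case by (simp add: algebra_simps)
qed simp

lemma Z_lim: "Z \<longlonglongrightarrow> 0"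
proof (rule tendsto_rabs_zero_cancel, rule tendsto_sandwich)
  show "\<forall>\<^sub>F i in sequentially. 0 \<le> \<bar>Z i\<bar>"
    "\<forall>\<^sub>F i in sequentially. \<bar>Z i\<bar> \<le> (\<bar>Z 0\<bar> + 4 * B * real i) * D ^ i" using Z_bound by auto
  have "(\<lambda>i. real i * D ^ i) \<longlonglongrightarrow> 0" using D_pos D_less by (intro powser_times_n_limit_0) auto
  then have "(\<lambda>i. \<bar>Z 0\<bar> * D ^ i + 4 * B * (real i * D ^ i)) \<longlonglongrightarrow> \<bar>Z 0\<bar> * 0 + 4 * B * 0"
    by (intro tendsto_intros D_pow_lim)
  then show "(\<lambda>i. (\<bar>Z 0\<bar> + 4 * B * real i) * D ^ i) \<longlonglongrightarrow> 0" by (simp add: algebra_simps)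
qed simp

lemma s_bound: "\<bar>real_of_int (s i)\<bar> \<le> 2 * B + b"
  using n_bound[of "2*i+1"] n_bound[of "2*i"] a_ge a_less_b unfolding E_def s_def by auto

lemma Y_bounded: "\<bar>\<eta> * (s i + Y i)\<bar> \<le> 2 * B + 1"
proof -
  have "D ^ i * \<bar>1 - \<eta> + \<eta> * (s i + Y i)\<bar> = \<bar>2 * r (2 * i)\<bar>"
    unfolding r_even using D_pos by (simp add: abs_mult)
  also have "\<dots> \<le> D ^ i * (2 * B)" using r_bound[of "2 * i"] dd_even[of i] by (simp add: algebra_simps)
  finally have "\<bar>1 - \<eta> + \<eta> * (s i + Y i)\<bar> \<le> 2 * B" using D_pos by simp
  then show ?thesis using eta_pos eta_less by linarith
qed

end

section \<open>From limit cells to exact cells\<close>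

context params begin

lemma approx_product_eventually:
  fixes A A' B :: "nat \<Rightarrow> real"
  assumes AB: "\<And>i. i \<ge> K \<Longrightarrow> c \<le> A' i * B i" and B: "\<And>i. i \<ge> K \<Longrightarrow> 0 < B i \<and> B i \<le> 3"
    and lim: "(\<lambda>i. A i - A' i) \<longlonglongrightarrow> 0" and c: "0 < c" "c' < c"
  shows "\<forall>\<^sub>F i in sequentially. 0 < A i \<and> c' \<le> A i * B i"
proof -
  \<comment> \<open>The bound \<open>c / 3\<close> keeps the perturbed factor positive, and
    \<open>(c - c') / 3\<close> limits the loss to \<open>c - c'\<close>, because the other factor
    is at most 3.\<close>
  define \<delta> where "\<delta> = min ((c - c') / 3) (c / 3)"
  have \<delta>: "\<delta> > 0" using c by (auto simp: \<delta>_def)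
  have "\<forall>\<^sub>F i in sequentially. \<bar>A i - A' i\<bar> < \<delta>"
    using tendstoD[OF lim \<delta>] by (simp add: dist_real_def)
  then show ?thesis using eventually_ge_at_top[of K]
  proof eventually_elim
    case (elim i)
    have Bi: "0 < B i" "B i \<le> 3" and cAB: "c \<le> A' i * B i" using B AB elim(2) by auto
    have "A' i > 0" using cAB c(1) Bi by (smt (verit) mult_nonpos_nonneg)
    then have "A' i * B i \<le> A' i * 3" using Bi by (intro mult_left_mono) auto
    then have "A' i \<ge> c / 3" using cAB by simp
    moreover have "A i \<ge> A' i - \<bar>A i - A' i\<bar>" "\<delta> \<le> c / 3" by (auto simp: \<delta>_def)
    ultimately have 1: "A i > 0" using elim(1) by linarith
    have "\<bar>(A i - A' i) * B i\<bar> \<le> \<delta> * 3" unfolding abs_mult using elim(1) Bi by (intro mult_mono) auto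
    moreover have "\<delta> \<le> (c - c') / 3" unfolding \<delta>_def by (rule min.cobounded1)
    ultimately have "\<bar>(A i - A' i) * B i\<bar> \<le> c - c'" by (elim order_trans) simp
    then have "A i * B i \<ge> A' i * B i - (c - c')" by (simp add: algebra_simps)
    then show ?case using 1 cAB by simp
  qed
qed

lemma rescale:
  assumes "2 * ((1 - D) * e * x) = A" and "2 * y = e * B" and "e > 0"
  shows "4 * (1 - D) * (x * y) = A * B"
proof -
  have "e * (4 * (1 - D) * (x * y)) = (2 * ((1 - D) * e * x)) * (2 * y)" by (simp add: algebra_simps)
  also have "\<dots> = e * (A * B)" unfolding assms(1,2) by (simp add: algebra_simps)
  finally show ?thesis using assms(3) by simp
qed

text \<open>One statement serves both parities: \<open>(\<mu>, \<nu>)\<close> is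
  \<open>(\<beta>, \<eta>)\<close> at even stages and \<open>(\<eta>, \<beta>)\<close> at odd ones,
  and \<open>z1\<close>, \<open>z2\<close>, \<open>z3\<close> are the vanishing errors of the three
  abscissas.\<close>

lemma cell_eventually:
  fixes e x y q q' \<xi> \<zeta> z1 z2 z3 :: "nat \<Rightarrow> real"
  assumes e: "\<And>i. e i > 0"
    and hx: "\<And>i. 2 * ((1 - D) * e i * x i) = 1 - \<mu> + \<xi> i + z1 i"
    and hq: "\<And>i. 2 * ((1 - D) * e i * q i) = 2 * \<mu> + z2 i"
    and hq': "\<And>i. 2 * ((1 - D) * e i * q' i) = 2 + z3 i"
    and hy: "\<And>i. 2 * y i = e i * (1 - \<nu> + \<zeta> i)"
    and z: "z1 \<longlonglongrightarrow> 0" "z2 \<longlonglongrightarrow> 0" "z3 \<longlonglongrightarrow> 0" and \<nu>: "0 < \<nu>" "\<nu> < 1"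
    and c: "0 < c" "c' < c"
    and nodes: "\<And>i. i \<ge> K \<Longrightarrow> \<bar>\<zeta> i\<bar> < 1 - \<nu> \<and> c \<le> (1 - \<mu> + \<xi> i) * (1 - \<nu> + \<zeta> i)
       \<and> c \<le> (1 + \<mu> + \<xi> i) * (1 + \<nu> - \<zeta> i) \<and> c \<le> (1 + \<mu> - \<xi> i) * (1 + \<nu> + \<zeta> i)
       \<and> c \<le> (1 - \<mu> - \<xi> i) * (1 - \<nu> - \<zeta> i)"
  shows "\<forall>\<^sub>F i in sequentially. 0 < x i \<and> x i < q' i - q i \<and> 0 < y i \<and> y i < e i - e i * \<nu>
     \<and> c' \<le> 4 * (1 - D) * (x i * y i) \<and> c' \<le> 4 * (1 - D) * ((x i + q i) * (e i - y i))
     \<and> c' \<le> 4 * (1 - D) * ((q' i - x i) * (y i + e i * \<nu>))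
     \<and> c' \<le> 4 * (1 - D) * ((q' i - q i - x i) * (e i - e i * \<nu> - y i))"
proof -
  have l2: "(\<lambda>i. z1 i + z2 i) \<longlonglongrightarrow> 0" using tendsto_add[OF z(1,2)] by simp
  have l3: "(\<lambda>i. z3 i - z1 i) \<longlonglongrightarrow> 0" using tendsto_diff[OF z(3,1)] by simp
  have l4: "(\<lambda>i. z3 i - z2 i - z1 i) \<longlonglongrightarrow> 0" using tendsto_diff[OF tendsto_diff[OF z(3,2)] z(1)] by simp
  have e1: "\<forall>\<^sub>F i in sequentially. 0 < 1 - \<mu> + \<xi> i + z1 i \<and> c' \<le> (1 - \<mu> + \<xi> i + z1 i) * (1 - \<nu> + \<zeta> i)"
  proof (rule approx_product_eventually[OF _ _ _ c])
    fix i assume "K \<le> i"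
    then show "c \<le> (1 - \<mu> + \<xi> i) * (1 - \<nu> + \<zeta> i)" "0 < 1 - \<nu> + \<zeta> i \<and> 1 - \<nu> + \<zeta> i \<le> 3"
      using nodes[of i] \<nu> by auto
  qed (use z in simp)
  have e2: "\<forall>\<^sub>F i in sequentially. 0 < 1 + \<mu> + \<xi> i + (z1 i + z2 i) \<and>
      c' \<le> (1 + \<mu> + \<xi> i + (z1 i + z2 i)) * (1 + \<nu> - \<zeta> i)"
  proof (rule approx_product_eventually[OF _ _ _ c])
    fix i assume "K \<le> i"
    then show "c \<le> (1 + \<mu> + \<xi> i) * (1 + \<nu> - \<zeta> i)" "0 < 1 + \<nu> - \<zeta> i \<and> 1 + \<nu> - \<zeta> i \<le> 3"
      using nodes[of i] \<nu> by auto
  qed (use l2 in simp)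
  have e3: "\<forall>\<^sub>F i in sequentially. 0 < 1 + \<mu> - \<xi> i + (z3 i - z1 i) \<and>
      c' \<le> (1 + \<mu> - \<xi> i + (z3 i - z1 i)) * (1 + \<nu> + \<zeta> i)"
  proof (rule approx_product_eventually[OF _ _ _ c])
    fix i assume "K \<le> i"
    then show "c \<le> (1 + \<mu> - \<xi> i) * (1 + \<nu> + \<zeta> i)" "0 < 1 + \<nu> + \<zeta> i \<and> 1 + \<nu> + \<zeta> i \<le> 3"
      using nodes[of i] \<nu> by auto
  qed (use l3 in simp)
  have e4: "\<forall>\<^sub>F i in sequentially. 0 < 1 - \<mu> - \<xi> i + (z3 i - z2 i - z1 i) \<and>
      c' \<le> (1 - \<mu> - \<xi> i + (z3 i - z2 i - z1 i)) * (1 - \<nu> - \<zeta> i)"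
  proof (rule approx_product_eventually[OF _ _ _ c])
    fix i assume "K \<le> i"
    then show "c \<le> (1 - \<mu> - \<xi> i) * (1 - \<nu> - \<zeta> i)" "0 < 1 - \<nu> - \<zeta> i \<and> 1 - \<nu> - \<zeta> i \<le> 3"
      using nodes[of i] \<nu> by auto
  qed (use l4 in simp)
  show ?thesis using e1 e2 e3 e4 eventually_ge_at_top[of K]
  proof eventually_elim
    case (elim i)
    have D1: "(1 - D) * e i > 0" using e[of i] D_less by simp
    have \<zeta>: "\<bar>\<zeta> i\<bar> < 1 - \<nu>" using nodes elim(5) by auto
    have h4: "2 * ((1 - D) * e i * (q' i - q i - x i)) = 1 - \<mu> - \<xi> i + (z3 i - z2 i - z1 i)"
      using hx[of i] hq[of i] hq'[of i] by (simp add: algebra_simps)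
    have h2: "2 * ((1 - D) * e i * (x i + q i)) = 1 + \<mu> + \<xi> i + (z1 i + z2 i)"
      using hx[of i] hq[of i] by (simp add: algebra_simps)
    have h3: "2 * ((1 - D) * e i * (q' i - x i)) = 1 + \<mu> - \<xi> i + (z3 i - z1 i)"
      using hx[of i] hq'[of i] by (simp add: algebra_simps)
    have y2: "2 * (e i - y i) = e i * (1 + \<nu> - \<zeta> i)" and y3: "2 * (y i + e i * \<nu>) = e i * (1 + \<nu> + \<zeta> i)"
      and y4: "2 * (e i - e i * \<nu> - y i) = e i * (1 - \<nu> - \<zeta> i)" using hy[of i] by (auto simp: algebra_simps)
    have "(1 - D) * e i * x i > 0" "(1 - D) * e i * (q' i - q i - x i) > 0"
      using elim(1,4) hx[of i] h4 by auto
    then have x: "x i > 0" "q' i - q i - x i > 0" using D1 by (simp_all only: zero_less_mult_pos[OF _ D1])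
    have "e i * (1 - \<nu> + \<zeta> i) > 0" "e i * (1 - \<nu> - \<zeta> i) > 0" using e[of i] \<zeta> by auto
    then have y: "y i > 0" "e i - e i * \<nu> - y i > 0" using hy[of i] y4 by auto
    show ?case
      using x y elim(1-4) rescale[OF hx hy e] rescale[OF h2 y2 e] rescale[OF h3 y3 e] rescale[OF h4 y4 e] by simp
  qed
qed

text \<open>A lower bound on a liminf controls only absolute values. A wrong sign either makes one
  product too small at once, or lets two products be regrouped into factors
  \<open>t * (2 * k - t) \<le> k * k\<close>, so that their product falls below
  \<open>c * c\<close>.\<close>

lemma divided_cell_signs:
  fixes \<mu> \<nu> x y c :: real
  assumes mu: "0 < \<mu>" "\<mu> < 27/100" and mu_nu: "\<mu> * \<nu> < 6/100" and nu: "0 < \<nu>" "\<nu> < 27/100" and c: "27/100 \<le> c"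
    and A: "- (1/100) \<le> 1 - \<mu> + x" "1 - \<mu> + x \<le> 2 + 1/100" and B: "0 \<le> 1 - \<nu> + y" "1 - \<nu> + y \<le> 2"
    and P1: "c \<le> \<bar>(1 - \<mu> + x) * (1 - \<nu> + y)\<bar>" and P2: "c \<le> \<bar>(1 + \<mu> + x) * (1 + \<nu> - y)\<bar>"
    and P3: "c \<le> \<bar>(1 + \<mu> - x) * (1 + \<nu> + y)\<bar>" and P4: "c \<le> \<bar>(1 - \<mu> - x) * (1 - \<nu> - y)\<bar>"
  shows "\<bar>x\<bar> < 1 - \<mu> \<and> \<bar>y\<bar> < 1 - \<nu>"
proof -
  define A B where "A = 1 - \<mu> + x" and "B = 1 - \<nu> + y"
  have A2: "-(1/100) \<le> A" "A \<le> 2 + 1/100" and B2: "0 \<le> B" "B \<le> 2" using A B by (auto simp: A_def B_def)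
  have P1: "c \<le> \<bar>A * B\<bar>" and P2: "c \<le> \<bar>(2 * \<mu> + A) * (2 - B)\<bar>" and P3: "c \<le> \<bar>(2 - A) * (2 * \<nu> + B)\<bar>"
    and P4: "c \<le> \<bar>(2 - 2 * \<mu> - A) * (2 - 2 * \<nu> - B)\<bar>"
  proof -
    have "2 * \<mu> + A = 1 + \<mu> + x" "2 - B = 1 + \<nu> - y" "2 - A = 1 + \<mu> - x" "2 * \<nu> + B = 1 + \<nu> + y"
      "2 - 2 * \<mu> - A = 1 - \<mu> - x" "2 - 2 * \<nu> - B = 1 - \<nu> - y" by (auto simp: A_def B_def)
    then show "c \<le> \<bar>A * B\<bar>" "c \<le> \<bar>(2 * \<mu> + A) * (2 - B)\<bar>" "c \<le> \<bar>(2 - A) * (2 * \<nu> + B)\<bar>"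
      "c \<le> \<bar>(2 - 2 * \<mu> - A) * (2 - 2 * \<nu> - B)\<bar>"
      using P1 P2 P3 P4 by (simp_all only: A_def[symmetric] B_def[symmetric])
  qed
  have A0: "A > 0"
  proof (rule ccontr)
    assume "\<not> A > 0"
    then have "\<bar>A\<bar> * \<bar>B\<bar> \<le> 1/100 * 2" using A2 B2 by (intro mult_mono) auto
    then show False using P1 c by (simp add: abs_mult)
  qed
  have B0: "B > 0"
  proof (rule ccontr)
    assume "\<not> B > 0"
    then have "B = 0" using B2 by simp
    then show False using P1 c by simp
  qed
  have A3: "A < 2"
  proof (rule ccontr)
    assume "\<not> A < 2"
    then have "\<bar>2 - A\<bar> * \<bar>2 * \<nu> + B\<bar> \<le> 1/100 * 3" using A2 B2 nu by (intro mult_mono) auto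
    then show False using P3 c by (simp add: abs_mult)
  qed
  have sq: "t * (2 * k - t) \<le> k * k" for t k :: real
    using zero_le_square[of "t - k"] by (simp add: algebra_simps)
  have A4: "A < 2 - 2 * \<mu>"
  proof (rule ccontr)
    assume "\<not> ?thesis"
    then have x: "0 \<le> A - (2 - 2 * \<mu>)" by simp
    show False
    proof (cases "B \<le> 2 - 2 * \<nu>")
      case True
      have "c * c \<le> \<bar>(2 - A) * (2 * \<nu> + B)\<bar> * \<bar>(2 - 2 * \<mu> - A) * (2 - 2 * \<nu> - B)\<bar>"
        using P3 P4 c by (intro mult_mono) auto
      also have "\<dots> = ((A - (2 - 2 * \<mu>)) * (2 * \<mu> - (A - (2 - 2 * \<mu>)))) * ((2 * \<nu> + B) * (2 * 1 - (2 * \<nu> + B)))"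
        using True x A3 B2 nu by (simp add: abs_mult)
      also have "\<dots> \<le> (\<mu> * \<mu>) * (1 * 1)"
        by (rule mult_mono[OF sq sq]) (use True B2 nu mu in auto)
      finally have "c * c \<le> \<mu> * \<mu>" by simp
      moreover have "\<mu> * \<mu> < c * c" using mu c by (intro mult_strict_mono) auto
      ultimately show False by simp
    next
      case False
      \<comment> \<open>Here both factors are small: the product is at most
        \<open>4 * \<mu> * \<nu>\<close>, below \<open>24/100\<close>.\<close>
      have "\<bar>2 - 2 * \<mu> - A\<bar> * \<bar>2 - 2 * \<nu> - B\<bar> \<le> (2 * \<mu>) * (2 * \<nu>)"
        using x False A3 B2 mu nu by (intro mult_mono) auto
      then show False using P4 c mu_nu by (simp add: abs_mult)
    qed
  qed
  have B4: "B < 2 - 2 * \<nu>"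
  proof (rule ccontr)
    assume "\<not> ?thesis"
    then have x: "0 \<le> B - (2 - 2 * \<nu>)" by simp
    have "c * c \<le> \<bar>(2 * \<mu> + A) * (2 - B)\<bar> * \<bar>(2 - 2 * \<mu> - A) * (2 - 2 * \<nu> - B)\<bar>"
      using P2 P4 c by (intro mult_mono) auto
    also have "\<dots> = ((2 * \<mu> + A) * (2 * 1 - (2 * \<mu> + A))) * ((B - (2 - 2 * \<nu>)) * (2 * \<nu> - (B - (2 - 2 * \<nu>))))"
      using A4 x A0 B2 mu by (simp add: abs_mult)
    also have "\<dots> \<le> (1 * 1) * (\<nu> * \<nu>)"
      by (rule mult_mono[OF sq sq]) (use x B2 mu nu in auto)
    finally have "c * c \<le> \<nu> * \<nu>" by simp
    moreover have "\<nu> * \<nu> < c * c" using nu c by (intro mult_strict_mono) auto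
    ultimately show False by simp
  qed
  show ?thesis using A0 B0 A4 B4 by (auto simp: A_def B_def)
qed

end

context expansion begin

lemma s_eq: "2 * n (2 * i) = s i + a - 2" and E_eq: "2 * n (2 * i + 1) = E i + b - 2"
  by (simp_all add: s_def E_def)

lemma r_lattice: "\<exists>p::int. - r k = Q k * \<eta> - \<gamma> + p"
proof (induction k)
  case 0
  then show ?case using gamma_eq by (intro exI[of _ m]) simp
next
  case (Suc k)
  then obtain p :: int where "- r k = Q k * \<eta> - \<gamma> + p" by blast
  then have "- r (Suc k) = Q (Suc k) * \<eta> - \<gamma> + (p - n k * pp (Suc k))"
    unfolding r_rec dd_lattice by (simp add: algebra_simps)
  then show ?case by (metis of_int_diff of_int_mult)
qed

lemma x_even: "2 * ((1 - D) * D ^ i * Q (2 * i)) = 1 - \<beta> + X i + Z i"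
  by (simp add: Z_def)

lemma x_odd: "2 * ((1 - D) * (\<eta> * D ^ i) * Q (2 * i + 1))
    = 1 - \<eta> + \<eta> * (s i + X i) + (\<eta> * Z i - \<eta> * (2 * n (2 * i)) * D ^ (2 * i + 1))"
proof -
  have "2 * ((1 - D) * (\<eta> * D ^ i) * Q (2 * i + 1)) = \<eta> * (2 * ((1 - D) * D ^ i * Q (2 * i)))
      + \<eta> * (2 * n (2 * i)) * ((1 - D) * D ^ i * qq (2 * i + 1))"
    by (simp add: algebra_simps)
  also have "\<dots> = \<eta> * (1 - \<beta> + X i + Z i) + \<eta> * (2 * n (2 * i)) * (1 - D ^ (2 * i + 1))"
    unfolding x_even qq_odd ..
  also have "\<eta> * (1 - \<beta> + X i + Z i) = \<eta> * (1 - \<beta> + X i) + \<eta> * Z i" by (simp add: algebra_simps)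
  also have "\<eta> * (1 - \<beta> + X i) + \<eta> * (2 * n (2 * i)) = \<eta> * (s i + X i) - \<eta> + (a * \<eta> - \<eta> * \<beta>)"
    unfolding s_eq by (simp add: algebra_simps)
  then have "\<eta> * (1 - \<beta> + X i) = \<eta> * (s i + X i) - \<eta> + 1 - \<eta> * (2 * n (2 * i))"
    unfolding a_eta D_eq by simp
  finally show ?thesis by (simp add: algebra_simps)
qed

lemma qq_even_scaled: "2 * ((1 - D) * D ^ i * qq (2 * i)) = 2 * \<beta> + - 2 * \<beta> * D ^ (2 * i)"
  and qq_odd_scaled: "2 * ((1 - D) * D ^ i * qq (2 * i + 1)) = 2 + - 2 * D ^ (2 * i + 1)"
  unfolding qq_odd qq_even by (simp_all add: algebra_simps)

lemma qq_odd_scaled': "2 * ((1 - D) * (\<eta> * D ^ i) * qq (2 * i + 1)) = 2 * \<eta> + - 2 * \<eta> * D ^ (2 * i + 1)"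
proof -
  have "2 * ((1 - D) * (\<eta> * D ^ i) * qq (2 * i + 1)) = 2 * \<eta> * ((1 - D) * D ^ i * qq (2 * i + 1))" by simp
  also have "\<dots> = 2 * \<eta> * (1 - D ^ (2 * i + 1))" unfolding qq_odd ..
  finally show ?thesis by (simp add: algebra_simps)
qed

lemma qq_even_scaled': "2 * ((1 - D) * (\<eta> * D ^ i) * qq (2 * i + 2)) = 2 + - 2 * D ^ (2 * i + 2)"
proof -
  have "\<beta> * (2 * ((1 - D) * (\<eta> * D ^ i) * qq (2 * i + 2))) = 2 * ((1 - D) * D ^ Suc i * qq (2 * Suc i))"
    by (simp add: D_eq)
  also have "\<dots> = \<beta> * (2 * (1 - D ^ (2 * Suc i)))" unfolding qq_even by simp
  finally have "2 * ((1 - D) * (\<eta> * D ^ i) * qq (2 * i + 2)) = 2 * (1 - D ^ (2 * Suc i))"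
    using beta_pos by (simp only: mult_cancel_left) auto
  then show ?thesis by simp
qed

lemma D_lims: "(\<lambda>i. D ^ (2 * i)) \<longlonglongrightarrow> 0" "(\<lambda>i. D ^ (2 * i + 1)) \<longlonglongrightarrow> 0" "(\<lambda>i. D ^ (2 * i + 2)) \<longlonglongrightarrow> 0"
proof -
  have D2: "D * D < 1" using D_pos D_less mult_strict_mono[of D 1 D 1] by simp
  then have "(\<lambda>i. (D * D) ^ i) \<longlonglongrightarrow> 0" using D_pos by (intro LIMSEQ_power_zero) auto
  moreover have "(D * D) ^ i = D ^ (2 * i)" for i by (simp add: power_mult power2_eq_square)
  ultimately show 1: "(\<lambda>i. D ^ (2 * i)) \<longlonglongrightarrow> 0" by simp
  show "(\<lambda>i. D ^ (2 * i + 1)) \<longlonglongrightarrow> 0" using tendsto_mult_left[OF 1, of D] by simp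
  show "(\<lambda>i. D ^ (2 * i + 2)) \<longlonglongrightarrow> 0" using tendsto_mult_left[OF 1, of "D * D"] by (simp add: mult.assoc)
qed

lemma digit_lim: "(\<lambda>i. \<eta> * Z i - \<eta> * (2 * n (2 * i)) * D ^ (2 * i + 1)) \<longlonglongrightarrow> 0"
proof -
  have "(\<lambda>i. real_of_int (n (2 * i)) * D ^ (2 * i + 1)) \<longlonglongrightarrow> 0"
  proof (rule tendsto_rabs_zero_cancel, rule tendsto_sandwich[of "\<lambda>_. 0" _ _ "\<lambda>i. B * D ^ (2 * i + 1)"])
    show "\<forall>\<^sub>F i in sequentially. \<bar>real_of_int (n (2 * i)) * D ^ (2 * i + 1)\<bar> \<le> B * D ^ (2 * i + 1)"
      using n_bound D_pos by (intro always_eventually allI) (simp add: abs_mult mult_right_mono)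
    show "(\<lambda>i. B * D ^ (2 * i + 1)) \<longlonglongrightarrow> 0" using tendsto_mult_left[OF D_lims(2), of B] by simp
  qed auto
  from tendsto_diff[OF tendsto_mult_left[OF Z_lim, of \<eta>] tendsto_mult_left[OF this, of "2 * \<eta>"]]
  show ?thesis by (simp add: algebra_simps)
qed

lemma eventually_parity:
  assumes "\<forall>\<^sub>F i in sequentially. P (2 * i)" and "\<forall>\<^sub>F i in sequentially. P (2 * i + 1)"
  shows "\<forall>\<^sub>F k in sequentially. P (k::nat)"
proof -
  obtain N where N: "\<And>i. i \<ge> N \<Longrightarrow> P (2 * i) \<and> P (2 * i + 1)"
    using eventually_conj[OF assms] unfolding eventually_sequentially by auto
  have "P k" if "k \<ge> 2 * N + 1" for k
  proof (cases "even k")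
    case True
    then obtain i where i: "k = 2 * i" by blast
    then show ?thesis using N[of i] that by auto
  next
    case False
    then obtain i where i: "k = 2 * i + 1" by (metis oddE)
    then show ?thesis using N[of i] that by auto
  qed
  then show ?thesis unfolding eventually_sequentially by blast
qed

text \<open>Nodes describe the limits of the cells; the exact cells satisfy the bounds only up to
  vanishing errors, hence the passage from \<open>c\<close> to a smaller \<open>c'\<close>.\<close>

lemma chain_of_nodes:
  assumes nodes: "\<And>i. i \<ge> K \<Longrightarrow> node c (X i) (Y i) (s i)" and c: "0 < c'" "c' < c"
  shows "\<exists>K\<ge>1. divided_chain (\<lambda>k. real_of_int (Q k)) r (\<lambda>k. real_of_int (qq k)) dd cf n K (c' / (4 * (1 - D)))"
proof -
  define P where "P k \<longleftrightarrow> 0 < real_of_int (Q k) \<and> real_of_int (Q k) < real_of_int (qq (Suc k)) - qq k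
     \<and> 0 < r k \<and> r k < dd k - dd (Suc k)
     \<and> c' \<le> 4 * (1 - D) * (Q k * r k) \<and> c' \<le> 4 * (1 - D) * ((real_of_int (Q k) + qq k) * (dd k - r k))
     \<and> c' \<le> 4 * (1 - D) * ((real_of_int (qq (Suc k)) - Q k) * (r k + dd (Suc k)))
     \<and> c' \<le> 4 * (1 - D) * ((real_of_int (qq (Suc k)) - qq k - Q k) * (dd k - dd (Suc k) - r k))" for k
  have c0: "0 < c" using c by simp
  have "\<forall>\<^sub>F k in sequentially. P k"
  proof (rule eventually_parity)
    have l2: "(\<lambda>i. - 2 * \<beta> * D ^ (2 * i)) \<longlonglongrightarrow> 0" and l3: "(\<lambda>i. - 2 * D ^ (2 * i + 1)) \<longlonglongrightarrow> 0"
      using tendsto_mult_left[OF D_lims(1), of "- 2 * \<beta>"] tendsto_mult_left[OF D_lims(2), of "- 2"] by simp_all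
    have "\<forall>\<^sub>F i in sequentially. 0 < real_of_int (Q (2*i)) \<and>
        real_of_int (Q (2*i)) < real_of_int (qq (2*i+1)) - qq (2*i) \<and> 0 < r (2*i) \<and> r (2*i) < D ^ i - D ^ i * \<eta>
     \<and> c' \<le> 4 * (1 - D) * (Q (2*i) * r (2*i)) \<and> c' \<le> 4 * (1 - D) * ((real_of_int (Q (2*i)) + qq (2*i)) * (D ^ i - r (2*i)))
     \<and> c' \<le> 4 * (1 - D) * ((real_of_int (qq (2*i+1)) - Q (2*i)) * (r (2*i) + D ^ i * \<eta>))
     \<and> c' \<le> 4 * (1 - D) * ((real_of_int (qq (2*i+1)) - qq (2*i) - Q (2*i)) * (D ^ i - D ^ i * \<eta> - r (2*i)))"
    proof (rule cell_eventually[OF _ x_even qq_even_scaled qq_odd_scaled r_even Z_lim l2 l3 _ _ c0 c(2)])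
      fix i assume "K \<le> i"
      from nodes[OF this] show "\<bar>\<eta> * (s i + Y i)\<bar> < 1 - \<eta> \<and> c \<le> (1 - \<beta> + X i) * (1 - \<eta> + \<eta> * (s i + Y i))
        \<and> c \<le> (1 + \<beta> + X i) * (1 + \<eta> - \<eta> * (s i + Y i)) \<and> c \<le> (1 + \<beta> - X i) * (1 + \<eta> + \<eta> * (s i + Y i))
        \<and> c \<le> (1 - \<beta> - X i) * (1 - \<eta> - \<eta> * (s i + Y i))"
        by (auto simp: node_def half_node_def p1_def p2_def p3_def p4_def)
    qed (use D_pos eta_pos eta_less in auto)
    then show "\<forall>\<^sub>F i in sequentially. P (2 * i)"
    proof eventually_elim
      case (elim i)
      then show ?case unfolding P_def Suc_eq_plus1 dd_even dd_odd by (simp only: mult.commute[of \<eta>])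
    qed
  next
    have l2: "(\<lambda>i. - 2 * \<eta> * D ^ (2 * i + 1)) \<longlonglongrightarrow> 0" and l3: "(\<lambda>i. - 2 * D ^ (2 * i + 2)) \<longlonglongrightarrow> 0"
      using tendsto_mult_left[OF D_lims(2), of "- 2 * \<eta>"] tendsto_mult_left[OF D_lims(3), of "- 2"] by simp_all
    have "\<forall>\<^sub>F i in sequentially. 0 < real_of_int (Q (2*i+1)) \<and>
        real_of_int (Q (2*i+1)) < real_of_int (qq (2*i+2)) - qq (2*i+1) \<and> 0 < r (2*i+1)
        \<and> r (2*i+1) < \<eta> * D ^ i - \<eta> * D ^ i * \<beta>
     \<and> c' \<le> 4 * (1 - D) * (Q (2*i+1) * r (2*i+1))
     \<and> c' \<le> 4 * (1 - D) * ((real_of_int (Q (2*i+1)) + qq (2*i+1)) * (\<eta> * D ^ i - r (2*i+1)))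
     \<and> c' \<le> 4 * (1 - D) * ((real_of_int (qq (2*i+2)) - Q (2*i+1)) * (r (2*i+1) + \<eta> * D ^ i * \<beta>))
     \<and> c' \<le> 4 * (1 - D) * ((real_of_int (qq (2*i+2)) - qq (2*i+1) - Q (2*i+1)) * (\<eta> * D ^ i - \<eta> * D ^ i * \<beta> - r (2*i+1)))"
    proof (rule cell_eventually[OF _ x_odd qq_odd_scaled' qq_even_scaled' r_odd digit_lim l2 l3 _ _ c0 c(2)])
      fix i assume "K \<le> i"
      from nodes[OF this] show "\<bar>Y i\<bar> < 1 - \<beta> \<and> c \<le> (1 - \<eta> + \<eta> * (s i + X i)) * (1 - \<beta> + Y i)
        \<and> c \<le> (1 + \<eta> + \<eta> * (s i + X i)) * (1 + \<beta> - Y i) \<and> c \<le> (1 + \<eta> - \<eta> * (s i + X i)) * (1 + \<beta> + Y i)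
        \<and> c \<le> (1 - \<eta> - \<eta> * (s i + X i)) * (1 - \<beta> - Y i)"
        by (auto simp: node_def half_node_def p1_def p2_def p3_def p4_def mult.commute)
    qed (use D_pos eta_pos beta_pos beta_less in auto)
    then show "\<forall>\<^sub>F i in sequentially. P (2 * i + 1)"
    proof eventually_elim
      case (elim i)
      have "dd (Suc (2 * i + 1)) = \<eta> * D ^ i * \<beta>" using dd_even[of "Suc i"] by (simp add: D_eq)
      moreover have "Suc (2 * i + 1) = 2 * i + 2" by simp
      ultimately show ?case using elim unfolding P_def dd_odd by simp
    qed
  qed
  then obtain K0 where K0: "\<And>k. k \<ge> K0 \<Longrightarrow> P k" unfolding eventually_sequentially by blast
  have D4: "4 * (1 - D) > 0" using D_less by simp
  show ?thesis
  \<comment> \<open>\<open>Suc K0\<close> instead of \<open>K0\<close>, because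
    \<open>qq 0 = 0\<close> and the chain needs positive denominators.\<close>
  proof (intro exI[of _ "Suc K0"] conjI)
    show "divided_chain (\<lambda>k. real_of_int (Q k)) r (\<lambda>k. real_of_int (qq k)) dd cf n (Suc K0) (c' / (4 * (1 - D)))"
    proof unfold_locales
      fix k
      show "real_of_int (qq (k + 2)) = real_of_int (cf k) * real_of_int (qq (k + 1)) - real_of_int (qq k)" by (simp add: numeral_2_eq_2)
      show "dd (k + 2) = cf k * dd (k + 1) - dd k" using dd_rec[of k] by (simp add: numeral_2_eq_2)
      show "dd (k + 1) < dd k" using dd_decreasing[of k] by simp
      assume k: "Suc K0 \<le> k"
      show "real_of_int (qq k) < qq (k + 1)" using qq_increasing[of k] by simp
      show "0 < real_of_int (qq k)" using qq_pos[of k] k by simp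
      have *: "c' \<le> 4 * (1 - D) * t \<Longrightarrow> c' / (4 * (1 - D)) \<le> t" for t
        using D4 by (simp add: divide_le_eq mult.commute)
      have "P k" using K0 k by simp
      then show "0 < real_of_int (Q k)" "real_of_int (Q k) < real_of_int (qq (k+1)) - qq k" "0 < r k" "r k < dd k - dd (k+1)"
        "c' / (4 * (1 - D)) \<le> real_of_int (Q k) * r k"
        "c' / (4 * (1 - D)) \<le> (real_of_int (Q k) + qq k) * (dd k - r k)"
        "c' / (4 * (1 - D)) \<le> (real_of_int (qq (k+1)) - Q k) * (r k + dd (k+1))"
        "c' / (4 * (1 - D)) \<le> (real_of_int (qq (k+1)) - qq k - Q k) * (dd k - dd (k+1) - r k)"
        unfolding P_def Suc_eq_plus1 by (blast intro: *)+
    qed (use r_rec dd_pos dd_lim c D4 in \<open>auto simp: add_ac\<close>)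
  qed simp
qed

theorem M_star_ge_of_nodes:
  assumes nodes: "\<And>i. i \<ge> K \<Longrightarrow> node c (X i) (Y i) (s i)" and c: "0 < c"
  shows "ereal c \<le> M_star a b \<gamma>" and "\<not> (\<exists>m n :: int. \<gamma> = of_int m + of_int n * \<eta>)"
proof -
  have rep: "\<exists>i j. divided_chain.coord (\<lambda>k. real_of_int (Q k)) r (\<lambda>k. real_of_int (qq k)) dd k X (X * \<eta> - \<gamma> + l) i j"
    if "divided_chain (\<lambda>k. real_of_int (Q k)) r (\<lambda>k. real_of_int (qq k)) dd cf n K c'" and "X \<in> \<int>"
    for k K c' X and l :: int
  proof -
    interpret divided_chain "\<lambda>k. real_of_int (Q k)" r "\<lambda>k. real_of_int (qq k)" dd cf n K c' by fact
    obtain h where h: "X = of_int h" using \<open>X \<in> \<int>\<close> by (auto elim: Ints_cases)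
    show ?thesis
    proof (induction k)
      case 0
      \<comment> \<open>At stage 0 the basis is \<open>(0, 1)\<close>, \<open>(1, \<eta>)\<close>
        and the base point is \<open>(0, - r 0)\<close>, so the coefficients can be read
        off.\<close>
      have "coord 0 X (X * \<eta> - \<gamma> + l) (l - m) h" unfolding coord_def
        using gamma_eq dd_even[of 0] dd_odd[of 0] by (simp add: h)
      then show ?case by blast
    next
      case (Suc k)
      then show ?case using coord_step[of k] by (metis Suc_eq_plus1)
    qed
  qed
  have D4: "4 * (1 - D) > 0" using D_less by simp
  have ge: "ereal c' \<le> M_star a b \<gamma>" if c': "0 < c'" "c' < c" for c'
  proof (rule M_star_ge)
    obtain K where ch: "divided_chain (\<lambda>k. real_of_int (Q k)) r (\<lambda>k. real_of_int (qq k)) dd cf n K (c' / (4 * (1 - D)))"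
      using chain_of_nodes[OF nodes c'] by auto
    interpret divided_chain "\<lambda>k. real_of_int (Q k)" r "\<lambda>k. real_of_int (qq k)" dd cf n K "c' / (4 * (1 - D))" by fact
    define X0 where "X0 = real_of_int (qq (K + 1)) + qq K * (1 + 1 / dd K)"
    have "finite {h::int. \<not> X0 \<le> \<bar>real_of_int h\<bar>}"
    proof (rule finite_subset)
      show "{h::int. \<not> X0 \<le> \<bar>real_of_int h\<bar>} \<subseteq> {- \<lceil>X0\<rceil> .. \<lceil>X0\<rceil>}"
        by (auto simp: abs_if not_le split: if_splits) linarith+
    qed simp
    then have "\<forall>\<^sub>F h::int in cofinite. X0 \<le> \<bar>real_of_int h\<bar>" by (simp add: eventually_cofinite)
    then show "\<forall>\<^sub>F h in cofinite. c' / (4 * (1 - D)) \<le> \<bar>real_of_int h\<bar> * ndist (of_int h * \<eta> - \<gamma>)"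
    proof eventually_elim
      case (elim h)
      let ?y = "real_of_int h * \<eta> - \<gamma>"
      have "c' / (4 * (1 - D)) \<le> \<bar>real_of_int h\<bar> * \<bar>?y + of_int (- round ?y)\<bar>"
      proof (rule far_points)
        show "\<exists>i j. coord K (real_of_int h) (?y + of_int (- round ?y)) i j" by (rule rep[OF ch]) simp
        show "\<bar>?y + of_int (- round ?y)\<bar> \<le> 1/2" using ndist_half[of ?y] by (simp add: ndist_def)
        show "real_of_int (qq (K + 1)) + qq K * (1 + 1 / dd K) \<le> \<bar>real_of_int h\<bar>" using elim by (simp add: X0_def)
      qed
      then show ?case by (simp add: ndist_def)
    qed
  qed
  show "ereal c \<le> M_star a b \<gamma>"
  proof (rule dense_le)
    fix x assume "x < ereal c"
    show "x \<le> M_star a b \<gamma>"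
    proof (cases x)
      case (real t)
      have "max t (c / 2) < c" "0 < max t (c / 2)" using \<open>x < ereal c\<close> real c by auto
      from ge[OF this(2,1)] have "ereal (max t (c / 2)) \<le> M_star a b \<gamma>" .
      moreover have "x \<le> ereal (max t (c / 2))" using real by simp
      ultimately show ?thesis by (rule order_trans[rotated])
    qed (use \<open>x < ereal c\<close> in auto)
  qed
  show "\<not> (\<exists>m n :: int. \<gamma> = of_int m + of_int n * \<eta>)"
  proof
    assume "\<exists>m n :: int. \<gamma> = of_int m + of_int n * \<eta>"
    then obtain l h :: int where lh: "\<gamma> = of_int l + of_int h * \<eta>" by blast
    obtain K where ch: "divided_chain (\<lambda>k. real_of_int (Q k)) r (\<lambda>k. real_of_int (qq k)) dd cf n K (c / 2 / (4 * (1 - D)))"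
      using chain_of_nodes[OF nodes, where c' = "c / 2"] c by auto
    interpret divided_chain "\<lambda>k. real_of_int (Q k)" r "\<lambda>k. real_of_int (qq k)" dd cf n K "c / 2 / (4 * (1 - D))" by fact
    have "real_of_int h * \<eta> - \<gamma> + of_int l = 0" using lh by simp
    then show False using rep[OF ch, of "of_int h" K l] no_point_on_axis[of "of_int h"] by auto
  qed
qed

end

section \<open>From the liminf back to vertex products\<close>

context expansion begin

text \<open>Points with bounded coefficients relative to stage \<open>2 * k\<close> approach the
  axis. No lattice point lies on it, so each of the finitely many exceptional abscissas keeps a
  positive distance and is eventually avoided. Rescaling turns the remaining inequality into one for
  the limit form of the point.\<close>

lemma vertices_of_M_star:
  fixes u v :: "nat \<Rightarrow> int"
  assumes irr: "\<not> (\<exists>m n :: int. \<gamma> = of_int m + of_int n * \<eta>)" and M: "ereal c < M_star a b \<gamma>"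
    and c': "c' < c" and uJ: "\<And>k. \<bar>real_of_int (u k)\<bar> \<le> J" and vJ: "\<And>k. \<bar>real_of_int (v k)\<bar> \<le> J"
  shows "\<forall>\<^sub>F k in sequentially. c' \<le> \<bar>(1 - \<beta> + X k + 2 * real_of_int (u k) * \<beta> + 2 * real_of_int (v k)) *
    (1 - \<eta> + \<eta> * (s k + Y k) - 2 * real_of_int (u k) - 2 * real_of_int (v k) * \<eta>)\<bar>"
proof -
  define F where "F = {h::int. \<not> c / (4 * (1 - D)) < \<bar>real_of_int h\<bar> * ndist (real_of_int h * \<eta> - \<gamma>)}"
  have finF: "finite F" using M_star_gtD[OF M] unfolding F_def by (simp add: eventually_cofinite)
  define N where "N k = Q (2 * k) + u k * qq (2 * k) + v k * qq (2 * k + 1)" for k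
  define w where "w k = - r (2 * k) + u k * dd (2 * k) + v k * dd (2 * k + 1)" for k
  define A where "A k = 1 - \<beta> + X k + 2 * real_of_int (u k) * \<beta> + 2 * real_of_int (v k)" for k
  define G where "G k = 1 - \<eta> + \<eta> * (s k + Y k) - 2 * real_of_int (u k) - 2 * real_of_int (v k) * \<eta>" for k
  define err where "err k = Z k - 2 * real_of_int (u k) * \<beta> * D ^ (2 * k) - 2 * real_of_int (v k) * D ^ (2 * k + 1)" for k
  have J0: "J \<ge> 0" using uJ[of 0] by linarith
  have w_lattice: "\<exists>p::int. w k = N k * \<eta> - \<gamma> - p" for k
  proof -
    obtain p :: int where "- r (2 * k) = Q (2 * k) * \<eta> - \<gamma> + p" using r_lattice by blast
    then have "w k = N k * \<eta> - \<gamma> - (u k * pp (2 * k) + v k * pp (2 * k + 1) - p)"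
      unfolding w_def N_def dd_lattice by (simp add: algebra_simps)
    then show ?thesis by (metis of_int_add of_int_diff of_int_mult)
  qed
  have wG: "2 * w k = - (D ^ k * G k)" for k
    using r_even[of k] unfolding w_def G_def dd_even dd_odd by (simp add: algebra_simps)
  have NA: "2 * ((1 - D) * D ^ k * N k) = A k + err k" for k
  proof -
    have "2 * ((1 - D) * D ^ k * N k) = 2 * ((1 - D) * D ^ k * Q (2 * k))
        + 2 * real_of_int (u k) * ((1 - D) * D ^ k * qq (2 * k)) + 2 * real_of_int (v k) * ((1 - D) * D ^ k * qq (2 * k + 1))"
      by (simp add: N_def algebra_simps)
    also have "\<dots> = (1 - \<beta> + X k + Z k) + 2 * real_of_int (u k) * (\<beta> * (1 - D ^ (2 * k))) + 2 * real_of_int (v k) * (1 - D ^ (2 * k + 1))"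
      unfolding x_even qq_even qq_odd by simp
    finally show ?thesis by (simp add: A_def err_def algebra_simps)
  qed
  have G_bd: "\<bar>G k\<bar> \<le> 2 * B + 3 + 4 * J" for k
  proof -
    have 1: "\<bar>1 - \<eta> + \<eta> * (s k + Y k)\<bar> \<le> 1 + (2 * B + 1)"
      using Y_bounded[of k] eta_pos eta_less by (intro abs_add_le) auto
    have "\<bar>v k * \<eta>\<bar> \<le> J * 1" unfolding abs_mult using vJ[of k] eta_pos eta_less J0 by (intro mult_mono) auto
    then have 2: "\<bar>- 2 * real_of_int (v k) * \<eta>\<bar> \<le> 2 * J" by (simp add: abs_mult)
    have 3: "\<bar>- 2 * real_of_int (u k)\<bar> \<le> 2 * J" using uJ[of k] by (simp add: abs_mult)
    from abs_add_le[OF abs_add_le[OF 1 3] 2] show ?thesis by (simp add: G_def)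
  qed
  have err_lim: "err \<longlonglongrightarrow> 0"
  proof -
    have l: "(\<lambda>k. real_of_int (x k) * D ^ f k) \<longlonglongrightarrow> 0"
      if "\<And>k. \<bar>real_of_int (x k)\<bar> \<le> J" "(\<lambda>k. D ^ f k) \<longlonglongrightarrow> 0" for x :: "nat \<Rightarrow> int" and f :: "nat \<Rightarrow> nat"
    proof (rule tendsto_rabs_zero_cancel, rule tendsto_sandwich[of "\<lambda>_. 0" _ _ "\<lambda>k. J * D ^ f k"])
      show "\<forall>\<^sub>F k in sequentially. \<bar>real_of_int (x k) * D ^ f k\<bar> \<le> J * D ^ f k"
        using that(1) D_pos by (intro always_eventually allI) (simp add: abs_mult mult_right_mono)
      show "(\<lambda>k. J * D ^ f k) \<longlonglongrightarrow> 0" using tendsto_mult_left[OF that(2), of J] by simp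
    qed auto
    have "(\<lambda>k. Z k - (2 * \<beta>) * (real_of_int (u k) * D ^ (2 * k)) - 2 * (real_of_int (v k) * D ^ (2 * k + 1)))
        \<longlonglongrightarrow> 0 - (2 * \<beta>) * 0 - 2 * 0"
      by (intro tendsto_intros Z_lim l[of u] l[of v] uJ vJ D_lims)
    moreover have "err = (\<lambda>k. Z k - (2 * \<beta>) * (real_of_int (u k) * D ^ (2 * k)) - 2 * (real_of_int (v k) * D ^ (2 * k + 1)))"
      unfolding err_def by (simp add: fun_eq_iff algebra_simps)
    ultimately show ?thesis by (simp only: mult_zero_right diff_zero)
  qed
  have w_lim: "w \<longlonglongrightarrow> 0"
  proof (rule tendsto_rabs_zero_cancel, rule tendsto_sandwich[of "\<lambda>_. 0" _ _ "\<lambda>k. (2 * B + 3 + 4 * J) * D ^ k"])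
    have "\<bar>w k\<bar> \<le> (2 * B + 3 + 4 * J) * D ^ k" for k
    proof -
      have "2 * \<bar>w k\<bar> = D ^ k * \<bar>G k\<bar>" using arg_cong[OF wG[of k], of abs] D_pos by (simp add: abs_mult)
      also have "\<dots> \<le> D ^ k * (2 * B + 3 + 4 * J)" using G_bd D_pos by (intro mult_left_mono) auto
      finally show ?thesis using D_pos B_nonneg J0 by (simp add: algebra_simps)
    qed
    then show "\<forall>\<^sub>F k in sequentially. \<bar>w k\<bar> \<le> (2 * B + 3 + 4 * J) * D ^ k" by simp
    show "(\<lambda>k. (2 * B + 3 + 4 * J) * D ^ k) \<longlonglongrightarrow> 0"
      using tendsto_mult_left[OF D_pow_lim, of "2 * B + 3 + 4 * J"] by simp
  qed auto
  have notF: "\<forall>\<^sub>F k in sequentially. \<forall>h\<in>F. N k \<noteq> h"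
  proof (rule eventually_ball_finite[OF finF], rule ballI)
    fix h assume "h \<in> F"
    have "ndist (of_int h * \<eta> - \<gamma>) \<noteq> 0"
    proof
      assume "ndist (of_int h * \<eta> - \<gamma>) = 0"
      then have "\<gamma> = of_int (- round (of_int h * \<eta> - \<gamma>)) + of_int h * \<eta>" by (simp add: ndist_def)
      then show False using irr by blast
    qed
    then have "ndist (of_int h * \<eta> - \<gamma>) > 0" by (simp add: ndist_def)
    then have "\<forall>\<^sub>F k in sequentially. \<bar>w k\<bar> < ndist (of_int h * \<eta> - \<gamma>)"
      using tendstoD[OF w_lim] by (simp add: dist_real_def)
    then show "\<forall>\<^sub>F k in sequentially. N k \<noteq> h"
    proof eventually_elim
      case (elim k)
      show ?case
      proof
        assume "N k = h"
        obtain p :: int where "w k = of_int (N k) * \<eta> - \<gamma> - of_int p" using w_lattice by blast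
        then show False using elim ndist_le[of "of_int h * \<eta> - \<gamma>" p] \<open>N k = h\<close> by simp
      qed
    qed
  qed
  define C where "C = 2 * B + 3 + 4 * J"
  have C: "C > 0" using B_nonneg J0 by (simp add: C_def)
  have "(c - c') / C > 0" using C c' by simp
  then have "\<forall>\<^sub>F k in sequentially. \<bar>err k\<bar> < (c - c') / C"
    using tendstoD[OF err_lim, of "(c - c') / C"] by (simp add: dist_real_def)
  with notF have "\<forall>\<^sub>F k in sequentially. c' \<le> \<bar>A k * G k\<bar>"
  proof eventually_elim
    case (elim k)
    then have "N k \<notin> F" by blast
    then have 1: "c / (4 * (1 - D)) < \<bar>real_of_int (N k)\<bar> * ndist (real_of_int (N k) * \<eta> - \<gamma>)"
      by (simp add: F_def)
    obtain p :: int where p: "w k = of_int (N k) * \<eta> - \<gamma> - of_int p" using w_lattice by blast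
    have "\<bar>real_of_int (N k)\<bar> * ndist (real_of_int (N k) * \<eta> - \<gamma>) \<le> \<bar>real_of_int (N k)\<bar> * \<bar>w k\<bar>"
      unfolding p by (intro mult_left_mono ndist_le) auto
    with 1 have "c / (4 * (1 - D)) < \<bar>N k * w k\<bar>" by (simp add: abs_mult)
    then have "c < 4 * (1 - D) * \<bar>N k * w k\<bar>" using D_less by (simp add: divide_less_eq mult.commute)
    also have "\<dots> = \<bar>4 * (1 - D) * (N k * - w k)\<bar>" using D_less by (simp add: abs_mult)
    also have "4 * (1 - D) * (N k * - w k) = (A k + err k) * G k"
      by (rule rescale[OF NA]) (use wG[of k] D_pos in auto)
    also have "\<bar>(A k + err k) * G k\<bar> \<le> \<bar>A k * G k\<bar> + \<bar>err k * G k\<bar>"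
      by (metis abs_triangle_ineq distrib_right)
    finally have 2: "c < \<bar>A k * G k\<bar> + \<bar>err k * G k\<bar>" .
    have "\<bar>err k * G k\<bar> \<le> (c - c') / C * C"
      unfolding abs_mult using elim(2) G_bd[of k] C by (intro mult_mono) (auto simp: C_def)
    then have "\<bar>err k * G k\<bar> \<le> c - c'" using C by simp
    with 2 show ?case by simp
  qed
  then show ?thesis by (simp add: A_def G_def)
qed

text \<open>The vertices of the odd cell are written in the even basis, where the vector of index
  \<open>2 * k + 2\<close> is \<open>a\<close> times the second basis vector minus the first; hence
  coefficients such as \<open>(1, n (2*k) - a)\<close>. The exchange of \<open>X\<close> and
  \<open>Y\<close> interchanges the roles of \<open>p2\<close> and \<open>p3\<close>.\<close>

lemma odd_vertex_factors:
  "\<bar>(1 - \<beta> + X k + 2 * real_of_int 0 * \<beta> + 2 * real_of_int (n (2*k))) * (1 - \<eta> + \<eta> * (s k + Y k) - 2 * real_of_int 0 - 2 * real_of_int (n (2*k)) * \<eta>)\<bar>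
     = \<bar>p1 (Y k) (\<eta> * (s k + X k))\<bar>"
  "\<bar>(1 - \<beta> + X k + 2 * real_of_int 0 * \<beta> + 2 * real_of_int (n (2*k) + 1)) * (1 - \<eta> + \<eta> * (s k + Y k) - 2 * real_of_int 0 - 2 * real_of_int (n (2*k) + 1) * \<eta>)\<bar>
     = \<bar>p3 (Y k) (\<eta> * (s k + X k))\<bar>"
  "\<bar>(1 - \<beta> + X k + 2 * real_of_int 1 * \<beta> + 2 * real_of_int (n (2*k) - a)) * (1 - \<eta> + \<eta> * (s k + Y k) - 2 * real_of_int 1 - 2 * real_of_int (n (2*k) - a) * \<eta>)\<bar>
     = \<bar>p2 (Y k) (\<eta> * (s k + X k))\<bar>"
  "\<bar>(1 - \<beta> + X k + 2 * real_of_int 1 * \<beta> + 2 * real_of_int (n (2*k) + 1 - a)) * (1 - \<eta> + \<eta> * (s k + Y k) - 2 * real_of_int 1 - 2 * real_of_int (n (2*k) + 1 - a) * \<eta>)\<bar>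
     = \<bar>p4 (Y k) (\<eta> * (s k + X k))\<bar>"
proof -
  have ae: "a * \<eta> = 1 + \<eta> * \<beta>" using a_eta D_eq by simp
  have n2: "real_of_int (n (2*k)) = (real_of_int (s k) + a) / 2 - 1" by (simp add: s_def add_divide_distrib)
  have abs4: "\<bar>x * y\<bar> = \<bar>t * z\<bar>" if "\<eta> * x = z" "y = \<eta> * t" for x y z t :: real
    using that by (auto simp: abs_mult ac_simps)
  have abs4': "\<bar>x * y\<bar> = \<bar>t * z\<bar>" if "\<eta> * x = z" "y = - (\<eta> * t)" for x y z t :: real
    using that by (auto simp: abs_mult ac_simps)
  have abs4'': "\<bar>x * y\<bar> = \<bar>t * z\<bar>" if "\<eta> * x = - z" "y = - (\<eta> * t)" for x y z t :: real
    using abs4[of x "- z" "- y" t] that by (simp add: abs_mult)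
  have abs4a: "\<bar>x * y\<bar> = \<bar>t * z\<bar>" if "\<eta> * x = - z" "y = \<eta> * t" for x y z t :: real
    using abs4[of x "- z" y t] that by (simp add: abs_mult)
  show "\<bar>(1 - \<beta> + X k + 2 * real_of_int 0 * \<beta> + 2 * real_of_int (n (2*k))) * (1 - \<eta> + \<eta> * (s k + Y k) - 2 * real_of_int 0 - 2 * real_of_int (n (2*k)) * \<eta>)\<bar>
     = \<bar>p1 (Y k) (\<eta> * (s k + X k))\<bar>"
    unfolding p1_def of_int_add of_int_diff n2 by (rule abs4) (use ae in \<open>simp_all add: algebra_simps add_divide_distrib diff_divide_distrib\<close>)
  show "\<bar>(1 - \<beta> + X k + 2 * real_of_int 0 * \<beta> + 2 * real_of_int (n (2*k) + 1)) * (1 - \<eta> + \<eta> * (s k + Y k) - 2 * real_of_int 0 - 2 * real_of_int (n (2*k) + 1) * \<eta>)\<bar>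
     = \<bar>p3 (Y k) (\<eta> * (s k + X k))\<bar>"
    unfolding p3_def of_int_add of_int_diff n2 by (rule abs4') (use ae in \<open>simp_all add: algebra_simps add_divide_distrib diff_divide_distrib\<close>)
  show "\<bar>(1 - \<beta> + X k + 2 * real_of_int 1 * \<beta> + 2 * real_of_int (n (2*k) - a)) * (1 - \<eta> + \<eta> * (s k + Y k) - 2 * real_of_int 1 - 2 * real_of_int (n (2*k) - a) * \<eta>)\<bar>
     = \<bar>p2 (Y k) (\<eta> * (s k + X k))\<bar>"
    unfolding p2_def of_int_add of_int_diff n2 by (rule abs4a) (use ae in \<open>simp_all add: algebra_simps add_divide_distrib diff_divide_distrib\<close>)
  show "\<bar>(1 - \<beta> + X k + 2 * real_of_int 1 * \<beta> + 2 * real_of_int (n (2*k) + 1 - a)) * (1 - \<eta> + \<eta> * (s k + Y k) - 2 * real_of_int 1 - 2 * real_of_int (n (2*k) + 1 - a) * \<eta>)\<bar>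
     = \<bar>p4 (Y k) (\<eta> * (s k + X k))\<bar>"
    unfolding p4_def of_int_add of_int_diff n2 by (rule abs4'') (use ae in \<open>simp_all add: algebra_simps add_divide_distrib diff_divide_distrib\<close>)
qed

lemma even_vertex_factors:
  "\<bar>(1 - \<beta> + X k + 2 * real_of_int 0 * \<beta> + 2 * real_of_int 0) * (1 - \<eta> + \<eta> * (s k + Y k) - 2 * real_of_int 0 - 2 * real_of_int 0 * \<eta>)\<bar>
     = \<bar>p1 (X k) (\<eta> * (s k + Y k))\<bar>"
  "\<bar>(1 - \<beta> + X k + 2 * real_of_int 1 * \<beta> + 2 * real_of_int 0) * (1 - \<eta> + \<eta> * (s k + Y k) - 2 * real_of_int 1 - 2 * real_of_int 0 * \<eta>)\<bar>
     = \<bar>p2 (X k) (\<eta> * (s k + Y k))\<bar>"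
  "\<bar>(1 - \<beta> + X k + 2 * real_of_int 0 * \<beta> + 2 * real_of_int (- 1)) * (1 - \<eta> + \<eta> * (s k + Y k) - 2 * real_of_int 0 - 2 * real_of_int (- 1) * \<eta>)\<bar>
     = \<bar>p3 (X k) (\<eta> * (s k + Y k))\<bar>"
  "\<bar>(1 - \<beta> + X k + 2 * real_of_int 1 * \<beta> + 2 * real_of_int (- 1)) * (1 - \<eta> + \<eta> * (s k + Y k) - 2 * real_of_int 1 - 2 * real_of_int (- 1) * \<eta>)\<bar>
     = \<bar>p4 (X k) (\<eta> * (s k + Y k))\<bar>"
  unfolding p1_def p2_def p3_def p4_def by (simp_all add: abs_mult abs_minus_commute add_ac diff_add_eq)
    (smt (verit))+

lemma all_vertices_of_M_star:
  assumes irr: "\<not> (\<exists>m n :: int. \<gamma> = of_int m + of_int n * \<eta>)" and M: "ereal c < M_star a b \<gamma>"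
    and c': "c' < c" and p: "p \<in> {p1, p2, p3, p4}"
  shows "\<forall>\<^sub>F k in sequentially. c' \<le> \<bar>p (X k) (\<eta> * (s k + Y k))\<bar> \<and> c' \<le> \<bar>p (Y k) (\<eta> * (s k + X k))\<bar>"
proof -
  define J where "J = B + a + 1"
  have bd: "\<bar>real_of_int 0\<bar> \<le> J" "\<bar>real_of_int 1\<bar> \<le> J" "\<bar>real_of_int (- 1)\<bar> \<le> J"
    "\<bar>real_of_int (n (2 * k))\<bar> \<le> J" "\<bar>real_of_int (n (2 * k) + 1)\<bar> \<le> J"
    "\<bar>real_of_int (n (2 * k) - a)\<bar> \<le> J" "\<bar>real_of_int (n (2 * k) + 1 - a)\<bar> \<le> J" for k
    using n_bound[of "2 * k"] B_nonneg a_ge unfolding J_def by auto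
  note V = vertices_of_M_star[OF irr M c']
  have ep1: "\<forall>\<^sub>F k in sequentially. c' \<le> \<bar>p1 (X k) (\<eta> * (s k + Y k))\<bar>"
    using V[of "\<lambda>_. 0" J "\<lambda>_. 0", OF bd(1) bd(1)] by (simp only: even_vertex_factors)
  have op1: "\<forall>\<^sub>F k in sequentially. c' \<le> \<bar>p1 (Y k) (\<eta> * (s k + X k))\<bar>"
    using V[of "\<lambda>_. 0" J "\<lambda>k. n (2 * k)", OF bd(1) bd(4)] by (simp only: odd_vertex_factors)
  have ep2: "\<forall>\<^sub>F k in sequentially. c' \<le> \<bar>p2 (X k) (\<eta> * (s k + Y k))\<bar>"
    using V[of "\<lambda>_. 1" J "\<lambda>_. 0", OF bd(2) bd(1)] by (simp only: even_vertex_factors)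
  have op2: "\<forall>\<^sub>F k in sequentially. c' \<le> \<bar>p2 (Y k) (\<eta> * (s k + X k))\<bar>"
    using V[of "\<lambda>_. 1" J "\<lambda>k. n (2 * k) - a", OF bd(2) bd(6)] by (simp only: odd_vertex_factors)
  have ep3: "\<forall>\<^sub>F k in sequentially. c' \<le> \<bar>p3 (X k) (\<eta> * (s k + Y k))\<bar>"
    using V[of "\<lambda>_. 0" J "\<lambda>_. - 1", OF bd(1) bd(3)] by (simp only: even_vertex_factors)
  have op3: "\<forall>\<^sub>F k in sequentially. c' \<le> \<bar>p3 (Y k) (\<eta> * (s k + X k))\<bar>"
    using V[of "\<lambda>_. 0" J "\<lambda>k. n (2 * k) + 1", OF bd(1) bd(5)] by (simp only: odd_vertex_factors)
  have ep4: "\<forall>\<^sub>F k in sequentially. c' \<le> \<bar>p4 (X k) (\<eta> * (s k + Y k))\<bar>"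
    using V[of "\<lambda>_. 1" J "\<lambda>_. - 1", OF bd(2) bd(3)] by (simp only: even_vertex_factors)
  have op4: "\<forall>\<^sub>F k in sequentially. c' \<le> \<bar>p4 (Y k) (\<eta> * (s k + X k))\<bar>"
    using V[of "\<lambda>_. 1" J "\<lambda>k. n (2 * k) + 1 - a", OF bd(2) bd(7)] by (simp only: odd_vertex_factors)
  show ?thesis using p eventually_conj[OF ep1 op1] eventually_conj[OF ep2 op2]
      eventually_conj[OF ep3 op3] eventually_conj[OF ep4 op4] by auto
qed

theorem M_star_le_of_vertex:
  assumes irr: "\<not> (\<exists>m n :: int. \<gamma> = of_int m + of_int n * \<eta>)" and p: "p \<in> {p1, p2, p3, p4}"
    and inf: "\<exists>\<^sub>F k in sequentially. \<bar>p (X k) (\<eta> * (s k + Y k))\<bar> \<le> c"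
  shows "M_star a b \<gamma> \<le> ereal c"
proof (rule ccontr)
  assume "\<not> ?thesis"
  then have "ereal c < M_star a b \<gamma>" by simp
  from ereal_dense2[OF this] obtain c2 where c2: "ereal c < ereal c2" "ereal c2 < M_star a b \<gamma>" by blast
  define c1 where "c1 = (c + c2) / 2"
  have "c < c1" "c1 < c2" using c2 by (auto simp: c1_def)
  from all_vertices_of_M_star[OF irr c2(2) this(2) p]
  have "\<forall>\<^sub>F k in sequentially. c1 \<le> \<bar>p (X k) (\<eta> * (s k + Y k))\<bar>" by (auto elim: eventually_mono)
  then have "\<forall>\<^sub>F k in sequentially. \<bar>p (X k) (\<eta> * (s k + Y k))\<bar> \<le> c \<longrightarrow> c1 \<le> c"
    by (rule eventually_mono) auto
  from frequently_rev_mp[OF inf this] have "c1 \<le> c" using frequently_ex by blast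
  then show False using \<open>c < c1\<close> by simp
qed

theorem nodes_of_M_star:
  assumes irr: "\<not> (\<exists>m n :: int. \<gamma> = of_int m + of_int n * \<eta>)" and M: "ereal c < M_star a b \<gamma>"
    and c': "27/100 \<le> c'" "c' < c"
    and Qb: "\<And>k. 0 \<le> Q k \<and> Q k < qq (Suc k)" and rb: "\<And>k. 0 \<le> r k \<and> r k < dd k"
  shows "\<exists>K. \<forall>k\<ge>K. node c' (X k) (Y k) (s k)"
proof -
  note V = all_vertices_of_M_star[OF irr M c'(2)]
  have strip: "-(1/100) \<le> x \<and> x \<le> 2 + 1/100"
    if "0 \<le> t" "t \<le> t'" "2 * t = x + e" "2 * t' = 2 + - 2 * u" "0 \<le> u" "\<bar>e\<bar> < 1/100" for x t t' e u :: real
    using that by linarith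
  have z1: "\<forall>\<^sub>F k in sequentially. \<bar>Z k\<bar> < 1/100"
    using tendstoD[OF Z_lim, of "1/100"] by (simp add: dist_real_def)
  have z2: "\<forall>\<^sub>F k in sequentially. \<bar>\<eta> * Z k - \<eta> * (2 * n (2 * k)) * D ^ (2 * k + 1)\<bar> < 1/100"
    using tendstoD[OF digit_lim, of "1/100"] by (simp add: dist_real_def)
  have v1: "\<forall>\<^sub>F k in sequentially. c' \<le> \<bar>p1 (X k) (\<eta> * (s k + Y k))\<bar> \<and> c' \<le> \<bar>p1 (Y k) (\<eta> * (s k + X k))\<bar>"
    and v2: "\<forall>\<^sub>F k in sequentially. c' \<le> \<bar>p2 (X k) (\<eta> * (s k + Y k))\<bar> \<and> c' \<le> \<bar>p2 (Y k) (\<eta> * (s k + X k))\<bar>"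
    and v3: "\<forall>\<^sub>F k in sequentially. c' \<le> \<bar>p3 (X k) (\<eta> * (s k + Y k))\<bar> \<and> c' \<le> \<bar>p3 (Y k) (\<eta> * (s k + X k))\<bar>"
    and v4: "\<forall>\<^sub>F k in sequentially. c' \<le> \<bar>p4 (X k) (\<eta> * (s k + Y k))\<bar> \<and> c' \<le> \<bar>p4 (Y k) (\<eta> * (s k + X k))\<bar>"
    by (rule V; simp)+
  have "\<forall>\<^sub>F k in sequentially. node c' (X k) (Y k) (s k)"
    using z1 z2 v1 v2 v3 v4
  proof eventually_elim
    case (elim k)
    have e: "(1 - D) * D ^ k \<ge> 0" "(1 - D) * (\<eta> * D ^ k) \<ge> 0" "D ^ k > 0" "\<eta> * D ^ k > 0" "D ^ (2 * k + 1) \<ge> 0" "D ^ (2 * k + 2) \<ge> 0"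
      using D_pos D_less eta_pos by auto
    have "0 \<le> (1 - D) * D ^ k * Q (2 * k)" "(1 - D) * D ^ k * Q (2 * k) \<le> (1 - D) * D ^ k * qq (2 * k + 1)"
      using e Qb[of "2 * k"] by (auto intro!: mult_left_mono mult_nonneg_nonneg)
    then have xe: "-(1/100) \<le> 1 - \<beta> + X k" "1 - \<beta> + X k \<le> 2 + 1/100"
      using strip[OF _ _ x_even qq_odd_scaled e(5) elim(1)] by blast+
    have "0 \<le> (1 - D) * (\<eta> * D ^ k) * Q (2 * k + 1)"
      "(1 - D) * (\<eta> * D ^ k) * Q (2 * k + 1) \<le> (1 - D) * (\<eta> * D ^ k) * qq (2 * k + 2)"
    proof -
      have "Suc (2 * k + 1) = 2 * k + 2" by simp
      then have "0 \<le> Q (2 * k + 1)" "Q (2 * k + 1) \<le> qq (2 * k + 2)" using Qb[of "2 * k + 1"] by (metis less_imp_le)+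
      then have "0 \<le> real_of_int (Q (2 * k + 1))" "real_of_int (Q (2 * k + 1)) \<le> real_of_int (qq (2 * k + 2))"
        by (simp_all only: of_int_0_le_iff of_int_le_iff)
      then show "0 \<le> (1 - D) * (\<eta> * D ^ k) * Q (2 * k + 1)"
        "(1 - D) * (\<eta> * D ^ k) * Q (2 * k + 1) \<le> (1 - D) * (\<eta> * D ^ k) * qq (2 * k + 2)"
        using e(2) by (blast intro: mult_left_mono mult_nonneg_nonneg)+
    qed
    then have xo: "-(1/100) \<le> 1 - \<eta> + \<eta> * (s k + X k)" "1 - \<eta> + \<eta> * (s k + X k) \<le> 2 + 1/100"
      using strip[OF _ _ x_odd qq_even_scaled' e(6) elim(2)] by blast+
    have "0 \<le> 2 * r (2 * k)" "2 * r (2 * k) \<le> D ^ k * 2" using rb[of "2 * k"] dd_even[of k] by auto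
    then have "0 \<le> D ^ k * (1 - \<eta> + \<eta> * (s k + Y k))" "D ^ k * (1 - \<eta> + \<eta> * (s k + Y k)) \<le> D ^ k * 2"
      unfolding r_even by blast+
    then have ye: "0 \<le> 1 - \<eta> + \<eta> * (s k + Y k)" "1 - \<eta> + \<eta> * (s k + Y k) \<le> 2"
      using e(3) by (simp_all only: mult_le_cancel_left_pos zero_le_mult_iff) auto
    have "0 \<le> 2 * r (2 * k + 1)" "2 * r (2 * k + 1) \<le> \<eta> * D ^ k * 2"
      using rb[of "2 * k + 1"] dd_odd[of k] by auto
    then have "0 \<le> \<eta> * D ^ k * (1 - \<beta> + Y k)" "\<eta> * D ^ k * (1 - \<beta> + Y k) \<le> \<eta> * D ^ k * 2"
      unfolding r_odd by blast+
    then have yo: "0 \<le> 1 - \<beta> + Y k" "1 - \<beta> + Y k \<le> 2"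
      using e(4) by (simp_all only: mult_le_cancel_left_pos zero_le_mult_iff) auto
    have small: "\<beta> < 27/100" "\<eta> < 27/100" "\<beta> * \<eta> < 6/100" "\<eta> * \<beta> < 6/100"
      using beta_less eta_less D_less by (auto simp: D_eq mult.commute)
    have 1: "\<bar>X k\<bar> < 1 - \<beta> \<and> \<bar>\<eta> * (s k + Y k)\<bar> < 1 - \<eta>"
      by (rule divided_cell_signs[OF beta_pos small(1) small(3) eta_pos small(2) c'(1) xe ye])
        (use elim in \<open>auto simp: p1_def p2_def p3_def p4_def\<close>)
    have 2: "\<bar>\<eta> * (s k + X k)\<bar> < 1 - \<eta> \<and> \<bar>Y k\<bar> < 1 - \<beta>"
      by (rule divided_cell_signs[OF eta_pos small(2) small(4) beta_pos small(1) c'(1) xo yo])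
        (use elim in \<open>auto simp: p1_def p2_def p3_def p4_def mult.commute\<close>)
    have pos: "\<bar>p1 x y\<bar> = p1 x y \<and> \<bar>p2 x y\<bar> = p2 x y \<and> \<bar>p3 x y\<bar> = p3 x y \<and> \<bar>p4 x y\<bar> = p4 x y"
      if "\<bar>x\<bar> < 1 - \<beta>" "\<bar>y\<bar> < 1 - \<eta>" for x y
      using that beta_pos eta_pos unfolding p1_def p2_def p3_def p4_def by auto
    show ?case unfolding node_def half_node_def
      using 1 2 elim pos[of "X k" "\<eta> * (s k + Y k)"] pos[of "Y k" "\<eta> * (s k + X k)"] by auto
  qed
  then show ?thesis unfolding eventually_sequentially .
qed

end

section \<open>The greedy expansion\<close>

context params begin

fun greedy_r :: "real \<Rightarrow> nat \<Rightarrow> real" where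
  "greedy_r \<gamma> 0 = frac \<gamma>"
| "greedy_r \<gamma> (Suc k) = greedy_r \<gamma> k - of_int \<lfloor>greedy_r \<gamma> k / dd (Suc k)\<rfloor> * dd (Suc k)"

definition greedy_n :: "real \<Rightarrow> nat \<Rightarrow> int" where "greedy_n \<gamma> k = \<lfloor>greedy_r \<gamma> k / dd (Suc k)\<rfloor>"

lemma greedy_r_bounds: "0 \<le> greedy_r \<gamma> k \<and> greedy_r \<gamma> k < dd k"
proof (cases k)
  case 0
  then show ?thesis using frac_lt_1[of \<gamma>] dd_even[of 0] by simp
next
  case (Suc j)
  let ?x = "greedy_r \<gamma> j / dd (Suc j)"
  have "greedy_r \<gamma> k = (?x - of_int \<lfloor>?x\<rfloor>) * dd (Suc j)"
    using dd_pos[of "Suc j"] by (simp add: Suc left_diff_distrib)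
  also have "?x - of_int \<lfloor>?x\<rfloor> = frac ?x" by (simp add: frac_def)
  finally show ?thesis using dd_pos[of "Suc j"] frac_lt_1[of ?x] by (simp add: Suc)
qed

lemma greedy_n_bounds: "0 \<le> greedy_n \<gamma> k" "greedy_n \<gamma> k < cf k"
proof -
  show "0 \<le> greedy_n \<gamma> k" using greedy_r_bounds[of \<gamma> k] dd_pos[of "Suc k"] by (simp add: greedy_n_def)
  have "greedy_r \<gamma> k < cf k * dd (Suc k)" using greedy_r_bounds[of \<gamma> k] dd_rec[of k] dd_pos[of "Suc (Suc k)"] by simp
  then show "greedy_n \<gamma> k < cf k" using dd_pos[of "Suc k"] by (simp add: greedy_n_def floor_less_iff divide_less_eq)
qed

lemma greedy_expansion: "expansion a b (greedy_n \<gamma>) (greedy_r \<gamma>) \<gamma> \<lfloor>\<gamma>\<rfloor> b"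
proof unfold_locales
  fix k
  show "greedy_r \<gamma> (Suc k) = greedy_r \<gamma> k - real_of_int (greedy_n \<gamma> k) * dd (Suc k)"
    by (simp add: greedy_n_def)
  have "cf k \<le> b" using a_less_b by (simp add: cf_def)
  then show "\<bar>real_of_int (greedy_n \<gamma> k)\<bar> \<le> real_of_int b" using greedy_n_bounds[of \<gamma> k] by simp
  have "1 * dd k \<le> b * dd k" using a_ge a_less_b dd_pos[of k] by (intro mult_right_mono) auto
  then show "\<bar>greedy_r \<gamma> k\<bar> \<le> real_of_int b * dd k" using greedy_r_bounds[of \<gamma> k] by linarith
qed (simp add: frac_def)

text \<open>The bound \<open>Q k < qq (Suc k)\<close> is not inductive by itself, since the digit
  \<open>cf k - 1\<close> could break it. That digit needs a large remainder and leaves a small one,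
  while after \<open>cf k - 2\<close> a large remainder stems from a large one; the third clause
  carries the room gained in this case along.\<close>

lemma greedy_Q_bounds:
  "0 \<le> expansion.Q a b (greedy_n \<gamma>) k \<and> expansion.Q a b (greedy_n \<gamma>) k < qq (Suc k)
    \<and> (greedy_r \<gamma> k \<ge> dd k - dd (Suc k) \<longrightarrow> expansion.Q a b (greedy_n \<gamma>) k < qq (Suc k) - qq k)"
proof -
  interpret expansion a b "greedy_n \<gamma>" "greedy_r \<gamma>" \<gamma> "\<lfloor>\<gamma>\<rfloor>" b by (rule greedy_expansion)
  show ?thesis
  proof (induction k)
    case 0
    then show ?case by simp
  next
    case (Suc k)
    let ?n = "greedy_n \<gamma> k"
    have n: "0 \<le> ?n" "?n < cf k" by (rule greedy_n_bounds)+
    have q: "qq k < qq (Suc k)" "0 \<le> qq k" using qq_increasing[of k] by auto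
    have q2: "qq (Suc (Suc k)) = cf k * qq (Suc k) - qq k" by simp
    have d2: "dd (Suc (Suc k)) = cf k * dd (Suc k) - dd k" by (rule dd_rec)
    have d: "0 < dd (Suc k)" "dd (Suc k) < dd k" "0 < dd (Suc (Suc k))" using dd_pos dd_decreasing by auto
    have r: "greedy_r \<gamma> (Suc k) = greedy_r \<gamma> k - ?n * dd (Suc k)" by (rule r_rec)
    have rk: "greedy_r \<gamma> k < dd k" and rk1: "0 \<le> greedy_r \<gamma> (Suc k)" using greedy_r_bounds by blast+
    have nn: "0 \<le> ?n * qq (Suc k)" using n q by simp
    consider "?n = cf k - 1" | "?n = cf k - 2" | "?n \<le> cf k - 3" using n by linarith
    then show ?case
    proof cases
      case 1
      have "greedy_r \<gamma> (Suc k) = greedy_r \<gamma> k - (dd k + dd (Suc (Suc k)) - dd (Suc k))"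
        unfolding r 1 d2 by (simp add: algebra_simps)
      then have "greedy_r \<gamma> k \<ge> dd k - dd (Suc k)" "\<not> greedy_r \<gamma> (Suc k) \<ge> dd (Suc k) - dd (Suc (Suc k))"
        using rk1 rk d by auto
      moreover have "?n * qq (Suc k) = qq (Suc (Suc k)) + qq k - qq (Suc k)" unfolding 1 q2 by (simp add: algebra_simps)
      ultimately show ?thesis using Suc nn by simp
    next
      case 2
      have "greedy_r \<gamma> (Suc k) = greedy_r \<gamma> k - (dd k + dd (Suc (Suc k)) - 2 * dd (Suc k))"
        unfolding r 2 d2 by (simp add: algebra_simps)
      then have "greedy_r \<gamma> (Suc k) \<ge> dd (Suc k) - dd (Suc (Suc k)) \<Longrightarrow> greedy_r \<gamma> k \<ge> dd k - dd (Suc k)"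
        by linarith
      moreover have "?n * qq (Suc k) = qq (Suc (Suc k)) + qq k - 2 * qq (Suc k)" unfolding 2 q2 by (simp add: algebra_simps)
      ultimately show ?thesis using Suc nn q by auto
    next
      case 3
      have "?n * qq (Suc k) \<le> (cf k - 3) * qq (Suc k)" using 3 q by (intro mult_right_mono) auto
      also have "\<dots> = qq (Suc (Suc k)) + qq k - 3 * qq (Suc k)" unfolding q2 by (simp add: algebra_simps)
      finally show ?thesis using Suc nn q by auto
    qed
  qed
qed

section \<open>Admissible digits\<close>

lemma half_node_neg: "half_node c (- x) (- y) \<longleftrightarrow> half_node c x y"
  unfolding half_node_def p1_def p2_def p3_def p4_def by auto

lemma node_neg: "node c (- x) (- z) (- s) \<longleftrightarrow> node c x z s"
proof -
  have "\<eta> * (real_of_int (- s) + - t) = - (\<eta> * (s + t))" for t :: real by (simp add: algebra_simps)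
  then show ?thesis unfolding node_def by (simp only: half_node_neg)
qed

lemma node_sym: "node c x z s \<longleftrightarrow> node c z x s"
  unfolding node_def by blast

text \<open>The cut product with both tails replaced by \<open>- 1\<close>. The tails defining the
  limit point exceed \<open>- 1\<close>, so \<open>\<theta>\<close> lies below it, and it involves
  no infinite series.\<close>

definition \<theta> :: real where "\<theta> = (1 - 2 * \<beta>) * (1 - \<eta> - D)"

lemma theta_eq: "\<theta> = 1 - 2 * \<beta> - \<eta> + D + 2 * \<beta> * D"
  unfolding \<theta>_def D_eq by (simp add: algebra_simps)

lemma theta_gt: "\<theta> > 38/100"
proof -
  have "(1 - 2 * (212/1000)) * (1 - 265/1000 - 6/100) < (1 - 2 * \<beta>) * (1 - \<eta> - D)"
    using beta_less eta_less D_less by (intro mult_strict_mono) auto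
  then show ?thesis by (simp add: \<theta>_def)
qed

text \<open>The first factors of \<open>p2\<close> and \<open>p4\<close> add up to 2. Weighting each
  inequality with the second factor of the other and adding therefore eliminates
  \<open>x\<close>.\<close>

lemma half_node_y_bound:
  assumes h: "half_node c x y" and y: "0 \<le> y" shows "y \<le> 1 - c - \<eta> * \<eta>"
proof -
  let ?A = "1 - \<beta> - x" let ?A' = "1 + \<beta> + x" let ?B = "1 - \<eta> - y" let ?B' = "1 + \<eta> - y"
  have pos: "?A > 0" "?A' > 0" "?B > 0" "?B' > 0" and c: "c \<le> ?A * ?B" "c \<le> ?A' * ?B'"
    using h beta_pos eta_pos unfolding half_node_def p4_def p2_def by auto
  have "c * ?B' + c * ?B \<le> ?A * ?B * ?B' + ?A' * ?B' * ?B"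
    using c pos by (intro add_mono mult_right_mono) auto
  also have "\<dots> = 2 * (?B * ?B')" by algebra
  finally have 1: "c * (1 - y) \<le> (1 - y) * (1 - y) - \<eta> * \<eta>" by (simp add: algebra_simps)
  have y1: "0 < 1 - y" "1 - y \<le> 1" using pos y eta_pos by auto
  have "\<eta> * \<eta> * (1 - y) \<le> \<eta> * \<eta> * 1" using y1 by (intro mult_left_mono) auto
  with 1 have "(c + \<eta> * \<eta>) * (1 - y) \<le> (1 - y) * (1 - y)" by (simp add: algebra_simps)
  then show ?thesis using y1 by simp
qed

text \<open>With \<open>s \<ge> 4\<close> and \<open>z > \<beta> - 1\<close> the ordinate is at
  least \<open>3 * \<eta> + D\<close>, whereas \<open>half_node_y_bound\<close> allows less than
  \<open>2 * \<beta> + \<eta>\<close>.\<close>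

lemma node_digit_bound:
  assumes n: "node c x z s" and c: "c > \<theta>" shows "s < 4" "s > - 4"
proof -
  have le: "s < 4" if n: "node c x z s" for x z s
  proof (rule ccontr)
    assume "\<not> s < 4"
    then have s: "real_of_int s \<ge> 4" by simp
    have z: "z > - (1 - \<beta>)" using n by (auto simp: node_def half_node_def)
    then have "\<eta> * (s + z) \<ge> \<eta> * (3 + \<beta>)" using s eta_pos by (intro mult_left_mono) auto
    moreover have "\<eta> * (3 + \<beta>) = 3 * \<eta> + D" by (simp add: D_eq algebra_simps)
    ultimately have y: "\<eta> * (s + z) \<ge> 3 * \<eta> + D" by simp
    have "\<eta> * (s + z) \<le> 1 - c - \<eta> * \<eta>"
      using n y eta_pos D_pos by (intro half_node_y_bound[of c x]) (auto simp: node_def)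
    moreover have "\<eta> * \<eta> > 0" "\<beta> * D > 0" using eta_pos beta_pos D_pos by auto
    ultimately show False using y c D_pos beta_less_eta unfolding theta_eq by linarith
  qed
  show "s < 4" using le[OF n] .
  show "s > - 4" using le[of "- x" "- z" "- s"] n by (simp add: node_neg)
qed

text \<open>Only the larger of the two tails matters: in \<open>p4\<close> the other one helps at
  most by the term \<open>\<eta> * t\<close> coming from an opposite tail of the same size.\<close>

lemma zero_node_bound:
  assumes n: "node c x z 0" and c: "c > \<theta>"
  shows "\<bar>x\<bar> * (1 - 2 * \<eta>) < \<beta>" "\<bar>z\<bar> * (1 - 2 * \<eta>) < \<beta>"
proof -
  have key: "t * (1 - 2 * \<eta>) < \<beta>" if h: "half_node c t (\<eta> * w)" and t: "0 \<le> t" "- t \<le> w" for t w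
  proof -
    have pos: "1 - \<beta> - t > 0" and p4: "c \<le> (1 - \<beta> - t) * (1 - \<eta> - \<eta> * w)"
      using h by (auto simp: half_node_def p4_def)
    have "\<eta> * - t \<le> \<eta> * w" using t eta_pos by (intro mult_left_mono) auto
    then have "(1 - \<beta> - t) * (1 - \<eta> - \<eta> * w) \<le> (1 - \<beta> - t) * (1 - \<eta> + \<eta> * t)"
      using pos by (intro mult_left_mono) auto
    with p4 c have "\<theta> < (1 - \<beta> - t) * (1 - \<eta> + \<eta> * t)" by simp
    also have "\<dots> = 1 - \<beta> - \<eta> + D - t * (1 - 2 * \<eta>) - D * t - \<eta> * (t * t)"
      by (simp add: D_eq algebra_simps)
    finally have "t * (1 - 2 * \<eta>) < \<beta> - 2 * \<beta> * D - D * t - \<eta> * (t * t)" unfolding theta_eq by simp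
    moreover have "D * t \<ge> 0" "\<eta> * (t * t) \<ge> 0" "\<beta> * D > 0" using D_pos eta_pos beta_pos t by auto
    ultimately show ?thesis by linarith
  qed
  have key2: "\<bar>t\<bar> * (1 - 2 * \<eta>) < \<beta>" if h: "half_node c t (\<eta> * w)" and w: "\<bar>w\<bar> \<le> \<bar>t\<bar>" for t w
  proof (cases "t \<ge> 0")
    case True
    then show ?thesis using key[OF h] w by auto
  next
    case False
    have "half_node c (- t) (\<eta> * - w)" using h half_node_neg[of c t "\<eta> * w"] by simp
    from key[OF this] show ?thesis using False w by auto
  qed
  have h: "half_node c x (\<eta> * z)" "half_node c z (\<eta> * x)" using n by (auto simp: node_def)
  have e: "1 - 2 * \<eta> \<ge> 0" using eta_less by simp
  show "\<bar>x\<bar> * (1 - 2 * \<eta>) < \<beta>"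
  proof (cases "\<bar>z\<bar> \<le> \<bar>x\<bar>")
    case False
    then have "\<bar>x\<bar> * (1 - 2 * \<eta>) \<le> \<bar>z\<bar> * (1 - 2 * \<eta>)" using e by (intro mult_right_mono) auto
    then show ?thesis using key2[OF h(2)] False by simp
  qed (use key2[OF h(1)] in simp)
  show "\<bar>z\<bar> * (1 - 2 * \<eta>) < \<beta>"
  proof (cases "\<bar>x\<bar> \<le> \<bar>z\<bar>")
    case False
    then have "\<bar>z\<bar> * (1 - 2 * \<eta>) \<le> \<bar>x\<bar> * (1 - 2 * \<eta>)" using e by (intro mult_right_mono) auto
    then show ?thesis using key2[OF h(1)] False by simp
  qed (use key2[OF h(2)] in simp)
qed

lemma zero_node_bound':
  assumes n: "node c x z 0" and c: "c > \<theta>" shows "\<bar>x\<bar> < 22/10 * \<beta>" "\<bar>z\<bar> < 22/10 * \<beta>"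
proof -
  have "t < 22/10 * \<beta>" if t: "0 \<le> t" "t * (1 - 2 * \<eta>) < \<beta>" for t
  proof -
    \<comment> \<open>\<open>47/100\<close> is \<open>1 - 2 * (265/1000)\<close>, and its reciprocal
      is below \<open>22/10\<close>.\<close>
    have "t * (47/100) \<le> t * (1 - 2 * \<eta>)" using t eta_less by (intro mult_left_mono) auto
    then show ?thesis using t beta_pos by linarith
  qed
  from this[OF _ zero_node_bound(1)[OF n c]] this[OF _ zero_node_bound(2)[OF n c]]
  show "\<bar>x\<bar> < 22/10 * \<beta>" "\<bar>z\<bar> < 22/10 * \<beta>" by auto
qed

lemma two_node_neg:
  assumes n: "node c x z 2" and c: "c > \<theta>" shows "x < 0" "z < 0"
proof -
  have key: "x < 0" if n: "node c x z 2" for x z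
  proof (rule ccontr)
    assume "\<not> x < 0"
    have z: "z > - (1 - \<beta>)" and p: "1 - \<beta> - x > 0" and p4: "c \<le> (1 - \<beta> - x) * (1 - \<eta> - \<eta> * (2 + z))"
      using n by (auto simp: node_def half_node_def p4_def)
    have "\<eta> * (2 + z) \<ge> \<eta> * (1 + \<beta>)" using z eta_pos by (intro mult_left_mono) auto
    then have 1: "1 - \<eta> - \<eta> * (2 + z) \<le> 1 - 2 * \<eta> - D" by (simp add: D_eq algebra_simps)
    have "(1 - \<beta> - x) * (1 - \<eta> - \<eta> * (2 + z)) \<le> (1 - \<beta> - x) * (1 - 2 * \<eta> - D)"
      using 1 p by (intro mult_left_mono) auto
    also have "\<dots> \<le> (1 - \<beta>) * (1 - 2 * \<eta> - D)"
      using \<open>\<not> x < 0\<close> eta_less D_less by (intro mult_right_mono) auto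
    also have "\<dots> = 1 - 2 * \<eta> - \<beta> + D + \<beta> * D" by (simp add: D_eq algebra_simps)
    finally have "\<theta> < 1 - 2 * \<eta> - \<beta> + D + \<beta> * D" using p4 c by simp
    moreover have "\<beta> * D > 0" using beta_pos D_pos by simp
    ultimately show False using beta_less_eta unfolding theta_eq by linarith
  qed
  show "x < 0" using key[OF n] .
  show "z < 0" using key[of z x] n by (simp add: node_sym)
qed

text \<open>Let \<open>p\<close> be the larger of \<open>- x\<close> and \<open>- z\<close>. Then
  \<open>p2\<close> bounds the increasing expression
  \<open>p * (1 - 2 * \<eta> - D) + \<eta> * (p * p)\<close> from above and \<open>p4\<close> bounds
  it from below; both can hold only if \<open>\<eta> < 2 * \<beta>\<close>. The threshold
  \<open>\<beta> * (5 - 2 * \<eta>)\<close> is the size that a neighbouring digit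
  \<open>e \<le> - 5\<close> would produce.\<close>

lemma two_node_bounds:
  assumes n: "node c x z 2" and c: "c > \<theta>"
  shows "\<eta> < 2 * \<beta>" "- x < \<beta> * (5 - 2 * \<eta>)" "- z < \<beta> * (5 - 2 * \<eta>)"
proof -
  have key: "\<eta> < 2 * \<beta> \<and> - x < \<beta> * (5 - 2 * \<eta>)" if n: "node c x z 2" and le: "- z \<le> - x" for x z
  proof -
    define p where "p = - x"
    have p0: "p > 0" using two_node_neg[OF n c] by (simp add: p_def)
    have pb: "1 + \<beta> - p > 0" and A: "c \<le> (1 + \<beta> - p) * (1 + \<eta> - \<eta> * (2 + z))"
      and B: "c \<le> (1 - \<beta> + p) * (1 - \<eta> - \<eta> * (2 + z))"
      using n beta_pos by (auto simp: node_def half_node_def p2_def p4_def p_def)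
    have "\<eta> * - p \<le> \<eta> * z" using le eta_pos by (intro mult_left_mono) (auto simp: p_def)
    then have z: "1 + \<eta> - \<eta> * (2 + z) \<le> 1 - \<eta> + \<eta> * p" "1 - \<eta> - \<eta> * (2 + z) \<le> 1 - 3 * \<eta> + \<eta> * p"
      by (auto simp: algebra_simps)
    have "(1 + \<beta> - p) * (1 + \<eta> - \<eta> * (2 + z)) \<le> (1 + \<beta> - p) * (1 - \<eta> + \<eta> * p)"
      using z pb by (intro mult_left_mono) auto
    also have "\<dots> = 1 + \<beta> - \<eta> - D - (p * (1 - 2 * \<eta> - D) + \<eta> * (p * p))" by (simp add: D_eq algebra_simps)
    finally have 1: "p * (1 - 2 * \<eta> - D) + \<eta> * (p * p) < 3 * \<beta> - 2 * D - 2 * \<beta> * D"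
      using A c unfolding theta_eq by linarith
    have "(1 - \<beta> + p) * (1 - \<eta> - \<eta> * (2 + z)) \<le> (1 - \<beta> + p) * (1 - 3 * \<eta> + \<eta> * p)"
      using z p0 beta_less by (intro mult_left_mono) auto
    also have "\<dots> = 1 - \<beta> - 3 * \<eta> + 3 * D + (p * (1 - 2 * \<eta> - D) + \<eta> * (p * p))" by (simp add: D_eq algebra_simps)
    finally have 2: "p * (1 - 2 * \<eta> - D) + \<eta> * (p * p) > 2 * \<eta> - \<beta> - 2 * D + 2 * \<beta> * D"
      using B c unfolding theta_eq by linarith
    have bD: "\<beta> * D > 0" using beta_pos D_pos by simp
    have e2b: "\<eta> < 2 * \<beta>" using 1 2 bD by linarith
    moreover have "p < \<beta> * (5 - 2 * \<eta>)"
    proof (rule ccontr)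
      assume "\<not> ?thesis"
      then have p: "\<beta> * (5 - 2 * \<eta>) \<le> p" by simp
      have g: "0 \<le> \<beta> * (5 - 2 * \<eta>)" "0 \<le> 1 - 2 * \<eta> - D" using beta_pos eta_less D_less by auto
      have "\<beta> * (5 - 2 * \<eta>) * (1 - 2 * \<eta> - D) + \<eta> * ((\<beta> * (5 - 2 * \<eta>)) * (\<beta> * (5 - 2 * \<eta>)))
         \<le> p * (1 - 2 * \<eta> - D) + \<eta> * (p * p)"
        using p g eta_pos by (intro add_mono mult_mono mult_left_mono) auto
      with 1 have "\<beta> * (5 - 2 * \<eta>) * (1 - 2 * \<eta> - D) + \<eta> * ((\<beta> * (5 - 2 * \<eta>)) * (\<beta> * (5 - 2 * \<eta>))) < 3 * \<beta> - 2 * D"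
        using bD by linarith
      then have "\<beta> * ((5 - 2 * \<eta>) * (1 - 2 * \<eta>) + D * ((5 - 2 * \<eta>) * (4 - 2 * \<eta>))) < \<beta> * (3 - 2 * \<eta>)"
        unfolding D_eq by (simp add: algebra_simps)
      then have 3: "(5 - 2 * \<eta>) * (1 - 2 * \<eta>) + D * ((5 - 2 * \<eta>) * (4 - 2 * \<eta>)) < 3 - 2 * \<eta>"
        using beta_pos by simp
      have "\<eta> * (\<eta> / 2) \<le> D" unfolding D_eq using e2b eta_pos by (intro mult_left_mono) auto
      then have "\<eta> * (\<eta> / 2) * ((5 - 2 * \<eta>) * (4 - 2 * \<eta>)) \<le> D * ((5 - 2 * \<eta>) * (4 - 2 * \<eta>))"
        using eta_less by (intro mult_right_mono) auto
      with 3 have 4: "2 - 10 * \<eta> + 14 * (\<eta> * \<eta>) - 9 * (\<eta> * \<eta>) * \<eta> + 2 * (\<eta> * \<eta>) * (\<eta> * \<eta>) < 0"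
        by (simp add: algebra_simps)
      have "(\<eta> * \<eta>) * \<eta> \<le> (\<eta> * \<eta>) * (265/1000)" using eta_less eta_pos by (intro mult_left_mono) auto
      moreover have "(\<eta> * \<eta>) * (\<eta> * \<eta>) \<ge> 0" by simp
      \<comment> \<open>The tangent of the square at the upper bound of \<open>\<eta>\<close>; it
        makes the remaining inequality linear.\<close>
      moreover have "\<eta> * \<eta> \<ge> 53/100 * \<eta> - 70225/1000000"
        using zero_le_square[of "\<eta> - 265/1000"] by (simp add: algebra_simps)
      ultimately show False using 4 eta_less by linarith
    qed
    ultimately show ?thesis by (simp add: p_def)
  qed
  have n': "node c z x 2" using n by (simp add: node_sym)
  show "\<eta> < 2 * \<beta>" "- x < \<beta> * (5 - 2 * \<eta>)" "- z < \<beta> * (5 - 2 * \<eta>)"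
    using key[OF n] key[OF n'] by linarith+
qed

text \<open>\<open>edge\<close> relates the data of two consecutive nodes separated by the digit \<open>e\<close>.\<close>

definition edge :: "real \<Rightarrow> real \<Rightarrow> int \<Rightarrow> int \<Rightarrow> real \<Rightarrow> real \<Rightarrow> int \<Rightarrow> bool" where
  "edge x z s e x' z' s' \<longleftrightarrow> x' = \<beta> * (e + \<eta> * (s + x)) \<and> z = \<beta> * (e + \<eta> * (s' + z'))"

lemma edge_sym: "edge x z s e x' z' s' \<longleftrightarrow> edge z' x' s' e z x s"
  unfolding edge_def by blast

lemma even_small_cases: "even s \<Longrightarrow> s < 4 \<Longrightarrow> s > - 4 \<Longrightarrow> s \<in> {- 2, 0, 2 :: int}"
  by (auto elim!: evenE)

lemma digit_shift_small:
  assumes n: "node c x z s" and c: "c > \<theta>" and s: "even s" shows "\<bar>\<eta> * (s + x)\<bar> < 3 * \<eta>"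
proof -
  have "s \<in> {- 2, 0, 2}" using node_digit_bound[OF n c] s by (intro even_small_cases)
  moreover have "\<bar>x\<bar> < 1" using n beta_pos by (auto simp: node_def half_node_def)
  ultimately have "\<bar>s + x\<bar> < 3" by auto
  then have "\<eta> * \<bar>s + x\<bar> < \<eta> * 3" using eta_pos by (intro mult_strict_left_mono) auto
  then show ?thesis using eta_pos by (simp add: abs_mult)
qed

text \<open>A digit with \<open>\<bar>e\<bar> \<ge> 3\<close> gives
  \<open>\<bar>x'\<bar> \<ge> \<beta> * (3 - 3 * \<eta>)\<close>. This contradicts
  \<open>zero_node_bound\<close>, because \<open>(3 - 3 * \<eta>) * (1 - 2 * \<eta>)\<close> still
  exceeds 1 at the upper bound of \<open>\<eta>\<close>.\<close>

lemma zero_node_edge: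
  assumes n: "node c x z s" "node c x' z' 0" and c: "c > \<theta>" and s: "even s" and e: "odd e"
    and ed: "edge x z s e x' z' 0"
  shows "\<bar>e\<bar> = 1"
proof (rule ccontr)
  assume "\<bar>e\<bar> \<noteq> 1"
  then have "\<bar>e\<bar> \<ge> 3" using e by presburger
  then have e3: "\<bar>real_of_int e\<bar> \<ge> 3" by linarith
  have "\<bar>e + \<eta> * (s + x)\<bar> \<ge> \<bar>real_of_int e\<bar> - \<bar>\<eta> * (s + x)\<bar>"
    using abs_triangle_ineq4[of "e + \<eta> * (s + x)" "\<eta> * (s + x)"] by simp
  then have "\<bar>e + \<eta> * (s + x)\<bar> \<ge> 3 - 3 * \<eta>" using e3 digit_shift_small[OF n(1) c s] by linarith
  then have "\<beta> * (3 - 3 * \<eta>) \<le> \<bar>x'\<bar>" using ed beta_pos by (simp add: edge_def abs_mult)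
  then have "\<beta> * (3 - 3 * \<eta>) * (1 - 2 * \<eta>) \<le> \<bar>x'\<bar> * (1 - 2 * \<eta>)"
    using eta_less by (intro mult_right_mono) auto
  with zero_node_bound(1)[OF n(2) c] have "\<beta> * ((3 - 3 * \<eta>) * (1 - 2 * \<eta>)) < \<beta> * 1" by simp
  then have "(3 - 3 * \<eta>) * (1 - 2 * \<eta>) < 1" using beta_pos by simp
  moreover have "(3 - 3 * (265/1000)) * (1 - 2 * (265/1000)) \<le> (3 - 3 * \<eta>) * (1 - 2 * \<eta>)"
    using eta_less by (intro mult_mono) auto
  ultimately show False by simp
qed

text \<open>Both tails at a digit 2 are negative, which forces \<open>e < 0\<close> and excludes a
  neighbour \<open>- 2\<close>, whose tails are positive. Digits \<open>e \<le> - 5\<close> would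
  make the tail larger than \<open>two_node_bounds\<close> permits.\<close>

lemma two_node_edge:
  assumes n: "node c x z s" "node c x' z' 2" and c: "c > \<theta>" and s: "even s" and e: "odd e"
    and ed: "edge x z s e x' z' 2"
  shows "s \<in> {0, 2}" "e \<in> {- 1, - 3}"
proof -
  have sm: "\<bar>\<eta> * (s + x)\<bar> < 8/10" using digit_shift_small[OF n(1) c s] eta_less by simp
  have x': "x' = \<beta> * (e + \<eta> * (s + x))" "z = \<beta> * (e + \<eta> * (2 + z'))" using ed by (auto simp: edge_def)
  have "e + \<eta> * (s + x) < 0" using two_node_neg(1)[OF n(2) c] beta_pos x'(1) by (simp add: mult_less_0_iff)
  then have "e < 1" using sm by linarith
  then have em: "e \<le> - 1" using e by presburger
  have s3: "s \<in> {- 2, 0, 2}" using node_digit_bound[OF n(1) c] s by (intro even_small_cases)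
  moreover have "s \<noteq> - 2"
  proof
    assume "s = - 2"
    then have "node c (- x) (- z) 2" using n(1) node_neg[of c x z s] by simp
    then have "z > 0" using two_node_neg[OF _ c] by force
    then have "e + \<eta> * (2 + z') > 0" using beta_pos x'(2) by (simp add: zero_less_mult_iff)
    moreover have "\<bar>\<eta> * (2 + z')\<bar> < 8/10"
      using digit_shift_small[of c z' x' 2] n(2) c eta_less by (simp add: node_sym)
    ultimately show False using em by linarith
  qed
  ultimately show s02: "s \<in> {0, 2}" by auto
  have "\<not> e \<le> - 5"
  proof
    assume "e \<le> - 5"
    have "s + x < 2"
    proof (cases "s = 2")
      case True
      then show ?thesis using two_node_neg(1)[of c x z] n(1) c by simp
    next
      case False
      then show ?thesis using s02 n(1) beta_pos by (auto simp: node_def half_node_def)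
    qed
    then have "\<eta> * (s + x) < \<eta> * 2" using eta_pos by (intro mult_strict_left_mono) auto
    then have "e + \<eta> * (s + x) \<le> - (5 - 2 * \<eta>)" using \<open>e \<le> - 5\<close> by linarith
    then have "x' \<le> \<beta> * (- (5 - 2 * \<eta>))" unfolding x' using beta_pos by (intro mult_left_mono) auto
    then show False using two_node_bounds(2)[OF n(2) c] by (simp add: algebra_simps)
  qed
  then have "e = - 1 \<or> e = - 3" using em e by presburger
  then show "e \<in> {- 1, - 3}" by simp
qed

text \<open>For \<open>e1 = - 1\<close> the tail \<open>x\<close> is hardly below
  \<open>- \<beta>\<close>, and \<open>p4\<close> gets too small. The leading terms of this estimate
  and of \<open>\<theta>\<close> cancel once \<open>\<eta> - \<beta>\<close> is replaced by its
  lower bound \<open>D - D * D\<close>, a consequence of \<open>b - a \<ge> 1\<close>; the terms of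
  the order of \<open>\<eta> * D\<close> give the contradiction.\<close>

lemma two_node_digit:
  assumes n: "node c x1 z1 s1" "node c x z 2" "node c x2 z2 s2" and c: "c > \<theta>"
    and par: "even s1" "even s2" "odd e1" "odd e2"
    and ed: "edge x1 z1 s1 e1 x z 2" "edge x z 2 e2 x2 z2 s2"
  shows "e1 = - 3"
proof (rule ccontr)
  assume "e1 \<noteq> - 3"
  note L = two_node_edge[OF n(1,2) c par(1,3) ed(1)]
  have ed2: "edge z2 x2 s2 e2 z x 2" using ed(2) edge_sym by blast
  have n3: "node c z2 x2 s2" "node c z x 2" using n node_sym by blast+
  note R = two_node_edge[OF n3 c par(2,4) ed2]
  have e1: "e1 = - 1" using L \<open>e1 \<noteq> - 3\<close> by auto
  have shift: "s + t \<ge> - (22/10) * \<beta>" if "node c t w s" "s \<in> {0, 2}" for s t w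
  proof (cases "s = 0")
    case True
    then show ?thesis using zero_node_bound'(1)[of c t w] that c by auto
  next
    case False
    then have "s = 2" using that by auto
    then have "- t < \<beta> * (5 - 2 * \<eta>)" using two_node_bounds(2)[of c t w] that c by simp
    also have "\<dots> \<le> \<beta> * 5" using beta_pos eta_pos by (intro mult_left_mono) auto
    finally show ?thesis using \<open>s = 2\<close> beta_less beta_pos by simp
  qed
  have shift': "\<eta> * (s + t) \<ge> - (22/10) * D" if "node c t w s" "s \<in> {0, 2}" for s t w
  proof -
    have "\<eta> * (- (22/10) * \<beta>) \<le> \<eta> * (s + t)" using shift[OF that] eta_pos by (intro mult_left_mono) auto
    then show ?thesis by (simp add: D_eq algebra_simps)
  qed
  have "x = \<beta> * (- 1 + \<eta> * (s1 + x1))" using ed(1) e1 by (simp add: edge_def)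
  also have "\<dots> \<ge> \<beta> * (- 1 - (22/10) * D)"
    using shift'[OF n(1) L(1)] beta_pos by (intro mult_left_mono) auto
  finally have x: "x \<ge> - \<beta> - (22/10) * (\<beta> * D)" by (simp add: algebra_simps)
  have zz: "e2 + \<eta> * (s2 + z2) \<ge> - 3 + 2 * \<eta> - 5 * D"
  proof (cases "e2 = - 1")
    case True
    then show ?thesis using shift'[OF n3(1) R(1)] eta_less D_pos by simp
  next
    case False
    then have e2: "e2 = - 3" using R by auto
    then have "s2 \<noteq> 0" using zero_node_edge[OF n(2) _ c _ par(4), of x2 z2] n(3) ed(2) by auto
    then have s2: "s2 = 2" using R by auto
    then have "- z2 < \<beta> * (5 - 2 * \<eta>)" using two_node_bounds(3)[of c x2 z2] n(3) c by simp
    also have "\<dots> \<le> \<beta> * 5" using beta_pos eta_pos by (intro mult_left_mono) auto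
    finally have "\<eta> * (s2 + z2) \<ge> \<eta> * (2 - 5 * \<beta>)" using s2 eta_pos by (intro mult_left_mono) auto
    then show ?thesis using e2 by (simp add: D_eq algebra_simps)
  qed
  have "z = \<beta> * (e2 + \<eta> * (s2 + z2))" using ed(2) by (simp add: edge_def)
  then have "\<eta> * z = D * (e2 + \<eta> * (s2 + z2))" by (simp add: D_eq)
  also have "\<dots> \<ge> D * (- 3 + 2 * \<eta> - 5 * D)" using zz D_pos by (intro mult_left_mono) auto
  finally have z: "\<eta> * z \<ge> - 3 * D + 2 * (\<eta> * D) - 5 * (D * D)" by (simp add: algebra_simps)
  define W where "W = 1 - 3 * \<eta> + 3 * D - 2 * (\<eta> * D) + 5 * (D * D)"
  have p: "1 - \<beta> - x > 0" and p4: "c \<le> (1 - \<beta> - x) * (1 - \<eta> - \<eta> * (2 + z))"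
    using n(2) by (auto simp: node_def half_node_def p4_def)
  have bD: "\<beta> * D > 0" "\<eta> * D > 0" "D * D > 0" using beta_pos eta_pos D_pos by auto
  have DE: "D \<le> \<eta> * (212/1000)" unfolding D_eq using beta_less eta_pos by (intro mult_left_mono) auto
  have DD': "D * D \<le> (6/100) * D" using D_less D_pos by (intro mult_right_mono) auto
  have W1: "W \<le> 1" unfolding W_def using DE DD' bD D_pos eta_pos by linarith
  have W0: "W \<ge> 0" using eta_less D_pos bD mult_mono[of \<eta> "265/1000" D "6/100"] D_less eta_pos by (simp add: W_def)
  have "1 - \<eta> - \<eta> * (2 + z) \<le> W" using z by (simp add: W_def algebra_simps)
  then have "(1 - \<beta> - x) * (1 - \<eta> - \<eta> * (2 + z)) \<le> (1 - \<beta> - x) * W" using p by (intro mult_left_mono) auto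
  also have "\<dots> \<le> (1 + (22/10) * (\<beta> * D)) * W" using x W0 by (intro mult_right_mono) auto
  also have "\<dots> = W + (22/10) * (\<beta> * D) * W" by (simp add: algebra_simps)
  also have "\<dots> \<le> W + (22/10) * (\<beta> * D) * 1" using W1 bD by (intro add_left_mono mult_left_mono) auto
  also have "\<dots> = W + (22/10) * (\<beta> * D)" by simp
  finally have 1: "\<theta> < W + (22/10) * (\<beta> * D)" using p4 c by simp
  have "(\<eta> - \<beta>) * (1 + D) \<ge> 1 * D" unfolding eta_minus_beta
    using a_less_b D_pos by (intro mult_right_mono) auto
  moreover have "(D - D * D) * (1 + D) \<le> D" using D_pos by (simp add: algebra_simps)
  ultimately have "(D - D * D) * (1 + D) \<le> (\<eta> - \<beta>) * (1 + D)" by simp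
  then have 2: "D - D * D \<le> \<eta> - \<beta>" using D_pos by simp
  have "D * D \<le> \<eta> * (212/1000) * D" using DE D_pos by (intro mult_right_mono) auto
  then have 3: "D * D \<le> (212/1000) * (\<eta> * D)" by simp
  have "\<beta> * D < \<eta> * D" using beta_less_eta D_pos by simp
  then show False using 1 2 3 bD unfolding theta_eq W_def by linarith
qed

end

locale node_sequence = params +
  fixes s E :: "nat \<Rightarrow> int" and X Y :: "nat \<Rightarrow> real" and K :: nat and c :: real
  assumes even_s: "\<And>i. even (s i)" and odd_E: "\<And>i. odd (E i)"
    and X_rec: "\<And>i. X (Suc i) = \<beta> * (E i + \<eta> * (s i + X i))"
    and Y_rec: "\<And>i. Y i = \<beta> * (E i + \<eta> * (s (Suc i) + Y (Suc i)))"
    and nodes: "\<And>i. i \<ge> K \<Longrightarrow> node c (X i) (Y i) (s i)"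
    and c_gt_theta: "c > \<theta>"
begin

lemma edge: "edge (X i) (Y i) (s i) (E i) (X (Suc i)) (Y (Suc i)) (s (Suc i))"
  unfolding edge_def using X_rec Y_rec by blast

text \<open>Nodes and edges are symmetric, so \<open>two_node_digit\<close> read backwards fixes the
  digit on the right as \<open>- 3\<close>. Such a digit cannot touch a zero node, hence the 2
  reproduces itself.\<close>

lemma two_step:
  assumes i: "i > K" and s: "s i = 2" shows "E i = - 3 \<and> s (Suc i) = 2"
proof -
  obtain j where j: "i = Suc j" "j \<ge> K" using i by (cases i) auto
  have n: "node c (X j) (Y j) (s j)" "node c (X i) (Y i) 2" "node c (X (Suc i)) (Y (Suc i)) (s (Suc i))"
    using nodes[of j] nodes[of i] nodes[of "Suc i"] i j s by auto
  have e: "edge (X j) (Y j) (s j) (E j) (X i) (Y i) 2" "edge (X i) (Y i) 2 (E i) (X (Suc i)) (Y (Suc i)) (s (Suc i))"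
    using edge[of j] edge[of i] j s by auto
  have n': "node c (Y (Suc i)) (X (Suc i)) (s (Suc i))" "node c (Y i) (X i) 2" "node c (Y j) (X j) (s j)"
    using n node_sym by blast+
  have e': "edge (Y (Suc i)) (X (Suc i)) (s (Suc i)) (E i) (Y i) (X i) 2" "edge (Y i) (X i) 2 (E j) (Y j) (X j) (s j)"
    using e edge_sym by blast+
  have E3: "E i = - 3"
    by (rule two_node_digit[OF n' c_gt_theta even_s even_s odd_E odd_E e'])
  have "s (Suc i) \<noteq> 0"
    using zero_node_edge[OF n(2) _ c_gt_theta _ odd_E, of "X (Suc i)" "Y (Suc i)" i] n(3) e(2) E3 by auto
  then show ?thesis using two_node_edge(1)[OF n'(1,2) c_gt_theta even_s odd_E e'(1)] E3 by auto
qed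

lemma two_tail:
  assumes i: "i > K" and s: "s i = 2" shows "j \<ge> i \<Longrightarrow> E j = - 3 \<and> s j = 2"
proof (induction j rule: dec_induct)
  case base
  then show ?case using two_step[OF i s] s by simp
next
  case (step j)
  then show ?case using two_step[of j] two_step[of "Suc j"] i by auto
qed

end

context node_sequence begin

interpretation neg: node_sequence a b "\<lambda>i. - s i" "\<lambda>i. - E i" "\<lambda>i. - X i" "\<lambda>i. - Y i" K c
proof unfold_locales
  fix i
  show "- X (Suc i) = \<beta> * (real_of_int (- E i) + \<eta> * (real_of_int (- s i) + - X i))"
    unfolding X_rec by (simp add: algebra_simps)
  show "- Y i = \<beta> * (real_of_int (- E i) + \<eta> * (real_of_int (- s (Suc i)) + - Y (Suc i)))"
    by (subst Y_rec) (simp add: algebra_simps)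
  show "K \<le> i \<Longrightarrow> node c (- X i) (- Y i) (- s i)" using nodes[of i] by (simp only: node_neg)
qed (use even_s odd_E c_gt_theta in auto)

theorem digit_dichotomy:
  "(\<exists>N. \<exists>\<sigma>\<in>{1, - 1}. \<forall>i\<ge>N. s i = \<sigma> * - 2 \<and> E i = \<sigma> * 3) \<or> (\<forall>i>K. s i = 0 \<and> \<bar>E i\<bar> = 1)"
proof (cases "\<exists>i>K. s i = 2 \<or> s i = - 2")
  case True
  then obtain i where i: "i > K" and "s i = 2 \<or> s i = - 2" by auto
  then show ?thesis
  proof (elim disjE)
    assume "s i = 2"
    then have "\<forall>j\<ge>i. s j = - 1 * - 2 \<and> E j = - 1 * 3" using two_tail[OF i] by auto
    then show ?thesis by blast
  next
    assume "s i = - 2"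
    then have "\<forall>j\<ge>i. s j = 1 * - 2 \<and> E j = 1 * 3" using neg.two_tail[OF i] by force
    then show ?thesis by blast
  qed
next
  case False
  have s0: "s i = 0" if "i > K" for i
    using even_small_cases[OF even_s node_digit_bound[OF nodes c_gt_theta]] that False by (meson empty_iff insert_iff less_imp_le)
  have "\<bar>E i\<bar> = 1" if "i > K" for i
    using zero_node_edge[OF nodes[of i] _ c_gt_theta even_s odd_E, of "X (Suc i)" "Y (Suc i)" i]
      edge[of i] nodes[of "Suc i"] s0[of "Suc i"] that by simp
  then show ?thesis using s0 by blast
qed

end

section \<open>Sequences of signs\<close>

context params begin

text \<open>This is \<open>p1\<close> at a zero digit whose tails are \<open>\<beta> * l\<close> and
  \<open>\<beta> * r\<close>; at the negated arguments it is \<open>p4\<close>. The remaining two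
  products turn out to be at least 1.\<close>

definition h :: "real \<Rightarrow> real \<Rightarrow> real" where "h l r = (1 - \<beta> + \<beta> * l) * (1 - \<eta> + D * r)"

text \<open>\<open>w\<close> is the power series in \<open>D\<close> with signs
  \<open>++--++--...\<close>. \<open>LI\<close> belongs to the signs \<open>-+-\<close> followed by
  that sequence and \<open>RI\<close> to a single \<open>-\<close> followed by it. They are the
  tails of a cut inside the block next to an isolated defect, read outwards from the cut.\<close>

definition w :: real where "w = (1 + D) / (1 + D * D)"
definition LI :: real where "LI = - 1 + D - D * D + D * D * D * w"
definition RI :: real where "RI = - 1 + D * w"

lemma w_eq: "w = 1 + D - D * D * w"
proof -
  have "1 + D * D \<noteq> 0" using D_pos by (simp add: add_pos_pos less_imp_neq[symmetric])
  then show ?thesis by (simp add: w_def field_simps)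
qed

lemma DD_less: "D * D < (6/100) * D" using D_less D_pos by simp

lemma w_bounds: "1 < w" "w < 1 + D" "w < 107/100" "w > 1 + D - D * D - D * D * D"
proof -
  have 1: "w > 0" unfolding w_def using D_pos by (simp add: add_pos_pos)
  have DD: "D * D > 0" using D_pos by simp
  have "D * D * w > 0" using 1 DD by simp
  then show 2: "w < 1 + D" using w_eq by simp
  then show "w < 107/100" using D_less by simp
  have "D * D * w < D * D * (1 + D)" using 2 DD by (intro mult_strict_left_mono) auto
  then show 3: "w > 1 + D - D * D - D * D * D" using w_eq by (simp add: algebra_simps)
  have "D * D * D < (6/100) * (D * D)" using D_less D_pos by simp
  then show "1 < w" using 3 DD_less D_pos by linarith
qed

lemma delta_inf_eq: "delta_inf a b = h LI RI"
proof -
  have n: "1 + D * D \<noteq> 0" using D_pos by (simp add: add_pos_pos less_imp_neq[symmetric])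
  have l: "(1 - D) * (1 + 2 * D\<^sup>2) / (1 + D\<^sup>2) = - LI"
    using n by (simp add: LI_def w_def field_simps power2_eq_square)
  have r: "(1 - D) / (1 + D\<^sup>2) = - RI"
    using n by (simp add: RI_def w_def field_simps power2_eq_square)
  have "\<beta> * (1 - D) * (1 + 2 * D\<^sup>2) / (1 + D\<^sup>2) = \<beta> * ((1 - D) * (1 + 2 * D\<^sup>2) / (1 + D\<^sup>2))"
    "D * (1 - D) / (1 + D\<^sup>2) = D * ((1 - D) / (1 + D\<^sup>2))" by (simp_all add: mult.assoc)
  then have "\<beta> * (1 - D) * (1 + 2 * D\<^sup>2) / (1 + D\<^sup>2) = - (\<beta> * LI)"
    "D * (1 - D) / (1 + D\<^sup>2) = - (D * RI)" unfolding l r by simp_all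
  then show ?thesis unfolding delta_inf_def h_def Let_def by (simp only: diff_minus_eq_add)
qed

lemma LI_bounds: "- 1 < LI" "LI < 0" and RI_bounds: "- 1 < RI" "RI < 0"
proof -
  have D1: "D * D < D" using DD_less D_pos by simp
  have p: "D * D * D * w > 0" using w_bounds D_pos by simp
  then show "- 1 < LI" using D1 unfolding LI_def by simp
  have "D * w < D * (107/100)" using w_bounds D_pos by simp
  then have dw: "D * w < 1/10" using D_less by simp
  then show "RI < 0" unfolding RI_def by simp
  show "- 1 < RI" using w_bounds D_pos unfolding RI_def by simp
  have "D * D \<le> 1" using D1 D_less by linarith
  then have "D * D * (D * w) \<le> 1 * (D * w)" using D_pos w_bounds by (intro mult_right_mono) auto
  moreover have "D * D > 0" using D_pos by simp
  ultimately show "LI < 0" using dw D_less unfolding LI_def by (simp add: mult.assoc)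
qed

lemma theta_less_delta_inf: "\<theta> < delta_inf a b"
proof -
  have "(1 - 2 * \<beta>) * (1 - \<eta> - D) < (1 - \<beta> + \<beta> * LI) * (1 - \<eta> + D * RI)"
  proof (rule mult_strict_mono)
    have "\<beta> * - 1 < \<beta> * LI" using LI_bounds beta_pos by (intro mult_strict_left_mono) auto
    then show "1 - 2 * \<beta> < 1 - \<beta> + \<beta> * LI" by simp
    then show "0 < 1 - \<beta> + \<beta> * LI" using beta_less by simp
    have "D * - 1 < D * RI" using RI_bounds D_pos by (intro mult_strict_left_mono) auto
    then show "1 - \<eta> - D < 1 - \<eta> + D * RI" by simp
  qed (use eta_less D_less in auto)
  then show ?thesis unfolding \<theta>_def delta_inf_eq h_def .
qed

text \<open>Both factors below are close to 1, and the second summand carries the extra factor \<open>\<eta>\<close>.\<close>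

lemma h_gt_delta_infD:
  assumes g: "h l r > delta_inf a b"
  shows "(l - LI) * (1 - \<eta> + D * r) + \<eta> * (r - RI) * (1 - \<beta> + \<beta> * LI) > 0"
proof -
  have "h l r - h LI RI = \<beta> * ((l - LI) * (1 - \<eta> + D * r) + \<eta> * (r - RI) * (1 - \<beta> + \<beta> * LI))"
    unfolding h_def D_eq by (simp add: algebra_simps)
  then have "\<beta> * ((l - LI) * (1 - \<eta> + D * r) + \<eta> * (r - RI) * (1 - \<beta> + \<beta> * LI)) > 0"
    using g unfolding delta_inf_eq by simp
  then show ?thesis using beta_pos by (simp add: zero_less_mult_iff)
qed

lemma factor_bounds:
  assumes r: "\<bar>r\<bar> \<le> 12/10"
  shows "66/100 \<le> 1 - \<eta> + D * r" "1 - \<eta> + D * r \<le> 1"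
    "57/100 \<le> 1 - \<beta> + \<beta> * LI" "1 - \<beta> + \<beta> * LI \<le> 1"
proof -
  have "\<bar>D * r\<bar> \<le> D * (12/10)" unfolding abs_mult using r D_pos by (intro mult_mono) auto
  moreover have "D \<le> \<eta> * (212/1000)" unfolding D_eq using beta_less eta_pos by (intro mult_left_mono) auto
  ultimately show "66/100 \<le> 1 - \<eta> + D * r" "1 - \<eta> + D * r \<le> 1" using eta_less D_less eta_pos by linarith+
  have "\<beta> * - 1 \<le> \<beta> * LI" "\<beta> * LI \<le> \<beta> * 0" using LI_bounds beta_pos by (intro mult_left_mono; simp)+
  then show "57/100 \<le> 1 - \<beta> + \<beta> * LI" "1 - \<beta> + \<beta> * LI \<le> 1" using beta_less beta_pos by linarith+
qed

text \<open>The right tail enters with the extra weight \<open>\<eta>\<close>, and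
  \<open>(265/1000) * (12/5) < 66/100\<close>. So a deficit \<open>x\<close> on the left cannot be
  repaired by an excess of \<open>12/5 * x\<close> on the right.\<close>

lemma left_deficit:
  assumes "l \<le> LI - x" and "r \<le> RI + 12/5 * x" and "0 < x" and "\<bar>r\<bar> \<le> 12/10"
  shows "h l r \<le> delta_inf a b"
proof (rule ccontr)
  assume "\<not> ?thesis"
  then have g: "(l - LI) * (1 - \<eta> + D * r) + \<eta> * (r - RI) * (1 - \<beta> + \<beta> * LI) > 0"
    using h_gt_delta_infD by simp
  note f = factor_bounds[OF assms(4)]
  have "(l - LI) * (1 - \<eta> + D * r) \<le> (- x) * (1 - \<eta> + D * r)" using assms f by (intro mult_right_mono) auto
  also have "\<dots> \<le> (- x) * (66/100)" using assms f by (intro mult_left_mono_neg) auto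
  finally have 1: "(l - LI) * (1 - \<eta> + D * r) \<le> - (66/100) * x" by simp
  have "\<eta> * (r - RI) * (1 - \<beta> + \<beta> * LI) \<le> \<eta> * (12/5 * x) * (1 - \<beta> + \<beta> * LI)"
    using assms f eta_pos by (intro mult_right_mono mult_left_mono) auto
  also have "\<dots> \<le> \<eta> * (12/5 * x) * 1" using assms f eta_pos by (intro mult_left_mono) auto
  also have "\<dots> \<le> (265/1000) * (12/5 * x) * 1" using assms eta_less by (intro mult_right_mono) auto
  finally show False using 1 g assms(3) by simp
qed

text \<open>The signs of the word defining \<open>delta a b k\<close>: one pair \<open>-+\<close>,
  then \<open>k\<close> copies of \<open>--++\<close>.\<close>

definition pk :: "nat \<Rightarrow> nat \<Rightarrow> int" where
  "pk k i = (let j = i mod (4 * k + 2) in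
     if j = 0 then - 1 else if j = 1 then 1 else if (j - 2) mod 4 < 2 then - 1 else 1)"

definition pblocks :: "nat \<Rightarrow> int" where "pblocks i = (if i mod 4 < 2 then 1 else - 1)"

end

text \<open>The bound \<open>114/100\<close> is what one step of the recursion makes of the crude
  bound \<open>22/10\<close> at zero nodes.\<close>

locale sign_sequence = params +
  fixes e :: "nat \<Rightarrow> int" and L R :: "nat \<Rightarrow> real" and K :: nat and c :: real
  assumes e_pm: "\<And>i. i \<ge> K \<Longrightarrow> e i = 1 \<or> e i = - 1"
    and L_rec: "\<And>i. i \<ge> K \<Longrightarrow> L (Suc i) = e i + D * L i"
    and R_rec: "\<And>i. i \<ge> K \<Longrightarrow> R i = e i + D * R (Suc i)"
    and L_bound: "\<And>i. i \<ge> K \<Longrightarrow> \<bar>L i\<bar> \<le> 114/100"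
    and R_bound: "\<And>i. i \<ge> K \<Longrightarrow> \<bar>R i\<bar> \<le> 114/100"
    and cuts: "\<And>i. i \<ge> K \<Longrightarrow> c \<le> h (L i) (R i) \<and> c \<le> h (- L i) (- R i) \<and> c \<le> h (R i) (L i) \<and> c \<le> h (- R i) (- L i)"
    and c_gt: "c > delta_inf a b"
begin

lemma cut:
  assumes "i \<ge> K" and "\<sigma> = 1 \<or> \<sigma> = (- 1 :: int)"
  shows "h (\<sigma> * L i) (\<sigma> * R i) > delta_inf a b" "h (\<sigma> * R i) (\<sigma> * L i) > delta_inf a b"
  using cuts[OF assms(1)] c_gt assms(2) by auto

lemma sL_bound: assumes "i \<ge> K" "\<sigma> = 1 \<or> \<sigma> = (- 1 :: int)"
  shows "\<bar>\<sigma> * L i\<bar> \<le> 114/100" "\<bar>\<sigma> * R i\<bar> \<le> 114/100"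
  using L_bound[OF assms(1)] R_bound[OF assms(1)] assms(2) by auto

lemma sL_rec: assumes "i \<ge> K" shows "\<sigma> * L (Suc i) = of_int (\<sigma> * e i) + D * (\<sigma> * L i)"
  using L_rec[OF assms] by (simp add: algebra_simps)

lemma sR_rec: assumes "i \<ge> K" shows "\<sigma> * R i = of_int (\<sigma> * e i) + D * (\<sigma> * R (Suc i))"
  using R_rec[OF assms] by (simp add: algebra_simps)

lemma sign_cases: "i \<ge> K \<Longrightarrow> \<sigma> = 1 \<or> \<sigma> = - 1 \<Longrightarrow> \<sigma> * e i = 1 \<or> \<sigma> * e i = - 1"
  using e_pm[of i] by auto

lemma D_mult_le: "x \<le> y \<Longrightarrow> D * x \<le> D * y" using D_pos by simp

text \<open>At the cut before the third of three signs \<open>-\<close> the left tail begins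
  \<open>- 1 - D\<close>, while \<open>LI\<close> begins \<open>- 1 + D\<close>; the right tail
  begins with \<open>- 1\<close> too and cannot compensate.\<close>

lemma no_triple:
  assumes i: "i \<ge> K" and eq: "e i = e (i + 1)" shows "e (i + 2) = - e i"
proof (rule ccontr)
  assume "e (i + 2) \<noteq> - e i"
  then have e2: "e (i + 2) = e i" using e_pm[of i] e_pm[of "i+2"] i by auto
  define \<sigma> where "\<sigma> = - e i"
  have \<sigma>: "\<sigma> = 1 \<or> \<sigma> = - 1" using e_pm[OF i] by (auto simp: \<sigma>_def)
  have se: "\<sigma> * e i = - 1" "\<sigma> * e (i+1) = - 1" "\<sigma> * e (i+2) = - 1"
    using e_pm[OF i] eq e2 by (auto simp: \<sigma>_def)
  let ?n = "i + 2"
  have l: "\<sigma> * L ?n = - 1 + D * (- 1 + D * (\<sigma> * L i))"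
    using sL_rec[of "i+1" \<sigma>] sL_rec[of i \<sigma>] i se by (simp add: numeral_2_eq_2 del: of_int_mult)
  have r: "\<sigma> * R ?n = - 1 + D * (\<sigma> * R (i+3))"
    using sR_rec[of "i+2" \<sigma>] i se by (simp add: numeral_3_eq_3 del: of_int_mult)
  have "D * (\<sigma> * L i) \<le> D * (114/100)" using sL_bound(1)[OF i \<sigma>] by (intro D_mult_le) auto
  then have "D * (- 1 + D * (\<sigma> * L i)) \<le> D * (- 1 + D * (114/100))" by (intro D_mult_le) auto
  moreover have "D * (- 1 + D * (114/100)) = - D + 114/100 * (D * D)" by (simp add: algebra_simps)
  moreover have "D * D * D * w > 0" using w_bounds D_pos by simp
  ultimately have lD: "\<sigma> * L ?n \<le> LI - D" using DD_less D_pos unfolding l LI_def by linarith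
  have "D * (\<sigma> * R (i+3)) \<le> D * (114/100)" using sL_bound(2)[of "i+3" \<sigma>] i \<sigma> by (intro D_mult_le) auto
  moreover have "D * 1 \<le> D * w" using w_bounds by (intro D_mult_le) auto
  ultimately have "\<sigma> * R ?n \<le> RI + 12/5 * D" using D_pos unfolding r RI_def by linarith
  moreover have "\<bar>\<sigma> * R ?n\<bar> \<le> 12/10" using sL_bound(2)[of ?n \<sigma>] i \<sigma> by simp
  ultimately have "h (\<sigma> * L ?n) (\<sigma> * R ?n) \<le> delta_inf a b" using D_pos lD by (intro left_deficit[of _ D]) auto
  then show False using cut(1)[of ?n \<sigma>] i \<sigma> by simp
qed

text \<open>Without triples the largest possible tail begins \<open>++-\<close>, as \<open>w\<close>
  does, so three signs determine the bound up to a multiple of \<open>D * D * D\<close>.\<close>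

lemma left_tail_le:
  fixes \<sigma> :: int
  assumes i: "i \<ge> K + 2" and \<sigma>: "\<sigma> = 1 \<or> \<sigma> = - 1"
  shows "\<sigma> * L (Suc i) \<le> w + 3 * (D * D * D)"
proof -
  obtain j where j: "i = j + 2" "j \<ge> K" using i by (metis add.commute le_Suc_ex le_add1 add_leE add.assoc)
  have s3: "\<sigma> * e j = 1 \<or> \<sigma> * e j = - 1" "\<sigma> * e (j+1) = 1 \<or> \<sigma> * e (j+1) = - 1" "\<sigma> * e (j+2) = 1 \<or> \<sigma> * e (j+2) = - 1"
    using sign_cases[OF _ \<sigma>] j by auto
  have ex: "\<sigma> * L (Suc i) = of_int (\<sigma> * e (j+2)) + D * (of_int (\<sigma> * e (j+1)) + D * (of_int (\<sigma> * e j) + D * (\<sigma> * L j)))"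
    using sL_rec[of "j+2" \<sigma>] sL_rec[of "j+1" \<sigma>] sL_rec[of j \<sigma>] j by (simp add: numeral_2_eq_2 del: of_int_mult)
  define t where "t = \<sigma> * L j"
  have t: "\<bar>t\<bar> \<le> 114/100" using sL_bound(1)[OF j(2) \<sigma>] by (simp add: t_def)
  have Dt: "D * t \<le> D * (114/100)" using t by (intro D_mult_le) auto
  have DDt: "D * (D * (D * t)) \<le> D * (D * (D * (114/100)))" by (rule D_mult_le[OF D_mult_le[OF Dt]])
  have DDt2: "D * (D * t) \<le> D * (D * (114/100))" by (rule D_mult_le[OF Dt])
  have D3: "D * D * D < (6/100) * (D * D)" "0 < D * D" "0 < D * D * D" using D_less D_pos by auto
  have not_triple: "\<not> (\<sigma> * e (j+2) = 1 \<and> \<sigma> * e (j+1) = 1 \<and> \<sigma> * e j = 1)"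
  proof
    assume a: "\<sigma> * e (j+2) = 1 \<and> \<sigma> * e (j+1) = 1 \<and> \<sigma> * e j = 1"
    then have "e j = e (j+1)" using \<sigma> by auto
    from no_triple[OF j(2) this] show False using a \<sigma> by auto
  qed
  consider "\<sigma> * e (j+2) = - 1" | "\<sigma> * e (j+2) = 1" "\<sigma> * e (j+1) = - 1" "\<sigma> * e j = 1 \<or> \<sigma> * e j = - 1"
    | "\<sigma> * e (j+2) = 1" "\<sigma> * e (j+1) = 1" "\<sigma> * e j = - 1" using s3 not_triple by auto
  then have "\<sigma> * L (Suc i) \<le> 1 + D - D * D + 2 * (D * D * D)"
  proof cases
    case 1
    have "of_int (\<sigma> * e (j+1)) + D * (of_int (\<sigma> * e j) + D * t) \<le> 1 + D * (1 + D * (114/100))"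
    proof -
      have "\<sigma> * e (j+1) \<le> 1" "\<sigma> * e j \<le> 1" using s3 by auto
      then have "real_of_int (\<sigma> * e (j+1)) \<le> 1" "real_of_int (\<sigma> * e j) \<le> 1" by (simp_all only: of_int_le_1_iff)
      from add_mono[OF this(1) D_mult_le[OF add_mono[OF this(2) Dt]]] show ?thesis .
    qed
    then have "D * (of_int (\<sigma> * e (j+1)) + D * (of_int (\<sigma> * e j) + D * t)) \<le> D * (1 + D * (1 + D * (114/100)))"
      by (rule D_mult_le)
    moreover have "D * (1 + D * (1 + D * (114/100))) = D + D * D + 114/100 * (D * D * D)" by (simp add: algebra_simps)
    moreover have "\<sigma> * L (Suc i) = - 1 + D * (of_int (\<sigma> * e (j+1)) + D * (of_int (\<sigma> * e j) + D * t))"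
      unfolding ex 1 t_def by simp
    moreover have "u \<le> 1 + D - D * D + 2 * (D * D * D)"
      if "v \<le> z" "z = D + D * D + 114/100 * (D * D * D)" "u = - 1 + v" for u v z
      using that D3 D_less DD_less by linarith
    ultimately show ?thesis by blast
  next
    case 2
    have "\<sigma> * e j \<le> 1" using 2 by auto
    then have "of_int (\<sigma> * e j) + D * t \<le> 1 + D * (114/100)" using Dt by (simp only: of_int_le_1_iff add_mono)
    then have "D * (D * (of_int (\<sigma> * e j) + D * t)) \<le> D * (D * (1 + D * (114/100)))" by (intro D_mult_le)
    moreover have "D * (D * (1 + D * (114/100))) = D * D + 114/100 * (D * D * D)" by (simp add: algebra_simps)
    moreover have "\<sigma> * L (Suc i) = 1 - D + D * (D * (of_int (\<sigma> * e j) + D * t))"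
      unfolding ex 2(1,2) t_def by (simp add: algebra_simps)
    moreover have "u \<le> 1 + D - D * D + 2 * (D * D * D)"
      if "v \<le> z" "z = D * D + 114/100 * (D * D * D)" "u = 1 - D + v" for u v z
      using that D3 D_pos D_less DD_less by linarith
    ultimately show ?thesis by blast
  next
    case 3
    then show ?thesis unfolding ex 3 t_def[symmetric] using DDt D3 by (simp add: algebra_simps)
  qed
  then show ?thesis using w_bounds(4) by simp
qed

text \<open>At the cut inside the double, the tail towards the single sign plays the role of
  \<open>LI\<close>. Any other continuation makes it too small by at least
  \<open>17/10 * D^4\<close>, while the opposite tail exceeds \<open>RI\<close> by at most
  \<open>3 * D^4\<close>; since \<open>12/5 * (17/10) > 3\<close>, \<open>left_deficit\<close>
  applies.\<close>

lemma bad_right: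
  assumes i: "i \<ge> K + 4" and d: "e i = e (i + 1)" and b: "e (i + 3) = e i"
  shows "e (i + 2) = - e i" "e (i + 4) = - e i" "e (i + 5) = - e i"
proof -
  show e2: "e (i + 2) = - e i" using no_triple[of i] i d by simp
  define \<sigma> where "\<sigma> = - e i"
  have \<sigma>: "\<sigma> = 1 \<or> \<sigma> = - 1" using e_pm[of i] i by (auto simp: \<sigma>_def)
  have se: "\<sigma> * e i = - 1" "\<sigma> * e (i+1) = - 1" "\<sigma> * e (i+2) = 1" "\<sigma> * e (i+3) = - 1"
    using e_pm[of i] i d b e2 by (auto simp: \<sigma>_def)
  let ?n = "i + 1"
  obtain j where j: "i = Suc j" "j \<ge> K + 2" using i by (cases i) auto
  have l: "\<sigma> * L ?n = - 1 + D * (\<sigma> * L i)" using sL_rec[of i \<sigma>] i se by (simp del: of_int_mult)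
  have "\<sigma> * L i \<le> w + 3 * (D * D * D)" using left_tail_le[of j \<sigma>] j \<sigma> by simp
  then have "D * (\<sigma> * L i) \<le> D * (w + 3 * (D * D * D))" by (rule D_mult_le)
  then have L3: "\<sigma> * L ?n \<le> RI + 3 * (D * D * D * D)" unfolding l RI_def by (simp add: algebra_simps)
  have r: "\<sigma> * R ?n = - 1 + D * (1 + D * (- 1 + D * (\<sigma> * R (i+4))))"
    using sR_rec[of "i+1" \<sigma>] sR_rec[of "i+2" \<sigma>] sR_rec[of "i+3" \<sigma>] i se by (simp add: eval_nat_numeral del: of_int_mult)
  have bd: "\<bar>\<sigma> * L ?n\<bar> \<le> 12/10" using sL_bound(1)[of ?n \<sigma>] i \<sigma> by simp
  have D4: "0 < D * D * D" "D * D * D * D < (6/100) * (D * D * D)" "D * D * D * D > 0" using D_pos D_less by auto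
  have s4: "\<sigma> * e (i+4) = 1"
  proof (rule ccontr)
    assume "\<sigma> * e (i+4) \<noteq> 1"
    then have "\<sigma> * e (i+4) = - 1" using sign_cases[of "i+4" \<sigma>] \<sigma> i by auto
    then have "\<sigma> * R (i+4) = - 1 + D * (\<sigma> * R (i+5))" using sR_rec[of "i+4" \<sigma>] i by (simp add: eval_nat_numeral del: of_int_mult)
    also have "\<dots> \<le> - 1 + D * (114/100)" using sL_bound(2)[of "i+5" \<sigma>] \<sigma> i by (intro add_left_mono D_mult_le) auto
    also have "\<dots> \<le> w - 19/10" using w_bounds D_less by simp
    finally have "D * (D * (D * (\<sigma> * R (i+4)))) \<le> D * (D * (D * (w - 19/10)))" by (intro D_mult_le)
    then have "\<sigma> * R ?n \<le> LI - 19/10 * (D * D * D)" unfolding r LI_def by (simp add: algebra_simps)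
    moreover have "\<sigma> * L ?n \<le> RI + 12/5 * (19/10 * (D * D * D))" using L3 D4 by linarith
    ultimately have "h (\<sigma> * R ?n) (\<sigma> * L ?n) \<le> delta_inf a b" using D4 bd by (intro left_deficit[of _ "19/10 * (D * D * D)"]) auto
    then show False using cut(2)[of ?n \<sigma>] i \<sigma> by simp
  qed
  have s5: "\<sigma> * e (i+5) = 1"
  proof (rule ccontr)
    assume "\<sigma> * e (i+5) \<noteq> 1"
    then have "\<sigma> * e (i+5) = - 1" using sign_cases[of "i+5" \<sigma>] \<sigma> i by auto
    then have "\<sigma> * R (i+4) = 1 + D * (- 1 + D * (\<sigma> * R (i+6)))"
      using sR_rec[of "i+4" \<sigma>] sR_rec[of "i+5" \<sigma>] s4 i by (simp add: eval_nat_numeral del: of_int_mult)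
    also have "\<dots> \<le> 1 + D * (- 1 + D * (114/100))"
      using sL_bound(2)[of "i+6" \<sigma>] \<sigma> i by (intro add_left_mono D_mult_le) auto
    also have "\<dots> \<le> w - 17/10 * D"
    proof -
      have "D * D * D \<le> (6/100) * (D * D)" using D_less D_pos by simp
      moreover have eq: "1 + D * (- 1 + D * (114/100)) = 1 - D + 114/100 * (D * D)" by (simp add: algebra_simps)
      ultimately show ?thesis using w_bounds(4) DD_less D_pos unfolding eq by linarith
    qed
    finally have "D * (D * (D * (\<sigma> * R (i+4)))) \<le> D * (D * (D * (w - 17/10 * D)))" by (intro D_mult_le)
    then have "\<sigma> * R ?n \<le> LI - 17/10 * (D * D * D * D)" unfolding r LI_def by (simp add: algebra_simps)
    moreover have "\<sigma> * L ?n \<le> RI + 12/5 * (17/10 * (D * D * D * D))" using L3 D4 by linarith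
    ultimately have "h (\<sigma> * R ?n) (\<sigma> * L ?n) \<le> delta_inf a b" using D4 bd by (intro left_deficit[of _ "17/10 * (D * D * D * D)"]) auto
    then show False using cut(2)[of ?n \<sigma>] i \<sigma> by simp
  qed
  show "e (i + 4) = - e i" "e (i + 5) = - e i" using s4 s5 \<sigma> by (auto simp: \<sigma>_def)
qed

end

context params begin

text \<open>A tail that runs into a defect begins \<open>+-++\<close> instead of
  \<open>++--\<close>; it falls short of \<open>w\<close> by \<open>2 * D\<close> up to terms of
  order \<open>D * D\<close>.\<close>

lemma defect_tail_bounds:
  assumes x: "\<bar>x\<bar> \<le> 114/100"
  shows "18/10 * D \<le> w - (1 - D + D * D + D * D * D + D * D * D * D * x)"
    "w - (1 - D + D * D + D * D * D + D * D * D * D * x) \<le> 2 * D"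
proof -
  have D3: "D * D * D > 0" "D * D * D < (6/100) * (D * D)" "D * D > 0" using D_pos D_less by auto
  have "\<bar>D * D * D * D * x\<bar> \<le> (D * D * D * D) * (114/100)"
    unfolding abs_mult using x D_pos by (simp add: mult_left_mono)
  also have "\<dots> \<le> D * D * D * (6/100) * (114/100)" using D_less D_pos by (intro mult_right_mono mult_left_mono) auto
  finally have 1: "\<bar>D * D * D * D * x\<bar> \<le> (1/10) * (D * D * D)" using D3 by linarith
  have "D * D * w > D * D * 1" using w_bounds D3 by (intro mult_strict_left_mono) auto
  then have w2: "w < 1 + D - D * D" using w_eq by simp
  show "18/10 * D \<le> w - (1 - D + D * D + D * D * D + D * D * D * D * x)"
    using 1 D3 DD_less D_pos w_bounds(4) by linarith
  show "w - (1 - D + D * D + D * D * D + D * D * D * D * x) \<le> 2 * D"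
    using 1 D3 w2 by linarith
qed

text \<open>\<open>r\<close> and \<open>p\<close> are the deviations of the tails on the two sides
  of a defect. Each inequality says that one of them, times \<open>D^4\<close>, is dominated by the
  other; since \<open>T\<close> and \<open>T'\<close> are nearly equal, only equal odd exponents
  survive.\<close>

lemma gap_balance:
  assumes T: "18/10 * D \<le> T" "T \<le> 2 * D" and T': "18/10 * D \<le> T'" "T' \<le> 2 * D"
    and r: "r = - ((- (D * D)) ^ i * T)" and p: "p = - ((- (D * D)) ^ j * T')"
    and A: "66/100 \<le> A1" "A1 \<le> 1" "57/100 \<le> A2" "A2 \<le> 1" "66/100 \<le> A1'" "A1' \<le> 1"
    and rp: "D * D * D * D * p * A1 < \<eta> * r * A2" and pr: "D * D * D * D * r * A1' < \<eta> * p * A2"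
  shows "i = j \<and> odd i"
proof -
  have TT: "T > 0" "T' > 0" using T T' D_pos by linarith+
  define \<kappa> where "\<kappa> = D * D * D * D"
  have \<kappa>: "\<kappa> > 0" "\<kappa> \<le> \<eta> / 100"
  proof -
    show "\<kappa> > 0" using D_pos by (simp add: \<kappa>_def)
    have "D * D * D * D = \<eta> * (\<beta> * (D * D * D))" by (simp add: D_eq ac_simps)
    also have "\<beta> * (D * D * D) \<le> 1 * (D * D * D)" using beta_less D_pos by (intro mult_right_mono) auto
    also have "D * D * D \<le> (6/100) * (D * D)" using D_less D_pos by simp
    finally have "D * D * D * D \<le> \<eta> * ((6/100) * (D * D))" using eta_pos by simp
    moreover have "D * D \<le> 6/100" using DD_less D_less by linarith
    then have "\<eta> * ((6/100) * (D * D)) \<le> \<eta> * (1/100)" using eta_pos by (intro mult_left_mono) auto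
    ultimately show "\<kappa> \<le> \<eta> / 100" unfolding \<kappa>_def by linarith
  qed
  have rp: "\<kappa> * p * A1 < \<eta> * r * A2" and pr: "\<kappa> * r * A1' < \<eta> * p * A2" using rp pr by (simp_all add: \<kappa>_def)
  \<comment> \<open>If one deviation were negative, the other would be too, and each would be at
    most a small fraction of the other in size.\<close>
  have pos: "u > 0" if uv: "\<kappa> * v * B < \<eta> * u * A2" and vu: "\<kappa> * u * B' < \<eta> * v * A2" and u0: "u \<noteq> 0"
    and B: "66/100 \<le> B" "B \<le> 1" "66/100 \<le> B'" "B' \<le> 1" for u v B B'
  proof (rule ccontr)
    assume "\<not> u > 0"
    then have u: "u < 0" using u0 by simp
    then have "\<eta> * u * A2 < 0" using eta_pos A by (simp add: mult_pos_neg mult_neg_pos)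
    then have "\<kappa> * v * B < 0" using uv by linarith
    then have v: "v < 0" using \<kappa> B by (simp add: mult_less_0_iff zero_less_mult_iff)
    have key: "x * (57/100) \<le> y / 100" if "\<kappa> * - y * C < \<eta> * - x * A2" "x > 0" "y > 0" "66/100 \<le> C" "C \<le> 1" for x y C
    proof -
      have "\<eta> * x * (57/100) \<le> \<eta> * x * A2" using that eta_pos A by (intro mult_left_mono) auto
      also have "\<dots> < \<kappa> * y * C" using that(1) by simp
      also have "\<dots> \<le> \<kappa> * y * 1" using that \<kappa> by (intro mult_left_mono) auto
      also have "\<dots> \<le> \<eta> / 100 * y * 1" using that \<kappa> by (intro mult_right_mono) auto
      finally have "\<eta> * (x * (57/100)) \<le> \<eta> * (y / 100)" by simp
      then show ?thesis using eta_pos by simp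
    qed
    have "- u * (57/100) \<le> - v / 100" "- v * (57/100) \<le> - u / 100"
      using key[of "- v" B "- u"] key[of "- u" B' "- v"] uv vu u v B by auto
    then show False using u v by linarith
  qed
  have nz: "r \<noteq> 0" "p \<noteq> 0" using r p TT D_pos by auto
  have r0: "r > 0" by (rule pos[OF rp pr nz(1) A(1,2,5,6)])
  have p0: "p > 0" by (rule pos[OF pr rp nz(2) A(5,6,1,2)])
  have odd: "odd l" if "- ((- (D * D)) ^ l * t) > 0" "t > 0" for l t
  proof
    assume "even l"
    then have "(- (D * D)) ^ l > 0" using D_pos by (intro zero_less_power_eq[THEN iffD2]) auto
    then show False using that by (simp add: zero_less_mult_iff not_less_iff_gr_or_eq mult_less_0_iff)
  qed
  have oi: "odd i" using odd[of i T] r0 r TT by simp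
  have oj: "odd j" using odd[of j T'] p0 p TT by simp
  have r': "r = (D * D) ^ i * T" and p': "p = (D * D) ^ j * T'" using r p oi oj by simp_all
  \<comment> \<open>Odd exponents with \<open>l < l'\<close> differ by at least 2, which produces
    the factor \<open>\<kappa>\<close> on the right as well. After cancelling it,
    \<open>18/10 * (66/100)\<close> would have to be smaller than
    \<open>2 * (265/1000)\<close>.\<close>
  have nl: "\<not> l < l'" if uv: "\<kappa> * ((D * D) ^ l * t) * B < \<eta> * ((D * D) ^ l' * t') * A2"
    and "odd l" "odd l'" and t: "18/10 * D \<le> t" "t' \<le> 2 * D" "t' > 0" and B: "66/100 \<le> B" for l l' t t' B
  proof
    assume "l < l'"
    then have ll: "l + 2 \<le> l'" using \<open>odd l\<close> \<open>odd l'\<close> by presburger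
    define q where "q = (D * D) ^ l"
    have q: "q > 0" using D_pos by (simp add: q_def)
    have "D * D \<le> 1" using DD_less D_less by linarith
    then have "(D * D) ^ l' \<le> (D * D) ^ (l + 2)" using ll D_pos by (intro power_decreasing) auto
    also have "\<dots> = q * \<kappa>" by (simp add: q_def \<kappa>_def power_add power2_eq_square)
    finally have "(D * D) ^ l' * t' \<le> q * \<kappa> * (2 * D)" using t q \<kappa> by (intro mult_mono) auto
    then have "\<eta> * ((D * D) ^ l' * t') \<le> \<eta> * (q * \<kappa> * (2 * D))" using eta_pos by (intro mult_left_mono) auto
    then have "\<eta> * ((D * D) ^ l' * t') * A2 \<le> \<eta> * (q * \<kappa> * (2 * D)) * 1"
      using A q \<kappa> eta_pos D_pos by (rule_tac mult_mono) auto
    also have "\<dots> \<le> (265/1000) * (q * \<kappa> * (2 * D)) * 1" using eta_less q \<kappa> D_pos by (intro mult_right_mono) auto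
    finally have 1: "\<eta> * ((D * D) ^ l' * t') * A2 \<le> (53/100) * (q * \<kappa> * D)" by (simp add: ac_simps)
    have "\<kappa> * (q * (18/10 * D)) * (66/100) \<le> \<kappa> * (q * t) * B"
      using t q \<kappa> B D_pos by (intro mult_mono mult_left_mono) auto
    then have "(53/100) * (q * \<kappa> * D) < \<kappa> * ((D * D) ^ l * t) * B"
    proof -
      assume a: "\<kappa> * (q * (18/10 * D)) * (66/100) \<le> \<kappa> * (q * t) * B"
      have "q * \<kappa> * D > 0" using q \<kappa> D_pos by simp
      moreover have "\<kappa> * (q * (18/10 * D)) * (66/100) = (1188/1000) * (q * \<kappa> * D)" by simp
      ultimately show ?thesis using a unfolding q_def by linarith
    qed
    then show False using uv 1 by simp
  qed
  have "\<not> j < i" using nl[of j T' A1 i T] rp oi oj T T' TT A unfolding r' p' by simp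
  moreover have "\<not> i < j" using nl[of i T A1' j T'] pr oi oj T T' TT A unfolding r' p' by simp
  ultimately show ?thesis using oi by simp
qed

end

lemma mod_4_less: "(2 * t) mod 4 < 2 \<longleftrightarrow> even t" "(2 * t + 1) mod 4 < 2 \<longleftrightarrow> even t" for t :: nat
  by presburger+

section \<open>Defects and the gaps between them\<close>

context sign_sequence begin

definition dbl :: "nat \<Rightarrow> bool" where "dbl i \<longleftrightarrow> e i = e (i + 1)"
text \<open>By \<open>no_triple\<close> the sign after the double is single; by
  \<open>bad_right\<close> exactly one more single sign follows before the next double. This is a
  defect in the pattern \<open>++--\<close>.\<close>

definition bad :: "nat \<Rightarrow> bool" where "bad i \<longleftrightarrow> dbl i \<and> e (i + 3) = e i"

lemma e_sq: "i \<ge> K \<Longrightarrow> e i * e i = 1"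
  using e_pm[of i] by auto

lemma bad_digits:
  assumes "i \<ge> K + 4" and "bad i"
  shows "e (i + 1) = e i" "e (i + 2) = - e i" "e (i + 3) = e i" "e (i + 4) = - e i" "e (i + 5) = - e i"
  using bad_right[of i] assms unfolding bad_def dbl_def by auto

lemma good_step:
  assumes "i \<ge> K + 4" and "dbl i" and "\<not> bad i"
  shows "dbl (i + 2)" "e (i + 2) = - e i"
proof -
  show 1: "e (i + 2) = - e i" using no_triple[of i] assms by (simp add: dbl_def)
  have "e (i + 3) \<noteq> e i" using assms by (simp add: bad_def)
  then have "e (i + 3) = - e i" using e_pm[of i] e_pm[of "i+3"] assms by auto
  then show "dbl (i + 2)" using 1 by (simp add: dbl_def eval_nat_numeral)
qed

lemma good_run:
  assumes i: "i \<ge> K + 4" and d: "dbl i" and g: "\<And>u. u < t \<Longrightarrow> \<not> bad (i + 2 * u)"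
  shows "dbl (i + 2 * t) \<and> e (i + 2 * t) = e i * (- 1) ^ t"
  using g
proof (induction t)
  case (Suc t)
  then have IH: "dbl (i + 2 * t)" "e (i + 2 * t) = e i * (- 1) ^ t" by auto
  show ?case using good_step[of "i + 2 * t"] IH Suc.prems[of t] i by auto
qed (use d in simp)

text \<open>The two single signs of the defect sit at \<open>d + 2\<close> and \<open>d + 3\<close>.
  Then \<open>m\<close> double blocks follow, the last of which, at \<open>d + 2 + 2 * m\<close>,
  starts the next defect; consecutive defects are therefore \<open>2 + 2 * m\<close> apart.\<close>

definition gap :: "nat \<Rightarrow> nat \<Rightarrow> bool" where
  "gap d m \<longleftrightarrow> bad d \<and> m \<ge> 1 \<and>
     (\<forall>t<m. e (d + 4 + 2 * t) = - e d * (- 1) ^ t \<and> e (d + 5 + 2 * t) = - e d * (- 1) ^ t) \<and>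
     bad (d + 2 + 2 * m)"

lemma first_bad:
  assumes i: "i \<ge> K + 4" and d: "dbl i" and ex: "\<exists>t. bad (i + 2 * t)"
  obtains t where "bad (i + 2 * t)"
    "\<And>u. u \<le> t \<Longrightarrow> e (i + 2 * u) = e i * (- 1) ^ u \<and> e (i + 2 * u + 1) = e i * (- 1) ^ u"
proof -
  define t where "t = (LEAST t. bad (i + 2 * t))"
  have b: "bad (i + 2 * t)" using LeastI_ex[OF ex] by (simp add: t_def)
  have "\<not> bad (i + 2 * u)" if "u < t" for u using not_less_Least[of u "\<lambda>t. bad (i + 2 * t)"] that by (simp add: t_def)
  then have "dbl (i + 2 * u) \<and> e (i + 2 * u) = e i * (- 1) ^ u" if "u \<le> t" for u
    using good_run[OF i d, of u] that by auto
  then show ?thesis using that[OF b] unfolding dbl_def by metis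
qed

lemma gap_exists:
  assumes d: "d \<ge> K + 4" and b: "bad d" and ex: "\<exists>t. bad (d + 4 + 2 * t)"
  shows "\<exists>m. gap d m"
proof -
  note bd = bad_digits[OF d b]
  have "d + 4 + 1 = d + 5" by simp
  then have db: "dbl (d + 4)" using bd unfolding dbl_def by metis
  obtain t where t: "bad (d + 4 + 2 * t)"
    and dig: "\<And>u. u \<le> t \<Longrightarrow> e (d + 4 + 2 * u) = e (d + 4) * (- 1) ^ u \<and> e (d + 4 + 2 * u + 1) = e (d + 4) * (- 1) ^ u"
    by (rule first_bad[OF _ db ex]) (use d in auto)
  have "gap d (Suc t)" unfolding gap_def
  proof (intro conjI allI impI)
    fix u assume "u < Suc t"
    moreover have "d + 4 + 2 * u + 1 = d + 5 + 2 * u" by simp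
    ultimately show "e (d + 4 + 2 * u) = - e d * (- 1) ^ u" "e (d + 5 + 2 * u) = - e d * (- 1) ^ u"
      using dig[of u] bd(4) by (metis less_Suc_eq_le)+
  next
    have "d + 2 + 2 * Suc t = d + 4 + 2 * t" by simp
    then show "bad (d + 2 + 2 * Suc t)" using t by metis
  qed (use b in auto)
  then show ?thesis ..
qed

text \<open>\<open>w = 1 + D - D * D * w\<close> says that \<open>w\<close> is the fixed point of
  passing a double block and changing sign, so the deviation from \<open>w\<close> picks up the
  multiplier of that map.\<close>

lemma forward_deviation:
  fixes \<tau> :: int
  assumes i: "i \<ge> K" and \<tau>: "\<tau> * e i = 1" "\<tau> * e (i + 1) = 1"
  shows "\<tau> * R i - w = - (D * D) * ((- \<tau>) * R (i + 2) - w)"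
proof -
  have "\<tau> * R i = 1 + D * (1 + D * (\<tau> * R (i + 2)))"
    using sR_rec[of i \<tau>] sR_rec[of "i+1" \<tau>] i \<tau> by (simp add: numeral_2_eq_2 del: of_int_mult)
  then have "\<tau> * R i - w = 1 + D * (1 + D * (\<tau> * R (i + 2))) - (1 + D - D * D * w)" using w_eq by linarith
  then show ?thesis by (simp add: algebra_simps)
qed

lemma backward_deviation:
  fixes \<tau> :: int
  assumes i: "i \<ge> K" and \<tau>: "\<tau> * e i = 1" "\<tau> * e (i + 1) = 1"
  shows "\<tau> * L (i + 2) - w = - (D * D) * ((- \<tau>) * L i - w)"
proof -
  have "\<tau> * L (i + 2) = 1 + D * (1 + D * (\<tau> * L i))"
    using sL_rec[of i \<tau>] sL_rec[of "i+1" \<tau>] i \<tau> by (simp add: numeral_2_eq_2 del: of_int_mult)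
  then have "\<tau> * L (i + 2) - w = 1 + D * (1 + D * (\<tau> * L i)) - (1 + D - D * D * w)" using w_eq by linarith
  then show ?thesis by (simp add: algebra_simps)
qed

text \<open>From \<open>d + 6\<close>, behind the first block of the gap, \<open>m - 1\<close>
  blocks are passed, each contributing \<open>- (D * D)\<close>. What remains is a tail running into
  the next defect, which \<open>defect_tail_bounds\<close> compares with \<open>w\<close>.
  \<open>backward_gap\<close> is the same towards the left.\<close>

lemma forward_gap:
  assumes d: "d \<ge> K + 4" and g: "gap d m"
  shows "\<exists>T. 18/10 * D \<le> T \<and> T \<le> 2 * D \<and> e d * R (d + 6) - w = - ((- (D * D)) ^ (m - 1) * T)"
proof -
  have m: "m \<ge> 1" using g by (simp add: gap_def)
  have dig: "e (d + 4 + 2 * t) = - e d * (- 1) ^ t" "e (d + 5 + 2 * t) = - e d * (- 1) ^ t" if "t < m" for t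
    using g that by (auto simp: gap_def)
  have sq: "e d * e d = 1" using e_sq d by simp
  have chain: "e d * R (d + 6) - w = (- (D * D)) ^ t * (of_int (e d * (- 1) ^ t) * R (d + 6 + 2 * t) - w)" if "t < m" for t
    using that
  proof (induction t)
    case (Suc t)
    have p1: "(- 1 :: int) ^ t * (- 1) ^ t = 1" by (simp flip: power_mult_distrib)
    have "e (d + 6 + 2 * t) = e d * (- 1) ^ t" "e (d + 6 + 2 * t + 1) = e d * (- 1) ^ t"
    proof -
      have "d + 4 + 2 * Suc t = d + 6 + 2 * t" "d + 5 + 2 * Suc t = d + 6 + 2 * t + 1" by simp_all
      moreover have "- e d * (- 1) ^ Suc t = e d * (- 1) ^ t" by simp
      ultimately show "e (d + 6 + 2 * t) = e d * (- 1) ^ t" "e (d + 6 + 2 * t + 1) = e d * (- 1) ^ t"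
        using dig[OF Suc.prems] by metis+
    qed
    then have "e d * (- 1) ^ t * e (d + 6 + 2 * t) = 1" "e d * (- 1) ^ t * e (d + 6 + 2 * t + 1) = 1"
      using sq p1 by (simp_all add: algebra_simps)
    from forward_deviation[OF _ this] d
    have "of_int (e d * (- 1) ^ t) * R (d + 6 + 2 * t) - w
        = - (D * D) * (of_int (- (e d * (- 1) ^ t)) * R (d + 6 + 2 * t + 2) - w)" by simp
    then show ?case using Suc by (simp add: eval_nat_numeral)
  qed simp
  let ?d = "d + 2 + 2 * m"
  have b: "bad ?d" using g by (simp add: gap_def)
  have ed: "e ?d = - e d * (- 1) ^ (m - 1)"
  proof -
    have "d + 4 + 2 * (m - 1) = ?d" "m - 1 < m" using m by auto
    then show ?thesis using dig(1)[of "m - 1"] by metis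
  qed
  note bd = bad_digits[OF _ b]
  have dK: "?d \<ge> K + 4" using d by simp
  define \<tau> where "\<tau> = - e ?d"
  have se: "\<tau> * e (?d + 2) = 1" "\<tau> * e (?d + 3) = - 1" "\<tau> * e (?d + 4) = 1" "\<tau> * e (?d + 5) = 1"
    using bd[OF dK] e_sq[of ?d] dK by (auto simp: \<tau>_def)
  have \<tau>1: "\<tau> = 1 \<or> \<tau> = - 1" using e_pm[of ?d] dK by (auto simp: \<tau>_def)
  define x where "x = \<tau> * R (?d + 6)"
  have x: "\<bar>x\<bar> \<le> 114/100" using sL_bound(2)[of "?d + 6" \<tau>] \<tau>1 dK by (simp add: x_def)
  have "\<tau> * R (?d + 2) = 1 + D * (- 1 + D * (1 + D * (1 + D * x)))"
    using sR_rec[of "?d+2" \<tau>] sR_rec[of "?d+3" \<tau>] sR_rec[of "?d+4" \<tau>] sR_rec[of "?d+5" \<tau>] se dK unfolding x_def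
    by (simp add: eval_nat_numeral del: of_int_mult)
  then have R2: "\<tau> * R (?d + 2) - w = - (w - (1 - D + D * D + D * D * D + D * D * D * D * x))"
    by (simp add: algebra_simps)
  have m1: "m - 1 < m" and ix: "d + 6 + 2 * (m - 1) = ?d + 2" using m by auto
  have \<tau>e: "e d * (- 1) ^ (m - 1) = \<tau>" unfolding \<tau>_def ed by simp
  from chain[OF m1] have "e d * R (d + 6) - w = (- (D * D)) ^ (m - 1) * (\<tau> * R (?d + 2) - w)"
    by (simp only: \<tau>e ix)
  then have "e d * R (d + 6) - w = - ((- (D * D)) ^ (m - 1) * (w - (1 - D + D * D + D * D * D + D * D * D * D * x)))"
    unfolding R2 by (simp only: mult_minus_right)
  then show ?thesis using defect_tail_bounds[OF x] by blast
qed

lemma backward_gap: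
  assumes d: "d \<ge> K + 4" and g: "gap d m"
  shows "\<exists>T. 18/10 * D \<le> T \<and> T \<le> 2 * D \<and>
    - e (d + 2 + 2 * m) * L (d + 2 + 2 * m) - w = - ((- (D * D)) ^ (m - 1) * T)"
proof -
  have m: "m \<ge> 1" using g by (simp add: gap_def)
  have dig: "e (d + 4 + 2 * t) = - e d * (- 1) ^ t" "e (d + 5 + 2 * t) = - e d * (- 1) ^ t" if "t < m" for t
    using g that by (auto simp: gap_def)
  have sq: "e d * e d = 1" using e_sq d by simp
  have chain: "of_int (e d * (- 1) ^ t) * L (d + 4 + 2 * t) - w = (- (D * D)) ^ t * (e d * L (d + 4) - w)" if "t < m" for t
    using that
  proof (induction t)
    case (Suc t)
    have p1: "(- 1 :: int) ^ t * (- 1) ^ t = 1" by (simp flip: power_mult_distrib)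
    have "e (d + 4 + 2 * t) = - e d * (- 1) ^ t" "e (d + 4 + 2 * t + 1) = - e d * (- 1) ^ t"
    proof -
      have "d + 5 + 2 * t = d + 4 + 2 * t + 1" by simp
      then show "e (d + 4 + 2 * t) = - e d * (- 1) ^ t" "e (d + 4 + 2 * t + 1) = - e d * (- 1) ^ t"
        using dig[of t] Suc_lessD[OF Suc.prems] by metis+
    qed
    then have "- e d * (- 1) ^ t * e (d + 4 + 2 * t) = 1" "- e d * (- 1) ^ t * e (d + 4 + 2 * t + 1) = 1"
      using sq p1 by (simp_all add: algebra_simps)
    from backward_deviation[OF _ this] d
    have "of_int (- e d * (- 1) ^ t) * L (d + 4 + 2 * t + 2) - w
        = - (D * D) * (of_int (e d * (- 1) ^ t) * L (d + 4 + 2 * t) - w)" by simp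
    then show ?case using Suc by (simp add: eval_nat_numeral)
  qed simp
  let ?d = "d + 2 + 2 * m"
  have b: "bad d" using g by (simp add: gap_def)
  have ed: "e ?d = - e d * (- 1) ^ (m - 1)"
  proof -
    have "d + 4 + 2 * (m - 1) = ?d" "m - 1 < m" using m by auto
    then show ?thesis using dig(1)[of "m - 1"] by metis
  qed
  note bd = bad_digits[OF d b]
  define \<tau> where "\<tau> = e d"
  have se: "\<tau> * e d = 1" "\<tau> * e (d + 1) = 1" "\<tau> * e (d + 2) = - 1" "\<tau> * e (d + 3) = 1"
    using bd sq by (auto simp: \<tau>_def)
  have \<tau>1: "\<tau> = 1 \<or> \<tau> = - 1" using e_pm[of d] d by (auto simp: \<tau>_def)
  define x where "x = \<tau> * L d"
  have x: "\<bar>x\<bar> \<le> 114/100" using sL_bound(1)[of d \<tau>] \<tau>1 d by (simp add: x_def)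
  have "\<tau> * L (d + 4) = 1 + D * (- 1 + D * (1 + D * (1 + D * x)))"
    using sL_rec[of "d+3" \<tau>] sL_rec[of "d+2" \<tau>] sL_rec[of "d+1" \<tau>] sL_rec[of d \<tau>] se d unfolding x_def
    by (simp add: eval_nat_numeral del: of_int_mult)
  then have L4: "e d * L (d + 4) - w = - (w - (1 - D + D * D + D * D * D + D * D * D * D * x))"
    by (simp add: \<tau>_def algebra_simps)
  have m1: "m - 1 < m" and ix: "d + 4 + 2 * (m - 1) = ?d" using m by auto
  have \<tau>e: "e d * (- 1) ^ (m - 1) = - e ?d" unfolding ed by simp
  from chain[OF m1] have "- e ?d * L ?d - w = (- (D * D)) ^ (m - 1) * (e d * L (d + 4) - w)"
    by (simp only: \<tau>e ix)
  then have "- e ?d * L ?d - w = - ((- (D * D)) ^ (m - 1) * (w - (1 - D + D * D + D * D * D + D * D * D * D * x)))"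
    unfolding L4 by (simp only: mult_minus_right)
  then show ?thesis using defect_tail_bounds[OF x] by blast
qed

text \<open>The cuts inside the two blocks adjacent to a defect force the deviations of the
  tails on both sides to be comparable.\<close>

lemma gaps_equal:
  assumes d: "d \<ge> K + 4" and g: "gap d m" and g': "gap (d + 2 + 2 * m) m'"
  shows "m' = m \<and> even m"
proof -
  let ?d = "d + 2 + 2 * m"
  have dK: "?d \<ge> K + 4" using d by simp
  have m: "m \<ge> 1" "m' \<ge> 1" using g g' by (auto simp: gap_def)
  obtain T where T: "18/10 * D \<le> T" "T \<le> 2 * D" "e ?d * R (?d + 6) - w = - ((- (D * D)) ^ (m' - 1) * T)"
    using forward_gap[OF dK g'] by blast
  obtain T' where T': "18/10 * D \<le> T'" "T' \<le> 2 * D" "- e ?d * L ?d - w = - ((- (D * D)) ^ (m - 1) * T')"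
    using backward_gap[OF d g] by blast
  define \<sigma> where "\<sigma> = e ?d"
  define r where "r = \<sigma> * R (?d + 6) - w"
  define p where "p = - \<sigma> * L ?d - w"
  have b: "bad ?d" using g' by (simp add: gap_def)
  note bd = bad_digits[OF dK b]
  have sq: "\<sigma> * \<sigma> = 1" using e_sq[of ?d] dK by (simp add: \<sigma>_def)
  have \<sigma>1: "\<sigma> = 1 \<or> \<sigma> = - 1" using e_pm[of ?d] dK by (auto simp: \<sigma>_def)
  have se: "\<sigma> * e ?d = 1" "\<sigma> * e (?d + 1) = 1" "\<sigma> * e (?d + 2) = - 1" "\<sigma> * e (?d + 3) = 1"
    "\<sigma> * e (?d + 4) = - 1" "\<sigma> * e (?d + 5) = - 1"
    using bd sq by (auto simp: \<sigma>_def)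
  have wD: "1 + D - w = D * D * w" using w_eq by linarith
  have R5: "\<sigma> * R (?d + 5) = - 1 + D * (w + r)"
    using sR_rec[of "?d + 5" \<sigma>] se dK unfolding r_def by (simp add: eval_nat_numeral del: of_int_mult)
  have L2: "\<sigma> * L (?d + 2) = 1 + D * (1 + D * (\<sigma> * L ?d))"
    using sL_rec[of "?d + 1" \<sigma>] sL_rec[of ?d \<sigma>] se dK by (simp add: eval_nat_numeral del: of_int_mult)
  have L5: "\<sigma> * L (?d + 5) = - 1 + D * (1 + D * (- 1 + D * (\<sigma> * L (?d + 2))))"
    using sL_rec[of "?d + 4" \<sigma>] sL_rec[of "?d + 3" \<sigma>] sL_rec[of "?d + 2" \<sigma>] se dK
    by (simp add: eval_nat_numeral del: of_int_mult)
  have sL: "\<sigma> * L ?d = - (w + p)" by (simp add: p_def)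
  have "\<sigma> * L (?d + 2) - w = - (D * D * p)" unfolding L2 sL using wD by (simp add: algebra_simps)
  then have s2: "\<sigma> * L (?d + 2) = w - D * D * p" by simp
  have L5': "\<sigma> * L (?d + 5) - LI = - (D * D * D * D * D * p)"
    unfolding L5 s2 LI_def by (simp add: algebra_simps)
  have R5': "\<sigma> * R (?d + 5) - RI = D * r" unfolding R5 RI_def by (simp add: algebra_simps)
  have bR5: "\<bar>\<sigma> * R (?d + 5)\<bar> \<le> 12/10" using sL_bound(2)[of "?d+5" \<sigma>] \<sigma>1 dK by simp
  define A1 where "A1 = 1 - \<eta> + D * (\<sigma> * R (?d + 5))"
  define A2 where "A2 = 1 - \<beta> + \<beta> * LI"
  \<comment> \<open>This cut lies inside the block after the defect: the left tail is
    \<open>LI\<close> changed by \<open>D^5 * p\<close>, the right tail is \<open>RI\<close> changed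
    by \<open>D * r\<close>.\<close>
  have cut1: "D * D * D * D * p * A1 < \<eta> * r * A2"
  proof -
    have "h (\<sigma> * L (?d + 5)) (\<sigma> * R (?d + 5)) > delta_inf a b" using cut(1)[of "?d+5" \<sigma>] \<sigma>1 dK by simp
    from h_gt_delta_infD[OF this] have "- (D * D * D * D * D * p) * A1 + \<eta> * (D * r) * A2 > 0"
      unfolding L5' R5' A1_def A2_def .
    then have "D * (\<eta> * r * A2 - D * D * D * D * p * A1) > 0" by (simp add: algebra_simps)
    then show ?thesis using D_pos by (simp add: zero_less_mult_iff)
  qed
  have "- \<sigma> * L (?d + 1) = - 1 + D * (- \<sigma> * L ?d)" using sL_rec[of ?d \<sigma>] se dK by (simp del: of_int_mult)
  then have L1': "- \<sigma> * L (?d + 1) - RI = D * p" unfolding RI_def p_def by (simp add: algebra_simps)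
  have R4: "\<sigma> * R (?d + 4) = - 1 + D * (- 1 + D * (\<sigma> * R (?d + 6)))"
    using sR_rec[of "?d + 4" \<sigma>] sR_rec[of "?d + 5" \<sigma>] se dK by (simp add: eval_nat_numeral del: of_int_mult)
  have R1: "\<sigma> * R (?d + 1) = 1 + D * (- 1 + D * (1 + D * (\<sigma> * R (?d + 4))))"
    using sR_rec[of "?d + 1" \<sigma>] sR_rec[of "?d + 2" \<sigma>] sR_rec[of "?d + 3" \<sigma>] se dK
    by (simp add: eval_nat_numeral del: of_int_mult)
  have sR: "\<sigma> * R (?d + 6) = w + r" by (simp add: r_def)
  have "- \<sigma> * R (?d + 4) - w = - (D * D * r)" using R4 wD unfolding sR by (simp add: algebra_simps)
  then have s4: "\<sigma> * R (?d + 4) = - w + D * D * r" by simp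
  have R1': "- \<sigma> * R (?d + 1) - LI = - (D * D * D * D * D * r)"
    using R1 unfolding s4 LI_def by (simp add: algebra_simps)
  have bL1: "\<bar>- \<sigma> * L (?d + 1)\<bar> \<le> 12/10" using sL_bound(1)[of "?d+1" \<sigma>] \<sigma>1 dK by simp
  define A1' where "A1' = 1 - \<eta> + D * (- \<sigma> * L (?d + 1))"
  \<comment> \<open>The mirror image, inside the block before the defect, with \<open>p\<close> and
    \<open>r\<close> exchanged.\<close>
  have cut2: "D * D * D * D * r * A1' < \<eta> * p * A2"
  proof -
    have "h (of_int (- \<sigma>) * R (?d + 1)) (of_int (- \<sigma>) * L (?d + 1)) > delta_inf a b"
      using cut(2)[of "?d+1" "- \<sigma>"] \<sigma>1 dK by auto
    from h_gt_delta_infD[OF this] have "(- \<sigma> * R (?d + 1) - LI) * A1' + \<eta> * (- \<sigma> * L (?d + 1) - RI) * A2 > 0"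
      unfolding A1'_def A2_def by simp
    then have "- (D * D * D * D * D * r) * A1' + \<eta> * (D * p) * A2 > 0" unfolding R1' L1' .
    then have "D * (\<eta> * p * A2 - D * D * D * D * r * A1') > 0" by (simp add: algebra_simps)
    then show ?thesis using D_pos by (simp add: zero_less_mult_iff)
  qed
  have "m' - 1 = m - 1 \<and> odd (m' - 1)"
  proof (rule gap_balance[OF T(1,2) T'(1,2) _ _ _ _ _ _ _ _ cut1 cut2])
    show "r = - ((- (D * D)) ^ (m' - 1) * T)" "p = - ((- (D * D)) ^ (m - 1) * T')"
      using T(3) T'(3) by (simp_all add: r_def p_def \<sigma>_def)
  qed (use factor_bounds[OF bR5] factor_bounds[OF bL1] in \<open>auto simp: A1_def A2_def A1'_def\<close>)
  then show ?thesis using m by (cases m; cases m') auto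
qed

text \<open>Eventually there are no doubles, or some double is followed by no defect, or every
  double runs into a defect. In the last case all gaps equal one even \<open>m = 2 * k\<close>, and
  the period is \<open>2 + 2 * m = 4 * k + 2\<close>.\<close>

theorem sign_patterns:
  "\<exists>N. \<exists>\<sigma>\<in>{1, - 1}. (\<exists>k. \<forall>i. e (N + i) = \<sigma> * pk k i) \<or> (\<forall>i. e (N + i) = \<sigma> * pblocks i)"
proof (cases "\<exists>i\<ge>K+4. dbl i")
  case False
  define N where "N = K + 4"
  have "e (N + i) = e N * (- 1) ^ i" for i
  proof (induction i)
    case (Suc i)
    have "N + i \<ge> K + 4" by (simp add: N_def)
    then have "e (N + i) \<noteq> e (N + i + 1)" using False unfolding dbl_def by blast
    then have "e (N + Suc i) = - e (N + i)" using e_pm[of "N+i"] e_pm[of "N+i+1"] by (auto simp: N_def)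
    then show ?case using Suc by simp
  qed simp
  moreover have "pk 0 i = - ((- 1) ^ i)" for i
  proof (cases "even i")
    case True
    then have "i mod (4 * 0 + 2) = 0" by presburger
    then show ?thesis using True unfolding pk_def Let_def by simp
  next
    case False
    then have "i mod (4 * 0 + 2) = 1" by presburger
    then show ?thesis using False unfolding pk_def Let_def by simp
  qed
  ultimately have "\<forall>i. e (N + i) = - e N * pk 0 i" by simp
  moreover have "- e N \<in> {1, - 1}" using e_pm[of N] by (auto simp: N_def)
  ultimately show ?thesis by blast
next
  case True
  then obtain i0 where i0: "i0 \<ge> K + 4" "dbl i0" by blast
  show ?thesis
  proof (cases "\<exists>d\<ge>K+4. dbl d \<and> (\<forall>t. \<not> bad (d + 2 * t))")
    case True
    then obtain d where d: "d \<ge> K + 4" "dbl d" "\<And>t. \<not> bad (d + 2 * t)" by blast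
    have run: "dbl (d + 2 * t) \<and> e (d + 2 * t) = e d * (- 1) ^ t" for t using good_run[OF d(1,2)] d(3) by blast
    have "e (d + i) = e d * pblocks i" for i
    proof (cases "even i")
      case True
      then obtain t where t: "i = 2 * t" by blast
      have "pblocks i = (- 1) ^ t" unfolding pblocks_def t using mod_4_less(1)[of t] by simp
      then show ?thesis using run[of t] t by simp
    next
      case False
      then obtain t where t: "i = 2 * t + 1" by (metis oddE)
      have "pblocks i = (- 1) ^ t" unfolding pblocks_def t using mod_4_less(2)[of t] by simp
      then show ?thesis using run[of t] t by (simp add: dbl_def)
    qed
    moreover have "e d \<in> {1, - 1}" using e_pm[of d] d by auto
    ultimately show ?thesis by blast
  next
    case False
    then have ex: "\<exists>t. bad (d + 2 * t)" if "d \<ge> K + 4" "dbl d" for d using that by blast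
    have gap_ex: "\<exists>m. gap d m" if "d \<ge> K + 4" "bad d" for d
    proof -
      have "d + 4 + 1 = d + 5" by simp
      then have "dbl (d + 4)" using bad_digits[OF that] unfolding dbl_def by metis
      then have "\<exists>t. bad (d + 4 + 2 * t)" using ex[of "d + 4"] that(1) by simp
      then show ?thesis by (rule gap_exists[OF that])
    qed
    obtain t where "bad (i0 + 2 * t)" using ex[OF i0] by blast
    moreover define d where "d = i0 + 2 * t"
    ultimately have d: "d \<ge> K + 4" "bad d" using i0 by simp_all
    obtain m where g: "gap d m" using gap_ex[OF d] by blast
    have next_gap: "gap (d' + 2 + 2 * m) m \<and> even m" if "d' \<ge> K + 4" "gap d' m" for d'
    proof -
      have "bad (d' + 2 + 2 * m)" using that by (simp add: gap_def)
      moreover have "d' + 2 + 2 * m \<ge> K + 4" using that(1) by simp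
      ultimately obtain m' where "gap (d' + 2 + 2 * m) m'" using gap_ex by blast
      then show ?thesis using gaps_equal[OF that] by blast
    qed
    have m: "even m" using next_gap[OF d(1) g] by blast
    have m1: "m \<ge> 1" using g unfolding gap_def by blast
    obtain k where k: "m = 2 * k" using m by blast
    have all: "gap (d + n * (4 * k + 2)) m \<and> e (d + n * (4 * k + 2)) = e d" for n
    proof (induction n)
      case (Suc n)
      let ?d = "d + n * (4 * k + 2)"
      have eq: "d + Suc n * (4 * k + 2) = ?d + 2 + 2 * m" by (simp add: k)
      have "m - 1 < m" using m1 by simp
      then have "e (?d + 4 + 2 * (m - 1)) = - e ?d * (- 1) ^ (m - 1)" using Suc unfolding gap_def by blast
      moreover have "?d + 4 + 2 * (m - 1) = ?d + 2 + 2 * m" using m1 by simp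
      moreover have "odd (m - 1)" using m m1 by (cases m) auto
      ultimately have "e (?d + 2 + 2 * m) = e ?d" by (metis minus_mult_minus mult.right_neutral neg_one_odd_power)
      moreover have "?d \<ge> K + 4" using d(1) by simp
      ultimately show ?case using next_gap[of ?d] Suc unfolding eq by metis
    qed (use g in simp)
    \<comment> \<open>The pattern is read from \<open>d + 2\<close>, the first single sign of the
      defect, because \<open>pk\<close> starts with its pair of single signs.\<close>
    have "e (d + 2 + i) = e d * pk k i" for i
    proof -
      define n j where "n = i div (4 * k + 2)" and "j = i mod (4 * k + 2)"
      have i: "i = n * (4 * k + 2) + j" unfolding n_def j_def by (simp only: div_mult_mod_eq)
      have j: "j < 4 * k + 2" unfolding j_def by (rule mod_less_divisor) simp
      let ?d = "d + n * (4 * k + 2)"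
      have pos: "d + 2 + i = ?d + 2 + j" by (simp add: i)
      have G: "gap ?d m" "e ?d = e d" using all[of n] by blast+
      then have "bad ?d" unfolding gap_def by blast
      moreover have "?d \<ge> K + 4" using d(1) by simp
      ultimately have bd: "e (?d + 2) = - e d" "e (?d + 3) = e d" using bad_digits[of ?d] G(2) by metis+
      have pkj: "pk k i = (if j = 0 then - 1 else if j = 1 then 1 else if (j - 2) mod 4 < 2 then - 1 else 1)"
        by (simp add: pk_def j_def Let_def)
      consider "j = 0" | "j = 1" | "j \<ge> 2" by linarith
      then show ?thesis
      proof cases
        case 1
        then have "d + 2 + i = ?d + 2" using pos by simp
        moreover have "pk k i = - 1" using pkj 1 by simp
        ultimately show ?thesis using bd(1) by (metis mult_minus_right mult.right_neutral)
      next
        case 2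
        then have "d + 2 + i = ?d + 3" using pos by simp
        moreover have "pk k i = 1" using pkj 2 by simp
        ultimately show ?thesis using bd(2) by (metis mult.right_neutral)
      next
        case 3
        define t where "t = (j - 2) div 2"
        have t: "t < m" using j k 3 by (simp add: t_def)
        have dig: "e (?d + 4 + 2 * t) = - e d * (- 1) ^ t" "e (?d + 5 + 2 * t) = - e d * (- 1) ^ t"
          using G t unfolding gap_def by metis+
        have jj: "j = 2 + 2 * t \<or> j = 3 + 2 * t" using 3 unfolding t_def by presburger
        have "(j - 2) mod 4 < 2 \<longleftrightarrow> even t" using jj mod_4_less[of t] by auto
        then have pkt: "pk k i = - ((- 1) ^ t)" using 3 unfolding pkj by simp
        from jj show ?thesis
        proof
          assume "j = 2 + 2 * t"
          then have "d + 2 + i = ?d + 4 + 2 * t" using pos by simp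
          then show ?thesis using dig(1) pkt by (metis mult_minus_left mult_minus_right)
        next
          assume "j = 3 + 2 * t"
          then have "d + 2 + i = ?d + 5 + 2 * t" using pos by simp
          then show ?thesis using dig(2) pkt by (metis mult_minus_left mult_minus_right)
        qed
      qed
    qed
    then have "\<forall>i. e (d + 2 + i) = e d * pk k i" by blast
    moreover have "e d \<in> {1, - 1}" using e_pm[of d] d by auto
    ultimately show ?thesis by blast
  qed
qed

end

section \<open>Eventually periodic expansions\<close>

context params begin

text \<open>In each half node only one of the two arguments moves, so one factor of every product
  changes by at most \<open>\<delta>\<close> while the other is at most 3.\<close>

lemma node_perturb:
  assumes n: "node v x z s" and dx: "\<bar>x' - x\<bar> \<le> \<delta>" and \<delta>: "3 * \<delta> \<le> v - c" "0 < c" "0 \<le> \<delta>"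
  shows "node c x' z s"
proof -
  have near: "half_node c x' y'" if h: "half_node v x y" and xx: "\<bar>x' - x\<bar> \<le> \<delta>1" and yy: "\<bar>y' - y\<bar> \<le> \<delta>2"
    and d12: "\<delta>1 = 0 \<and> \<delta>2 = \<delta> \<or> \<delta>1 = \<delta> \<and> \<delta>2 = 0" for x y x' y' \<delta>1 \<delta>2
  proof -
    have xb: "\<bar>x\<bar> < 1 - \<beta>" and yb: "\<bar>y\<bar> < 1 - \<eta>" using h by (auto simp: half_node_def)
    have prod: "0 < A' \<and> 0 < B' \<and> c \<le> A' * B'" if AB: "v \<le> A * B" and A: "0 < A" "A \<le> 3" and B: "0 < B" "B \<le> 3"
      and AA: "\<bar>A' - A\<bar> \<le> \<delta>1" and BB: "\<bar>B' - B\<bar> \<le> \<delta>2" for A B A' B'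
      using d12
    proof
      assume d: "\<delta>1 = 0 \<and> \<delta>2 = \<delta>"
      then have A': "A' = A" using AA by simp
      have "A * B' \<ge> A * (B - \<delta>)" using A BB d by (intro mult_left_mono) auto
      moreover have "A * \<delta> \<le> 3 * \<delta>" using A \<delta> by (intro mult_right_mono) auto
      ultimately have "A * B' \<ge> c" using AB \<delta> by (simp add: algebra_simps)
      moreover from this have "B' > 0" using \<delta>(2) A by (smt (verit) mult_nonneg_nonpos)
      ultimately show ?thesis using A A' by simp
    next
      assume d: "\<delta>1 = \<delta> \<and> \<delta>2 = 0"
      then have B': "B' = B" using BB by simp
      have "A' * B \<ge> (A - \<delta>) * B" using B AA d by (intro mult_right_mono) auto
      moreover have "\<delta> * B \<le> \<delta> * 3" using B \<delta> by (intro mult_left_mono) auto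
      ultimately have "A' * B \<ge> c" using AB \<delta> by (simp add: algebra_simps)
      moreover from this have "A' > 0" using \<delta>(2) B by (smt (verit) mult_nonpos_nonneg)
      ultimately show ?thesis using B B' by simp
    qed
    have bd: "1 - \<beta> + x > 0" "1 - \<beta> + x \<le> 3" "1 - \<eta> + y > 0" "1 - \<eta> + y \<le> 3"
      "1 + \<beta> + x > 0" "1 + \<beta> + x \<le> 3" "1 + \<eta> - y > 0" "1 + \<eta> - y \<le> 3"
      "1 + \<beta> - x > 0" "1 + \<beta> - x \<le> 3" "1 + \<eta> + y > 0" "1 + \<eta> + y \<le> 3"
      "1 - \<beta> - x > 0" "1 - \<beta> - x \<le> 3" "1 - \<eta> - y > 0" "1 - \<eta> - y \<le> 3"
      using xb yb beta_pos eta_pos beta_less eta_less by auto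
    have P: "v \<le> (1 - \<beta> + x) * (1 - \<eta> + y)" "v \<le> (1 + \<beta> + x) * (1 + \<eta> - y)"
      "v \<le> (1 + \<beta> - x) * (1 + \<eta> + y)" "v \<le> (1 - \<beta> - x) * (1 - \<eta> - y)"
      using h by (auto simp: half_node_def p1_def p2_def p3_def p4_def)
    have "0 < 1 - \<beta> + x' \<and> 0 < 1 - \<eta> + y' \<and> c \<le> (1 - \<beta> + x') * (1 - \<eta> + y')"
      by (rule prod[OF P(1) bd(1-4)]) (use xx yy in auto)
    moreover have "0 < 1 + \<beta> + x' \<and> 0 < 1 + \<eta> - y' \<and> c \<le> (1 + \<beta> + x') * (1 + \<eta> - y')"
      by (rule prod[OF P(2) bd(5-8)]) (use xx yy in auto)
    moreover have "0 < 1 + \<beta> - x' \<and> 0 < 1 + \<eta> + y' \<and> c \<le> (1 + \<beta> - x') * (1 + \<eta> + y')"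
      by (rule prod[OF P(3) bd(9-12)]) (use xx yy in auto)
    moreover have "0 < 1 - \<beta> - x' \<and> 0 < 1 - \<eta> - y' \<and> c \<le> (1 - \<beta> - x') * (1 - \<eta> - y')"
      by (rule prod[OF P(4) bd(13-16)]) (use xx yy in auto)
    ultimately show ?thesis unfolding half_node_def p1_def p2_def p3_def p4_def by auto
  qed
  have e: "\<bar>\<eta> * (s + x') - \<eta> * (s + x)\<bar> \<le> \<delta>"
  proof -
    have "\<bar>\<eta> * (s + x') - \<eta> * (s + x)\<bar> = \<eta> * \<bar>x' - x\<bar>" using eta_pos by (simp add: abs_mult flip: right_diff_distrib)
    also have "\<dots> \<le> 1 * \<delta>" using dx eta_pos eta_less by (intro mult_mono) auto
    finally show ?thesis by simp
  qed
  show ?thesis unfolding node_def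
    using near[of x "\<eta> * (s + z)" x' \<delta> "\<eta> * (s + z)" 0] near[of z "\<eta> * (s + x)" z 0 "\<eta> * (s + x')" \<delta>] n dx e
    by (auto simp: node_def)
qed

text \<open>\<open>v\<close> is the exact value: eventually all vertex products are at least
  \<open>v\<close>, and one of them equals \<open>v\<close> infinitely often. The solution
  \<open>x\<close> is arbitrary because it forgets its start; \<open>y\<close> is bounded because
  that determines it uniquely.\<close>

definition is_pattern :: "real \<Rightarrow> (nat \<Rightarrow> int) \<Rightarrow> (nat \<Rightarrow> int) \<Rightarrow> bool" where
  "is_pattern v sP eP \<longleftrightarrow> v > 0 \<and> (\<exists>x y K C. (\<forall>i. x (Suc i) = \<beta> * (eP i + \<eta> * (sP i + x i)))
     \<and> (\<forall>i. y i = \<beta> * (eP i + \<eta> * (sP (Suc i) + y (Suc i)))) \<and> (\<forall>i. \<bar>y i\<bar> \<le> C)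
     \<and> (\<forall>i\<ge>K. node v (x i) (y i) (sP i))
     \<and> (\<exists>p\<in>{p1, p2, p3, p4}. \<exists>\<^sub>F i in sequentially. \<bar>p (x i) (\<eta> * (sP i + y i))\<bar> = v))"

lemma is_pattern_neg:
  assumes "is_pattern v sP eP" shows "is_pattern v (\<lambda>i. - sP i) (\<lambda>i. - eP i)"
proof -
  obtain x y :: "nat \<Rightarrow> real" and K :: nat and C :: real and p where v: "v > 0"
    and x: "\<And>i. x (Suc i) = \<beta> * (eP i + \<eta> * (sP i + x i))"
    and y: "\<And>i. y i = \<beta> * (eP i + \<eta> * (sP (Suc i) + y (Suc i)))"
    and C: "\<And>i. \<bar>y i\<bar> \<le> C" and n: "\<And>i. i \<ge> K \<Longrightarrow> node v (x i) (y i) (sP i)"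
    and p: "p \<in> {p1, p2, p3, p4}" and f: "\<exists>\<^sub>F i in sequentially. \<bar>p (x i) (\<eta> * (sP i + y i))\<bar> = v"
    using assms unfolding is_pattern_def by blast
  have "\<exists>p'\<in>{p1, p2, p3, p4}. \<forall>x y. p' (- x) (- y) = p x y"
    using p by (auto simp: p1_def p2_def p3_def p4_def)
  then obtain p' where p': "p' \<in> {p1, p2, p3, p4}" "\<And>x y. p' (- x) (- y) = p x y" by blast
  have eq: "\<eta> * (real_of_int (- s) + - t) = - (\<eta> * (s + t))" for s :: int and t :: real by (simp add: algebra_simps)
  show ?thesis unfolding is_pattern_def
  proof (rule conjI[OF v], rule exI[of _ "\<lambda>i. - x i"], rule exI[of _ "\<lambda>i. - y i"], rule exI[of _ K],
      rule exI[of _ C], intro conjI allI impI bexI[OF _ p'(1)])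
    fix i
    show "- x (Suc i) = \<beta> * (real_of_int (- eP i) + \<eta> * (real_of_int (- sP i) + - x i))"
      unfolding x by (simp add: algebra_simps)
    show "- y i = \<beta> * (real_of_int (- eP i) + \<eta> * (real_of_int (- sP (Suc i)) + - y (Suc i)))"
      by (subst y) (simp add: algebra_simps)
    show "K \<le> i \<Longrightarrow> node v (- x i) (- y i) (- sP i)" using n[of i] by (simp only: node_neg)
    show "\<exists>\<^sub>F i in sequentially. \<bar>p' (- x i) (\<eta> * (real_of_int (- sP i) + - y i))\<bar> = v"
      using f by (simp only: eq p'(2))
  qed (use C in simp)
qed

end

context expansion begin

lemma value_of_pattern_aux:
  assumes pat: "is_pattern v sP eP" and s: "\<And>i. s (N + i) = sP i" and E: "\<And>i. E (N + i) = eP i"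
  shows "M_star a b \<gamma> = ereal v" "\<not> (\<exists>m n :: int. \<gamma> = of_int m + of_int n * \<eta>)"
proof -
  obtain x y :: "nat \<Rightarrow> real" and K :: nat and C :: real and p where v: "v > 0"
    and x: "\<And>i. x (Suc i) = \<beta> * (eP i + \<eta> * (sP i + x i))"
    and y: "\<And>i. y i = \<beta> * (eP i + \<eta> * (sP (Suc i) + y (Suc i)))"
    and C: "\<And>i. \<bar>y i\<bar> \<le> C" and n: "\<And>i. i \<ge> K \<Longrightarrow> node v (x i) (y i) (sP i)"
    and p: "p \<in> {p1, p2, p3, p4}" and f: "\<exists>\<^sub>F i in sequentially. \<bar>p (x i) (\<eta> * (sP i + y i))\<bar> = v"
    using pat unfolding is_pattern_def by blast
  have X: "X (N + i) - x i = D ^ i * (X N - x 0)" for i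
  proof (induction i)
    case (Suc i)
    have "X (N + Suc i) - x (Suc i) = D * (X (N + i) - x i)" using s[of i] E[of i]
      by (simp add: x D_eq algebra_simps)
    then show ?case using Suc by simp
  qed simp
  have Ystep: "Y (N + i) - y i = D * (Y (N + Suc i) - y (Suc i))" for i
    using Y_rec[of "N + i"] y[of i] s[of "Suc i"] E[of i] by (simp add: D_eq algebra_simps)
  have Yj: "Y (N + i) - y i = D ^ j * (Y (N + (i + j)) - y (i + j))" for i j
  proof (induction j)
    case (Suc j) then show ?case using Ystep[of "i + j"] by simp
  qed simp
  \<comment> \<open>The recursion for \<open>Y\<close> runs backwards: two bounded solutions differ
    at \<open>i\<close> by \<open>D ^ j\<close> times a bounded quantity for every \<open>j\<close>,
    hence agree exactly, whereas \<open>X\<close> only converges to \<open>x\<close>.\<close>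
  have Y: "Y (N + i) = y i" for i
  proof -
    define C' where "C' = (2 * B + 1) / \<eta> + (2 * B + b) + C"
    have bd: "\<bar>Y (N + j) - y j\<bar> \<le> C'" for j
    proof -
      have "\<eta> * \<bar>s (N + j) + Y (N + j)\<bar> \<le> 2 * B + 1" using Y_bounded[of "N+j"] eta_pos by (simp add: abs_mult)
      then have "\<bar>s (N + j) + Y (N + j)\<bar> \<le> (2 * B + 1) / \<eta>" using eta_pos by (simp add: field_simps)
      then show ?thesis using s_bound[of "N+j"] C[of j] unfolding C'_def by linarith
    qed
    have "\<bar>Y (N + i) - y i\<bar> \<le> C' * D ^ j" for j
    proof -
      have "\<bar>Y (N + i) - y i\<bar> = D ^ j * \<bar>Y (N + (i + j)) - y (i + j)\<bar>" using Yj[of i j] D_pos by (simp add: abs_mult)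
      also have "\<dots> \<le> D ^ j * C'" using bd D_pos by (intro mult_left_mono) auto
      finally show ?thesis by (simp add: mult.commute)
    qed
    moreover have "(\<lambda>j. C' * D ^ j) \<longlonglongrightarrow> 0" using tendsto_mult_left[OF D_pow_lim, of C'] by simp
    ultimately have "\<bar>Y (N + i) - y i\<bar> \<le> 0" by (intro LIMSEQ_le_const[of _ 0]) auto
    then show ?thesis by simp
  qed
  have lim: "(\<lambda>i. X (N + i) - x i) \<longlonglongrightarrow> 0"
    using tendsto_mult_right[OF D_pow_lim, of "X N - x 0"] by (simp only: X mult_zero_left)
  have near: "\<forall>\<^sub>F i in sequentially. \<bar>X (N + i) - x i\<bar> \<le> \<epsilon>" if "\<epsilon> > 0" for \<epsilon>
    by (rule eventually_mono[OF tendstoD[OF lim that]]) (simp add: dist_real_def)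
  have nodes: "\<exists>K. \<forall>k\<ge>K. node c (X k) (Y k) (s k)" if c: "0 < c" "c < v" for c
  proof -
    have "(v - c) / 3 > 0" using c by simp
    from near[OF this] eventually_ge_at_top[of K]
    have "\<forall>\<^sub>F i in sequentially. node c (X (N + i)) (Y (N + i)) (s (N + i))"
    proof eventually_elim
      case (elim i)
      show ?case unfolding s Y by (rule node_perturb[OF n[OF elim(2)] elim(1)]) (use c in auto)
    qed
    then obtain K' where "\<And>i. i \<ge> K' \<Longrightarrow> node c (X (N + i)) (Y (N + i)) (s (N + i))"
      unfolding eventually_sequentially by blast
    then have "node c (X k) (Y k) (s k)" if "k \<ge> N + K'" for k
    proof -
      have "k = N + (k - N)" "k - N \<ge> K'" using that by auto
      then show ?thesis using \<open>\<And>i. i \<ge> K' \<Longrightarrow> node c (X (N + i)) (Y (N + i)) (s (N + i))\<close> by metis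
    qed
    then show ?thesis by blast
  qed
  show irr: "\<not> (\<exists>m n :: int. \<gamma> = of_int m + of_int n * \<eta>)"
  proof -
    obtain K' where "\<And>k. k \<ge> K' \<Longrightarrow> node (v/2) (X k) (Y k) (s k)" using nodes[of "v/2"] v by auto
    from M_star_ge_of_nodes(2)[OF this] v show ?thesis by simp
  qed
  have ge: "ereal v \<le> M_star a b \<gamma>"
  proof (rule dense_le)
    fix t assume "t < ereal v"
    show "t \<le> M_star a b \<gamma>"
    proof (cases t)
      case (real u)
      have "max u (v / 2) < v" "0 < max u (v / 2)" using \<open>t < ereal v\<close> real v by auto
      from nodes[OF this(2,1)] obtain K' where
        "\<And>k. k \<ge> K' \<Longrightarrow> node (max u (v / 2)) (X k) (Y k) (s k)" by blast
      from M_star_ge_of_nodes(1)[OF this] v have "ereal (max u (v / 2)) \<le> M_star a b \<gamma>" by simp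
      moreover have "t \<le> ereal (max u (v / 2))" using real by simp
      ultimately show ?thesis by (rule order_trans[rotated])
    qed (use \<open>t < ereal v\<close> in auto)
  qed
  have le: "M_star a b \<gamma> \<le> ereal (v + \<epsilon>)" if \<epsilon>: "\<epsilon> > 0" for \<epsilon>
  proof (rule M_star_le_of_vertex[OF irr p])
    define y' where "y' i = \<eta> * (sP i + y i)" for i
    define C' where "C' = \<bar>C\<bar> + \<bar>\<eta> * (2 * B + b)\<bar> + 3"
    have C'0: "C' > 0" by (simp add: C'_def)
    have y'b: "\<bar>y' i\<bar> + 2 \<le> C'" for i
    proof -
      have "\<bar>y' i\<bar> = \<eta> * \<bar>s (N + i) + y i\<bar>" using eta_pos s[of i] by (simp add: y'_def abs_mult)
      also have "\<dots> \<le> \<eta> * ((2 * B + b) + C)" using s_bound[of "N+i"] C[of i] eta_pos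
        by (intro mult_left_mono abs_add_le) auto
      also have "\<dots> = \<eta> * (2 * B + b) + \<eta> * C" by (rule distrib_left)
      also have "\<eta> * C \<le> 1 * C" using C[of 0] eta_pos eta_less by (intro mult_right_mono) auto
      finally have "\<bar>y' i\<bar> \<le> \<eta> * (2 * B + b) + C" by simp
      then show ?thesis unfolding C'_def by linarith
    qed
    have lip: "\<bar>p t (y' i) - p t' (y' i)\<bar> \<le> C' * \<bar>t - t'\<bar>" for t t' i
    proof -
      have "\<exists>g. \<bar>g\<bar> \<le> \<bar>y' i\<bar> + 2 \<and> p t (y' i) - p t' (y' i) = g * (t - t')"
        using p
      proof (elim insertE emptyE)
        assume "p = p1" then show ?thesis using eta_pos eta_less
          by (intro exI[of _ "1 - \<eta> + y' i"]) (auto simp: p1_def algebra_simps)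
      next
        assume "p = p2" then show ?thesis using eta_pos eta_less
          by (intro exI[of _ "1 + \<eta> - y' i"]) (auto simp: p2_def algebra_simps)
      next
        assume "p = p3" then show ?thesis using eta_pos eta_less
          by (intro exI[of _ "- (1 + \<eta> + y' i)"]) (auto simp: p3_def algebra_simps)
      next
        assume "p = p4" then show ?thesis using eta_pos eta_less
          by (intro exI[of _ "- (1 - \<eta> - y' i)"]) (auto simp: p4_def algebra_simps)
      qed
      then obtain g where g: "\<bar>g\<bar> \<le> \<bar>y' i\<bar> + 2" "p t (y' i) - p t' (y' i) = g * (t - t')" by blast
      show ?thesis unfolding g(2) abs_mult using g(1) y'b[of i] by (intro mult_right_mono) auto
    qed
    have pos: "\<epsilon> / C' > 0" using \<epsilon> C'0 by simp
    have "\<forall>\<^sub>F i in sequentially. \<bar>p (x i) (y' i)\<bar> = v \<longrightarrow> \<bar>p (X (N + i)) (\<eta> * (s (N + i) + Y (N + i)))\<bar> \<le> v + \<epsilon>"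
      using near[OF pos]
    proof eventually_elim
      case (elim i)
      have "C' * \<bar>X (N + i) - x i\<bar> \<le> \<epsilon>" using elim C'0 by (simp add: field_simps)
      then have "\<bar>p (X (N + i)) (y' i) - p (x i) (y' i)\<bar> \<le> \<epsilon>" using lip[of "X (N + i)" i "x i"] by linarith
      then show ?case unfolding s Y y'_def[symmetric] by linarith
    qed
    from frequently_rev_mp[OF f[folded y'_def] this]
    have F: "\<forall>m. \<exists>i\<ge>m. \<bar>p (X (N + i)) (\<eta> * (s (N + i) + Y (N + i)))\<bar> \<le> v + \<epsilon>"
      unfolding frequently_sequentially .
    show "\<exists>\<^sub>F k in sequentially. \<bar>p (X k) (\<eta> * (s k + Y k))\<bar> \<le> v + \<epsilon>"
      unfolding frequently_sequentially
    proof
      fix m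
      obtain i where "i \<ge> m" "\<bar>p (X (N + i)) (\<eta> * (s (N + i) + Y (N + i)))\<bar> \<le> v + \<epsilon>" using F by blast
      then show "\<exists>k\<ge>m. \<bar>p (X k) (\<eta> * (s k + Y k))\<bar> \<le> v + \<epsilon>" by (intro exI[of _ "N + i"]) simp
    qed
  qed
  show "M_star a b \<gamma> = ereal v"
  proof (rule antisym[OF _ ge])
    show "M_star a b \<gamma> \<le> ereal v"
    proof (rule ereal_le_epsilon2)
      fix \<epsilon> :: real
      assume "0 < \<epsilon>"
      then show "M_star a b \<gamma> \<le> ereal v + ereal \<epsilon>" using le by simp
    qed
  qed
qed

theorem value_of_pattern:
  assumes pat: "is_pattern v sP eP" and \<sigma>: "\<sigma> \<in> {1, - 1}"
    and s: "\<And>i. s (N + i) = \<sigma> * sP i" and E: "\<And>i. E (N + i) = \<sigma> * eP i"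
  shows "M_star a b \<gamma> = ereal v" "\<not> (\<exists>m n :: int. \<gamma> = of_int m + of_int n * \<eta>)"
proof -
  consider "\<sigma> = 1" | "\<sigma> = - 1" using \<sigma> by blast
  then have "M_star a b \<gamma> = ereal v \<and> \<not> (\<exists>m n :: int. \<gamma> = of_int m + of_int n * \<eta>)"
  proof cases
    case 1
    then show ?thesis using value_of_pattern_aux[OF pat, of N] s E by simp
  next
    case 2
    then show ?thesis using value_of_pattern_aux[OF is_pattern_neg[OF pat], of N] s E by simp
  qed
  then show "M_star a b \<gamma> = ereal v" "\<not> (\<exists>m n :: int. \<gamma> = of_int m + of_int n * \<eta>)" by blast+
qed

end

context params begin

lemma word_expansion:
  fixes f g :: "nat \<Rightarrow> int"
  assumes f: "\<And>i. \<bar>f i\<bar> \<le> C" and g: "\<And>i. \<bar>g i\<bar> \<le> C"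
  defines "n \<equiv> \<lambda>k. if even k then f (k div 2) else g (k div 2)"
  shows "\<exists>r B. expansion a b n r (\<Sum>i. (f i * \<eta> + g i * D) * D ^ i) 0 B"
proof -
  define t where "t i = f i * \<eta> + g i * D" for i
  have fr: "\<bar>real_of_int (f i)\<bar> \<le> real_of_int C" and gr: "\<bar>real_of_int (g i)\<bar> \<le> real_of_int C" for i
    using f[of i] g[of i] by (metis of_int_abs of_int_le_iff)+
  have C0: "0 \<le> real_of_int C" using fr[of 0] by linarith
  have tb: "\<bar>t i\<bar> \<le> 2 * real_of_int C" for i
  proof -
    have "\<bar>f i * \<eta>\<bar> \<le> real_of_int C * 1" unfolding abs_mult using fr[of i] eta_pos eta_less C0 by (intro mult_mono) auto
    moreover have "\<bar>g i * D\<bar> \<le> real_of_int C * 1" unfolding abs_mult using gr[of i] D_pos D_less C0 by (intro mult_mono) auto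
    ultimately show ?thesis unfolding t_def using abs_add_le[of "f i * \<eta>" "real_of_int C * 1" "g i * D" "real_of_int C * 1"] by simp
  qed
  have D1: "norm D < 1" using D_pos D_less by simp
  have sm: "summable (\<lambda>j. t (i + j) * D ^ j)" for i
  proof (rule summable_comparison_test[OF _ summable_mult[OF summable_geometric[OF D1], of "2 * real_of_int C"]])
    show "\<exists>N. \<forall>j\<ge>N. norm (t (i + j) * D ^ j) \<le> 2 * real_of_int C * D ^ j"
      using tb D_pos by (auto simp: abs_mult intro!: mult_right_mono)
  qed
  define \<rho> where "\<rho> i = (\<Sum>j. t (i + j) * D ^ j)" for i
  have \<rho>_rec: "\<rho> i = t i + D * \<rho> (Suc i)" for i
  proof -
    have "\<rho> i = t i + (\<Sum>j. t (i + Suc j) * D ^ Suc j)"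
      using suminf_split_head[OF sm[of i]] unfolding \<rho>_def by simp
    also have "(\<lambda>j. t (i + Suc j) * D ^ Suc j) = (\<lambda>j. D * (t (Suc i + j) * D ^ j))" by (auto simp: fun_eq_iff)
    also have "(\<Sum>j. D * (t (Suc i + j) * D ^ j)) = D * \<rho> (Suc i)" unfolding \<rho>_def by (rule suminf_mult[OF sm])
    finally show ?thesis .
  qed
  have \<rho>b: "\<bar>\<rho> i\<bar> \<le> 4 * real_of_int C" for i
  proof -
    have sg: "summable (\<lambda>j. 2 * real_of_int C * D ^ j)" by (rule summable_mult[OF summable_geometric[OF D1]])
    have "\<bar>\<rho> i\<bar> \<le> (\<Sum>j. 2 * real_of_int C * D ^ j)"
      unfolding \<rho>_def real_norm_def[symmetric]
    proof (rule norm_suminf_le[OF _ sg])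
      show "norm (t (i + j) * D ^ j) \<le> 2 * real_of_int C * D ^ j" for j
        using mult_right_mono[OF tb[of "i + j"], of "D ^ j"] D_pos by (simp add: abs_mult)
    qed
    also have "\<dots> = 2 * real_of_int C * (1 / (1 - D))" using suminf_mult[OF summable_geometric[OF D1], of "2 * real_of_int C"] suminf_geometric[OF D1] by simp
    also have "\<dots> \<le> 2 * real_of_int C * 2" using C0 D_less D_pos by (intro mult_left_mono) (auto simp: field_simps)
    finally show ?thesis by simp
  qed
  define r where "r k = (if even k then D ^ (k div 2) * \<rho> (k div 2)
    else D ^ (k div 2) * \<rho> (k div 2) - f (k div 2) * (\<eta> * D ^ (k div 2)))" for k
  \<comment> \<open>At odd stages \<open>dd\<close> carries an extra factor \<open>\<eta>\<close>,
    which the bound on the remainders has to make up for.\<close>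
  define B where "B = 4 * real_of_int C / \<eta> + C"
  have B1: "4 * real_of_int C \<le> 4 * real_of_int C / \<eta>" using C0 eta_pos eta_less by (simp add: field_simps mult_left_le)
  have "expansion a b n r (\<Sum>i. (f i * \<eta> + g i * D) * D ^ i) 0 B"
  proof unfold_locales
    fix k
    show "r (Suc k) = r k - real_of_int (n k) * dd (Suc k)"
    proof (cases "even k")
      case True
      then obtain i where "k = 2 * i" by blast
      then show ?thesis using dd_odd[of i] by (simp add: r_def n_def)
    next
      case False
      then obtain i where k: "k = 2 * i + 1" by (metis oddE)
      have "r (Suc k) = D ^ i * (D * \<rho> (Suc i))" "r k = D ^ i * \<rho> i - f i * (\<eta> * D ^ i)" "n k = g i"
        "dd (Suc k) = D * D ^ i" using dd_even[of "Suc i"] by (auto simp: r_def n_def k)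
      then show ?thesis using \<rho>_rec[of i] by (simp add: t_def algebra_simps)
    qed
    show "\<bar>real_of_int (n k)\<bar> \<le> B" using fr[of "k div 2"] gr[of "k div 2"] B1 C0 unfolding n_def B_def by auto
    show "\<bar>r k\<bar> \<le> B * dd k"
    proof (cases "even k")
      case True
      then obtain i where k: "k = 2 * i" by blast
      have "\<bar>r k\<bar> = D ^ i * \<bar>\<rho> i\<bar>" using D_pos by (simp add: r_def k abs_mult)
      also have "\<dots> \<le> D ^ i * B" using \<rho>b[of i] B1 C0 D_pos unfolding B_def by (intro mult_left_mono) auto
      finally show ?thesis using dd_even[of i] by (simp add: k mult.commute)
    next
      case False
      then obtain i where k: "k = 2 * i + 1" by (metis oddE)
      have "\<bar>r k\<bar> = D ^ i * \<bar>\<rho> i + - (f i * \<eta>)\<bar>" 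
      proof -
        have "r k = D ^ i * (\<rho> i + - (f i * \<eta>))" by (simp add: r_def k algebra_simps)
        then show ?thesis using D_pos by (simp add: abs_mult)
      qed
      also have "\<dots> \<le> D ^ i * (4 * real_of_int C + C * \<eta>)"
      proof (intro mult_left_mono abs_add_le \<rho>b)
        show "\<bar>- (f i * \<eta>)\<bar> \<le> C * \<eta>" using fr[of i] eta_pos by (simp add: abs_mult)
      qed (use D_pos in auto)
      also have "\<dots> = D ^ i * (\<eta> * B)" using eta_pos by (simp add: B_def algebra_simps)
      finally show ?thesis using dd_odd[of i] by (simp add: k algebra_simps)
    qed
  next
    show "(\<Sum>i. (f i * \<eta> + g i * D) * D ^ i) = real_of_int 0 + r 0"
      by (simp add: r_def \<rho>_def t_def)
  qed
  then show ?thesis by blast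
qed

lemma gamma_word_value:
  assumes pat: "is_pattern v sP eP"
    and P: "\<And>i. 2 * fst (P ! (i mod length P)) - (a - 2) = sP i \<and> 2 * snd (P ! (i mod length P)) - (b - 2) = eP i"
    and ne: "P \<noteq> []"
  shows "M_star a b (gamma_word a b P) = ereal v"
    "\<not> (\<exists>m n :: int. gamma_word a b P = of_int m + of_int n * \<eta>)"
proof -
  define f where "f i = fst (P ! (i mod length P))" for i
  define g where "g i = snd (P ! (i mod length P))" for i
  define C where "C = Max ((\<lambda>x. \<bar>fst x\<bar> + \<bar>snd x\<bar>) ` set P)"
  have bd: "\<bar>fst (P ! (i mod length P))\<bar> + \<bar>snd (P ! (i mod length P))\<bar> \<le> C" for i
    unfolding C_def using ne by (intro Max_ge) auto
  have fb: "\<bar>f i\<bar> \<le> C" and gb: "\<bar>g i\<bar> \<le> C" for i using bd[of i] by (auto simp: f_def g_def)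
  define n where "n = (\<lambda>k. if even k then f (k div 2) else g (k div 2))"
  obtain r B where ex: "expansion a b n r (\<Sum>i. (f i * \<eta> + g i * D) * D ^ i) 0 B"
    using word_expansion[of f C g, OF fb gb] unfolding n_def by blast
  have gw: "gamma_word a b P = (\<Sum>i. (f i * \<eta> + g i * D) * D ^ i)"
    unfolding gamma_word_def f_def g_def ..
  interpret expansion a b n r "gamma_word a b P" 0 B using ex gw by simp
  have n1: "n (2 * i) = f i" "n (Suc (2 * i)) = g i" for i by (simp_all add: n_def)
  have "s (0 + i) = 1 * sP i" "E (0 + i) = 1 * eP i" for i
    using P[of i] n1[of i] by (simp_all add: s_def E_def f_def g_def)
  from value_of_pattern[OF pat _ this]
  show "M_star a b (gamma_word a b P) = ereal v"
    "\<not> (\<exists>m n :: int. gamma_word a b P = of_int m + of_int n * \<eta>)" by simp_all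
qed

section \<open>Values of the sign patterns\<close>

lemma signed_series:
  fixes f :: "nat \<Rightarrow> int"
  assumes f: "\<And>i. f i = 1 \<or> f i = - 1" and per: "\<And>i. f (i + q) = f i" and q: "q \<ge> 1"
  shows "\<exists>L R :: nat \<Rightarrow> real. (\<forall>i. L (Suc i) = f i + D * L i) \<and> (\<forall>i. R i = f i + D * R (Suc i)) \<and>
    (\<forall>i. \<bar>L i\<bar> \<le> 107/100) \<and> (\<forall>i. \<bar>R i\<bar> \<le> 107/100) \<and> (\<forall>i. L (i + q) = L i) \<and> (\<forall>i. R (i + q) = R i)"
proof -
  have D1: "norm D < 1" using D_pos D_less by simp
  have sg: "summable (\<lambda>j. D ^ j)" by (rule summable_geometric[OF D1])
  have sm: "summable (\<lambda>j. real_of_int (f (u j)) * D ^ j)" for u :: "nat \<Rightarrow> nat"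
  proof (rule summable_comparison_test[OF _ sg])
    have "norm (real_of_int (f (u j)) * D ^ j) \<le> D ^ j" for j using f[of "u j"] D_pos by (auto simp: abs_mult)
    then show "\<exists>N. \<forall>j\<ge>N. norm (real_of_int (f (u j)) * D ^ j) \<le> D ^ j" by blast
  qed
  have bd: "\<bar>\<Sum>j. real_of_int (f (u j)) * D ^ j\<bar> \<le> 107/100" for u :: "nat \<Rightarrow> nat"
  proof -
    have "norm (\<Sum>j. real_of_int (f (u j)) * D ^ j) \<le> (\<Sum>j. D ^ j)"
    proof (rule norm_suminf_le[OF _ sg])
      show "norm (real_of_int (f (u j)) * D ^ j) \<le> D ^ j" for j using f[of "u j"] D_pos by (auto simp: abs_mult)
    qed
    also have "\<dots> = 1 / (1 - D)" by (rule suminf_geometric[OF D1])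
    also have "\<dots> \<le> 107/100" using D_less D_pos by (simp add: field_simps)
    finally show ?thesis by simp
  qed
  have split: "(\<Sum>j. real_of_int (f (u j)) * D ^ j) = f (u 0) + D * (\<Sum>j. real_of_int (f (u (Suc j))) * D ^ j)" for u :: "nat \<Rightarrow> nat"
  proof -
    have "(\<Sum>j. real_of_int (f (u j)) * D ^ j) = f (u 0) + (\<Sum>j. real_of_int (f (u (Suc j))) * D ^ Suc j)"
      using suminf_split_head[OF sm[of u]] by simp
    also have "(\<lambda>j. real_of_int (f (u (Suc j))) * D ^ Suc j) = (\<lambda>j. D * (real_of_int (f (u (Suc j))) * D ^ j))"
      by (auto simp: fun_eq_iff)
    also have "(\<Sum>j. D * (real_of_int (f (u (Suc j))) * D ^ j)) = D * (\<Sum>j. real_of_int (f (u (Suc j))) * D ^ j)"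
      by (rule suminf_mult[OF sm[of "\<lambda>j. u (Suc j)"]])
    finally show ?thesis .
  qed
  define R where "R i = (\<Sum>j. real_of_int (f (i + j)) * D ^ j)" for i
  \<comment> \<open>\<open>ix i j\<close> is a nonnegative representative of
    \<open>i - 1 - j\<close> modulo \<open>q\<close>; periodicity thus supplies the digits before
    the start.\<close>
  define ix where "ix i j = i + q * Suc j - Suc j" for i j :: nat
  have qj: "q * Suc j \<ge> Suc j" for j using q by (metis mult_le_mono1 mult_1)
  have ixS: "ix (Suc i) (Suc j) = ix i j + q" for i j
    using qj[of j] by (simp add: ix_def)
  have ix0: "ix (Suc i) 0 = i + q" for i using q by (simp add: ix_def)
  have ixq: "ix (i + q) j = ix i j + q" for i j using qj[of j] by (simp add: ix_def)
  define L where "L i = (\<Sum>j. real_of_int (f (ix i j)) * D ^ j)" for i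
  have "L (Suc i) = f i + D * L i" for i
    unfolding L_def by (subst split) (simp add: ixS ix0 per)
  moreover have "R i = f i + D * R (Suc i)" for i
    unfolding R_def by (subst split) simp
  moreover have "L (i + q) = L i" "R (i + q) = R i" for i
  proof -
    show "L (i + q) = L i" unfolding L_def by (simp add: ixq per)
    have "f (i + q + j) = f (i + j)" for j using per[of "i + j"] by (simp add: ac_simps)
    then show "R (i + q) = R i" unfolding R_def by simp
  qed
  moreover have "\<bar>L i\<bar> \<le> 107/100" "\<bar>R i\<bar> \<le> 107/100" for i unfolding L_def R_def by (rule bd)+
  ultimately show ?thesis by blast
qed

text \<open>In \<open>p2\<close> and \<open>p3\<close> the added \<open>\<beta>\<close> and
  \<open>\<eta>\<close> outweigh the tails: one factor loses at most \<open>7/100 * \<eta>\<close>,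
  the other gains at least \<open>77/100 * \<eta>\<close>. These products are at least 1, so a value
  \<open>v \<le> 1\<close> is decided by \<open>h\<close> alone.\<close>

lemma is_pattern_signs:
  assumes L: "\<And>i. L (Suc i) = f i + D * L i" and R: "\<And>i. R i = f i + D * R (Suc i)"
    and Lb: "\<And>i. \<bar>L i\<bar> \<le> 107/100" and Rb: "\<And>i. \<bar>R i\<bar> \<le> 107/100" and v: "0 < v" "v \<le> 1"
    and cut: "\<And>i. i \<ge> K \<Longrightarrow> v \<le> h (L i) (R i) \<and> v \<le> h (- L i) (- R i) \<and> v \<le> h (R i) (L i) \<and> v \<le> h (- R i) (- L i)"
    and att: "\<exists>\<^sub>F i in sequentially. h (L i) (R i) = v"
  shows "is_pattern v (\<lambda>_. 0) f"
proof -
  have DE: "D \<le> (212/1000) * \<eta>" unfolding D_eq using beta_less eta_pos by simp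
  have hn: "half_node v (\<beta> * l) (\<eta> * (of_int 0 + \<beta> * r))"
    if lr: "\<bar>l\<bar> \<le> 107/100" "\<bar>r\<bar> \<le> 107/100" and h: "v \<le> h l r" "v \<le> h (- l) (- r)" for l r
  proof -
    have e: "\<eta> * (of_int 0 + \<beta> * r) = D * r" by (simp add: D_eq)
    have bl: "\<bar>\<beta> * l\<bar> \<le> \<beta> * (107/100)" unfolding abs_mult using lr beta_pos by (intro mult_mono) auto
    have dr: "\<bar>D * r\<bar> \<le> D * (107/100)" unfolding abs_mult using lr D_pos by (intro mult_mono) auto
    have big: "1 \<le> (1 + \<beta> + x) * (1 + \<eta> + y)" if "\<bar>x\<bar> \<le> \<beta> * (107/100)" "\<bar>y\<bar> \<le> D * (107/100)" for x y
    proof -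
      have "1 + (77/100) * \<eta> \<le> 1 + \<eta> + y" using that DE eta_pos by linarith
      moreover have "1 - (7/100) * \<eta> \<le> 1 + \<beta> + x" using that beta_less_eta by linarith
      ultimately have "(1 - (7/100) * \<eta>) * (1 + (77/100) * \<eta>) \<le> (1 + \<beta> + x) * (1 + \<eta> + y)"
        using eta_pos eta_less by (intro mult_mono) auto
      moreover have "(1 - (7/100) * \<eta>) * (1 + (77/100) * \<eta>) = 1 + (70/100) * \<eta> - (539/10000) * (\<eta> * \<eta>)"
        by (simp add: field_simps)
      moreover have "\<eta> * \<eta> \<le> \<eta> * 1" using eta_pos eta_less by (intro mult_left_mono) auto
      ultimately show ?thesis using eta_pos by linarith
    qed
    have "1 \<le> p2 (\<beta> * l) (D * r)" using big[of "\<beta> * l" "- (D * r)"] bl dr by (simp add: p2_def)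
    moreover have "1 \<le> p3 (\<beta> * l) (D * r)" using big[of "- (\<beta> * l)" "D * r"] bl dr by (simp add: p3_def)
    moreover have "p1 (\<beta> * l) (D * r) = h l r" "p4 (\<beta> * l) (D * r) = h (- l) (- r)"
      by (simp_all add: p1_def p4_def h_def)
    moreover have "\<bar>\<beta> * l\<bar> < 1 - \<beta>" using bl beta_less by linarith
    moreover have "\<bar>D * r\<bar> < 1 - \<eta>" using dr eta_less D_less by linarith
    ultimately show ?thesis unfolding half_node_def e using h v by auto
  qed
  show ?thesis unfolding is_pattern_def
  proof (rule conjI[OF v(1)], rule exI[of _ "\<lambda>i. \<beta> * L i"], rule exI[of _ "\<lambda>i. \<beta> * R i"], rule exI[of _ K],
      rule exI[of _ "107/100"], intro conjI allI impI bexI[of _ p1])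
    fix i
    show "\<beta> * L (Suc i) = \<beta> * (f i + \<eta> * (of_int 0 + \<beta> * L i))" using L[of i] by (simp add: D_eq)
    show "\<beta> * R i = \<beta> * (f i + \<eta> * (of_int 0 + \<beta> * R (Suc i)))" using R[of i] by (simp add: D_eq)
    have "\<bar>\<beta> * R i\<bar> \<le> 1 * (107/100)" unfolding abs_mult using Rb[of i] beta_pos beta_less by (intro mult_mono) auto
    then show "\<bar>\<beta> * R i\<bar> \<le> 107/100" by simp
    show "K \<le> i \<Longrightarrow> node v (\<beta> * L i) (\<beta> * R i) 0"
      unfolding node_def using hn[OF Lb Rb, of i i] hn[OF Rb Lb, of i i] cut[of i] by blast
    have "p1 (\<beta> * L i) (\<eta> * (of_int 0 + \<beta> * R i)) = h (L i) (R i)" for i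
      by (simp add: p1_def h_def D_eq)
    then show "\<exists>\<^sub>F i in sequentially. \<bar>p1 (\<beta> * L i) (\<eta> * (of_int 0 + \<beta> * R i))\<bar> = v"
      using frequently_rev_mp[OF att] v by (simp add: always_eventually)
  qed simp
qed

section \<open>Comparison of cut products\<close>

lemma h_diff: "h l r - h l' r' = \<beta> * ((l - l') * (1 - \<eta> + D * r) + \<eta> * (r - r') * (1 - \<beta> + \<beta> * l'))"
  unfolding h_def D_eq by (simp add: algebra_simps)

lemma h_factors:
  assumes r: "\<bar>r\<bar> \<le> 12/10" and l: "- 1 \<le> l'" "l' \<le> 1"
  shows "66/100 \<le> 1 - \<eta> + D * r" "1 - \<eta> + D * r \<le> 1" "57/100 \<le> 1 - \<beta> + \<beta> * l'" "1 - \<beta> + \<beta> * l' \<le> 1"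
proof -
  have "\<beta> * - 1 \<le> \<beta> * l'" "\<beta> * l' \<le> \<beta> * 1" using l beta_pos by (intro mult_left_mono; simp)+
  then show "57/100 \<le> 1 - \<beta> + \<beta> * l'" "1 - \<beta> + \<beta> * l' \<le> 1" using beta_less beta_pos by linarith+
qed (use factor_bounds[OF r] in auto)

lemma h_ge_left:
  assumes "l' + x \<le> l" and "r' - 12/5 * x \<le> r" and x: "0 \<le> x" and r: "\<bar>r\<bar> \<le> 12/10" and l: "- 1 \<le> l'" "l' \<le> 1"
  shows "h l' r' \<le> h l r"
proof -
  note f = h_factors[OF r l]
  have "x * (66/100) \<le> (l - l') * (1 - \<eta> + D * r)" using assms f by (intro mult_mono) auto
  moreover have "\<eta> * (r - r') * (1 - \<beta> + \<beta> * l') \<ge> - ((265/1000) * (12/5 * x))"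
  proof -
    have "\<eta> * (12/5 * x) * (1 - \<beta> + \<beta> * l') \<le> (265/1000) * (12/5 * x) * 1"
      using f x eta_less eta_pos by (intro mult_mono) auto
    moreover have "\<eta> * (- (12/5 * x)) * (1 - \<beta> + \<beta> * l') \<le> \<eta> * (r - r') * (1 - \<beta> + \<beta> * l')"
      using assms f eta_pos by (intro mult_right_mono mult_left_mono) auto
    moreover have "\<eta> * (- (12/5 * x)) * (1 - \<beta> + \<beta> * l') = - (\<eta> * (12/5 * x) * (1 - \<beta> + \<beta> * l'))" by simp
    ultimately show ?thesis by linarith
  qed
  ultimately have "0 \<le> (l - l') * (1 - \<eta> + D * r) + \<eta> * (r - r') * (1 - \<beta> + \<beta> * l')" using x by linarith
  then have "0 \<le> h l r - h l' r'" unfolding h_diff using beta_pos by simp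
  then show ?thesis by simp
qed

text \<open>The gain on the right counts only with weight about \<open>\<eta>\<close>, so it pays
  for a loss of at most \<open>\<eta> * x / 2\<close> on the left.\<close>

lemma h_ge_right:
  assumes "r' + x \<le> r" and "l' - \<eta> * x / 2 \<le> l" and x: "0 \<le> x" and r: "\<bar>r\<bar> \<le> 12/10" and l: "- 1 \<le> l'" "l' \<le> 1"
  shows "h l' r' \<le> h l r"
proof -
  note f = h_factors[OF r l]
  have ex: "\<eta> * x \<ge> 0" using x eta_pos by simp
  have "- (\<eta> * x / 2) * (1 - \<eta> + D * r) \<le> (l - l') * (1 - \<eta> + D * r)" using assms f by (intro mult_right_mono) auto
  moreover have "\<eta> * x / 2 * (1 - \<eta> + D * r) \<le> \<eta> * x / 2 * 1" using ex f by (intro mult_left_mono) auto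
  moreover have "\<eta> * x * (57/100) \<le> \<eta> * (r - r') * (1 - \<beta> + \<beta> * l')" using assms f eta_pos by (intro mult_mono) auto
  ultimately have "0 \<le> (l - l') * (1 - \<eta> + D * r) + \<eta> * (r - r') * (1 - \<beta> + \<beta> * l')" using ex by linarith
  then have "0 \<le> h l r - h l' r'" unfolding h_diff using beta_pos by simp
  then show ?thesis by simp
qed

text \<open>The tails at the extremal cut of a pattern with equal gaps: the right tail behind the
  first sign deviates from \<open>w\<close> by \<open>r\<close>, and by periodicity the left tail
  behind its first three signs deviates by \<open>- D * D * r\<close>. At \<open>r = 0\<close> they
  become \<open>LI\<close> and \<open>RI\<close>.\<close>

definition lstar :: "real \<Rightarrow> real" where "lstar r = - 1 + D - D * D + D * D * D * (w - D * D * r)"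
definition rstar :: "real \<Rightarrow> real" where "rstar r = - 1 + D * (w + r)"
definition c0 :: real where "c0 = 2 * D - 2 * (D * D * w)"
text \<open>The deviation solving the fixed point equation of one period, in which \<open>c0\<close>
  is the contribution of a defect. Writing \<open>D ^ (4 * k) / (D * D)\<close> for the contraction
  of \<open>2 * k - 1\<close> blocks keeps the formula meaningful at \<open>k = 0\<close>.\<close>

definition rk :: "nat \<Rightarrow> real" where "rk k = D ^ (4 * k) * c0 / (D * D * (1 - D ^ (4 * k + 2)))"
definition vk :: "nat \<Rightarrow> real" where "vk k = h (lstar (rk k)) (rstar (rk k))"

lemma c0_bounds: "0 < c0" "c0 < 2 * D"
proof -
  have "D * D * w > 0" using D_pos w_bounds by simp
  then show "c0 < 2 * D" by (simp add: c0_def)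
  have "D * D * w < D * D * (107/100)" using D_pos w_bounds by (intro mult_strict_left_mono) auto
  then show "0 < c0" using DD_less D_pos unfolding c0_def by linarith
qed

lemma D_pow_less: "D ^ (4 * k + 2) < 1/10"
proof -
  have "D ^ (4 * k + 2) \<le> D ^ 2" using D_pos D_less by (intro power_decreasing) auto
  then show ?thesis using DD_less D_less by (simp add: power2_eq_square)
qed

lemma rk_pos: "0 < rk k"
  unfolding rk_def using D_pos c0_bounds D_pow_less[of k] by (intro divide_pos_pos mult_pos_pos) auto

lemma rk_strict_decreasing: "rk (Suc k) < rk k"
proof -
  have p: "1 - D ^ (4 * k + 2) > 0" "1 - D ^ (4 * Suc k + 2) > 0" using D_pow_less[of k] D_pow_less[of "Suc k"] by auto
  have "D ^ (4 * Suc k + 2) \<le> D ^ (4 * k + 2)" using D_pos D_less by (intro power_decreasing) auto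
  then have "1 - D ^ (4 * k + 2) \<le> 1 - D ^ (4 * Suc k + 2)" by simp
  moreover have "D ^ (4 * Suc k) < D ^ (4 * k)" using D_pos D_less by (intro power_strict_decreasing) auto
  ultimately show ?thesis unfolding rk_def using p D_pos c0_bounds
    by (intro frac_less mult_strict_right_mono mult_left_mono mult_pos_pos) auto
qed

text \<open>The index 0 has to be left out, since \<open>rk 0\<close> is of order
  \<open>1 / D\<close>; this is why the alternating pattern gets a proof of its own.\<close>

lemma rk_Suc_less: "rk (Suc k) < 3 * (D * D * D)"
proof -
  have "rk (Suc k) \<le> rk 1"
  proof (induction k)
    case (Suc k) then show ?case using rk_strict_decreasing[of "Suc k"] by simp
  qed simp
  also have "rk 1 \<le> D ^ 4 * (2 * D) / (D * D * (9/10))"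
  proof -
    have "9/10 \<le> 1 - D ^ (4 * 1 + 2)" using D_pow_less[of 1] by simp
    then show ?thesis unfolding rk_def using D_pos c0_bounds by (intro frac_le mult_left_mono) auto
  qed
  also have "\<dots> = (20/9) * (D * D * D)" using D_pos by (simp add: field_simps power4_eq_xxxx)
  also have "\<dots> < 3 * (D * D * D)" using D_pos by simp
  finally show ?thesis .
qed

text \<open>The general formulas at \<open>k = 0\<close> give the alternating tails, so the
  alternating sequence belongs to the same monotone family.\<close>

lemma vk_0: "lstar (rk 0) = - (1 / (1 + D))" "rstar (rk 0) = 1 / (1 + D)"
proof -
  have n: "1 + D * D > 0" "1 + D > 0" "1 - D > 0" "D > 0" using D_pos D_less by (auto simp: add_pos_pos)
  have n2: "D * D * (1 - D ^ 2) = D * D * ((1 - D) * (1 + D))" by (simp add: power2_eq_square algebra_simps)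
  have c: "c0 = 2 * D * (1 - D) / (1 + D * D)" using n by (simp add: c0_def w_def field_simps)
  have r: "rk 0 = 2 / (D * (1 + D) * (1 + D * D))"
  proof -
    have "D * D * ((1 - D) * (1 + D)) \<noteq> 0" using n by simp
    then have "rk 0 * (D * D * ((1 - D) * (1 + D))) = c0"
      unfolding rk_def n2[symmetric] by (simp add: power2_eq_square)
    moreover have "c0 * (1 + D * D) = 2 * D * (1 - D)" unfolding c using n by simp
    ultimately have "rk 0 * (D * D * ((1 - D) * (1 + D))) * (1 + D * D) = 2 * D * (1 - D)" by simp
    then have "(D * (1 - D)) * (rk 0 * (D * (1 + D) * (1 + D * D))) = (D * (1 - D)) * 2" by (simp add: ac_simps)
    then have "rk 0 * (D * (1 + D) * (1 + D * D)) = 2" using n by simp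
    then show ?thesis using n by (simp add: eq_divide_eq)
  qed
  have "D * (w + rk 0) = (2 + D) / (1 + D)"
    unfolding r w_def using n by (simp add: divide_simps) (simp add: algebra_simps)
  then show "rstar (rk 0) = 1 / (1 + D)" unfolding rstar_def using n by (simp add: field_simps)
  have "w - D * D * rk 0 = ((1 + D) * (1 + D) - 2 * D) / ((1 + D) * (1 + D * D))"
    unfolding r w_def using n by (simp add: divide_simps)
  also have "(1 + D) * (1 + D) - 2 * D = 1 + D * D" by (simp add: algebra_simps)
  finally have "w - D * D * rk 0 = 1 / (1 + D)" using n by simp
  then show "lstar (rk 0) = - (1 / (1 + D))" unfolding lstar_def using n by (simp add: divide_simps) (simp add: algebra_simps)
qed

lemma star_bounds:
  assumes r: "0 \<le> r" "r \<le> 3 * (D * D * D)"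
  shows "- 1 \<le> lstar r" "lstar r \<le> - 1 + D - D * D + (107/100) * (D * D * D)" "lstar r \<le> 1"
    "- 1 \<le> rstar r" "rstar r \<le> - 1 + D + 2 * (D * D)"
proof -
  have D3: "0 < D * D" "0 < D * D * D" "D * D * D < (6/100) * (D * D)" using D_pos D_less by auto
  have Dr: "D * r \<le> D * (3 * (D * D * D))" using r D_pos by (intro mult_left_mono) auto
  have "D * (D * D * D) \<le> (6/100) * (D * D * D)" using D_less D3 by (intro mult_right_mono) auto
  then have D4: "D * (3 * (D * D * D)) \<le> (18/100) * (D * D * D)" by simp
  have "D * (D * r) \<le> 1 * (D * r)" using r D_pos D_less by (intro mult_right_mono) auto
  moreover have "D * D * r = D * (D * r)" by simp
  ultimately have "D * D * r \<le> 1/2" using Dr D4 D3 DD_less D_less by linarith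
  then have w1: "0 \<le> w - D * D * r" using w_bounds by simp
  have w2: "w - D * D * r \<le> 107/100" using w_bounds r D_pos by (smt (verit) mult_nonneg_nonneg)
  have "0 \<le> D * D * D * (w - D * D * r)" using w1 D3 by simp
  then show "- 1 \<le> lstar r" using DD_less D_pos unfolding lstar_def by linarith
  have "D * D * D * (w - D * D * r) \<le> D * D * D * (107/100)" using w2 D3 by (intro mult_left_mono) auto
  then show 2: "lstar r \<le> - 1 + D - D * D + (107/100) * (D * D * D)" unfolding lstar_def by simp
  then show "lstar r \<le> 1" using D3 DD_less D_less by linarith
  show "- 1 \<le> rstar r" unfolding rstar_def using D_pos w_bounds r by simp
  have "D * w \<le> D * (1 + D)" using w_bounds D_pos by simp
  then have "rstar r \<le> - 1 + D * (1 + D) + D * r" unfolding rstar_def by (simp add: algebra_simps)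
  then show "rstar r \<le> - 1 + D + 2 * (D * D)" using Dr D4 D3 by (simp add: algebra_simps)
qed

text \<open>The cuts that are not extremal fall under three beginnings, read outwards: left tail
  \<open>+\<close>; left tail \<open>-\<close> against right tail \<open>+\<close>; left tail
  \<open>-++\<close> against right tail \<open>-+\<close>. The extremal left tail begins
  \<open>-+-\<close>.\<close>

lemma star_minimal:
  assumes r: "0 \<le> r" "r \<le> 3 * (D * D * D)" and l': "\<bar>l'\<bar> \<le> 107/100" and r': "\<bar>r'\<bar> \<le> 107/100"
  shows "h (lstar r) (rstar r) \<le> h (1 + D * l') r'"
    "h (lstar r) (rstar r) \<le> h (- 1 + D * l') (1 + D * r')"
    "h (lstar r) (rstar r) \<le> h (- 1 + D * (1 + D * (1 + D * l'))) (- 1 + D * (1 + D * r'))"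
proof -
  note sb = star_bounds[OF r]
  have D3: "0 < D * D" "0 < D * D * D" "D * D * D < (6/100) * (D * D)" using D_pos D_less by auto
  have dl: "\<bar>D * l'\<bar> \<le> D * (107/100)" unfolding abs_mult using l' D_pos by (intro mult_mono) auto
  have dr: "\<bar>D * r'\<bar> \<le> D * (107/100)" unfolding abs_mult using r' D_pos by (intro mult_mono) auto
  have small: "D * (107/100) \<le> 7/100" using D_less by simp
  have ls: "lstar r \<le> - 9/10" "rstar r \<le> - 9/10" using sb D3 DD_less D_less by linarith+
  show "h (lstar r) (rstar r) \<le> h (1 + D * l') r'"
    by (rule h_ge_left[of _ "3/2"]) (use dl small ls sb r' in linarith)+
  show "h (lstar r) (rstar r) \<le> h (- 1 + D * l') (1 + D * r')"
  proof (rule h_ge_right[of _ "3/2"])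
    have "D \<le> (212/1000) * \<eta>" unfolding D_eq using beta_less eta_pos by simp
    then show "lstar r - \<eta> * (3/2) / 2 \<le> - 1 + D * l'" using sb(2) dl D3 D_pos by linarith
  qed (use dr small ls sb in linarith)+
  have DDl: "D * D * (D * l') \<ge> - (D * D * (D * (107/100)))"
    using dl D3 mult_left_mono[of "- (D * (107/100))" "D * l'" "D * D"] by simp
  have el: "- 1 + D * (1 + D * (1 + D * l')) = - 1 + D + D * D + D * D * (D * l')" by (simp add: algebra_simps)
  have DDr: "D * (D * r') \<ge> - (D * (D * (107/100)))" "D * (D * r') \<le> D * (D * (107/100))"
  proof -
    have "- (D * (107/100)) \<le> D * r'" "D * r' \<le> D * (107/100)" using dr by linarith+
    then have "D * - (D * (107/100)) \<le> D * (D * r')" "D * (D * r') \<le> D * (D * (107/100))"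
      using D_pos by (intro mult_left_mono; simp)+
    then show "D * (D * r') \<ge> - (D * (D * (107/100)))" "D * (D * r') \<le> D * (D * (107/100))" by simp_all
  qed
  have er: "- 1 + D * (1 + D * r') = - 1 + D + D * (D * r')" by (simp add: algebra_simps)
  show "h (lstar r) (rstar r) \<le> h (- 1 + D * (1 + D * (1 + D * l'))) (- 1 + D * (1 + D * r'))"
    unfolding el er
  proof (rule h_ge_left[of _ "9/5 * (D * D)"])
    have "D * D * (D * (107/100)) = (107/100) * (D * D * D)" by simp
    then show "lstar r + 9/5 * (D * D) \<le> - 1 + D + D * D + D * D * (D * l')" using sb(2) DDl D3 by linarith
    have e2: "D * (D * (107/100)) = (107/100) * (D * D)" by simp
    then show "rstar r - 12/5 * (9/5 * (D * D)) \<le> - 1 + D + D * (D * r')" using sb(5) DDr D3 by linarith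
    show "\<bar>- 1 + D + D * (D * r')\<bar> \<le> 12/10" using e2 DDr D3 DD_less D_less D_pos by linarith
  qed (use sb D3 in auto)
qed

text \<open>An increment of \<open>r\<close> lowers the left tail by \<open>D^5\<close> times and
  raises the right one by \<open>D\<close> times the increment. Even with its weight
  \<open>\<eta>\<close> the right tail wins, because \<open>D^4 = \<eta> * \<beta> * D^3\<close> is
  tiny compared with \<open>\<eta>\<close>.\<close>

lemma vk_strict_mono:
  assumes r: "0 \<le> r" "r < r'" and r': "r' \<le> rk 0"
  shows "h (lstar r) (rstar r) < h (lstar r') (rstar r')"
proof -
  define \<Delta> where "\<Delta> = r' - r"
  have \<Delta>: "\<Delta> > 0" using r by (simp add: \<Delta>_def)
  have g: "1 / (1 + D) \<le> 1" using D_pos by simp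
  have a: "rstar r' \<le> 1"
  proof -
    have "rstar r' \<le> rstar (rk 0)" unfolding rstar_def using r' D_pos by simp
    then show ?thesis using vk_0 g by simp
  qed
  have a2: "rstar r' \<ge> - 1" unfolding rstar_def using r w_bounds D_pos by simp
  have b: "lstar r \<ge> - 1"
  proof -
    have "D * D * D * (D * D * r) \<le> D * D * D * (D * D * rk 0)" using r r' D_pos by (intro mult_left_mono) auto
    then have "lstar (rk 0) \<le> lstar r" unfolding lstar_def by (simp add: algebra_simps)
    then show ?thesis using vk_0 g by simp
  qed
  have b2: "lstar r \<le> 1"
  proof -
    have "0 \<le> D * D * r" using r D_pos by simp
    then have "w - D * D * r \<le> 107/100" using w_bounds by linarith
    then have "D * D * D * (w - D * D * r) \<le> D * D * D * (107/100)" using D_pos by (intro mult_left_mono) auto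
    moreover have "D * D * D < (6/100) * (D * D)" using D_pos D_less by simp
    moreover have "D * D > 0" using D_pos by simp
    ultimately show ?thesis using DD_less D_less D_pos unfolding lstar_def by linarith
  qed
  note f = h_factors[of "rstar r'" "lstar r"]
  have f: "1 - \<eta> + D * rstar r' \<le> 1" "57/100 \<le> 1 - \<beta> + \<beta> * lstar r" using f a a2 b b2 by auto
  have d1: "lstar r' - lstar r = - (D * D * D * D * D * \<Delta>)" by (simp add: lstar_def \<Delta>_def algebra_simps)
  have d2: "rstar r' - rstar r = D * \<Delta>" by (simp add: rstar_def \<Delta>_def algebra_simps)
  have "D * D * D * D * D * \<Delta> * (1 - \<eta> + D * rstar r') \<le> D * D * D * D * D * \<Delta> * 1"
    using f \<Delta> D_pos by (intro mult_left_mono) auto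
  also have "\<dots> = (D * \<Delta>) * (\<eta> * (\<beta> * (D * D * D)))" by (simp add: D_eq ac_simps)
  also have "\<dots> \<le> (D * \<Delta>) * (\<eta> * (1/10))"
  proof -
    have "D * D * D < (6/100) * (D * D)" using D_pos D_less by simp
    then have "D * D * D \<le> 1/10" using DD_less D_less by linarith
    then have "\<beta> * (D * D * D) \<le> 1 * (1/10)" using beta_less beta_pos D_pos by (intro mult_mono) auto
    then show ?thesis using \<Delta> D_pos eta_pos by (intro mult_left_mono) auto
  qed
  finally have 1: "D * D * D * D * D * \<Delta> * (1 - \<eta> + D * rstar r') \<le> \<eta> * (D * \<Delta>) * (1/10)"
    by (simp add: mult.commute[of \<eta>])
  have 2: "\<eta> * (D * \<Delta>) * (57/100) \<le> \<eta> * (D * \<Delta>) * (1 - \<beta> + \<beta> * lstar r)"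
    using f \<Delta> D_pos eta_pos by (intro mult_left_mono) auto
  have "\<eta> * (D * \<Delta>) > 0" using \<Delta> D_pos eta_pos by simp
  then have "0 < (lstar r' - lstar r) * (1 - \<eta> + D * rstar r') + \<eta> * (rstar r' - rstar r) * (1 - \<beta> + \<beta> * lstar r)"
    using 1 2 unfolding d1 d2 by simp
  then have "0 < h (lstar r') (rstar r') - h (lstar r) (rstar r)" unfolding h_diff using beta_pos by simp
  then show ?thesis by simp
qed

lemma star_0: "lstar 0 = LI" "rstar 0 = RI"
  by (simp_all add: lstar_def rstar_def LI_def RI_def)

lemma rk_le_rk0: "rk k \<le> rk 0"
proof (induction k)
  case (Suc k) then show ?case using rk_strict_decreasing[of k] by simp
qed simp

lemma vk_decreasing: "vk (Suc k) < vk k"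
  unfolding vk_def using rk_pos[of "Suc k"] rk_strict_decreasing[of k] rk_le_rk0[of k] by (intro vk_strict_mono) auto

lemma vk_gt_delta_inf: "vk k > delta_inf a b"
  unfolding vk_def delta_inf_eq star_0[symmetric] using rk_pos[of k] rk_le_rk0[of k] by (intro vk_strict_mono) auto

lemma rk_lim: "rk \<longlonglongrightarrow> 0"
proof (rule tendsto_sandwich[of "\<lambda>_. 0" _ _ "\<lambda>k. c0 / (D * D * (9/10)) * D ^ k"])
  show "(\<lambda>k. c0 / (D * D * (9/10)) * D ^ k) \<longlonglongrightarrow> 0"
    using tendsto_mult_left[OF D_pow_lim, of "c0 / (D * D * (9/10))"] by simp
  have "rk k \<le> D ^ k * c0 / (D * D * (9/10))" for k
  proof -
    have "D ^ (4 * k) \<le> D ^ k" using D_pos D_less by (intro power_decreasing) auto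
    then show ?thesis unfolding rk_def using D_pow_less[of k] D_pos c0_bounds
      by (intro frac_le mult_right_mono mult_left_mono) auto
  qed
  then show "\<forall>\<^sub>F k in sequentially. rk k \<le> c0 / (D * D * (9/10)) * D ^ k" by (simp add: ac_simps)
qed (use rk_pos in \<open>auto intro!: always_eventually less_imp_le\<close>)

lemma vk_lim: "vk \<longlonglongrightarrow> delta_inf a b"
proof -
  have "(\<lambda>k. h (lstar (rk k)) (rstar (rk k))) \<longlonglongrightarrow> h (lstar 0) (rstar 0)"
    unfolding h_def lstar_def rstar_def by (intro tendsto_intros rk_lim)
  then show ?thesis unfolding vk_def[abs_def] delta_inf_eq star_0 .
qed

lemma vk_le_1: "vk k \<le> 1"
proof -
  have "vk k \<le> vk 0"
  proof (induction k)
    case (Suc k) then show ?case using vk_decreasing[of k] by simp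
  qed simp
  also have "vk 0 = (1 - \<beta> + \<beta> * - (1 / (1 + D))) * (1 - \<eta> + D * (1 / (1 + D)))"
    by (simp add: vk_def vk_0 h_def)
  also have "\<dots> \<le> 1 * 1"
  proof (rule mult_mono)
    have g: "1 / (1 + D) \<le> 1" "0 < 1 / (1 + D)" using D_pos by auto
    have "D * (1 / (1 + D)) \<le> D * 1" using g D_pos by (intro mult_left_mono) auto
    moreover have "D \<le> 1 * \<eta>" unfolding D_eq using beta_less eta_pos by simp
    ultimately show "1 - \<eta> + D * (1 / (1 + D)) \<le> 1" by simp
    have "0 \<le> D * (1 / (1 + D))" using g D_pos by simp
    then show "0 \<le> 1 - \<eta> + D * (1 / (1 + D))" using eta_less by simp
    have "0 \<le> \<beta> * (1 / (1 + D))" using g beta_pos by simp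
    then show "1 - \<beta> + \<beta> * - (1 / (1 + D)) \<le> 1" using beta_pos by simp
  qed simp
  finally show ?thesis by simp
qed

lemma frequently_periodic:
  assumes "\<And>i::nat. P i \<Longrightarrow> P (i + q)" and "P i0" and "q \<ge> 1"
  shows "\<exists>\<^sub>F i in sequentially. P i"
  unfolding frequently_sequentially
proof
  fix m
  have "P (i0 + q * m)" for m
  proof (induction m)
    case (Suc m)
    have "i0 + q * Suc m = (i0 + q * m) + q" by simp
    then show ?case using assms(1)[OF Suc] by metis
  qed (use assms(2) in simp)
  moreover have "i0 + q * m \<ge> m" using assms(3) by (metis le_add2 le_trans mult_le_mono1 mult_1)
  ultimately show "\<exists>i\<ge>m. P i" by blast
qed

lemma periodic_shift:
  fixes L :: "nat \<Rightarrow> 'b"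
  assumes "\<And>i. L (i + q) = L i" shows "L (i + n * q) = L i"
  by (induction n) (use assms in \<open>auto simp: add.assoc[symmetric] add.commute[of q]\<close>)

lemma pk_periodic: "pk k (i + (4 * k + 2)) = pk k i"
  unfolding pk_def by (simp only: mod_add_self2)

lemma pk_sign: "pk k i = 1 \<or> pk k i = - 1"
  by (simp add: pk_def Let_def)

lemma pk_values:
  "pk k 0 = - 1" "pk k 1 = 1"
  "t < k \<Longrightarrow> pk k (4 * t + 2) = - 1" "t < k \<Longrightarrow> pk k (4 * t + 3) = - 1"
  "t < k \<Longrightarrow> pk k (4 * t + 4) = 1" "t < k \<Longrightarrow> pk k (4 * t + 5) = 1"
proof -
  show "pk k 0 = - 1" "pk k 1 = 1" by (simp_all add: pk_def Let_def)
  assume t: "t < k"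
  have base: "pk k x = (if x = 0 then - 1 else if x = 1 then 1 else if (x - 2) mod 4 < 2 then - 1 else 1)"
    if "x < 4 * k + 2" for x using that by (simp add: pk_def Let_def)
  have m: "(4 * t) mod 4 = 0" "(4 * t + 1) mod 4 = 1" "(4 * t + 2) mod 4 = 2" "(4 * t + 3) mod 4 = 3" by presburger+
  have "4 * t + 2 - 2 = 4 * t" "4 * t + 3 - 2 = 4 * t + 1" "4 * t + 4 - 2 = 4 * t + 2" "4 * t + 5 - 2 = 4 * t + 3" by simp_all
  then show "pk k (4 * t + 2) = - 1" "pk k (4 * t + 3) = - 1" "pk k (4 * t + 4) = 1" "pk k (4 * t + 5) = 1"
    using base[of "4 * t + 2"] base[of "4 * t + 3"] base[of "4 * t + 4"] base[of "4 * t + 5"] t m by simp_all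
qed

lemma vk_0_pattern: "is_pattern (vk 0) (\<lambda>_. 0) (pk 0)"
proof -
  have per0: "pk 0 (i + 2) = pk 0 i" for i using pk_periodic[of 0 i] by (simp only: mult_0_right add_0)
  have sgn: "pk 0 i = 1 \<or> pk 0 i = - 1" for i by (rule pk_sign)
  have q1: "(2::nat) \<ge> 1" by simp
  from signed_series[of "pk 0" 2, OF sgn per0 q1]
  obtain L R :: "nat \<Rightarrow> real" where LR: "(\<forall>i. L (Suc i) = pk 0 i + D * L i) \<and> (\<forall>i. R i = pk 0 i + D * R (Suc i)) \<and>
    (\<forall>i. \<bar>L i\<bar> \<le> 107/100) \<and> (\<forall>i. \<bar>R i\<bar> \<le> 107/100) \<and> (\<forall>i. L (i + 2) = L i) \<and> (\<forall>i. R (i + 2) = R i)"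
    by (elim exE)
  have L: "\<And>i. L (Suc i) = pk 0 i + D * L i" and R: "\<And>i. R i = pk 0 i + D * R (Suc i)"
    and Lb: "\<And>i. \<bar>L i\<bar> \<le> 107/100" and Rb: "\<And>i. \<bar>R i\<bar> \<le> 107/100"
    and Lp: "\<And>i. L (i + 2) = L i" and Rp: "\<And>i. R (i + 2) = R i"
    using LR by blast+
  have p: "pk 0 0 = - 1" "pk 0 1 = 1" by (rule pk_values)+
  have n: "1 + D > 0" "1 - D > 0" using D_pos D_less by auto
  define g where "g = 1 / (1 + D)"
  have g: "0 < g" "g \<le> 1" using D_pos by (auto simp: g_def)
  have gD: "g + D * g = 1" using n by (simp add: g_def field_simps)
  have uniq: "x = g" if "x = 1 + D * (- 1 + D * x)" for x
  proof -
    have "(1 - D) * (x + D * x) = (1 - D) * 1" using that by (simp add: algebra_simps)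
    then have "x + D * x = 1" using n by (simp only: mult_cancel_left) auto
    then have "x * (1 + D) = 1" by (simp add: algebra_simps)
    then show ?thesis using n by (simp add: g_def field_simps)
  qed
  have L1: "L 1 = - 1 + D * L 0" and L2: "L 2 = 1 + D * L 1"
    using L[of 0] L[of 1] p by (simp_all add: numeral_2_eq_2)
  have R0: "R 0 = - 1 + D * R 1" and R1: "R 1 = 1 + D * R 2"
    using R[of 0] R[of 1] p by (simp_all add: numeral_2_eq_2)
  have L20: "L 2 = L 0" and R20: "R 2 = R 0" using Lp[of 0] Rp[of 0] by (simp_all only: add_0)
  have L0: "L 0 = g" by (rule uniq) (use L1 L2 L20 in simp)
  have R1g: "R 1 = g" by (rule uniq) (use R0 R1 R20 in simp)
  have L1g: "L 1 = - g" and R0g: "R 0 = - g" using L1 R0 gD unfolding L0 R1g by linarith+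
  have alt: "L i = g \<and> R i = - g \<or> L i = - g \<and> R i = g" for i
  proof (induction i rule: nat_less_induct)
    case (1 i)
    consider "i = 0" | "i = 1" | j where "i = j + 2" by (metis One_nat_def Suc_1 add_2_eq_Suc' not0_implies_Suc)
    then show ?case
    proof cases
      case 3
      then show ?thesis using 1 Lp[of j] Rp[of j] by auto
    qed (use L0 R0g L1g R1g in auto)
  qed
  have v: "vk 0 = h (- g) g" by (simp add: vk_def vk_0 g_def)
  have hg: "h (- g) g \<le> h g (- g)"
    by (rule h_ge_left[of _ "2 * g"]) (use g in auto)
  show ?thesis
  proof (rule is_pattern_signs[where L = L and R = R and K = 0, OF L R Lb Rb _ vk_le_1])
    show "0 < vk 0" using vk_gt_delta_inf[of 0] theta_less_delta_inf theta_gt by simp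
    fix i
    show "vk 0 \<le> h (L i) (R i) \<and> vk 0 \<le> h (- L i) (- R i) \<and> vk 0 \<le> h (R i) (L i) \<and> vk 0 \<le> h (- R i) (- L i)"
      using alt[of i] hg v by auto
  next
    show "\<exists>\<^sub>F i in sequentially. h (L i) (R i) = vk 0"
      by (rule frequently_periodic[of _ 2 1]) (use L1g R1g v Lp Rp in auto)
  qed
qed

text \<open>Of the four products at a cut between opposite signs, two have a first tail beginning
  with \<open>+\<close> and two pair a tail \<open>-\<close> with a tail \<open>+\<close>; these are
  the first two cases of \<open>star_minimal\<close>.\<close>

lemma four_cuts_opposite:
  assumes r: "0 \<le> r" "r \<le> 3 * (D * D * D)" and \<sigma>: "\<sigma> = 1 \<or> \<sigma> = - 1"
    and l: "l = \<sigma> + D * l'" "\<bar>l'\<bar> \<le> 107/100" and p: "p = - \<sigma> + D * p'" "\<bar>p'\<bar> \<le> 107/100"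
    and b: "\<bar>l\<bar> \<le> 107/100" "\<bar>p\<bar> \<le> 107/100" and v: "v = h (lstar r) (rstar r)"
  shows "v \<le> h l p \<and> v \<le> h (- l) (- p) \<and> v \<le> h p l \<and> v \<le> h (- p) (- l)"
proof -
  note m = star_minimal[OF r, folded v]
  have nb: "\<bar>- l\<bar> \<le> 107/100" "\<bar>- p\<bar> \<le> 107/100" "\<bar>- l'\<bar> \<le> 107/100" "\<bar>- p'\<bar> \<le> 107/100"
    unfolding abs_minus_cancel using b l(2) p(2) by auto
  show ?thesis using \<sigma>
  proof
    assume "\<sigma> = 1"
    then have e: "l = 1 + D * l'" "p = - 1 + D * p'" "- l = - 1 + D * (- l')" "- p = 1 + D * (- p')" using l p by auto
    have "v \<le> h l p" unfolding e(1) by (rule m(1)[OF l(2) b(2)])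
    moreover have "v \<le> h (- p) (- l)" unfolding e(4) by (rule m(1)[OF nb(4) nb(1)])
    moreover have "v \<le> h (- l) (- p)" unfolding e(3,4) by (rule m(2)[OF nb(3,4)])
    moreover have "v \<le> h p l" unfolding e(1,2) by (rule m(2)[OF p(2) l(2)])
    ultimately show ?thesis by blast
  next
    assume "\<sigma> = - 1"
    then have e: "l = - 1 + D * l'" "p = 1 + D * p'" "- l = 1 + D * (- l')" "- p = - 1 + D * (- p')" using l p by auto
    have "v \<le> h p l" unfolding e(2) by (rule m(1)[OF p(2) b(1)])
    moreover have "v \<le> h (- l) (- p)" unfolding e(3) by (rule m(1)[OF nb(3) nb(2)])
    moreover have "v \<le> h (- p) (- l)" unfolding e(3,4) by (rule m(2)[OF nb(4,3)])
    moreover have "v \<le> h l p" unfolding e(1,2) by (rule m(2)[OF l(2) p(2)])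
    ultimately show ?thesis by blast
  qed
qed

text \<open>A cut inside a block of two equal signs; the two sides are well behaved unless the
  adjacent side is exactly the extremal one.\<close>

lemma four_cuts_block:
  assumes r: "0 \<le> r" "r \<le> 3 * (D * D * D)" and \<sigma>: "\<sigma> = 1 \<or> \<sigma> = - 1"
    and l: "\<sigma> * l = - 1 + D * (1 + D * l2)" "\<bar>l2\<bar> \<le> 107/100" and p: "\<sigma> * p = - 1 + D * (1 + D * q2)" "\<bar>q2\<bar> \<le> 107/100"
    and lx: "(\<exists>x. \<bar>x\<bar> \<le> 107/100 \<and> l2 = 1 + D * x) \<or> \<sigma> * l = lstar r \<and> \<sigma> * p = rstar r"
    and px: "(\<exists>x. \<bar>x\<bar> \<le> 107/100 \<and> q2 = 1 + D * x) \<or> \<sigma> * p = lstar r \<and> \<sigma> * l = rstar r"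
    and b: "\<bar>l\<bar> \<le> 107/100" "\<bar>p\<bar> \<le> 107/100" and v: "v = h (lstar r) (rstar r)"
  shows "v \<le> h l p \<and> v \<le> h (- l) (- p) \<and> v \<le> h p l \<and> v \<le> h (- p) (- l)"
proof -
  note m = star_minimal[OF r, folded v]
  have c1: "v \<le> h (\<sigma> * l) (\<sigma> * p)"
    using lx
  proof
    assume "\<exists>x. \<bar>x\<bar> \<le> 107/100 \<and> l2 = 1 + D * x"
    then obtain x where x: "\<bar>x\<bar> \<le> 107/100" "l2 = 1 + D * x" by blast
    from m(3)[OF x(1) p(2)] show ?thesis unfolding l(1) p(1) x(2) .
  qed (use v in simp)
  have c2: "v \<le> h (\<sigma> * p) (\<sigma> * l)"
    using px
  proof
    assume "\<exists>x. \<bar>x\<bar> \<le> 107/100 \<and> q2 = 1 + D * x"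
    then obtain x where x: "\<bar>x\<bar> \<le> 107/100" "q2 = 1 + D * x" by blast
    from m(3)[OF x(1) l(2)] show ?thesis unfolding l(1) p(1) x(2) .
  qed (use v in simp)
  have tl: "\<bar>- (1 + D * t)\<bar> \<le> 107/100" if "\<bar>t\<bar> \<le> 107/100" for t
  proof -
    have "\<bar>D * t\<bar> \<le> (6/100) * (107/100)" unfolding abs_mult using that D_pos D_less by (intro mult_mono) auto
    then show ?thesis by linarith
  qed
  have nl: "- (\<sigma> * l) = 1 + D * (- (1 + D * l2))" "- (\<sigma> * p) = 1 + D * (- (1 + D * q2))" unfolding l(1) p(1) by (simp_all add: algebra_simps)
  have sb: "\<bar>- (\<sigma> * l)\<bar> \<le> 107/100" "\<bar>- (\<sigma> * p)\<bar> \<le> 107/100" using b \<sigma> by (auto simp: abs_mult)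
  have c3: "v \<le> h (- (\<sigma> * l)) (- (\<sigma> * p))" using m(1)[OF tl[OF l(2)] sb(2)] unfolding nl(1)[symmetric] .
  have c4: "v \<le> h (- (\<sigma> * p)) (- (\<sigma> * l))" using m(1)[OF tl[OF p(2)] sb(1)] unfolding nl(2)[symmetric] .
  from c1 c2 c3 c4 \<sigma> show ?thesis by auto
qed

text \<open>Going once around the period gives a linear equation for the deviation behind the
  defect, solved by \<open>rk k\<close>. The extremal cuts are at 3 and, mirrored and negated, at
  \<open>4 * k + 1\<close>; every other cut falls under \<open>star_minimal\<close>.\<close>

lemma vk_pattern: "is_pattern (vk k) (\<lambda>_. 0) (pk k)"
proof (cases "k = 0")
  case True
  then show ?thesis using vk_0_pattern by simp
next
  case False
  then obtain k' where k': "k = Suc k'" by (cases k) auto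
  define f where "f = pk k"
  define q where "q = 4 * k + 2"
  have fq: "f (i + q) = f i" for i unfolding f_def q_def by (rule pk_periodic)
  have sgn: "f i = 1 \<or> f i = - 1" for i unfolding f_def by (rule pk_sign)
  have q1: "q \<ge> 1" by (simp add: q_def)
  from signed_series[of "f" q, OF sgn fq q1]
  obtain L R :: "nat \<Rightarrow> real" where LR: "(\<forall>i. L (Suc i) = f i + D * L i) \<and> (\<forall>i. R i = f i + D * R (Suc i)) \<and>
    (\<forall>i. \<bar>L i\<bar> \<le> 107/100) \<and> (\<forall>i. \<bar>R i\<bar> \<le> 107/100) \<and> (\<forall>i. L (i + q) = L i) \<and> (\<forall>i. R (i + q) = R i)"
    by (elim exE)
  have L: "\<And>i. L (Suc i) = f i + D * L i" and R: "\<And>i. R i = f i + D * R (Suc i)"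
    and Lb: "\<And>i. \<bar>L i\<bar> \<le> 107/100" and Rb: "\<And>i. \<bar>R i\<bar> \<le> 107/100"
    and Lp: "\<And>i. L (i + q) = L i" and Rp: "\<And>i. R (i + q) = R i"
    using LR by blast+
  note pv = pk_values(1,2)[of k, folded f_def] pk_values(3-6)[of _ k, folded f_def]
  define r where "r = rk k"
  have r: "0 \<le> r" "r \<le> 3 * (D * D * D)" using rk_pos[of k] rk_Suc_less[of k'] by (auto simp: r_def k')
  have Lr: "L (i + 1) = f i + D * L i" for i using L[of i] by simp
  have Rr: "R i = f i + D * R (i + 1)" for i using R[of i] by simp
  have Lr': "L j = f i + D * L i" if "j = i + 1" for i j using L[of i] that by simp
  have Rr': "R i = f i + D * R j" if "j = i + 1" for i j using R[of i] that by simp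
  have f4: "f (4 + 2 * u) = (- 1) ^ u \<and> f (5 + 2 * u) = (- 1) ^ u" if u: "u + 2 \<le> 2 * k" for u
  proof (cases "even u")
    case True
    then obtain t where t: "u = 2 * t" by blast
    then have "t < k" using u by simp
    moreover have "4 + 2 * u = 4 * t + 4" "5 + 2 * u = 4 * t + 5" using t by auto
    ultimately show ?thesis using pv(5,6)[of t] neg_one_even_power[where ?'a=int, OF True] by (simp only: simp_thms)
  next
    case False
    then obtain t where t: "u = 2 * t + 1" by (metis oddE)
    then have "Suc t < k" using u by simp
    moreover have "4 + 2 * u = 4 * Suc t + 2" "5 + 2 * u = 4 * Suc t + 3" using t by auto
    ultimately show ?thesis using pv(3,4)[of "Suc t"] neg_one_odd_power[where ?'a=int, OF False] by (simp only: simp_thms)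
  qed
  have f2: "f (2 + 2 * u) = - ((- 1) ^ u) \<and> f (3 + 2 * u) = - ((- 1) ^ u)" if u: "u < 2 * k" for u
  proof (cases "even u")
    case True
    then obtain t where t: "u = 2 * t" by blast
    then have "t < k" using u by simp
    moreover have "2 + 2 * u = 4 * t + 2" "3 + 2 * u = 4 * t + 3" using t by auto
    ultimately show ?thesis using pv(3,4)[of t] neg_one_even_power[where ?'a=int, OF True] by (simp only: simp_thms)
  next
    case False
    then obtain t where t: "u = 2 * t + 1" by (metis oddE)
    then have "t < k" using u by simp
    moreover have "2 + 2 * u = 4 * t + 4" "3 + 2 * u = 4 * t + 5" using t by auto
    ultimately show ?thesis using pv(5,6)[of t] neg_one_odd_power[where ?'a=int, OF False] by (simp only: simp_thms minus_minus)
  qed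
  have Rch: "R 4 - w = (- (D * D)) ^ u * ((- 1) ^ u * R (4 + 2 * u) - w)" if "u + 1 \<le> 2 * k" for u
    using that
  proof (induction u)
    case (Suc u)
    have e: "R (4 + 2 * u) = (- 1) ^ u + D * ((- 1) ^ u + D * R (4 + 2 * Suc u))"
      using Rr'[of "5 + 2 * u" "4 + 2 * u"] Rr'[of "4 + 2 * Suc u" "5 + 2 * u"] f4[of u] Suc.prems by simp
    have s: "(- 1 :: real) ^ u * (- 1) ^ u = 1" by (simp flip: power_mult_distrib)
    have "(- 1) ^ u * R (4 + 2 * u) = (- 1) ^ u * (- 1) ^ u + D * ((- 1) ^ u * (- 1) ^ u + D * ((- 1) ^ u * R (4 + 2 * Suc u)))"
      unfolding e by (simp add: algebra_simps)
    then have "(- 1) ^ u * R (4 + 2 * u) = 1 + D * (1 + D * ((- 1) ^ u * R (4 + 2 * Suc u)))" unfolding s .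
    then have "(- 1) ^ u * R (4 + 2 * u) - w = 1 + D * (1 + D * ((- 1) ^ u * R (4 + 2 * Suc u))) - (1 + D - D * D * w)"
      using w_eq by linarith
    also have "\<dots> = - (D * D) * ((- 1) ^ Suc u * R (4 + 2 * Suc u) - w)" by (simp add: algebra_simps)
    finally have "(- 1) ^ u * R (4 + 2 * u) - w = - (D * D) * ((- 1) ^ Suc u * R (4 + 2 * Suc u) - w)" .
    then show ?case using Suc by simp
  qed simp
  have Lch: "(- 1) ^ u * L (2 + 2 * u) - w = (- (D * D)) ^ u * (L 2 - w)" if "u \<le> 2 * k" for u
    using that
  proof (induction u)
    case (Suc u)
    have e: "L (2 + 2 * Suc u) = - ((- 1) ^ u) + D * (- ((- 1) ^ u) + D * L (2 + 2 * u))"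
      using Lr'[of "3 + 2 * u" "2 + 2 * u"] Lr'[of "2 + 2 * Suc u" "3 + 2 * u"] f2[of u] Suc.prems by simp
    have s: "(- 1 :: real) ^ u * (- 1) ^ u = 1" by (simp flip: power_mult_distrib)
    have "(- 1) ^ Suc u * L (2 + 2 * Suc u)
      = (- 1) ^ u * (- 1) ^ u + D * ((- 1) ^ u * (- 1) ^ u - D * ((- 1) ^ u * L (2 + 2 * u)))"
      unfolding e by (simp add: algebra_simps)
    then have "(- 1) ^ Suc u * L (2 + 2 * Suc u) = 1 + D * (1 - D * ((- 1) ^ u * L (2 + 2 * u)))" unfolding s .
    then have "(- 1) ^ Suc u * L (2 + 2 * Suc u) - w = 1 + D * (1 - D * ((- 1) ^ u * L (2 + 2 * u))) - (1 + D - D * D * w)"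
      using w_eq by linarith
    also have "\<dots> = - (D * D) * ((- 1) ^ u * L (2 + 2 * u) - w)" by (simp add: algebra_simps)
    finally show ?case using Suc by simp
  qed simp
  have odd1: "odd (2 * k - 1)" "2 * k - 1 + 1 = 2 * k" "2 * k - 1 \<le> 2 * k" using False by auto
  define P where "P = (D * D) ^ (2 * k - 1)"
  have PP: "D * D * P = D ^ (4 * k)"
  proof -
    have "D * D * P = (D * D) ^ (2 * k)" unfolding P_def using False by (cases k) auto
    also have "\<dots> = D ^ (4 * k)" by (simp add: power_mult power2_eq_square[symmetric] flip: power_mult)
    finally show ?thesis .
  qed
  have P0: "P > 0" using D_pos by (simp add: P_def)
  have P1: "1 - D * D * (D * D * P) > 0"
    using D_pow_less[of k] unfolding PP by (simp add: power_add power2_eq_square mult.commute)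
  have rP: "r * (1 - D * D * (D * D * P)) = P * c0"
  proof -
    have e: "D ^ (4 * k + 2) = D * D * (D * D * P)" unfolding PP by (simp add: power_add power2_eq_square mult.commute)
    have "r = (D * D * P) * c0 / (D * D * (1 - D * D * (D * D * P)))" unfolding r_def rk_def e PP[symmetric] ..
    also have "\<dots> = (D * D) * (P * c0) / ((D * D) * (1 - D * D * (D * D * P)))" by (simp only: mult.assoc)
    also have "\<dots> = P * c0 / (1 - D * D * (D * D * P))" using D_pos by (intro mult_divide_mult_cancel_left) simp
    finally show ?thesis using P1 by simp
  qed
  have f01: "f 0 = - 1" "f 1 = 1" "f 2 = - 1" "f 3 = - 1" using pv(1,2) pv(3,4)[of 0, unfolded mult_0_right add_0] False by blast+
  have R0: "R 0 = - 1 + D * (1 + D * (- 1 + D * (- 1 + D * R 4)))"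
    using Rr'[of 1 0] Rr'[of 2 1] Rr'[of 3 2] Rr'[of 4 3] f01 by simp
  have L2: "L 2 = 1 + D * (- 1 + D * L 0)" using Lr'[of 1 0] Lr'[of 2 1] f01 by simp
  have w4: "D * D * w = 1 + D - w" using w_eq by linarith
  \<comment> \<open>The deviation \<open>t\<close> is carried through \<open>2 * k - 1\<close>
    blocks and one defect back to itself, which gives
    \<open>t = P * (c0 + D * D * (D * D * t))\<close>.\<close>
  have R4: "R 4 = w + r"
  proof -
    define t where "t = R 4 - w"
    have "4 + 2 * (2 * k - 1) = 0 + q" using False by (simp add: q_def)
    then have e: "R (4 + 2 * (2 * k - 1)) = R 0" using Rp[of 0] by (simp only:)
    have "t = (- (D * D)) ^ (2 * k - 1) * ((- 1) ^ (2 * k - 1) * R 0 - w)"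
      unfolding t_def by (rule Rch[of "2 * k - 1", unfolded odd1(2) e, OF order_refl])
    then have "t = - P * (- R 0 - w)" using odd1(1) by (simp add: P_def)
    moreover have "- R 0 - w = - (c0 + D * D * (D * D * t))"
    proof -
      have "R 4 = w + t" by (simp add: t_def)
      then have "- R 0 - w = 1 - D + D * D + D * (D * D) - D * D * (D * D * w) - w - D * D * (D * D * t)"
        unfolding R0 by (simp add: algebra_simps)
      moreover have "D * D * (D * D * w) = D * D * (1 + D - w)" by (simp only: w4)
      then have "D * D * (D * D * w) = D * D + D * (D * D) - D * D * w" by (simp add: algebra_simps)
      ultimately show ?thesis using w4 unfolding c0_def by linarith
    qed
    ultimately have "t = P * (c0 + D * D * (D * D * t))" by (simp only: minus_mult_minus)
    then have "t * (1 - D * D * (D * D * P)) = P * c0" by (simp add: algebra_simps)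
    then have "t * (1 - D * D * (D * D * P)) = r * (1 - D * D * (D * D * P))" using rP by simp
    then have "t = r" using P1 by simp
    then show ?thesis by (simp add: t_def)
  qed
  define m where "m = L 2 - w"
  have Lq: "L 0 - w = (D * D * P) * m"
  proof -
    have "2 + 2 * (2 * k) = 0 + q" by (simp add: q_def)
    then have e: "L (2 + 2 * (2 * k)) = L 0" using Lp[of 0] by (simp only:)
    have "(- 1) ^ (2 * k) * L 0 - w = (- (D * D)) ^ (2 * k) * m"
      unfolding m_def by (rule Lch[of "2 * k", unfolded e, OF order_refl])
    moreover have "(- (D * D)) ^ (2 * k) = D * D * P" unfolding P_def using False by (cases k) auto
    ultimately show ?thesis by simp
  qed
  have m_r: "P * m = - r"
  proof -
    have l0: "L 0 = w + D * D * P * m" using Lq by linarith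
    have "m = 1 + D * (- 1 + D * L 0) - w" using L2 by (simp add: m_def)
    then have "m = 1 + D * (- 1 + D * (w + D * D * P * m)) - w" unfolding l0 .
    then have "m * (1 - D * D * (D * D * P)) = 1 - D + D * D * w - w" by (simp add: algebra_simps)
    also have "\<dots> = - c0" unfolding c0_def w4 by simp
    finally have e: "m * (1 - D * D * (D * D * P)) = - c0" .
    have "(P * m) * (1 - D * D * (D * D * P)) = - (P * c0)" unfolding mult.assoc[of P m] e by simp
    also have "\<dots> = - r * (1 - D * D * (D * D * P))" using rP by simp
    finally show ?thesis using P1 by (metis less_irrefl mult_right_cancel)
  qed
  have L0: "L 0 = w - D * D * r" using Lq m_r unfolding mult.assoc[of "D * D" P] by simp
  have L3: "L 3 = lstar r"
  proof -
    have "L 3 = - 1 + D * L 2" using Lr'[of 3 2] f01 by simp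
    then show ?thesis unfolding L2 L0 lstar_def by (simp add: algebra_simps)
  qed
  have R3: "R 3 = rstar r" using Rr'[of 4 3] f01 R4 unfolding rstar_def by simp
  have "k' < k" "4 * k' + 5 = 4 * k + 1" "4 * k' + 4 = 4 * k" using k' by auto
  then have fe: "f (4 * k + 1) = 1" "f (4 * k) = 1" using pv(5,6)[of k'] by (simp_all only:)
  have Rl: "- R (4 * k + 1) = lstar r"
  proof -
    have "4 * k + 1 + 1 = 0 + q" by (simp add: q_def)
    then have "R (4 * k + 1) = 1 + D * R (0 + q)" using Rr[of "4 * k + 1"] fe(1) by (simp only: of_int_1)
    then have "R (4 * k + 1) = 1 + D * R 0" unfolding Rp .
    then have 1: "- R (4 * k + 1) = - 1 + D - D * D + D * D * D + D * D * D * D - D * (D * D * (D * D * w)) - D * D * D * (D * D * r)"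
      unfolding R0 R4 by (simp add: algebra_simps)
    have "D * (D * D * (D * D * w)) = D * D * D * (1 + D - w)" unfolding w4 by (simp add: algebra_simps)
    then have 2: "D * (D * D * (D * D * w)) = D * D * D + D * D * D * D - D * D * D * w" by (simp add: algebra_simps)
    have "lstar r = - 1 + D - D * D + D * D * D * w - D * D * D * (D * D * r)" unfolding lstar_def by (simp add: algebra_simps)
    then show ?thesis using 1 2 by linarith
  qed
  have Ll: "- L (4 * k + 1) = rstar r"
  proof -
    have e: "2 + 2 * (2 * k - 1) = 4 * k" using False by simp
    have "(- 1) ^ (2 * k - 1) * L (4 * k) - w = (- (D * D)) ^ (2 * k - 1) * m"
      unfolding m_def by (rule Lch[of "2 * k - 1", unfolded e, OF odd1(3)])
    then have "- L (4 * k) - w = - P * m" using odd1(1) by (simp add: P_def)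
    then have "- L (4 * k) = w + r" using m_r by simp
    moreover have "L (4 * k + 1) = 1 + D * L (4 * k)" using Lr[of "4 * k"] fe(2) by (simp only: of_int_1)
    ultimately have "L (4 * k + 1) = 1 + D * - (w + r)" by (metis minus_minus)
    then show ?thesis unfolding rstar_def by (simp add: algebra_simps)
  qed
  have v: "vk k = h (lstar r) (rstar r)" by (simp add: vk_def r_def)
  define good where "good i \<longleftrightarrow> vk k \<le> h (L i) (R i) \<and> vk k \<le> h (- L i) (- R i) \<and> vk k \<le> h (R i) (L i) \<and> vk k \<le> h (- R i) (- L i)" for i
  have opp: "good j" if j: "j = i + 1" and fj: "f j = - f i" for i j
    unfolding good_def
  proof (rule four_cuts_opposite[OF r _ _ Lb _ Rb Lb Rb v])
    show "real_of_int (f i) = 1 \<or> real_of_int (f i) = - 1" using pk_sign[of k i] by (auto simp: f_def)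
    show "L j = f i + D * L i" unfolding j by (rule Lr)
    show "R j = - real_of_int (f i) + D * R (j + 1)" using Rr[of j] fj by simp
  qed
  have neg_b: "\<bar>- x\<bar> \<le> 107/100" if "\<bar>x\<bar> \<le> 107/100" for x :: real using that by simp
  have minus: "good (4 * t + 3)" if t: "t < k" for t
    unfolding good_def
  proof (rule four_cuts_block[OF r, of 1 _ "L (4 * t + 1)" _ "R (4 * t + 5)"])
    have Lpos: "f (4 * t + 1) = 1"
    proof (cases t)
      case (Suc t')
      then have "t' < k" "4 * t + 1 = 4 * t' + 5" using t by auto
      then show ?thesis using pv(6)[of t'] by (simp only:)
    qed (use pv(2) in simp)
    have l: "L (4 * t + 3) = - 1 + D * L (4 * t + 2)" "L (4 * t + 2) = 1 + D * L (4 * t + 1)"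
      using Lr'[of "4 * t + 3" "4 * t + 2"] Lr'[of "4 * t + 2" "4 * t + 1"] pv(3)[OF t] Lpos by simp_all
    show "1 * L (4 * t + 3) = - 1 + D * (1 + D * L (4 * t + 1))" unfolding l by simp
    have r3: "R (4 * t + 3) = - 1 + D * R (4 * t + 4)" "R (4 * t + 4) = 1 + D * R (4 * t + 5)"
      "R (4 * t + 5) = 1 + D * R (4 * t + 6)"
      using Rr'[of "4 * t + 4" "4 * t + 3"] Rr'[of "4 * t + 5" "4 * t + 4"] Rr'[of "4 * t + 6" "4 * t + 5"] pv(4-6)[OF t] by simp_all
    show "1 * R (4 * t + 3) = - 1 + D * (1 + D * R (4 * t + 5))" unfolding r3(1,2) by simp
    show "(\<exists>x. \<bar>x\<bar> \<le> 107/100 \<and> R (4 * t + 5) = 1 + D * x) \<or> 1 * R (4 * t + 3) = lstar r \<and> 1 * L (4 * t + 3) = rstar r"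
      using r3(3) Rb[of "4 * t + 6"] by blast
    show "(\<exists>x. \<bar>x\<bar> \<le> 107/100 \<and> L (4 * t + 1) = 1 + D * x) \<or> 1 * L (4 * t + 3) = lstar r \<and> 1 * R (4 * t + 3) = rstar r"
    proof (cases t)
      case 0
      then show ?thesis using L3 R3 by simp
    next
      case (Suc t')
      then have "t' < k" "4 * t = 4 * t' + 4" using t by auto
      then have "f (4 * t) = 1" using pv(5)[of t'] by (simp only:)
      then have "L (4 * t + 1) = 1 + D * L (4 * t)" using Lr[of "4 * t"] by (simp only: of_int_1)
      then show ?thesis using Lb by blast
    qed
  qed (use Lb Rb v in auto)
  have plus: "good (4 * t + 5)" if t: "t < k" for t
    unfolding good_def
  proof (rule four_cuts_block[OF r, of "- 1" _ "- L (4 * t + 3)" _ "- R (4 * t + 7)"])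
    have l: "L (4 * t + 5) = 1 + D * L (4 * t + 4)" "L (4 * t + 4) = - 1 + D * L (4 * t + 3)" "L (4 * t + 3) = - 1 + D * L (4 * t + 2)"
      using Lr'[of "4 * t + 5" "4 * t + 4"] Lr'[of "4 * t + 4" "4 * t + 3"] Lr'[of "4 * t + 3" "4 * t + 2"] pv(3-5)[OF t] by simp_all
    show "- 1 * L (4 * t + 5) = - 1 + D * (1 + D * - L (4 * t + 3))" unfolding l(1,2) by (simp add: algebra_simps)
    have "- L (4 * t + 3) = 1 + D * - L (4 * t + 2)" unfolding l(3) by simp
    then show "(\<exists>x. \<bar>x\<bar> \<le> 107/100 \<and> - L (4 * t + 3) = 1 + D * x) \<or> - 1 * L (4 * t + 5) = lstar r \<and> - 1 * R (4 * t + 5) = rstar r"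
      using neg_b[OF Lb] by blast
    have f6: "f (4 * t + 6) = - 1"
    proof (cases "Suc t = k")
      case True
      then have "4 * t + 6 = 0 + q" by (simp add: q_def)
      then show ?thesis using fq[of 0] f01 by metis
    next
      case False
      then have "Suc t < k" using t by simp
      moreover have "4 * Suc t + 2 = 4 * t + 6" by simp
      ultimately show ?thesis using pv(3)[of "Suc t"] by metis
    qed
    have r5: "R (4 * t + 5) = 1 + D * R (4 * t + 6)" "R (4 * t + 6) = - 1 + D * R (4 * t + 7)"
      using Rr'[of "4 * t + 6" "4 * t + 5"] Rr'[of "4 * t + 7" "4 * t + 6"] pv(6)[OF t] f6 by simp_all
    show "- 1 * R (4 * t + 5) = - 1 + D * (1 + D * - R (4 * t + 7))" unfolding r5 by (simp add: algebra_simps)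
    show "(\<exists>x. \<bar>x\<bar> \<le> 107/100 \<and> - R (4 * t + 7) = 1 + D * x) \<or> - 1 * R (4 * t + 5) = lstar r \<and> - 1 * L (4 * t + 5) = rstar r"
    proof (cases "Suc t = k")
      case True
      then have e: "4 * k + 1 = 4 * t + 5" by simp
      show ?thesis using Rl Ll unfolding e mult_minus1 by blast
    next
      case False
      then have "Suc t < k" using t by simp
      moreover have "4 * Suc t + 3 = 4 * t + 7" by simp
      ultimately have "f (4 * t + 7) = - 1" using pv(4)[of "Suc t"] by metis
      then have "- R (4 * t + 7) = 1 + D * - R (4 * t + 8)" using Rr'[of "4 * t + 8" "4 * t + 7"] by simp
      then show ?thesis using neg_b[OF Rb] by blast
    qed
  qed (use Lb Rb v in auto)
  have good_q: "good (q + j)" if j: "j < q" for j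
  proof -
    have gp: "good (i + q) \<longleftrightarrow> good i" for i unfolding good_def Lp Rp ..
    have G: "good j" if "j \<ge> 1"
    proof -
      have "\<exists>t \<rho>. j = 4 * t + 3 + \<rho> \<and> \<rho> < 4" if "j \<ge> 3"
      proof (intro exI conjI)
        have "(j - 3) div 4 * 4 + (j - 3) mod 4 = j - 3" by (rule div_mult_mod_eq)
        then show "j = 4 * ((j - 3) div 4) + 3 + (j - 3) mod 4" using that by linarith
      qed simp
      moreover have "j = 1 \<or> j = 2 \<or> j \<ge> 3" using that by arith
      ultimately consider "j = 1" | "j = 2" | t \<rho> where "j = 4 * t + 3 + \<rho>" "\<rho> < 4" by blast
      then show ?thesis
      proof cases
        case 1
        have f: "f 1 = - f 0" unfolding f01 by (rule minus_minus[symmetric])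
        have "(1::nat) = 0 + 1" by simp
        from opp[OF this f] show ?thesis unfolding 1 .
      next
        case 2
        have f: "f 2 = - f 1" unfolding f01 ..
        have "(2::nat) = 1 + 1" by simp
        from opp[OF this f] show ?thesis unfolding 2 .
      next
        case (3 t \<rho>)
        have t: "t < k" using 3 j by (simp add: q_def)
        consider "\<rho> = 0" | "\<rho> = 1" | "\<rho> = 2" | "\<rho> = 3" using 3 by linarith
        then show ?thesis
        proof cases
          case 1
          then have jt: "j = 4 * t + 3" using 3 by simp
          show ?thesis unfolding jt by (rule minus[OF t])
        next
          case 2
          then have jt: "j = 4 * t + 4" "4 * t + 4 = 4 * t + 3 + 1" using 3 by simp_all
          have "f (4 * t + 4) = - f (4 * t + 3)" unfolding pv(4,5)[OF t] by simp
          then show ?thesis unfolding jt(1) by (rule opp[OF jt(2)])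
        next
          case rho: 3
          then have jt: "j = 4 * t + 5" using 3 by simp
          show ?thesis unfolding jt by (rule plus[OF t])
        next
          case 4
          then have jt: "j = 4 * Suc t + 2" "4 * Suc t + 2 = 4 * t + 5 + 1" using 3 by simp_all
          then have t': "Suc t < k" using j by (simp add: q_def)
          have "f (4 * Suc t + 2) = - f (4 * t + 5)" unfolding pv(3)[OF t'] pv(6)[OF t] ..
          then show ?thesis unfolding jt(1) by (rule opp[OF jt(2)])
        qed
      qed
    qed
    show ?thesis
    proof (cases "j = 0")
      case False
      then have "good j" using G by simp
      then show ?thesis using gp[of j] unfolding add.commute[of q j] by blast
    next
      case True
      have e: "0 + q = 4 * k + 1 + 1" by (simp add: q_def)
      have "f (0 + q) = - f (4 * k + 1)" unfolding fq f01 fe(1) ..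
      then have "good (0 + q)" by (rule opp[OF e])
      then show ?thesis unfolding True by (simp only: add_0 add_0_right)
    qed
  qed
  have good_all: "good i" if i: "i \<ge> q" for i
  proof -
    have gp: "good (i + q) = good i" for i unfolding good_def Lp Rp ..
    define n m where "n = (i - q) div q" and "m = (i - q) mod q"
    have "n * q + m = i - q" unfolding n_def m_def by (rule div_mult_mod_eq)
    then have im: "i = (q + m) + n * q" using i by linarith
    have "m < q" unfolding m_def using q1 by simp
    then have "good (q + m)" by (rule good_q)
    then show ?thesis unfolding im periodic_shift[of good q, OF gp] .
  qed
  show ?thesis unfolding f_def[symmetric]
  proof (rule is_pattern_signs[where L = L and R = R and K = q, OF L R Lb Rb _ vk_le_1])
    show "0 < vk k" using vk_gt_delta_inf[of k] theta_less_delta_inf theta_gt by simp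
    fix i
    assume "q \<le> i"
    then show "vk k \<le> h (L i) (R i) \<and> vk k \<le> h (- L i) (- R i) \<and> vk k \<le> h (R i) (L i) \<and> vk k \<le> h (- R i) (- L i)"
      using good_all unfolding good_def by blast
  next
    show "\<exists>\<^sub>F i in sequentially. h (L i) (R i) = vk k"
    proof (rule frequently_periodic[of _ q 3])
      show "h (L 3) (R 3) = vk k" unfolding L3 R3 v ..
      show "h (L i) (R i) = vk k \<Longrightarrow> h (L (i + q)) (R (i + q)) = vk k" for i unfolding Lp Rp .
    qed (simp add: q_def)
  qed
qed

subsection \<open>The pattern of blocks of length two\<close>

text \<open>Both tails at the cut inside a block of \<open>++--++--...\<close> are equal to
  \<open>RI\<close> up to a common sign.\<close>

definition vb :: real where "vb = h (- (1 - D * w)) (- (1 - D * w))"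

lemma vb_aux: "D * w < 7/100" "0 < D * w"
proof -
  have "D * w < (6/100) * (107/100)" using D_less D_pos w_bounds by (intro mult_strict_mono) auto
  then show "D * w < 7/100" by simp
  show "0 < D * w" using D_pos w_bounds by simp
qed

lemma vb_le: "vb \<le> h w (- w)" "vb \<le> h (- w) w" "vb \<le> h (1 - D * w) (1 - D * w)" "vb \<le> vk 0"
proof -
  have DE: "D \<le> (212/1000) * \<eta>" unfolding D_eq using beta_less eta_pos by simp
  have g: "- 1 \<le> - (1 - D * w)" "- (1 - D * w) \<le> 1" using vb_aux by linarith+
  have g': "\<bar>1 - D * w\<bar> \<le> 12/10" using vb_aux by linarith
  show "vb \<le> h w (- w)" unfolding vb_def
    by (rule h_ge_left[of _ 1]) (use vb_aux w_bounds g D_less in auto)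
  have x1: "- (1 - D * w) - \<eta> * 1 / 2 \<le> - w" using w_bounds vb_aux DE D_pos
  proof -
    have "D * w \<le> D * (107/100)" using w_bounds D_pos by (intro mult_left_mono) auto
    then show ?thesis using w_bounds DE D_pos by linarith
  qed
  show "vb \<le> h (- w) w" unfolding vb_def
    by (rule h_ge_right[of _ 1]) (use vb_aux w_bounds g x1 D_less in auto)
  show "vb \<le> h (1 - D * w) (1 - D * w)" unfolding vb_def
    by (rule h_ge_left[of _ 1]) (use vb_aux w_bounds g g' D_less in auto)
  define u where "u = 1 / (1 + D)"
  have i: "0 < u" "u \<le> 1" using D_pos by (auto simp: u_def)
  have x2: "- (1 - D * w) - \<eta> * (1/2) / 2 \<le> - u"
  proof -
    have "D * w \<le> D * (107/100)" using w_bounds D_pos by (intro mult_left_mono) auto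
    then show ?thesis using i DE D_pos by linarith
  qed
  have "vb \<le> h (- u) u" unfolding vb_def
    by (rule h_ge_right[of _ "1/2"]) (use vb_aux i g x2 in auto)
  then show "vb \<le> vk 0" unfolding vk_def vk_0 u_def .
qed

lemma vb_gt_delta_inf: "vb > delta_inf a b"
proof -
  have r: "- (1 - D * w) = RI" by (simp add: RI_def)
  have "LI + 2 * (D * D) * (1 - D * w) = - 1 + D + D * D - D * D * D * w" unfolding LI_def by (simp add: algebra_simps)
  moreover have "D * w = D * (1 + D - D * D * w)" by (subst w_eq) simp
  then have "D * w = D + D * D - D * D * D * w" by (simp add: algebra_simps)
  ultimately have l: "RI - LI = 2 * (D * D) * (1 - D * w)" unfolding RI_def by linarith
  then have "RI - LI > 0" using vb_aux D_pos by simp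
  moreover have "1 - \<eta> + D * RI > 0" using factor_bounds(1)[of RI] RI_bounds by simp
  moreover have "vb - delta_inf a b = \<beta> * ((RI - LI) * (1 - \<eta> + D * RI))"
    unfolding vb_def delta_inf_eq r h_diff by simp
  ultimately have "vb - delta_inf a b > 0" using beta_pos by simp
  then show ?thesis by simp
qed

lemma pblocks_pattern: "is_pattern vb (\<lambda>_. 0) pblocks"
proof -
  define g where "g = 1 - D * w"
  define L where "L i = (if i mod 4 = 0 then - w else if i mod 4 = 1 then g else if i mod 4 = 2 then w else - g)" for i :: nat
  define R where "R i = (if i mod 4 = 0 then w else if i mod 4 = 1 then g else if i mod 4 = 2 then - w else - g)" for i :: nat
  have c: "i mod 4 = 0 \<or> i mod 4 = 1 \<or> i mod 4 = 2 \<or> i mod 4 = 3" for i :: nat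
    using mod_less_divisor[of 4 i] by linarith
  have w: "w = 1 + D * g" using w_eq by (simp add: g_def algebra_simps)
  have wg: "\<bar>w\<bar> \<le> 107/100" "\<bar>g\<bar> \<le> 107/100" unfolding g_def using w_bounds vb_aux by linarith+
  show ?thesis
  proof (rule is_pattern_signs[where L = L and R = R and K = 0])
    fix i
    have s: "Suc i mod 4 = (if i mod 4 = 3 then 0 else Suc (i mod 4))" by (simp add: mod_Suc)
    show "L (Suc i) = pblocks i + D * L i"
      using c[of i] by (elim disjE; simp add: L_def pblocks_def s; use w g_def in linarith)
    show "R i = pblocks i + D * R (Suc i)"
      using c[of i] by (elim disjE; simp add: R_def pblocks_def s; use w g_def in linarith)
    show "\<bar>L i\<bar> \<le> 107/100" "\<bar>R i\<bar> \<le> 107/100" using wg by (auto simp: L_def R_def)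
    show "vb \<le> h (L i) (R i) \<and> vb \<le> h (- L i) (- R i) \<and> vb \<le> h (R i) (L i) \<and> vb \<le> h (- R i) (- L i)"
      using c[of i] vb_le by (auto simp: L_def R_def g_def vb_def)
  next
    show "0 < vb" using vb_gt_delta_inf theta_less_delta_inf theta_gt by simp
    show "vb \<le> 1" using vb_le(4) vk_le_1[of 0] by simp
    show "\<exists>\<^sub>F i in sequentially. h (L i) (R i) = vb"
    proof (rule frequently_periodic[of _ 4 3])
      show "h (L i) (R i) = vb \<Longrightarrow> h (L (i + 4)) (R (i + 4)) = vb" for i
        unfolding L_def R_def mod_add_self2 .
      show "h (L 3) (R 3) = vb" by (simp add: L_def R_def vb_def g_def)
    qed simp
  qed
qed

subsection \<open>The constant pattern\<close>

text \<open>The fixed point of \<open>x = \<beta> * (3 + \<eta> * (x - 2))\<close>, the common value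
  of both tails in the constant pattern. \<open>v2\<close> can omit \<open>p2\<close>, which exceeds
  \<open>p1\<close> because \<open>X2 > 0 > Y2\<close>.\<close>

definition X2 :: real where "X2 = \<beta> * (3 - 2 * \<eta>) / (1 - D)"
definition Y2 :: real where "Y2 = \<eta> * (- 2 + X2)"
definition v2 :: real where "v2 = min (p1 X2 Y2) (min (p3 X2 Y2) (p4 X2 Y2))"

lemma X2: "(1 - D) * X2 = 3 * \<beta> - 2 * D"
proof -
  have "(1 - D) * X2 = \<beta> * (3 - 2 * \<eta>)" unfolding X2_def using D_less by simp
  then show ?thesis by (simp add: D_eq algebra_simps)
qed

lemma Y2: "(1 - D) * Y2 = 3 * D - 2 * \<eta>"
proof -
  have "(1 - D) * Y2 = \<eta> * ((1 - D) * X2) - 2 * \<eta> * (1 - D)" unfolding Y2_def by (simp add: algebra_simps)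
  then show ?thesis unfolding X2 by (simp add: D_eq algebra_simps)
qed

lemma scaled_vertices:
  "(1 - D) * (1 - D) * p1 X2 Y2 = (1 + 2 * \<beta> - 3 * D + \<beta> * D) * (1 - 3 * \<eta> + 2 * D + \<eta> * D)"
  "(1 - D) * (1 - D) * p3 X2 Y2 = (1 - 2 * \<beta> + D - \<beta> * D) * (1 - \<eta> + 2 * D - \<eta> * D)"
  "(1 - D) * (1 - D) * p4 X2 Y2 = (1 - 4 * \<beta> + D + \<beta> * D) * (1 + \<eta> - 4 * D + \<eta> * D)"
proof -
  have e: "(1 - D) * (1 - D) * (t * u) = ((1 - D) * t) * ((1 - D) * u)" for t u :: real by simp
  have f: "(1 - D) * (1 - \<beta> + X2) = 1 + 2 * \<beta> - 3 * D + \<beta> * D" "(1 - D) * (1 - \<eta> + Y2) = 1 - 3 * \<eta> + 2 * D + \<eta> * D"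
    "(1 - D) * (1 + \<beta> - X2) = 1 - 2 * \<beta> + D - \<beta> * D" "(1 - D) * (1 + \<eta> + Y2) = 1 - \<eta> + 2 * D - \<eta> * D"
    "(1 - D) * (1 - \<beta> - X2) = 1 - 4 * \<beta> + D + \<beta> * D" "(1 - D) * (1 - \<eta> - Y2) = 1 + \<eta> - 4 * D + \<eta> * D"
    using X2 Y2 by (simp_all add: algebra_simps)
  show "(1 - D) * (1 - D) * p1 X2 Y2 = (1 + 2 * \<beta> - 3 * D + \<beta> * D) * (1 - 3 * \<eta> + 2 * D + \<eta> * D)"
    "(1 - D) * (1 - D) * p3 X2 Y2 = (1 - 2 * \<beta> + D - \<beta> * D) * (1 - \<eta> + 2 * D - \<eta> * D)"
    "(1 - D) * (1 - D) * p4 X2 Y2 = (1 - 4 * \<beta> + D + \<beta> * D) * (1 + \<eta> - 4 * D + \<eta> * D)"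
    unfolding p1_def p3_def p4_def e f by (rule refl)+
qed

lemma X2_Y2_bounds: "0 < X2" "X2 < 1 - \<beta>" "Y2 < 0" "- Y2 < 1 - \<eta>"
proof -
  have n: "1 - D > 0" using D_less by simp
  have b1: "D \<le> \<beta> * (265/1000)" unfolding D_eq using eta_less beta_pos by (simp add: mult.commute)
  have "(1 - D) * X2 > 0" unfolding X2 using b1 beta_pos by linarith
  then show X0: "0 < X2" using n by (simp add: zero_less_mult_iff)
  have bD: "\<beta> * D > 0" using beta_pos D_pos by simp
  have "(1 - D) * X2 < (1 - D) * (1 - \<beta>)" unfolding X2 using beta_less D_pos bD by (simp add: algebra_simps)
  then show X1: "X2 < 1 - \<beta>" using n by (simp only: mult_less_cancel_left_pos)
  have "X2 < 2" using X1 beta_pos by simp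
  then show "Y2 < 0" unfolding Y2_def using eta_pos by (simp add: mult_pos_neg)
  have "\<eta> * X2 > 0" using X0 eta_pos by simp
  then show "- Y2 < 1 - \<eta>" unfolding Y2_def using eta_less by (simp add: algebra_simps)
qed

lemma v2_pattern: "is_pattern v2 (\<lambda>_. - 2) (\<lambda>_. 3)"
proof -
  note b = X2_Y2_bounds
  have pos: "p1 X2 Y2 > 0" "p3 X2 Y2 > 0" "p4 X2 Y2 > 0"
    unfolding p1_def p3_def p4_def using b beta_pos eta_pos by (auto intro!: mult_pos_pos)
  then have v: "v2 > 0" by (simp add: v2_def)
  have "p1 X2 Y2 \<le> p2 X2 Y2" unfolding p1_def p2_def using b beta_pos eta_pos by (intro mult_mono) auto
  then have "half_node v2 X2 Y2" unfolding half_node_def v2_def using b by auto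
  then have n: "node v2 X2 X2 (- 2)" unfolding node_def Y2_def by simp
  have "(1 - D) * X2 + D * X2 = 3 * \<beta> - 2 * D + D * X2" unfolding X2 ..
  then have X: "X2 = \<beta> * (3 + \<eta> * (- 2 + X2))" by (simp add: D_eq algebra_simps)
  have "\<exists>p\<in>{p1, p2, p3, p4}. p X2 Y2 = v2" unfolding v2_def by (auto simp: min_def)
  then obtain p where p: "p \<in> {p1, p2, p3, p4}" "p X2 Y2 = v2" by blast
  show ?thesis unfolding is_pattern_def
  proof (rule conjI[OF v], rule exI[of _ "\<lambda>_. X2"], rule exI[of _ "\<lambda>_. X2"], rule exI[of _ 0],
      rule exI[of _ "\<bar>X2\<bar>"], intro conjI allI impI bexI[OF _ p(1)])
    show "X2 = \<beta> * (real_of_int 3 + \<eta> * (real_of_int (- 2) + X2))" 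
      "X2 = \<beta> * (real_of_int 3 + \<eta> * (real_of_int (- 2) + X2))" using X by simp_all
    show "node v2 X2 X2 (- 2)" by (rule n)
    show "\<exists>\<^sub>F i in sequentially. \<bar>p X2 (\<eta> * (real_of_int (- 2) + X2))\<bar> = v2"
      using p(2) v unfolding Y2_def by simp
  qed simp
qed

subsection \<open>Comparison of the values\<close>

text \<open>Replacing \<open>\<eta> * \<beta>\<close> by \<open>D\<close> makes every difference
  below linear in these monomials; together with \<open>times_small\<close> they are the facts from
  which linear arithmetic decides the sign.\<close>

lemma monomials_pos:
  "0 < D * \<beta>" "0 < D * \<eta>" "0 < D * D" "0 < D * D * \<beta>" "0 < D * D * \<eta>" "0 < D * D * D"
  "0 < D * D * D * \<beta>" "0 < D * D * D * \<eta>" "0 < D * D * D * D" "0 < D * D * D * D * \<beta>" "0 < D * D * D * D * \<eta>"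
  "0 < D * D * D * D * D" "0 < D * D * D * D * D * \<beta>"
  using D_pos beta_pos eta_pos by simp_all

lemma times_small:
  assumes "0 < t"
  shows "t * D \<le> (6/100) * t" "t * \<beta> \<le> (212/1000) * t" "t * \<eta> \<le> (265/1000) * t"
proof -
  have "t * D \<le> t * (6/100)" "t * \<beta> \<le> t * (212/1000)" "t * \<eta> \<le> t * (265/1000)"
    using assms D_less beta_less eta_less by (simp_all only: mult_le_cancel_left_pos less_imp_le)
  then show "t * D \<le> (6/100) * t" "t * \<beta> \<le> (212/1000) * t" "t * \<eta> \<le> (265/1000) * t" by (simp_all add: mult.commute)
qed

lemma DD_le: "D * D \<le> (265/1000) * (D * \<beta>)" "D * D \<le> (212/1000) * (D * \<eta>)"
proof -
  have "(D * \<beta>) * \<eta> \<le> (265/1000) * (D * \<beta>)" "(D * \<eta>) * \<beta> \<le> (212/1000) * (D * \<eta>)"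
    by (rule times_small monomials_pos)+
  moreover have "D * D = (D * \<beta>) * \<eta>" "D * D = (D * \<eta>) * \<beta>" by (simp_all add: D_eq)
  ultimately show "D * D \<le> (265/1000) * (D * \<beta>)" "D * D \<le> (212/1000) * (D * \<eta>)" by linarith+
qed

text \<open>Iterating \<open>t = k * D - D * t\<close> bounds \<open>t\<close> alternately from
  above and below by partial sums of its expansion in \<open>D\<close>.\<close>

lemma ratio_bounds:
  assumes t: "t * (1 + D) = k * D" and k: "0 \<le> k"
  shows "k * D - k * (D * D) \<le> t" "t \<le> k * D" "t \<le> k * D - k * (D * D) + k * (D * D * D)"
proof -
  have kD: "0 \<le> k * D" using k D_pos by simp
  then have t0: "0 \<le> t" using t D_pos by (metis add_pos_pos zero_le_mult_iff zero_less_one not_less)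
  have e: "t = k * D - D * t" using t by (simp add: algebra_simps)
  then show 1: "t \<le> k * D" using t0 D_pos by (smt (verit) mult_nonneg_nonneg)
  have "D * t \<le> D * (k * D)" using 1 D_pos by simp
  also have "\<dots> = k * (D * D)" by simp
  finally show 2: "k * D - k * (D * D) \<le> t" using e by linarith
  have "D * (k * D - k * (D * D)) \<le> D * t" using 2 D_pos by simp
  moreover have "D * (k * D - k * (D * D)) = k * (D * D) - k * (D * D * D)" by (simp add: algebra_simps)
  ultimately show "t \<le> k * D - k * (D * D) + k * (D * D * D)" using e by linarith
qed

lemma ratio_lower:
  assumes t: "t * (1 + D) = k * D" and k: "k0 \<le> k" "0 \<le> k0"
  shows "k0 * D - k0 * (D * D) \<le> t"
proof -
  have "D * D \<le> D" using times_small(1)[OF D_pos] D_pos by simp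
  then have "k0 * (D - D * D) \<le> k * (D - D * D)" using k D_less D_pos by (intro mult_right_mono) auto
  then have "k0 * D - k0 * (D * D) \<le> k * D - k * (D * D)" by (simp add: algebra_simps)
  then show ?thesis using ratio_bounds(1)[OF t] k by linarith
qed

lemma m_ratio: "(\<eta> - \<beta>) * (1 + D) = real_of_int (b - a) * D"
  using eta_minus_beta by simp

lemma n_ratio: "(2 * \<beta> - \<eta>) * (1 + D) = real_of_int (2 * a - b) * D"
proof -
  have "2 * \<beta> * (a * \<eta>) - \<eta> * (b * \<beta>) = real_of_int (2 * a - b) * D" by (simp add: D_eq algebra_simps)
  then show ?thesis unfolding a_eta b_beta by (simp add: algebra_simps)
qed

text \<open>A majorant polynomial in \<open>\<eta>\<close>, \<open>\<beta>\<close> and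
  \<open>D\<close>, obtained by estimating \<open>w\<close>; strict inequalities above the limit
  point are checked against it, while for upper bounds on a vertex the smaller
  \<open>\<theta>\<close> suffices.\<close>

lemma delta_inf_upper: "delta_inf a b \<le> (1 - 2 * \<beta> + \<beta> * D) * (1 - \<eta> - D + 2 * (D * D))"
proof -
  have "D * D * D * w \<le> D * D * 1"
  proof -
    have "D * w \<le> 1" using vb_aux by simp
    then have "D * D * (D * w) \<le> D * D * 1" using D_pos by (intro mult_left_mono) auto
    then show ?thesis by (simp add: mult.assoc)
  qed
  then have "LI \<le> - 1 + D" unfolding LI_def by simp
  then have "\<beta> * LI \<le> \<beta> * (- 1 + D)" using beta_pos by (intro mult_left_mono) auto
  then have 1: "1 - \<beta> + \<beta> * LI \<le> 1 - 2 * \<beta> + \<beta> * D" by (simp add: algebra_simps)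
  have "D * w \<le> D * (1 + D)" using w_bounds D_pos by (intro mult_left_mono) auto
  then have "D * (D * w) \<le> D * (D * (1 + D))" using D_pos by (intro mult_left_mono) auto
  then have "D * RI \<le> - D + D * D + D * D * D" unfolding RI_def by (simp add: algebra_simps)
  then have 2: "1 - \<eta> + D * RI \<le> 1 - \<eta> - D + 2 * (D * D)" using times_small(1)[OF monomials_pos(3)] monomials_pos(3) by linarith
  show ?thesis unfolding delta_inf_eq h_def
    using 1 2 factor_bounds(1)[of RI] factor_bounds(3)[of 0] RI_bounds by (intro mult_mono) auto
qed

lemma scaled_vk_0: "(1 + D) * (1 + D) * vk 0 = (1 + D - 2 * \<beta> - \<beta> * D) * (1 + 2 * D - \<eta> - \<eta> * D)"
proof -
  define g where "g = 1 / (1 + D)"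
  have g: "(1 + D) * g = 1" using D_pos by (simp add: g_def)
  have "(1 + D) * (1 + D) * vk 0 = ((1 + D) * (1 - \<beta> + \<beta> * (- g))) * ((1 + D) * (1 - \<eta> + D * g))"
    unfolding vk_def vk_0 h_def g_def[symmetric] by simp
  also have "(1 + D) * (1 - \<beta> + \<beta> * (- g)) = (1 - \<beta>) * (1 + D) - \<beta> * ((1 + D) * g)" by (simp add: algebra_simps)
  also have "(1 + D) * (1 - \<eta> + D * g) = (1 - \<eta>) * (1 + D) + D * ((1 + D) * g)" by (simp add: algebra_simps)
  finally have "(1 + D) * (1 + D) * vk 0 = ((1 - \<beta>) * (1 + D) - \<beta>) * ((1 - \<eta>) * (1 + D) + D)" unfolding g by simp
  also have "\<dots> = (1 + D - 2 * \<beta> - \<beta> * D) * (1 + 2 * D - \<eta> - \<eta> * D)" by (simp add: algebra_simps)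
  finally show ?thesis .
qed

lemma one_minus_D: "(1 - D) * (1 - D) > 0" "(1 + D) * (1 + D) > 0" using D_less D_pos by simp_all

lemma gt_delta_infI:
  assumes "(1 - D) * (1 - D) * t - (1 - D) * (1 - D) * ((1 - 2 * \<beta> + \<beta> * D) * (1 - \<eta> - D + 2 * (D * D))) > 0"
  shows "delta_inf a b < t"
proof -
  have "(1 - D) * (1 - D) * ((1 - 2 * \<beta> + \<beta> * D) * (1 - \<eta> - D + 2 * (D * D))) < (1 - D) * (1 - D) * t" using assms by linarith
  then have "(1 - 2 * \<beta> + \<beta> * D) * (1 - \<eta> - D + 2 * (D * D)) < t" using one_minus_D by (simp only: mult_less_cancel_left_pos)
  then show ?thesis using delta_inf_upper by linarith
qed

lemma le_delta_infI:
  assumes "(1 - D) * (1 - D) * t - (1 - D) * (1 - D) * ((1 - 2 * \<beta>) * (1 - \<eta> - D)) \<le> 0"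
  shows "t \<le> delta_inf a b"
proof -
  have "(1 - D) * (1 - D) * t \<le> (1 - D) * (1 - D) * ((1 - 2 * \<beta>) * (1 - \<eta> - D))" using assms by linarith
  then have "t \<le> (1 - 2 * \<beta>) * (1 - \<eta> - D)" using one_minus_D by (simp only: mult_le_cancel_left_pos)
  then show ?thesis using theta_less_delta_inf unfolding \<theta>_def by linarith
qed

lemma vs_vk_0:
  "((1 + D) * (1 + D)) * ((1 - D) * (1 - D) * t) - ((1 - D) * (1 - D)) * ((1 + D - 2 * \<beta> - \<beta> * D) * (1 + 2 * D - \<eta> - \<eta> * D))
    = ((1 + D) * (1 + D)) * (((1 - D) * (1 - D)) * (t - vk 0))"
  unfolding scaled_vk_0[symmetric] by (simp add: algebra_simps)

lemma ge_vk_0I: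
  assumes "((1 + D) * (1 + D)) * ((1 - D) * (1 - D) * t) - ((1 - D) * (1 - D)) * ((1 + D - 2 * \<beta> - \<beta> * D) * (1 + 2 * D - \<eta> - \<eta> * D)) \<ge> 0"
  shows "vk 0 \<le> t"
proof -
  have "((1 - D) * (1 - D)) * (t - vk 0) \<ge> 0"
    using assms one_minus_D(2) unfolding vs_vk_0 by (metis less_le_not_le zero_le_mult_iff)
  then have "t - vk 0 \<ge> 0" using one_minus_D(1) by (metis less_le_not_le zero_le_mult_iff)
  then show ?thesis by simp
qed

lemma le_vk_0I:
  assumes "((1 + D) * (1 + D)) * ((1 - D) * (1 - D) * t) - ((1 - D) * (1 - D)) * ((1 + D - 2 * \<beta> - \<beta> * D) * (1 + 2 * D - \<eta> - \<eta> * D)) \<le> 0"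
  shows "t \<le> vk 0"
proof -
  have "((1 - D) * (1 - D)) * (t - vk 0) \<le> 0"
    using assms one_minus_D(2) unfolding vs_vk_0 by (metis less_le_not_le mult_le_0_iff)
  then have "t - vk 0 \<le> 0" using one_minus_D(1) by (metis less_le_not_le mult_le_0_iff)
  then show ?thesis by simp
qed

text \<open>The leading term of the scaled difference is \<open>4 * D\<close>, without any condition
  on \<open>b\<close>.\<close>

lemma p3_ge: "p3 X2 Y2 \<ge> vk 0"
proof (rule ge_vk_0I, unfold scaled_vertices)
  have id: "((1 + D) * (1 + D)) * ((1 - 2 * \<beta> + D - \<beta> * D) * (1 - \<eta> + 2 * D - \<eta> * D)) - ((1 - D) * (1 - D)) * ((1 + D - 2 * \<beta> - \<beta> * D) * (1 + 2 * D - \<eta> - \<eta> * D))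
    = 4 * D - 4 * (D * \<eta>) - 8 * (D * \<beta>) + 20 * (D * D) - 8 * (D * D * \<eta>) - 20 * (D * D * \<beta>) + 20 * (D * D * D) - 4 * (D * D * D * \<eta>) - 8 * (D * D * D * \<beta>) + 4 * (D * D * D * D)"
    by (simp add: D_eq algebra_simps)
  show "((1 + D) * (1 + D)) * ((1 - 2 * \<beta> + D - \<beta> * D) * (1 - \<eta> + 2 * D - \<eta> * D)) - ((1 - D) * (1 - D)) * ((1 + D - 2 * \<beta> - \<beta> * D) * (1 + 2 * D - \<eta> - \<eta> * D)) \<ge> 0"
    unfolding id using monomials_pos(1-3) times_small[OF D_pos] D_pos monomials_pos(9) times_small(2)[OF monomials_pos(6)] times_small(3)[OF monomials_pos(6)] monomials_pos(6) times_small(2)[OF monomials_pos(3)] times_small(3)[OF monomials_pos(3)] D_pos by linarith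
qed

text \<open>The leading part is \<open>2 * (\<eta> - \<beta>) - 6 * D\<close>, so the threshold is
  \<open>b - a = 3\<close>. There it vanishes to first order and the term
  \<open>10 * (D * \<beta>)\<close> decides.\<close>

lemma p4_gt_delta_inf: "a + 3 \<le> b \<Longrightarrow> delta_inf a b < p4 X2 Y2"
proof (rule gt_delta_infI, unfold scaled_vertices)
  assume "a + 3 \<le> b"
  then have "3 \<le> real_of_int (b - a)" by linarith
  from ratio_lower[OF m_ratio this]
  have r: "3 * D - 3 * (D * D) \<le> \<eta> - \<beta>" by simp
  have id: "(1 - 4 * \<beta> + D + \<beta> * D) * (1 + \<eta> - 4 * D + \<eta> * D) - (1 - D) * (1 - D) * ((1 - 2 * \<beta> + \<beta> * D) * (1 - \<eta> - D + 2 * (D * D)))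
    = 2 * \<eta> - 2 * \<beta> - 6 * D + 10 * (D * \<beta>) - 7 * (D * D) + 2 * (D * D * \<eta>) + 9 * (D * D * \<beta>) + 2 * (D * D * D) - 15 * (D * D * D * \<beta>) - 1 * (D * D * D * D) + 9 * (D * D * D * D * \<beta>) - 2 * (D * D * D * D * D * \<beta>)"
    by (simp add: D_eq algebra_simps)
  show "(1 - 4 * \<beta> + D + \<beta> * D) * (1 + \<eta> - 4 * D + \<eta> * D) - (1 - D) * (1 - D) * ((1 - 2 * \<beta> + \<beta> * D) * (1 - \<eta> - D + 2 * (D * D))) > 0"
    unfolding id using monomials_pos(1-3) times_small[OF D_pos] D_pos times_small(2)[OF monomials_pos(12)] times_small(1)[OF monomials_pos(9)] monomials_pos(10) times_small(1)[OF monomials_pos(6)] times_small(2)[OF monomials_pos(6)] times_small(1)[OF monomials_pos(3)] monomials_pos(4) monomials_pos(5) DD_le r by linarith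
qed

text \<open>As for \<open>p4\<close>, with \<open>2 * \<beta> - \<eta>\<close> and hence
  \<open>2 * a - b\<close> in place of \<open>\<eta> - \<beta>\<close> and
  \<open>b - a\<close>.\<close>

lemma p1_gt_delta_inf: "b \<le> 2 * a - 3 \<Longrightarrow> delta_inf a b < p1 X2 Y2"
proof (rule gt_delta_infI, unfold scaled_vertices)
  assume "b \<le> 2 * a - 3"
  then have "3 \<le> real_of_int (2 * a - b)" by linarith
  from ratio_lower[OF n_ratio this]
  have r: "3 * D - 3 * (D * D) \<le> 2 * \<beta> - \<eta>" by simp
  have "D * \<beta> < D * \<eta>" using D_pos beta_less_eta by simp
  moreover have id: "(1 + 2 * \<beta> - 3 * D + \<beta> * D) * (1 - 3 * \<eta> + 2 * D + \<eta> * D) - (1 - D) * (1 - D) * ((1 - 2 * \<beta> + \<beta> * D) * (1 - \<eta> - D + 2 * (D * D)))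
    = - 2 * \<eta> + 4 * \<beta> - 6 * D + 8 * (D * \<eta>) - 2 * (D * \<beta>) - 7 * (D * D) - 2 * (D * D * \<eta>) + 15 * (D * D * \<beta>) + 2 * (D * D * D) - 15 * (D * D * D * \<beta>) - 1 * (D * D * D * D) + 9 * (D * D * D * D * \<beta>) - 2 * (D * D * D * D * D * \<beta>)"
    by (simp add: D_eq algebra_simps)
  ultimately show "(1 + 2 * \<beta> - 3 * D + \<beta> * D) * (1 - 3 * \<eta> + 2 * D + \<eta> * D) - (1 - D) * (1 - D) * ((1 - 2 * \<beta> + \<beta> * D) * (1 - \<eta> - D + 2 * (D * D))) > 0"
    unfolding id using monomials_pos(1-3) times_small[OF D_pos] D_pos times_small(2)[OF monomials_pos(12)] times_small(1)[OF monomials_pos(9)] monomials_pos(10) times_small(1)[OF monomials_pos(6)] times_small(2)[OF monomials_pos(6)] times_small(1)[OF monomials_pos(3)] monomials_pos(4) times_small(3)[OF monomials_pos(3)] DD_le r by linarith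
qed

lemma p4_le_delta_inf: "b = a + 1 \<Longrightarrow> p4 X2 Y2 \<le> delta_inf a b"
proof (rule le_delta_infI, unfold scaled_vertices)
  assume "b = a + 1"
  then have r: "\<eta> - \<beta> \<le> D" using ratio_bounds(2)[OF m_ratio] by simp
  have id: "(1 - 4 * \<beta> + D + \<beta> * D) * (1 + \<eta> - 4 * D + \<eta> * D) - (1 - D) * (1 - D) * ((1 - 2 * \<beta>) * (1 - \<eta> - D))
    = 2 * \<eta> - 2 * \<beta> - 6 * D + 11 * (D * \<beta>) - 6 * (D * D) + 2 * (D * D * \<eta>) + 2 * (D * D * \<beta>) - 2 * (D * D * D * \<beta>)"
    by (simp add: D_eq algebra_simps)
  show "(1 - 4 * \<beta> + D + \<beta> * D) * (1 + \<eta> - 4 * D + \<eta> * D) - (1 - D) * (1 - D) * ((1 - 2 * \<beta>) * (1 - \<eta> - D)) \<le> 0"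
    unfolding id using monomials_pos(1-3) times_small[OF D_pos] D_pos monomials_pos(7) times_small(2)[OF monomials_pos(3)] times_small(3)[OF monomials_pos(3)] D_pos r by linarith
qed

lemma p1_le_delta_inf: "2 * a - 1 \<le> b \<Longrightarrow> p1 X2 Y2 \<le> delta_inf a b"
proof (rule le_delta_infI, unfold scaled_vertices)
  assume "2 * a - 1 \<le> b"
  then have "real_of_int (2 * a - b) \<le> 1" by linarith
  then have "real_of_int (2 * a - b) * D \<le> 1 * D" using D_pos by (intro mult_right_mono) auto
  then have n: "(2 * \<beta> - \<eta>) * (1 + D) \<le> D" unfolding n_ratio by simp
  have r: "2 * \<beta> - \<eta> \<le> D"
  proof (cases "2 * \<beta> - \<eta> \<le> 0")
    case False
    then have "(2 * \<beta> - \<eta>) * 1 \<le> (2 * \<beta> - \<eta>) * (1 + D)" using D_pos by (intro mult_left_mono) auto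
    then show ?thesis unfolding mult_1_right using n by (rule order_trans)
  qed (use D_pos in linarith)
  have id: "(1 + 2 * \<beta> - 3 * D + \<beta> * D) * (1 - 3 * \<eta> + 2 * D + \<eta> * D) - (1 - D) * (1 - D) * ((1 - 2 * \<beta>) * (1 - \<eta> - D))
    = - 2 * \<eta> + 4 * \<beta> - 6 * D + 8 * (D * \<eta>) - 1 * (D * \<beta>) - 6 * (D * D) - 2 * (D * D * \<eta>) + 8 * (D * D * \<beta>) - 2 * (D * D * D * \<beta>)"
    by (simp add: D_eq algebra_simps)
  show "(1 + 2 * \<beta> - 3 * D + \<beta> * D) * (1 - 3 * \<eta> + 2 * D + \<eta> * D) - (1 - D) * (1 - D) * ((1 - 2 * \<beta>) * (1 - \<eta> - D)) \<le> 0"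
    unfolding id using monomials_pos(1-3) times_small[OF D_pos] D_pos monomials_pos(7) times_small(2)[OF monomials_pos(3)] monomials_pos(5) D_pos r by linarith
qed

text \<open>Against \<open>vk 0\<close> the leading part is
  \<open>2 * (\<eta> - \<beta>) - 8 * D\<close>, with threshold \<open>b - a = 4\<close>. As
  \<open>b - a\<close> is odd, the critical cases are 5 here and 3 in \<open>p4_le_vk_0\<close>; for
  \<open>p1\<close> the same holds with \<open>2 * a - b\<close>.\<close>

lemma p4_ge_vk_0: "a + 5 \<le> b \<Longrightarrow> vk 0 \<le> p4 X2 Y2"
proof (rule ge_vk_0I, unfold scaled_vertices)
  assume "a + 5 \<le> b"
  then have "5 \<le> real_of_int (b - a)" by linarith
  from ratio_lower[OF m_ratio this]
  have r: "5 * D - 5 * (D * D) \<le> \<eta> - \<beta>" by simp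
  have id: "((1 + D) * (1 + D)) * ((1 - 4 * \<beta> + D + \<beta> * D) * (1 + \<eta> - 4 * D + \<eta> * D)) - ((1 - D) * (1 - D)) * ((1 + D - 2 * \<beta> - \<beta> * D) * (1 + 2 * D - \<eta> - \<eta> * D))
    = 2 * \<eta> - 2 * \<beta> - 8 * D + 4 * (D * \<eta>) + 10 * (D * \<beta>) - 16 * (D * D) + 4 * (D * D * \<eta>) + 20 * (D * D * \<beta>) - 16 * (D * D * D) + 4 * (D * D * D * \<eta>) + 10 * (D * D * D * \<beta>) - 8 * (D * D * D * D) + 2 * (D * D * D * D * \<eta>) - 2 * (D * D * D * D * \<beta>)"
    by (simp add: D_eq algebra_simps)
  show "((1 + D) * (1 + D)) * ((1 - 4 * \<beta> + D + \<beta> * D) * (1 + \<eta> - 4 * D + \<eta> * D)) - ((1 - D) * (1 - D)) * ((1 + D - 2 * \<beta> - \<beta> * D) * (1 + 2 * D - \<eta> - \<eta> * D)) \<ge> 0"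
    unfolding id using monomials_pos(1-3) times_small[OF D_pos] D_pos times_small(2)[OF monomials_pos(9)] monomials_pos(11) times_small(1)[OF monomials_pos(6)] monomials_pos(7) monomials_pos(8) times_small(1)[OF monomials_pos(3)] monomials_pos(4) monomials_pos(5) D_pos r by linarith
qed

lemma p1_ge_vk_0: "b \<le> 2 * a - 5 \<Longrightarrow> vk 0 \<le> p1 X2 Y2"
proof (rule ge_vk_0I, unfold scaled_vertices)
  assume "b \<le> 2 * a - 5"
  then have "5 \<le> real_of_int (2 * a - b)" by linarith
  from ratio_lower[OF n_ratio this]
  have r: "5 * D - 5 * (D * D) \<le> 2 * \<beta> - \<eta>" by simp
  have id: "((1 + D) * (1 + D)) * ((1 + 2 * \<beta> - 3 * D + \<beta> * D) * (1 - 3 * \<eta> + 2 * D + \<eta> * D)) - ((1 - D) * (1 - D)) * ((1 + D - 2 * \<beta> - \<beta> * D) * (1 + 2 * D - \<eta> - \<eta> * D))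
    = - 2 * \<eta> + 4 * \<beta> - 8 * D + 4 * (D * \<eta>) + 10 * (D * \<beta>) - 16 * (D * D) + 12 * (D * D * \<eta>) + 8 * (D * D * \<beta>) - 16 * (D * D * D) + 4 * (D * D * D * \<eta>) + 10 * (D * D * D * \<beta>) - 8 * (D * D * D * D) - 2 * (D * D * D * D * \<eta>) + 4 * (D * D * D * D * \<beta>)"
    by (simp add: D_eq algebra_simps)
  show "((1 + D) * (1 + D)) * ((1 + 2 * \<beta> - 3 * D + \<beta> * D) * (1 - 3 * \<eta> + 2 * D + \<eta> * D)) - ((1 - D) * (1 - D)) * ((1 + D - 2 * \<beta> - \<beta> * D) * (1 + 2 * D - \<eta> - \<eta> * D)) \<ge> 0"
    unfolding id using monomials_pos(1-3) times_small[OF D_pos] D_pos monomials_pos(10) times_small(3)[OF monomials_pos(9)] times_small(1)[OF monomials_pos(6)] monomials_pos(7) monomials_pos(8) times_small(1)[OF monomials_pos(3)] monomials_pos(4) monomials_pos(5) D_pos r by linarith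
qed

lemma p4_le_vk_0: "b = a + 3 \<Longrightarrow> p4 X2 Y2 \<le> vk 0"
proof (rule le_vk_0I, unfold scaled_vertices)
  assume b: "b = a + 3"
  then have r: "\<eta> - \<beta> \<le> 3 * D - 3 * (D * D) + 3 * (D * D * D)" using ratio_bounds(3)[OF m_ratio] by simp
  have "7 \<le> real_of_int b" using b a_ge by simp
  then have "7 * \<beta> \<le> b * \<beta>" using beta_pos by (intro mult_right_mono) auto
  then have b1: "\<beta> \<le> 152/1000" using b_beta D_less by linarith
  \<comment> \<open>Separate bounds on \<open>\<eta>\<close> and \<open>\<beta>\<close> do not
    suffice, since a lower bound for \<open>D * D\<close> is wanted as well. Expanding this
    nonnegative product gives one that is linear in \<open>D\<close>, \<open>D * \<beta>\<close> and
    \<open>D * \<eta>\<close>.\<close>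
  have "0 \<le> D * ((265/1000 - \<eta>) * (152/1000 - \<beta>))" using D_pos b1 eta_less by simp
  also have "\<dots> = (4028/100000) * D - (265/1000) * (D * \<beta>) - (152/1000) * (D * \<eta>) + D * D"
    by (simp add: D_eq algebra_simps)
  finally have q: "0 \<le> (4028/100000) * D - (265/1000) * (D * \<beta>) - (152/1000) * (D * \<eta>) + D * D" .
  have q': "D * \<beta> \<le> D * (152/1000)" "D * D * \<beta> \<le> D * D * (152/1000)" using b1 D_pos by simp_all
  have id: "((1 + D) * (1 + D)) * ((1 - 4 * \<beta> + D + \<beta> * D) * (1 + \<eta> - 4 * D + \<eta> * D)) - ((1 - D) * (1 - D)) * ((1 + D - 2 * \<beta> - \<beta> * D) * (1 + 2 * D - \<eta> - \<eta> * D))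
    = 2 * \<eta> - 2 * \<beta> - 8 * D + 4 * (D * \<eta>) + 10 * (D * \<beta>) - 16 * (D * D) + 4 * (D * D * \<eta>) + 20 * (D * D * \<beta>) - 16 * (D * D * D) + 4 * (D * D * D * \<eta>) + 10 * (D * D * D * \<beta>) - 8 * (D * D * D * D) + 2 * (D * D * D * D * \<eta>) - 2 * (D * D * D * D * \<beta>)"
    by (simp add: D_eq algebra_simps)
  show "((1 + D) * (1 + D)) * ((1 - 4 * \<beta> + D + \<beta> * D) * (1 + \<eta> - 4 * D + \<eta> * D)) - ((1 - D) * (1 - D)) * ((1 + D - 2 * \<beta> - \<beta> * D) * (1 + 2 * D - \<eta> - \<eta> * D)) \<le> 0"
    unfolding id using monomials_pos(1-3) times_small[OF D_pos] D_pos monomials_pos(10) times_small(3)[OF monomials_pos(9)] monomials_pos(9) times_small(2)[OF monomials_pos(6)] times_small(3)[OF monomials_pos(6)] monomials_pos(6) times_small(2)[OF monomials_pos(3)] times_small(3)[OF monomials_pos(3)] D_pos r q q' by linarith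
qed

text \<open>From \<open>a \<ge> 6\<close> follows \<open>b \<ge> 9\<close>, and with it the sharper
  bounds on \<open>\<eta>\<close> and \<open>\<beta>\<close> used here. For \<open>a = 4\<close> the
  value \<open>2 * a - 3\<close> equals \<open>a + 1\<close>, a case covered by the comparison with
  the limit point.\<close>

lemma p1_le_vk_0: "6 \<le> a \<Longrightarrow> b = 2 * a - 3 \<Longrightarrow> p1 X2 Y2 \<le> vk 0"
proof (rule le_vk_0I, unfold scaled_vertices)
  assume a: "6 \<le> a" and b: "b = 2 * a - 3"
  then have r: "2 * \<beta> - \<eta> \<le> 3 * D" using ratio_bounds(2)[OF n_ratio] by simp
  have "9 \<le> real_of_int b" "6 \<le> real_of_int a" using b a by simp_all
  then have "9 * \<beta> \<le> b * \<beta>" "6 * \<eta> \<le> a * \<eta>" using beta_pos eta_pos by (intro mult_right_mono; simp)+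
  then have b1: "\<beta> \<le> 118/1000" "\<eta> \<le> 177/1000" using b_beta a_eta D_less by linarith+
  have q: "D * \<beta> \<le> D * (118/1000)" "D * \<eta> \<le> D * (177/1000)" using b1 D_pos by simp_all
  have id: "((1 + D) * (1 + D)) * ((1 + 2 * \<beta> - 3 * D + \<beta> * D) * (1 - 3 * \<eta> + 2 * D + \<eta> * D)) - ((1 - D) * (1 - D)) * ((1 + D - 2 * \<beta> - \<beta> * D) * (1 + 2 * D - \<eta> - \<eta> * D))
    = - 2 * \<eta> + 4 * \<beta> - 8 * D + 4 * (D * \<eta>) + 10 * (D * \<beta>) - 16 * (D * D) + 12 * (D * D * \<eta>) + 8 * (D * D * \<beta>) - 16 * (D * D * D) + 4 * (D * D * D * \<eta>) + 10 * (D * D * D * \<beta>) - 8 * (D * D * D * D) - 2 * (D * D * D * D * \<eta>) + 4 * (D * D * D * D * \<beta>)"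
    by (simp add: D_eq algebra_simps)
  show "((1 + D) * (1 + D)) * ((1 + 2 * \<beta> - 3 * D + \<beta> * D) * (1 - 3 * \<eta> + 2 * D + \<eta> * D)) - ((1 - D) * (1 - D)) * ((1 + D - 2 * \<beta> - \<beta> * D) * (1 + 2 * D - \<eta> - \<eta> * D)) \<le> 0"
    unfolding id using monomials_pos(1-3) times_small[OF D_pos] D_pos times_small(2)[OF monomials_pos(9)] monomials_pos(11) monomials_pos(9) times_small(2)[OF monomials_pos(6)] times_small(3)[OF monomials_pos(6)] monomials_pos(6) times_small(2)[OF monomials_pos(3)] times_small(3)[OF monomials_pos(3)] D_pos r q by linarith
qed

lemma v2_gt_delta_inf: "a + 3 \<le> b \<Longrightarrow> b \<le> 2 * a - 3 \<Longrightarrow> delta_inf a b < v2"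
  using p1_gt_delta_inf p4_gt_delta_inf p3_ge vk_gt_delta_inf[of 0] by (auto simp: v2_def)

lemma v2_le_delta_inf: "b = a + 1 \<or> 2 * a - 1 \<le> b \<Longrightarrow> v2 \<le> delta_inf a b"
  using p1_le_delta_inf p4_le_delta_inf by (auto simp: v2_def min_le_iff_disj)

lemma v2_ge_vk_0: "a + 5 \<le> b \<Longrightarrow> b \<le> 2 * a - 5 \<Longrightarrow> vk 0 \<le> v2"
  using p1_ge_vk_0 p4_ge_vk_0 p3_ge by (auto simp: v2_def)

lemma v2_le_vk_0: "b = a + 3 \<or> 6 \<le> a \<and> b = 2 * a - 3 \<Longrightarrow> v2 \<le> vk 0"
  using p1_le_vk_0 p4_le_vk_0 by (auto simp: v2_def min_le_iff_disj)

end

section \<open>The spectrum above the limit point\<close>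

lemma nth_concat_replicate:
  assumes "length xs = n" and "j < k * n"
  shows "concat (replicate k xs) ! j = xs ! (j mod n)"
  using assms(2)
proof (induction k arbitrary: j)
  case (Suc k)
  show ?case
  proof (cases "j < n")
    case True
    then show ?thesis using assms(1) by (simp add: nth_append)
  next
    case False
    then have "concat (replicate k xs) ! (j - n) = xs ! ((j - n) mod n)" using Suc by (intro Suc.IH) auto
    then show ?thesis using assms(1) False by (simp add: nth_append le_mod_geq)
  qed
qed simp

context params begin

lemma blocks:
  "2 * fst (blockA a b 1) - (a - 2) = 0" "2 * snd (blockA a b 1) - (b - 2) = 1"
  "2 * fst (blockA' a b 1) - (a - 2) = 0" "2 * snd (blockA' a b 1) - (b - 2) = - 1"
  "2 * fst (blockC a b 3) - (a - 2) = - 2" "2 * snd (blockC a b 3) - (b - 2) = 3"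
  unfolding blockA_def blockA'_def blockC_def fst_conv snd_conv using even_a odd_b by presburger+

lemma L_starI: "\<not> (\<exists>m n :: int. \<gamma> = of_int m + of_int n * \<eta>) \<Longrightarrow> M_star a b \<gamma> \<in> L_star a b"
  unfolding L_star_def by blast

lemma delta_value: "delta a b k = ereal (vk k)" "delta a b k \<in> L_star a b"
proof -
  define U where "U = [blockA' a b 1, blockA' a b 1, blockA a b 1, blockA a b 1]"
  define W where "W = [blockA' a b 1, blockA a b 1] @ concat (replicate k U)"
  have len: "length (concat (replicate k U)) = 4 * k" by (induction k) (auto simp: U_def)
  then have lenW: "length W = 4 * k + 2" by (simp add: W_def)
  have W: "2 * fst (W ! (i mod length W)) - (a - 2) = 0 \<and> 2 * snd (W ! (i mod length W)) - (b - 2) = pk k i" for i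
  proof -
    define j where "j = i mod (4 * k + 2)"
    have j: "j < 4 * k + 2" by (simp add: j_def)
    have pk: "pk k i = (if j = 0 then - 1 else if j = 1 then 1 else if (j - 2) mod 4 < 2 then - 1 else 1)"
      unfolding pk_def j_def Let_def ..
    consider "j = 0" | "j = 1" | "2 \<le> j" by linarith
    then have "2 * fst (W ! j) - (a - 2) = 0 \<and> 2 * snd (W ! j) - (b - 2) = pk k i"
    proof cases
      case 3
      then have "W ! j = concat (replicate k U) ! (j - 2)" by (simp add: W_def nth_append numeral_2_eq_2)
      also have "\<dots> = U ! ((j - 2) mod 4)"
        by (rule nth_concat_replicate) (use 3 j in \<open>auto simp: U_def\<close>)
      finally have Wj: "W ! j = U ! ((j - 2) mod 4)" .
      have "(j - 2) mod 4 < 4" by simp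
      then have "(j - 2) mod 4 = 0 \<or> (j - 2) mod 4 = 1 \<or> (j - 2) mod 4 = 2 \<or> (j - 2) mod 4 = 3" by linarith
      then show ?thesis unfolding Wj pk using 3 blocks by (elim disjE) (simp_all add: U_def)
    qed (use blocks in \<open>simp_all add: W_def pk\<close>)
    then show ?thesis unfolding lenW j_def .
  qed
  have "W \<noteq> []" by (simp add: W_def)
  from gamma_word_value[OF vk_pattern W this]
  show "delta a b k = ereal (vk k)" "delta a b k \<in> L_star a b"
    unfolding delta_def W_def U_def by (blast intro: L_starI)+
qed

lemma delta_m1_value: "delta_m1 a b = ereal vb" "delta_m1 a b \<in> L_star a b"
proof -
  define W where "W = [blockA a b 1, blockA a b 1, blockA' a b 1, blockA' a b 1]"
  have W: "2 * fst (W ! (i mod length W)) - (a - 2) = 0 \<and> 2 * snd (W ! (i mod length W)) - (b - 2) = pblocks i" for i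
  proof -
    have "i mod 4 < 4" by simp
    then have "i mod 4 = 0 \<or> i mod 4 = 1 \<or> i mod 4 = 2 \<or> i mod 4 = 3" by linarith
    moreover have "length W = 4" by (simp add: W_def)
    ultimately show ?thesis unfolding pblocks_def using blocks by (elim disjE) (simp_all add: W_def)
  qed
  have "W \<noteq> []" by (simp add: W_def)
  from gamma_word_value[OF pblocks_pattern W this]
  show "delta_m1 a b = ereal vb" "delta_m1 a b \<in> L_star a b"
    unfolding delta_m1_def W_def by (blast intro: L_starI)+
qed

lemma delta_m2_value: "delta_m2 a b = ereal v2" "delta_m2 a b \<in> L_star a b"
proof -
  define W where "W = [blockC a b 3]"
  have W: "2 * fst (W ! (i mod length W)) - (a - 2) = - 2 \<and> 2 * snd (W ! (i mod length W)) - (b - 2) = 3" for i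
    using blocks by (simp add: W_def)
  have "W \<noteq> []" by (simp add: W_def)
  from gamma_word_value[OF v2_pattern W this]
  show "delta_m2 a b = ereal v2" "delta_m2 a b \<in> L_star a b"
    unfolding delta_m2_def W_def by (blast intro: L_starI)+
qed

text \<open>The greedy expansion turns a value above the limit point into nodes at a level still
  above it. The digit dichotomy and the sign patterns then make the digits eventually periodic, and
  \<open>value_of_pattern\<close> evaluates them.\<close>

lemma values_above_delta_inf:
  assumes irr: "\<not> (\<exists>m n :: int. \<gamma> = of_int m + of_int n * \<eta>)" and M: "ereal (delta_inf a b) < M_star a b \<gamma>"
  shows "M_star a b \<gamma> = ereal vb \<or> (\<exists>k. M_star a b \<gamma> = ereal (vk k)) \<or> M_star a b \<gamma> = ereal v2"
proof -
  interpret expansion a b "greedy_n \<gamma>" "greedy_r \<gamma>" \<gamma> "\<lfloor>\<gamma>\<rfloor>" b by (rule greedy_expansion)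
  from ereal_dense2[OF M] obtain c where c: "ereal (delta_inf a b) < ereal c" "ereal c < M_star a b \<gamma>" by blast
  define c' where "c' = (delta_inf a b + c) / 2"
  have c': "delta_inf a b < c'" "c' < c" using c(1) by (simp_all add: c'_def)
  then have "27/100 \<le> c'" using theta_less_delta_inf theta_gt by linarith
  have "0 \<le> Q k \<and> Q k < qq (Suc k)" for k using greedy_Q_bounds[of \<gamma> k] by (elim conjE, intro conjI)
  from nodes_of_M_star[OF irr c(2) \<open>27/100 \<le> c'\<close> c'(2) this greedy_r_bounds]
  obtain K where K: "\<And>k. k \<ge> K \<Longrightarrow> node c' (X k) (Y k) (s k)" by blast
  interpret N: node_sequence a b s E X Y K c'
  proof unfold_locales
    show "even (s i)" for i using even_a by (simp add: s_def)
    show "odd (E i)" for i using odd_b by (simp add: E_def)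
    show "c' > \<theta>" using c' theta_less_delta_inf by linarith
    show "X (Suc i) = \<beta> * (E i + \<eta> * (s i + X i))" for i by (rule X.simps(2))
    show "Y i = \<beta> * (E i + \<eta> * (s (Suc i) + Y (Suc i)))" for i by (rule Y_rec)
  qed (rule K)
  from N.digit_dichotomy show ?thesis
  proof
    assume "\<exists>N. \<exists>\<sigma>\<in>{1, - 1}. \<forall>i\<ge>N. s i = \<sigma> * - 2 \<and> E i = \<sigma> * 3"
    then obtain N and \<sigma> :: int where N: "\<sigma> \<in> {1, - 1}" "\<And>i. i \<ge> N \<Longrightarrow> s i = \<sigma> * - 2 \<and> E i = \<sigma> * 3" by blast
    have "M_star a b \<gamma> = ereal v2"
      by (rule value_of_pattern(1)[OF v2_pattern N(1), of N]) (use N(2) in auto)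
    then show ?thesis by blast
  next
    assume Z: "\<forall>i>K. s i = 0 \<and> \<bar>E i\<bar> = 1"
    \<comment> \<open>The shift is \<open>K + 2\<close> because the bound on \<open>L i\<close>
      comes from one step of the recursion starting at an index already beyond
      \<open>K\<close>.\<close>
    define e where "e i = E (K + 2 + i)" for i
    define L where "L i = X (K + 2 + i) / \<beta>" for i
    define R where "R i = Y (K + 2 + i) / \<beta>" for i
    have n: "node c' (X i) (Y i) 0" if "i > K" for i using K[of i] Z that by simp
    have Xs: "X (Suc i) / \<beta> = E i + D * (X i / \<beta>)" if "i > K" for i
      using Z that beta_pos by (simp add: D_eq)
    have Ys: "Y i / \<beta> = E i + D * (Y (Suc i) / \<beta>)" if "i > K" for i
    proof -
      have "s (Suc i) = 0" using Z that by simp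
      then have "Y i = \<beta> * (E i + \<eta> * Y (Suc i))" using Y_rec[of i] by simp
      then show ?thesis using beta_pos by (simp add: D_eq)
    qed
    have crude: "\<bar>X i / \<beta>\<bar> \<le> 22/10" "\<bar>Y i / \<beta>\<bar> \<le> 22/10" if "i > K" for i
      using zero_node_bound'[OF n[OF that] N.c_gt_theta] beta_pos by (simp_all add: abs_div_pos[symmetric] pos_divide_le_eq)
    have bound: "\<bar>real_of_int (E i) + D * t\<bar> \<le> 114/100" if "i > K" "\<bar>t\<bar> \<le> 22/10" for i t
    proof -
      have "\<bar>D * t\<bar> \<le> (6/100) * (22/10)" unfolding abs_mult using that(2) D_pos D_less by (intro mult_mono) auto
      moreover have "\<bar>real_of_int (E i)\<bar> = 1" using Z that(1) by (metis of_int_1 of_int_abs)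
      ultimately show ?thesis by linarith
    qed
    interpret S: sign_sequence a b e L R 0 c'
    proof unfold_locales
      fix i :: nat
      have i: "K + 2 + i > K" "K + 1 + i > K" by simp_all
      have "\<bar>e i\<bar> = 1" using Z i by (simp add: e_def)
      then show "e i = 1 \<or> e i = - 1" by linarith
      show "L (Suc i) = e i + D * L i" using Xs[OF i(1)] by (simp add: L_def e_def)
      show "R i = e i + D * R (Suc i)" using Ys[OF i(1)] by (simp add: R_def e_def)
      have "K + 2 + i = Suc (K + 1 + i)" by simp
      then show "\<bar>L i\<bar> \<le> 114/100" using Xs[OF i(2)] bound[OF i(2) crude(1)[OF i(2)]] by (simp only: L_def)
      show "\<bar>R i\<bar> \<le> 114/100" using Ys[OF i(1)] bound[OF i(1) crude(2), of "Suc (K + 2 + i)"] by (simp add: R_def)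
      have q: "t = \<beta> * (t / \<beta>)" for t using beta_pos by simp
      have x: "X (K + 2 + i) = \<beta> * L i" and y: "Y (K + 2 + i) = \<beta> * R i" unfolding L_def R_def by (rule q)+
      have cut: "c' \<le> h l r \<and> c' \<le> h (- l) (- r)" if "half_node c' (\<beta> * l) (\<eta> * (real_of_int 0 + \<beta> * r))" for l r
        using that by (simp add: half_node_def p1_def p4_def h_def D_eq mult.assoc)
      have "node c' (\<beta> * L i) (\<beta> * R i) 0" using n[OF i(1)] unfolding x y .
      then show "c' \<le> h (L i) (R i) \<and> c' \<le> h (- L i) (- R i) \<and> c' \<le> h (R i) (L i) \<and> c' \<le> h (- R i) (- L i)"
        unfolding node_def using cut by blast
    qed (use c' in auto)
    from S.sign_patterns obtain N and \<sigma> :: int where \<sigma>: "\<sigma> \<in> {1, - 1}"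
      and p: "(\<exists>k. \<forall>i. e (N + i) = \<sigma> * pk k i) \<or> (\<forall>i. e (N + i) = \<sigma> * pblocks i)" by blast
    have s0: "s (K + 2 + N + i) = \<sigma> * 0" for i using Z by simp
    have e: "E (K + 2 + N + i) = e (N + i)" for i by (simp add: e_def add.assoc)
    from p show ?thesis
    proof
      assume "\<exists>k. \<forall>i. e (N + i) = \<sigma> * pk k i"
      then obtain k where k: "\<And>i. e (N + i) = \<sigma> * pk k i" by blast
      have "M_star a b \<gamma> = ereal (vk k)"
        by (rule value_of_pattern(1)[OF vk_pattern \<sigma> s0]) (simp only: e k)
      then show ?thesis by blast
    next
      assume k: "\<forall>i. e (N + i) = \<sigma> * pblocks i"
      have "M_star a b \<gamma> = ereal vb"
        by (rule value_of_pattern(1)[OF pblocks_pattern \<sigma> s0]) (simp only: e k)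
      then show ?thesis by blast
    qed
  qed
qed

lemma L_star_cases:
  assumes "x \<in> L_star a b"
  shows "x \<le> ereal (delta_inf a b) \<or> x = ereal vb \<or> (\<exists>k. x = ereal (vk k)) \<or> x = ereal v2"
proof -
  obtain \<gamma> where "x = M_star a b \<gamma>" "\<not> (\<exists>m n :: int. \<gamma> = of_int m + of_int n * \<eta>)"
    using assms unfolding L_star_def by blast
  then show ?thesis using values_above_delta_inf[of \<gamma>] by (meson not_le)
qed

lemma rho_star_eqI:
  assumes "v \<in> L_star a b" and "vk 0 \<le> u" and "v2 \<le> u" and "v = ereal u"
  shows "rho_star a b = v \<and> v \<in> L_star a b \<and> (\<forall>x\<in>L_star a b. x \<le> v)"
proof -
  have "decseq vk" using vk_decreasing by (intro decseq_SucI) (simp add: less_imp_le)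
  then have k: "vk k \<le> u" for k using assms(2) decseqD[of vk 0 k] by simp
  then have "delta_inf a b \<le> u" "vb \<le> u" using vk_gt_delta_inf[of 0] vb_le(4) assms(2) by linarith+
  then have le: "\<forall>x\<in>L_star a b. x \<le> v"
  proof (intro ballI)
    fix x assume "x \<in> L_star a b"
    then consider "x \<le> ereal (delta_inf a b)" | "x = ereal vb" | k where "x = ereal (vk k)" | "x = ereal v2"
      using L_star_cases by blast
    then show "x \<le> v"
    proof cases
      case 1
      also have "ereal (delta_inf a b) \<le> v" unfolding assms(4) using \<open>delta_inf a b \<le> u\<close> by simp
      finally show ?thesis .
    qed (use \<open>vb \<le> u\<close> k assms(3,4) in auto)
  qed
  have "rho_star a b = v" unfolding rho_star_def by (rule Greatest_equality) (use assms(1) le in auto)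
  then show ?thesis using assms(1) le by blast
qed

lemma v2_range:
  "a + 3 \<le> b \<and> b \<le> 2 * a - 3 \<or> b = a + 1 \<or> 2 * a - 1 \<le> b"
  using even_a odd_b a_less_b by presburger

lemma v2_le_vk_0':
  assumes "b = a + 1 \<or> b = a + 3 \<or> b \<ge> 2 * a - 3" shows "v2 \<le> vk 0"
proof (cases "b = a + 1 \<or> 2 * a - 1 \<le> b")
  case True
  then show ?thesis using v2_le_delta_inf vk_gt_delta_inf[of 0] by linarith
next
  case False
  then have "a + 3 \<le> b" using v2_range by blast
  \<comment> \<open>Parity excludes \<open>2 * a - 2\<close>. In the remaining case
    \<open>b = 2 * a - 3\<close>, the bound \<open>a + 3 \<le> b\<close> gives
    \<open>a \<ge> 6\<close>.\<close>
  moreover have "b \<noteq> 2 * a - 2" using even_a odd_b by presburger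
  ultimately have "b = a + 3 \<or> 6 \<le> a \<and> b = 2 * a - 3" using False assms by linarith
  then show ?thesis by (rule v2_le_vk_0)
qed

lemma L_star_above_delta_inf:
  "L_star a b \<inter> {ereal (delta_inf a b)<..} =
     {delta_m1 a b} \<union> range (delta a b) \<union> (if a + 3 \<le> b \<and> b \<le> 2 * a - 3 then {delta_m2 a b} else {})"
  (is "?L = ?R")
proof
  show "?L \<subseteq> ?R"
  proof
    fix x assume x: "x \<in> ?L"
    then have gt: "ereal (delta_inf a b) < x" and "x = ereal vb \<or> (\<exists>k. x = ereal (vk k)) \<or> x = ereal v2"
      using L_star_cases[of x] by auto
    then consider "x = delta_m1 a b" | k where "x = delta a b k" | "x = ereal v2"
      unfolding delta_m1_value delta_value by blast
    then show "x \<in> ?R"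
    proof cases
      case 3
      then have "\<not> (b = a + 1 \<or> 2 * a - 1 \<le> b)" using gt v2_le_delta_inf by auto
      then have "a + 3 \<le> b \<and> b \<le> 2 * a - 3" using v2_range by blast
      then show ?thesis using 3 delta_m2_value by simp
    qed auto
  qed
  have "delta_m1 a b \<in> ?L" using delta_m1_value vb_gt_delta_inf by simp
  moreover have "delta a b k \<in> ?L" for k using delta_value[of k] vk_gt_delta_inf[of k] by simp
  moreover have "delta_m2 a b \<in> ?L" if "a + 3 \<le> b \<and> b \<le> 2 * a - 3"
    using delta_m2_value v2_gt_delta_inf that by simp
  ultimately show "?R \<subseteq> ?L" by (auto split: if_splits)
qed

end

theorem theorem1:
  fixes a b :: int
  assumes "4 \<le> a" and "even a" and "a < b" and "odd b"
  shows "((b = a + 1 \<or> b = a + 3 \<or> b \<ge> 2 * a - 3) \<longrightarrow>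
            rho_star a b = delta a b 0 \<and> delta a b 0 \<in> L_star a b \<and>
            (\<forall>x \<in> L_star a b. x \<le> delta a b 0))
       \<and> ((a + 5 \<le> b \<and> b \<le> 2 * a - 5) \<longrightarrow>
            rho_star a b = delta_m2 a b \<and> delta_m2 a b \<in> L_star a b \<and>
            (\<forall>x \<in> L_star a b. x \<le> delta_m2 a b))
       \<and> (\<forall>k. delta a b (Suc k) < delta a b k)
       \<and> (delta a b \<longlonglongrightarrow> ereal (delta_inf a b))
       \<and> L_star a b \<inter> {ereal (delta_inf a b)<..} =
           {delta_m1 a b} \<union> range (delta a b) \<union>
           (if a + 3 \<le> b \<and> b \<le> 2 * a - 3 then {delta_m2 a b} else {})"
proof -
  interpret params a b using assms by unfold_locales
  have 1: "(b = a + 1 \<or> b = a + 3 \<or> b \<ge> 2 * a - 3) \<longrightarrow>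
    rho_star a b = delta a b 0 \<and> delta a b 0 \<in> L_star a b \<and> (\<forall>x \<in> L_star a b. x \<le> delta a b 0)"
  proof
    assume "b = a + 1 \<or> b = a + 3 \<or> b \<ge> 2 * a - 3"
    then show "rho_star a b = delta a b 0 \<and> delta a b 0 \<in> L_star a b \<and> (\<forall>x \<in> L_star a b. x \<le> delta a b 0)"
      by (intro rho_star_eqI[OF delta_value(2) order_refl v2_le_vk_0' delta_value(1)])
  qed
  have 2: "(a + 5 \<le> b \<and> b \<le> 2 * a - 5) \<longrightarrow>
    rho_star a b = delta_m2 a b \<and> delta_m2 a b \<in> L_star a b \<and> (\<forall>x \<in> L_star a b. x \<le> delta_m2 a b)"
  proof
    assume "a + 5 \<le> b \<and> b \<le> 2 * a - 5"
    then have "vk 0 \<le> v2" using v2_ge_vk_0 by blast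
    then show "rho_star a b = delta_m2 a b \<and> delta_m2 a b \<in> L_star a b \<and> (\<forall>x \<in> L_star a b. x \<le> delta_m2 a b)"
      by (intro rho_star_eqI[OF delta_m2_value(2) _ order_refl delta_m2_value(1)])
  qed
  have 3: "\<forall>k. delta a b (Suc k) < delta a b k" using vk_decreasing by (simp add: delta_value(1))
  have "delta a b = (\<lambda>k. ereal (vk k))" using delta_value(1) by (rule ext)
  then have 4: "delta a b \<longlonglongrightarrow> ereal (delta_inf a b)" using vk_lim by simp
  show ?thesis by (intro conjI) (rule 1 2 3 4 L_star_above_delta_inf)+
qed

end
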